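(* Assume $k_+>k_->0$ and let $R_0>0$ be an arbitrary fixed number. For $y=(y_1,y_2)\in B^+_{R_0}\cup B^-_{R_0}$ and $x=|x|\hat x=|x|(\cos\theta_{\hat x},\sin\theta_{\hat x})\in\mathbb R^2_-$ with $\theta_{\hat x}\in(\pi,2\pi)$, we have the asymptotic behaviors $$G(x,y)=\frac{e^{ik_-|x|}}{\sqrt{|x|}}G^\infty(\hat x,y)+G_{Res}(x,y),\qquad \nabla_yG(x,y)=\frac{e^{ik_-|x|}}{\sqrt{|x|}}H^\infty(\hat x,y)+H_{Res}(x,y),$$ where $$G^\infty(\hat x,y):=\frac{e^{i\pi/4}}{\sqrt{8\pi k_-}}\begin{cases}\widetilde{\mathcal T}(\theta_{\hat x})e^{-ik_-(y_1\cos\theta_{\hat x}-iy_2\mathcal S(\cos\theta_{\hat x},1/n))}, & y\in\mathbb R^2_+,\\ e^{-ik_-\hat x\cdot y}+\widetilde{\mathcal R}(\theta_{\hat x})e^{-ik_-\hat x\cdot y'}, & y\in\mathbb R^2_-,\end{cases}$$ $$H^\infty(\hat x,y):=e^{-i\pi/4}\sqrt{\frac{k_-}{8\pi}}\begin{cases}\widetilde{\mathcal T}(\theta_{\hat x})e^{-ik_-(y_1\cos\theta_{\hat x}-iy_2\mathcal S(\cos\theta_{\hat x},1/n))}(\cos\theta_{\hat x},-i\mathcal S(\cos\theta_{\hat x},1/n)), & y\in\mathbb R^2_+,\\ e^{-ik_-\hat x\cdot y}(\cos\theta_{\hat x},\sin\theta_{\hat x})+\widetilde{\mathcal R}(\theta_{\hat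 x})e^{-ik_-\hat x\cdot y'}(\cos\theta_{\hat x},-\sin\theta_{\hat x}), & y\in\mathbb R^2_-,\end{cases}$$ and $G_{Res}$ and $H_{Res}$ satisfy $$|G_{Res}(x,y)|,\ |H_{Res}(x,y)|\le C_{R_0}|x|^{-3/2},\qquad|x|\to+\infty,$$ uniformly for all $\theta_{\hat x}\in(\pi,2\pi)$ and $y\in B^+_{R_0}\cup B^-_{R_0}$. Here the constant $C_{R_0}>0$ is independent of $x$ and $y$ but depends on $R_0$.
   Context: Notation. $\mathbb R^2_\pm=\{(x_1,x_2)\in\mathbb R^2: x_2\gtrless 0\}$, $\Gamma_0=\{(x_1,0):x_1\in\mathbb R\}$, $\mathbb S^1_\pm=\{x\in\mathbb R^2_\pm:|x|=1\}$, $B^\pm_{R_0}=\{y\in\mathbb R^2_\pm:|y|<R_0\}$, $\hat x=x/|x|$, and $y'=(y_1,-y_2)$ for $y=(y_1,y_2)$. $k_\pm>0$ are two different wave numbers and $n:=k_-/k_+$. Function $\mathcal S$. For $z=|z|e^{i\theta_1}\ne0$ with $\theta_1\in(-\frac{3\pi}2,\frac\pi2)$ let $\mathcal S_1(z)=\sqrt{|z|}e^{i\theta_1/2}$; for $z=|z|e^{i\theta_2}\neq 0$ with $\theta_2\in(-\frac\pi2,\frac{3\pi}2)$ let $\mathcal S_2(z)=\sqrt{|z|}e^{i\theta_2/2}$; $\mathcal S_1(0)=\mathcal S_2(0)=0$. For $a>0$ let $\mathcal S(z,a)=\mathcal S_1(z-a)\mathcal S_2(z+a)$. (For real $z$: $\mathcal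 S(z,a)=\sqrt{z^2-a^2}$ if $|z|\ge a$ and $\mathcal S(z,a)=-i\sqrt{a^2-z^2}$ if $|z|<a$.) For $\theta\in\mathbb R$, $$\widetilde{\mathcal R}(\theta)=\frac{i\sin\theta-\mathcal S(\cos\theta,1/n)}{i\sin\theta+\mathcal S(\cos\theta,1/n)},\qquad \widetilde{\mathcal T}(\theta)=\widetilde{\mathcal R}(\theta)+1.$$ Two-layered Green function. For $y\in\mathbb R^2_+\cup\mathbb R^2_-$, $G(\cdot,y)$ is the solution of $\Delta_xG(x,y)+k_\pm^2G(x,y)=-\delta(x,y)$ in $\mathbb R^2_\pm$, $[G(x,y)]=0$ and $[\partial G(x,y)/\partial\nu(x)]=0$ on $\Gamma_0$ (jumps across $\Gamma_0$, $\nu$ the unit normal pointing into $\mathbb R^2_+$), and the Sommerfeld radiation condition $\lim_{|x|\to\infty}\sqrt{|x|}(\partial G(x,y)/\partial|x|-ik_\pm G(x,y))=0$ uniformly for all $\hat x\in\mathbb S^1_\pm$. Explicitly, for $x\in\mathbb R^2_-$, $$G(x,y)=\frac1{2\pi}\int_{-\infty}^{\infty}\frac{e^{-\mathcal S(\xi,k_+)y_2+\mathcal S(\xi,k_-)x_2}}{\mathcal S(\xi,k_+)+\mathcal S(\xi,k_-)}e^{i\xi(x_1-y_1)}d\xi\quad(y\in\mathbb R^2_+),$$ $$G(x,y)=\frac i4H^{(1)}_0(k_-|x-y|)+\frac1{4\pi}\int_{-\infty}^{\infty}\frac{\mathcal S(\xi,k_-)-\mathcal S(\xi,k_+)}{\mathcal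 S(\xi,k_+)+\mathcal S(\xi,k_-)}\frac{e^{-\mathcal S(\xi,k_-)|x_2+y_2|}}{\mathcal S(\xi,k_-)}e^{i\xi(x_1-y_1)}d\xi\quad(y\in\mathbb R^2_-),$$ with $H_0^{(1)}$ the Hankel function of the first kind of order $0$. Convention. A bound "as $|x|\to+\infty$, uniformly for all $\theta_{\hat x}$ and $y$ in given sets" means that it holds for all $|x|$ sufficiently large, with the threshold independent of $\theta_{\hat x}$ and $y$ in these sets. Gradients are written as row vectors. *)

theory Defs
  imports "HOL-Analysis.Analysis"
begin

definition upper_half :: "(real^2) set" where
  "upper_half = {y. y $ 2 > 0}"

definition lower_half :: "(real^2) set" where
  "lower_half = {y. y $ 2 < 0}"

definition upper_half_disc :: "real \<Rightarrow> (real^2) set" where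
  "upper_half_disc R = {y \<in> upper_half. norm y < R}"

definition lower_half_disc :: "real \<Rightarrow> (real^2) set" where
  "lower_half_disc R = {y \<in> lower_half. norm y < R}"

definition direction :: "real \<Rightarrow> real^2" where
  "direction \<theta> = vector [cos \<theta>, sin \<theta>]"

definition reflect :: "real^2 \<Rightarrow> real^2" where
  "reflect y = vector [y $ 1, - (y $ 2)]"

text \<open>
  The branch of the argument with values in the open interval \<open>(a, b)\<close>. For \<open>b - a = 2\<pi>\<close> it is
  well defined for nonzero \<open>z\<close> off the ray of direction \<open>a\<close>, and unspecified on that ray.
\<close>
definition arg_between :: "real \<Rightarrow> real \<Rightarrow> complex \<Rightarrow> real" where
  "arg_between a b z = (THE \<theta>. a < \<theta> \<and> \<theta> < b \<and> z = rcis (cmod z) \<theta>)"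

definition S1 :: "complex \<Rightarrow> complex" where
  "S1 z = (if z = 0 then 0 else rcis (sqrt (cmod z)) (arg_between (-3*pi/2) (pi/2) z / 2))"

definition S2 :: "complex \<Rightarrow> complex" where
  "S2 z = (if z = 0 then 0 else rcis (sqrt (cmod z)) (arg_between (-pi/2) (3*pi/2) z / 2))"

definition S :: "complex \<Rightarrow> real \<Rightarrow> complex" where
  "S z a = S1 (z - complex_of_real a) * S2 (z + complex_of_real a)"

lemma arg_between_eqI:
  assumes "a < \<theta>" "\<theta> < b" "b - a \<le> 2 * pi" "z \<noteq> 0" "z = rcis (cmod z) \<theta>"
  shows "arg_between a b z = \<theta>"
  unfolding arg_between_def
proof (rule the_equality)
  show "a < \<theta> \<and> \<theta> < b \<and> z = rcis (cmod z) \<theta>"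
    using assms by blast
next
  fix \<phi> assume \<phi>: "a < \<phi> \<and> \<phi> < b \<and> z = rcis (cmod z) \<phi>"
  then have "complex_of_real (cmod z) * cis \<phi> = complex_of_real (cmod z) * cis \<theta>"
    using assms(5) unfolding rcis_def by simp
  then have "cis \<phi> = cis \<theta>"
    using assms(4) by simp
  then have "sin \<phi> = sin \<theta> \<and> cos \<phi> = cos \<theta>"
    by (metis cis.simps)
  then obtain m :: int where m: "\<phi> = \<theta> + 2 * pi * m"
    using sin_cos_eq_iff by blast
  have "\<bar>2 * pi * real_of_int m\<bar> < 2 * pi * 1"
    using m \<phi> assms(1-3) by linarith
  then have "\<bar>real_of_int m\<bar> < 1"
    by (simp add: abs_mult del: of_int_abs)
  then have "m = 0"
    by linarith
  then show "\<phi> = \<theta>"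
    using m by simp
qed

lemma S1_of_real:
  "S1 (complex_of_real t) = (if t \<ge> 0 then complex_of_real (sqrt t) else - \<i> * complex_of_real (sqrt (- t)))"
proof -
  have "arg_between (-3*pi/2) (pi/2) (complex_of_real t) = 0" if "t > 0"
    using that by (intro arg_between_eqI) (auto simp: rcis_def)
  moreover have "arg_between (-3*pi/2) (pi/2) (complex_of_real t) = - pi" if "t < 0"
    using that by (intro arg_between_eqI) (auto simp: rcis_def complex_eq_iff)
  ultimately show ?thesis
    by (auto simp: S1_def rcis_def complex_eq_iff)
qed

lemma S2_of_real:
  "S2 (complex_of_real t) = (if t \<ge> 0 then complex_of_real (sqrt t) else \<i> * complex_of_real (sqrt (- t)))"
proof -
  have "arg_between (-pi/2) (3*pi/2) (complex_of_real t) = 0" if "t > 0"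
    using that by (intro arg_between_eqI) (auto simp: rcis_def)
  moreover have "arg_between (-pi/2) (3*pi/2) (complex_of_real t) = pi" if "t < 0"
    using that pi_gt_zero by (intro arg_between_eqI) (auto simp: rcis_def complex_eq_iff intro: less_trans [of _ 0])
  ultimately show ?thesis
    by (auto simp: S2_def rcis_def complex_eq_iff)
qed

lemma S_of_real:
  assumes "a > 0"
  shows "S (complex_of_real t) a =
    (if \<bar>t\<bar> \<ge> a then complex_of_real (sqrt (t\<^sup>2 - a\<^sup>2)) else - \<i> * complex_of_real (sqrt (a\<^sup>2 - t\<^sup>2)))"
proof -
  have eq: "S (complex_of_real t) a = S1 (complex_of_real (t - a)) * S2 (complex_of_real (t + a))"
    by (simp add: S_def)
  consider "t \<ge> a" | "t \<le> - a" | "\<bar>t\<bar> < a"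
    using assms by linarith
  then show ?thesis
  proof cases
    case 1
    then have "sqrt (t - a) * sqrt (t + a) = sqrt (t\<^sup>2 - a\<^sup>2)"
      by (simp add: real_sqrt_mult [symmetric] algebra_simps power2_eq_square)
    then show ?thesis
      using 1 assms unfolding eq S1_of_real S2_of_real by (simp flip: of_real_mult)
  next
    case 2
    then have neg: "\<not> 0 \<le> t - a" "t + a = 0 \<or> \<not> 0 \<le> t + a" "a \<le> \<bar>t\<bar>"
      using assms by auto
    have "sqrt (a - t) * sqrt (- t - a) = sqrt (t\<^sup>2 - a\<^sup>2)"
      by (simp add: real_sqrt_mult [symmetric] algebra_simps power2_eq_square)
    moreover have "S1 (complex_of_real (t - a)) = - \<i> * complex_of_real (sqrt (a - t))"
      unfolding S1_of_real using neg by simp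
    moreover have "S2 (complex_of_real (t + a)) = \<i> * complex_of_real (sqrt (- t - a))"
      using neg(2)
    proof
      assume "t + a = 0"
      moreover from this have "- t - a = 0"
        by linarith
      ultimately show ?thesis
        by (simp only: S2_of_real) simp
    next
      assume "\<not> 0 \<le> t + a"
      then show ?thesis
        by (simp only: S2_of_real) simp
    qed
    moreover have "- \<i> * u * (\<i> * v) = u * v" for u v
      by (simp add: complex_eq_iff algebra_simps)
    ultimately have "S (complex_of_real t) a = complex_of_real (sqrt (t\<^sup>2 - a\<^sup>2))"
      unfolding eq by (simp only: of_real_mult [symmetric])
    then show ?thesis
      using neg(3) by simp
  next
    case 3
    have "sqrt (a - t) * sqrt (t + a) = sqrt (a\<^sup>2 - t\<^sup>2)"
      by (simp add: real_sqrt_mult [symmetric] algebra_simps power2_eq_square)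
    then show ?thesis
      using 3 assms unfolding eq S1_of_real S2_of_real
      by (auto simp flip: of_real_mult)
  qed
qed

definition refl_coeff :: "real \<Rightarrow> real \<Rightarrow> complex" where
  "refl_coeff n \<theta> =
     (\<i> * complex_of_real (sin \<theta>) - S (complex_of_real (cos \<theta>)) (1/n)) /
     (\<i> * complex_of_real (sin \<theta>) + S (complex_of_real (cos \<theta>)) (1/n))"

definition trans_coeff :: "real \<Rightarrow> real \<Rightarrow> complex" where
  "trans_coeff n \<theta> = refl_coeff n \<theta> + 1"

definition bessel_J0 :: "real \<Rightarrow> real" where
  "bessel_J0 t = (\<Sum>m. (-1) ^ m / (fact m)\<^sup>2 * (t/2) ^ (2*m))"

text \<open>Neumann's expansion of the Bessel function of the second kind.\<close>
definition bessel_Y0 :: "real \<Rightarrow> real" where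
  "bessel_Y0 t = 2/pi * (ln (t/2) + euler_mascheroni) * bessel_J0 t
     + 2/pi * (\<Sum>m. (-1) ^ (m + 1) * harm m / (fact m)\<^sup>2 * (t/2) ^ (2*m))"

definition hankel1_0 :: "real \<Rightarrow> complex" where
  "hankel1_0 t = Complex (bessel_J0 t) (bessel_Y0 t)"

text \<open>
  The Green function of the two-layered medium, with wave number \<open>kp\<close> in the upper and \<open>km\<close> in the
  lower half-plane, is given by its Fourier representation. This representation is the one for
  observation points \<open>x\<close> in the lower half-plane; the value is meaningful only for such \<open>x\<close> and for
  \<open>y\<close> off the interface with \<open>y \<noteq> x\<close>. All integrals then converge absolutely.
\<close>
definition layered_green :: "real \<Rightarrow> real \<Rightarrow> real^2 \<Rightarrow> real^2 \<Rightarrow> complex" where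
  "layered_green kp km x y =
    (if y \<in> upper_half then
       1 / (2 * complex_of_real pi) *
       (LBINT \<xi>. exp (- S (complex_of_real \<xi>) kp * complex_of_real (y $ 2)
                       + S (complex_of_real \<xi>) km * complex_of_real (x $ 2))
                 / (S (complex_of_real \<xi>) kp + S (complex_of_real \<xi>) km)
                 * exp (\<i> * complex_of_real (\<xi> * (x $ 1 - y $ 1))))
     else
       \<i> / 4 * hankel1_0 (km * norm (x - y)) +
       1 / (4 * complex_of_real pi) *
       (LBINT \<xi>. (S (complex_of_real \<xi>) km - S (complex_of_real \<xi>) kp)
                 / (S (complex_of_real \<xi>) kp + S (complex_of_real \<xi>) km)
                 * (exp (- S (complex_of_real \<xi>) km * complex_of_real \<bar>x $ 2 + y $ 2\<bar>)
                    / S (complex_of_real \<xi>) km)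
                 * exp (\<i> * complex_of_real (\<xi> * (x $ 1 - y $ 1)))))"

definition layered_green_grad :: "real \<Rightarrow> real \<Rightarrow> real^2 \<Rightarrow> real^2 \<Rightarrow> complex^2" where
  "layered_green_grad kp km x y =
     (\<chi> j. frechet_derivative (layered_green kp km x) (at y) (axis j 1))"

definition G_inf :: "real \<Rightarrow> real \<Rightarrow> real \<Rightarrow> real^2 \<Rightarrow> complex" where
  "G_inf kp km \<theta> y = (let n = km / kp; s = S (complex_of_real (cos \<theta>)) (1/n) in
     exp (\<i> * complex_of_real (pi/4)) / complex_of_real (sqrt (8 * pi * km)) *
     (if y \<in> upper_half then
        trans_coeff n \<theta> * exp (- \<i> * complex_of_real km *
          (complex_of_real (y $ 1 * cos \<theta>) - \<i> * complex_of_real (y $ 2) * s))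
      else
        exp (- \<i> * complex_of_real (km * (direction \<theta> \<bullet> y)))
        + refl_coeff n \<theta> * exp (- \<i> * complex_of_real (km * (direction \<theta> \<bullet> reflect y)))))"

definition H_inf :: "real \<Rightarrow> real \<Rightarrow> real \<Rightarrow> real^2 \<Rightarrow> complex^2" where
  "H_inf kp km \<theta> y = (let n = km / kp; s = S (complex_of_real (cos \<theta>)) (1/n) in
     (exp (- \<i> * complex_of_real (pi/4)) * complex_of_real (sqrt (km / (8 * pi)))) *s
     (if y \<in> upper_half then
        (trans_coeff n \<theta> * exp (- \<i> * complex_of_real km *
          (complex_of_real (y $ 1 * cos \<theta>) - \<i> * complex_of_real (y $ 2) * s)))
        *s vector [complex_of_real (cos \<theta>), - \<i> * s]
      else
        exp (- \<i> * complex_of_real (km * (direction \<theta> \<bullet> y)))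
        *s vector [complex_of_real (cos \<theta>), complex_of_real (sin \<theta>)]
        + (refl_coeff n \<theta> * exp (- \<i> * complex_of_real (km * (direction \<theta> \<bullet> reflect y))))
        *s vector [complex_of_real (cos \<theta>), - complex_of_real (sin \<theta>)]))"

end

theory Submission
  imports Defs "HOL-Complex_Analysis.Complex_Analysis" "HOL-Probability.Distributions" "HOL-Real_Asymp.Real_Asymp"
begin

text \<open>
The identity \<open>S(\<xi>,k)\<^sup>2 - S(\<xi>,K)\<^sup>2 = K\<^sup>2 - k\<^sup>2\<close>, with \<open>k\<close> the wave number
below and \<open>K > k\<close> the one above the interface, turns every denominator \<open>S(\<xi>,K) + S(\<xi>,k)\<close> into a
polynomial numerator. The Green function thus is the sum of a direct wave \<open>\<i>/4 H0(k |x - y|)\<close> (only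
for \<open>y\<close> below) and of finitely many integrals with integrand
\<open>\<xi>^i S(\<xi>,k)^j S(\<xi>,K)^l exp(-\<i> \<xi> y - S(\<xi>,K) a - S(\<xi>,k) b) exp(-S(\<xi>,k) h + \<i> \<xi> t) / S(\<xi>,k)\<close>
(constant \<open>spectral\<close>), and this family is closed under differentiation in \<open>y\<close>. Both assertions
therefore follow from one uniform expansion of these integrals, \<open>spectral_asymptotics\<close>, together with
the asymptotics of the Hankel function and of its derivative, \<open>hankel_asymptotics\<close>.

Expansion of the integrals. Put \<open>t = \<rho> cos \<phi>\<close>, \<open>h = \<rho> sin \<phi>\<close> with \<open>0 < \<phi> < \<pi>\<close>. With \<open>\<xi> = k cos z\<close>
the exponential becomes \<open>exp(\<i> k \<rho> cos(z - \<phi>))\<close>, the factor \<open>1 / S(\<xi>,k)\<close> cancels against \<open>d\<xi>\<close>, and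
the path is \<open>\<i>\<infinity> \<rightarrow> 0 \<rightarrow> \<pi> \<rightarrow> \<pi> - \<i>\<infinity>\<close>. The only singularities left are the branch points of
\<open>S(k cos z, K)\<close>, at \<open>z = \<plusminus>\<i> v0\<close> modulo \<open>\<pi>\<close> with \<open>cosh v0 = K / k\<close>; as \<open>K > k\<close> they keep a fixed distance
from the real axis, where the saddle point \<open>z = \<phi>\<close> lies, so nothing degenerates at any angle \<open>\<phi>\<close>.
In the strip \<open>|Im z| \<le> v0\<close> the path is moved through the saddle point
(\<open>saddle_point_contribution\<close>): a Gaussian integral gives the leading term, the next term is odd and
drops out, and the error is \<open>O(\<rho>^(-3/2))\<close>. The two ends of the path beyond the branch points are
shifted sideways by \<open>\<pi>/4\<close> and become, up to exponentially small terms, integrals over horizontal segments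
that start at the branch points (\<open>tail_shift\<close>). They run alongside segments of the deformed path in the
strip; on these the two branches of the square root differ by \<open>O(sqrt u)\<close> at distance \<open>u\<close> from the branch
point while the exponential is at most \<open>exp(-c \<rho> u)\<close>, so that the difference is again
\<open>O(\<rho>^(-3/2))\<close> (\<open>contour_asymptotics\<close>). For \<open>\<phi> > \<pi>/2\<close> one reflects \<open>\<xi>\<close> to \<open>-\<xi>\<close>.

Hankel function. It is defined by its power series. The Laplace integral
\<open>L(t) = \<integral> exp(t (\<i> - \<tau>\<^sup>2)) / csqrt(\<tau>\<^sup>2 - 2 \<i>) d\<tau>\<close> solves Bessel's equation, and it has the behaviour
of \<open>H0\<close> at the origin up to the factor \<open>-2 \<i>/\<pi>\<close>; the Euler constant enters through
\<open>\<integral> exp(-s) ln s ds\<close>. A solution of Bessel's equation that vanishes at the origin together with \<open>t u'(t)\<close>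
is zero by an energy argument, so \<open>H0 = -2 \<i>/\<pi> L\<close> (\<open>hankel_eq_laplace\<close>), and the expansion for
large \<open>t\<close> is read off from the integral.
\<close>

section \<open>Elementary estimates\<close>

lemma gaussian_integral:
  fixes a :: real
  assumes "a > 0"
  shows "integrable lborel (\<lambda>x. exp (- a * x\<^sup>2))" "(LBINT x. exp (- a * x\<^sup>2)) = sqrt (pi / a)"
proof -
  have "has_bochner_integral lborel (\<lambda>x::real. exp (- x\<^sup>2)) (2 *\<^sub>R (sqrt pi / 2))"
    by (rule has_bochner_integral_even_function[OF gaussian_moment_0]) simp
  then have *: "has_bochner_integral lborel (\<lambda>x::real. exp (- (0 + sqrt a * x)\<^sup>2)) (sqrt pi /\<^sub>R \<bar>sqrt a\<bar>)"
    using assms by (subst (asm) lborel_has_bochner_integral_real_affine_iff[where c="sqrt a" and t=0]) auto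
  have "(\<lambda>x::real. exp (- (0 + sqrt a * x)\<^sup>2)) = (\<lambda>x. exp (- a * x\<^sup>2))"
    using assms by (simp add: power_mult_distrib)
  with * have "has_bochner_integral lborel (\<lambda>x::real. exp (- a * x\<^sup>2)) (sqrt (pi / a))"
    using assms by (simp add: real_sqrt_divide real_sqrt_mult real_sqrt_inverse divide_inverse mult.commute)
  then show "integrable lborel (\<lambda>x. exp (- a * x\<^sup>2))" "(LBINT x. exp (- a * x\<^sup>2)) = sqrt (pi / a)"
    by (auto simp: has_bochner_integral_iff)
qed

lemma powr_three_halves:
  fixes r :: real
  assumes "r > 0"
  shows "r powr (-3/2) = 1 / (r * sqrt r)"
proof -
  have "r powr (3/2) = r powr 1 * r powr (1/2)"
    unfolding powr_add[symmetric] by simp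
  also have "\<dots> = r * sqrt r"
    using assms by (simp only: powr_one powr_half_sqrt less_imp_le)
  finally have "r powr - (3/2) = 1 / (r * sqrt r)"
    by (simp only: powr_minus inverse_eq_divide)
  then show ?thesis by (simp only: minus_divide_left)
qed

lemma exp_decay_three_halves:
  fixes c r :: real
  assumes "c > 0" "r \<ge> 1"
  shows "exp (- c * r) \<le> 2 / c\<^sup>2 * r powr (-3/2)"
proof -
  have "(c * r)\<^sup>2 / 2 \<le> exp (c * r)"
  proof -
    have "0 \<le> c * r" using assms by simp
    then show ?thesis using exp_lower_Taylor_quadratic[of "c * r"] by linarith
  qed
  then have "exp (- c * r) \<le> inverse ((c * r)\<^sup>2 / 2)"
    using assms by (simp add: exp_minus inverse_le_iff_le del: inverse_divide)
  also have "\<dots> = 2 / c\<^sup>2 * (1 / (r * r))"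
    by (simp add: power2_eq_square)
  also have "\<dots> \<le> 2 / c\<^sup>2 * (1 / (r * sqrt r))"
  proof -
    have "sqrt r \<le> r" using assms by (intro real_le_lsqrt) (auto simp: power2_eq_square)
    then show ?thesis using assms by (intro mult_left_mono divide_left_mono) auto
  qed
  also have "\<dots> = 2 / c\<^sup>2 * r powr (-3/2)"
    using powr_three_halves[of r] assms by (simp only:)
  finally show ?thesis .
qed

lemma Re_cos_cosh: "Re (cos z) = cos (Re z) * cosh (Im z)"
  by (simp add: Re_cos cosh_def)

lemma Im_cos_sinh: "Im (cos z) = - sin (Re z) * sinh (Im z)"
  by (simp add: Im_cos sinh_def field_simps)

lemma norm_exp_i_cos: "norm (exp (\<i> * of_real \<kappa> * cos \<beta>)) = exp (\<kappa> * sin (Re \<beta>) * sinh (Im \<beta>))"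
  by (simp add: norm_exp_eq_Re Im_cos_sinh mult.assoc)

lemma norm_cos_le_cosh: "norm (cos z) \<le> cosh (Im z)"
proof -
  have "(norm (cos z))\<^sup>2 = (cos (Re z))\<^sup>2 * (cosh (Im z))\<^sup>2 + (sin (Re z))\<^sup>2 * (sinh (Im z))\<^sup>2"
    by (simp add: cmod_power2 Re_cos_cosh Im_cos_sinh power_mult_distrib)
  also have "\<dots> \<le> (cos (Re z))\<^sup>2 * (cosh (Im z))\<^sup>2 + (sin (Re z))\<^sup>2 * (cosh (Im z))\<^sup>2"
    by (intro add_left_mono mult_left_mono) (auto simp: cosh_square_eq)
  also have "\<dots> = (cosh (Im z))\<^sup>2"
    by (simp add: distrib_right[symmetric])
  finally show ?thesis
    using cosh_real_nonneg power2_le_imp_le by blast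
qed

lemma norm_sin_le_cosh: "norm (sin z) \<le> cosh (Im z)"
  using norm_cos_le_cosh[of "of_real pi / 2 - z"] by (simp add: cos_diff)

lemma sin_ge_between:
  fixes d x :: real
  assumes "0 < d" "d \<le> pi / 2" "d \<le> x" "x \<le> pi - d"
  shows "sin d \<le> sin x"
proof (cases "x \<le> pi / 2")
  case True
  then show ?thesis using assms by (intro sin_monotone_2pi_le) auto
next
  case False
  have "sin d \<le> sin (pi - x)" using assms False by (intro sin_monotone_2pi_le) auto
  then show ?thesis by simp
qed

lemma norm_exp_diff_le:
  fixes z w :: complex
  assumes "Re z \<le> m" "Re w \<le> m"
  shows "norm (exp z - exp w) \<le> exp m * norm (z - w)"
proof (rule field_differentiable_bound[where S="{x. Re x \<le> m}" and f'=exp])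
  show "convex {x. Re x \<le> m}" by (rule convex_halfspace_Re_le)
qed (use assms in \<open>auto intro!: derivative_eq_intros\<close>)

lemma power_times_gaussian_le:
  fixes \<kappa> s :: real assumes "\<kappa> > 0"
  shows "s\<^sup>2 * exp (- \<kappa> * s\<^sup>2 / 2) \<le> 4 / \<kappa> * exp (- \<kappa> / 4 * s\<^sup>2)"
    and "\<kappa> * s ^ 4 * exp (- \<kappa> * s\<^sup>2 / 2) \<le> 64 / \<kappa> * exp (- \<kappa> / 4 * s\<^sup>2)"
proof -
  have *: "x * exp (- x) \<le> 1" for x :: real
  proof -
    have "x \<le> exp x" using exp_ge_add_one_self[of x] by linarith
    then show ?thesis by (simp add: exp_minus field_simps)
  qed
  have "s\<^sup>2 * exp (- \<kappa> * s\<^sup>2 / 2) = 4 / \<kappa> * ((\<kappa> * s\<^sup>2 / 4) * exp (- (\<kappa> * s\<^sup>2 / 4))) * exp (- \<kappa> / 4 * s\<^sup>2)"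
    using assms by (simp add: mult_exp_exp field_simps)
  also have "\<dots> \<le> 4 / \<kappa> * 1 * exp (- \<kappa> / 4 * s\<^sup>2)"
    using assms by (intro mult_left_mono mult_right_mono *) auto
  finally show "s\<^sup>2 * exp (- \<kappa> * s\<^sup>2 / 2) \<le> 4 / \<kappa> * exp (- \<kappa> / 4 * s\<^sup>2)" by simp
  have e: "exp (- (\<kappa> * s\<^sup>2 / 8))^2 * exp (- \<kappa> / 4 * s\<^sup>2) = exp (- \<kappa> * s\<^sup>2 / 2)"
    by (simp add: exp_of_nat_mult[symmetric] power2_eq_square mult_exp_exp)
  have "\<kappa> * s ^ 4 * exp (- \<kappa> * s\<^sup>2 / 2) = 64 / \<kappa> * ((\<kappa> * s\<^sup>2 / 8) * exp (- (\<kappa> * s\<^sup>2 / 8)))^2 * exp (- \<kappa> / 4 * s\<^sup>2)"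
    unfolding e[symmetric] using assms by (simp add: field_simps power2_eq_square power4_eq_xxxx)
  also have "\<dots> \<le> 64 / \<kappa> * 1^2 * exp (- \<kappa> / 4 * s\<^sup>2)"
    using assms by (intro mult_left_mono mult_right_mono power_mono *) auto
  finally show "\<kappa> * s ^ 4 * exp (- \<kappa> * s\<^sup>2 / 2) \<le> 64 / \<kappa> * exp (- \<kappa> / 4 * s\<^sup>2)" by simp
qed

lemma gaussian_truncation:
  fixes \<delta> \<kappa> :: real
  assumes "\<delta> > 0" "\<kappa> \<ge> 1"
  shows "\<bar>integral {-\<delta>..\<delta>} (\<lambda>s. exp (- \<kappa> * s\<^sup>2)) - sqrt (pi / \<kappa>)\<bar> \<le> (sqrt (2 * pi) * (8 / \<delta>^4)) * \<kappa> powr (-3/2)"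
proof -
  have k: "\<kappa> > 0" using assms by simp
  let ?g = "\<lambda>s. exp (- \<kappa> * s\<^sup>2)"
  have int: "integrable lborel ?g" "integral UNIV ?g = sqrt (pi / \<kappa>)" "?g integrable_on UNIV"
    using gaussian_integral[OF k] integral_lborel[of ?g] by (auto simp: integrable_on_lborel)
  have int2: "(\<lambda>s. exp (- (\<kappa> / 2) * s\<^sup>2)) integrable_on UNIV"
     "integral UNIV (\<lambda>s. exp (- (\<kappa> / 2) * s\<^sup>2)) = sqrt (2 * pi / \<kappa>)"
    using gaussian_integral[of "\<kappa>/2"] integral_lborel[of "\<lambda>s. exp (- (\<kappa> / 2) * s\<^sup>2)"] k
    by (auto simp: integrable_on_lborel mult.commute)
  have i1: "?g integrable_on {-\<delta>..\<delta>}"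
    using int(3) integrable_on_subinterval by blast
  have i2: "(\<lambda>s. if s \<in> {-\<delta>..\<delta>} then ?g s else 0) integrable_on UNIV"
    using i1 by (simp only: integrable_restrict_UNIV)
  have c1: "sqrt (pi / \<kappa>) - integral {-\<delta>..\<delta>} ?g = integral UNIV (\<lambda>s. ?g s - (if s \<in> {-\<delta>..\<delta>} then ?g s else 0))"
    using integral_diff[OF int(3) i2] int(2) integral_restrict_UNIV[of "{-\<delta>..\<delta>}" ?g] by simp
  have c2: "0 \<le> integral UNIV (\<lambda>s. ?g s - (if s \<in> {-\<delta>..\<delta>} then ?g s else 0))"
    by (rule integral_nonneg[OF integrable_diff[OF int(3) i2]]) auto
  have c3: "integral UNIV (\<lambda>s. ?g s - (if s \<in> {-\<delta>..\<delta>} then ?g s else 0))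
     \<le> integral UNIV (\<lambda>s. exp (- (\<kappa> / 2) * s\<^sup>2) * exp (- (\<delta>\<^sup>2/2) * \<kappa>))"
  proof (rule integral_le)
    show "(\<lambda>s. exp (- (\<kappa> / 2) * s\<^sup>2) * exp (- (\<delta>\<^sup>2/2) * \<kappa>)) integrable_on UNIV"
      by (rule integrable_on_mult_left[OF int2(1)])
    fix s :: real
    show "?g s - (if s \<in> {-\<delta>..\<delta>} then ?g s else 0) \<le> exp (- (\<kappa> / 2) * s\<^sup>2) * exp (- (\<delta>\<^sup>2/2) * \<kappa>)"
    proof (cases "s \<in> {-\<delta>..\<delta>}")
      case False
      then have "\<delta>\<^sup>2 \<le> s\<^sup>2" using assms by (subst abs_le_square_iff[symmetric]) auto
      then have "\<kappa> * \<delta>\<^sup>2 \<le> \<kappa> * s\<^sup>2" using k by (intro mult_left_mono) auto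
      then have "- \<kappa> * s\<^sup>2 \<le> - (\<kappa> / 2) * s\<^sup>2 + - (\<delta>\<^sup>2/2) * \<kappa>" by (simp add: field_simps)
      then show ?thesis using False by (simp add: exp_add[symmetric])
    qed auto
  qed (rule integrable_diff[OF int(3) i2])
  have c4: "integral UNIV (\<lambda>s. exp (- (\<kappa> / 2) * s\<^sup>2) * exp (- (\<delta>\<^sup>2/2) * \<kappa>)) = sqrt (2 * pi / \<kappa>) * exp (- (\<delta>\<^sup>2/2) * \<kappa>)"
    by (simp only: integral_mult_left int2(2))
  have c5: "sqrt (2 * pi / \<kappa>) * exp (- (\<delta>\<^sup>2/2) * \<kappa>) \<le> sqrt (2 * pi) * (2 / (\<delta>\<^sup>2/2)\<^sup>2 * \<kappa> powr (-3/2))"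
  proof (intro mult_mono exp_decay_three_halves)
    have "2 * pi / \<kappa> \<le> 2 * pi / 1" using assms by (intro divide_left_mono) auto
    then show "sqrt (2 * pi / \<kappa>) \<le> sqrt (2 * pi)" by (intro real_sqrt_le_mono) simp
  qed (use assms in auto)
  have c6: "2 / (\<delta>\<^sup>2/2)\<^sup>2 = 8 / \<delta>^4" by (simp add: power_divide power2_eq_square power4_eq_xxxx)
  have "sqrt (2 * pi) * (2 / (\<delta>\<^sup>2/2)\<^sup>2 * \<kappa> powr (-3/2)) = (sqrt (2 * pi) * (8 / \<delta>^4)) * \<kappa> powr (-3/2)"
    unfolding c6 by (simp only: mult.assoc)
  with c1 c2 c3 c4 c5 show ?thesis by linarith
qed

section \<open>The saddle point of the cosine phase\<close>

text \<open>
The integral of \<open>f\<close> times the exponential along a segment is expressed by a primitive \<open>F\<close>, and hence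
bounded by the mean value theorem; the modulus of the exponential is \<open>exp(\<kappa> sin(Re z - \<phi>) sinh(Im z))\<close>.
\<close>
lemma decaying_segment:
  fixes F f :: "complex \<Rightarrow> complex"
  assumes F: "\<And>z. z \<in> T \<Longrightarrow> (F has_field_derivative f z * exp (\<i> * of_real \<kappa> * cos (z - of_real \<phi>))) (at z within T)"
    and S: "convex W" "W \<subseteq> T" "a \<in> W" "b \<in> W"
    and f: "\<And>z. z \<in> W \<Longrightarrow> norm (f z) \<le> B"
    and c: "\<And>z. z \<in> W \<Longrightarrow> sin (Re z - \<phi>) * sinh (Im z) \<le> - c"
    and k: "\<kappa> \<ge> 0"
  shows "norm (F b - F a) \<le> B * exp (- c * \<kappa>) * norm (b - a)"
proof (rule field_differentiable_bound[OF S(1) _ _ S(4) S(3)])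
  fix z assume z: "z \<in> W"
  show "(F has_field_derivative f z * exp (\<i> * of_real \<kappa> * cos (z - of_real \<phi>))) (at z within W)"
    using F[of z] z S(2) by (auto intro: DERIV_subset)
  have "norm (exp (\<i> * of_real \<kappa> * cos (z - of_real \<phi>))) \<le> exp (- c * \<kappa>)"
    unfolding norm_exp_i_cos using mult_left_mono[OF c[OF z] k] by (simp add: mult_ac)
  moreover have "0 \<le> B" using f[OF z] norm_ge_zero order_trans by blast
  ultimately show "norm (f z * exp (\<i> * of_real \<kappa> * cos (z - of_real \<phi>))) \<le> B * exp (- c * \<kappa>)"
    unfolding norm_mult using f[OF z] by (intro mult_mono) auto
qed

text \<open>
The two long arms of the path through the saddle point stay in the sectors where
\<open>sin(Re z - \<phi>) sinh(Im z)\<close> is negative, so that only the neighbourhood of \<open>\<phi>\<close> matters. The arms end on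
the boundary of the strip, at abscissas which do not depend on \<open>\<phi>\<close>.
\<close>
lemma saddle_arms:
  fixes F f :: "complex \<Rightarrow> complex"
  assumes F: "\<And>z. \<bar>Im z\<bar> \<le> v \<Longrightarrow> (F has_field_derivative f z * exp (\<i> * of_real \<kappa> * cos (z - of_real \<phi>))) (at z within {z. \<bar>Im z\<bar> \<le> v})"
    and f: "\<And>z. \<bar>Im z\<bar> \<le> v \<Longrightarrow> norm (f z) \<le> B"
    and d: "0 < \<delta>" "\<delta> \<le> v" "\<delta> \<le> pi / 4"
    and phi: "0 \<le> \<phi>" "\<phi> \<le> pi / 2" and k: "\<kappa> \<ge> 0"
  shows "norm (F (Complex (\<phi> - \<delta>) \<delta>) - F (Complex (- pi / 4) v)) \<le> B * exp (- (sin \<delta> * sinh \<delta>) * \<kappa>) * (pi + v)"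
    and "norm (F (Complex (3 * pi / 4) (- v)) - F (Complex (\<phi> + \<delta>) (-\<delta>))) \<le> B * exp (- (sin \<delta> * sinh \<delta>) * \<kappa>) * (pi + v)"
proof -
  have B: "0 \<le> B" using order_trans[OF norm_ge_zero f[of 0]] d by simp
  have s0: "0 < sin \<delta>" using d by (intro sin_gt_zero) auto
  have mon: "sin \<delta> * sinh \<delta> \<le> sin x * sinh y" if "\<delta> \<le> x" "x \<le> 3 * pi / 4" "\<delta> \<le> y" for x y
  proof -
    have "sin \<delta> \<le> sin x" using that d by (intro sin_ge_between) auto
    then show ?thesis using that d s0 by (intro mult_mono) auto
  qed
  let ?S = "{z. \<phi> - 3 * pi / 4 \<le> Re z} \<inter> {z. Re z \<le> \<phi> - \<delta>} \<inter> ({z. \<delta> \<le> Im z} \<inter> {z. Im z \<le> v})"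
  have "norm (F (Complex (\<phi> - \<delta>) \<delta>) - F (Complex (- pi / 4) v)) \<le> B * exp (- (sin \<delta> * sinh \<delta>) * \<kappa>)
      * norm (Complex (\<phi> - \<delta>) \<delta> - Complex (- pi / 4) v)"
  proof (rule decaying_segment[where W="?S" and T="{z. \<bar>Im z\<bar> \<le> v}" and \<phi>=\<phi> and f=f])
    show "convex ?S" by (intro convex_Int convex_halfspace_Re_ge convex_halfspace_Re_le convex_halfspace_Im_ge convex_halfspace_Im_le)
    fix z assume z: "z \<in> ?S"
    then have "sin \<delta> * sinh \<delta> \<le> sin (\<phi> - Re z) * sinh (Im z)" by (intro mon) auto
    moreover have "sin (Re z - \<phi>) = - sin (\<phi> - Re z)" by (metis minus_diff_eq sin_minus)
    ultimately show "sin (Re z - \<phi>) * sinh (Im z) \<le> - (sin \<delta> * sinh \<delta>)" by simp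
  qed (use assms in auto)
  also have "norm (Complex (\<phi> - \<delta>) \<delta> - Complex (- pi / 4) v) \<le> pi + v"
    using d phi pi_gt_zero by (intro order_trans[OF cmod_le]) (auto simp: abs_if)
  finally show "norm (F (Complex (\<phi> - \<delta>) \<delta>) - F (Complex (- pi / 4) v)) \<le> B * exp (- (sin \<delta> * sinh \<delta>) * \<kappa>) * (pi + v)"
    using B by (simp add: mult_left_mono)
  let ?S = "{z. \<phi> + \<delta> \<le> Re z} \<inter> {z. Re z \<le> \<phi> + 3 * pi / 4} \<inter> ({z. - v \<le> Im z} \<inter> {z. Im z \<le> - \<delta>})"
  have "norm (F (Complex (3 * pi / 4) (- v)) - F (Complex (\<phi> + \<delta>) (-\<delta>))) \<le> B * exp (- (sin \<delta> * sinh \<delta>) * \<kappa>)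
      * norm (Complex (3 * pi / 4) (- v) - Complex (\<phi> + \<delta>) (-\<delta>))"
  proof (rule decaying_segment[where W="?S" and T="{z. \<bar>Im z\<bar> \<le> v}" and \<phi>=\<phi> and f=f])
    show "convex ?S" by (intro convex_Int convex_halfspace_Re_ge convex_halfspace_Re_le convex_halfspace_Im_ge convex_halfspace_Im_le)
    fix z assume z: "z \<in> ?S"
    then have "sin \<delta> * sinh \<delta> \<le> sin (Re z - \<phi>) * sinh (- Im z)" by (intro mon) auto
    then show "sin (Re z - \<phi>) * sinh (Im z) \<le> - (sin \<delta> * sinh \<delta>)" by simp
  qed (use assms in auto)
  also have "norm (Complex (3 * pi / 4) (- v) - Complex (\<phi> + \<delta>) (-\<delta>)) \<le> pi + v"
    using d phi pi_gt_zero by (intro order_trans[OF cmod_le]) (auto simp: abs_if)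
  finally show "norm (F (Complex (3 * pi / 4) (- v)) - F (Complex (\<phi> + \<delta>) (-\<delta>))) \<le> B * exp (- (sin \<delta> * sinh \<delta>) * \<kappa>) * (pi + v)"
    using B by (simp add: mult_left_mono)
qed

text \<open>
A bound in the strip alone controls the derivatives on the real axis (Cauchy estimates), uniformly in
the point of expansion; this is what makes the saddle point expansion uniform in all parameters.
\<close>
lemma holomorphic_strip_Taylor:
  fixes f :: "complex \<Rightarrow> complex"
  assumes f: "f holomorphic_on {z. \<bar>Im z\<bar> < v}" and B: "\<And>z. \<bar>Im z\<bar> \<le> v \<Longrightarrow> norm (f z) \<le> B"
    and v: "v > 0" and b: "norm b \<le> v / 2"
  shows "norm (deriv f (of_real \<phi>)) \<le> 4 * B / v"
    and "norm (f (of_real \<phi> + b) - f (of_real \<phi>) - deriv f (of_real \<phi>) * b) \<le> (32 * B / v\<^sup>2) * (norm b)\<^sup>2"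
proof -
  have op: "open {z. \<bar>Im z\<bar> < v}"
    by (intro open_Collect_less continuous_intros)
  have cauchy: "norm ((deriv ^^ n) f w) \<le> fact n * B / (v / 4) ^ n" if w: "w \<in> cball (of_real \<phi>) (v/2)" for n w
  proof (rule Cauchy_inequality)
    have sub: "\<bar>Im z\<bar> < v" if "z \<in> cball w (v/4)" for z
    proof -
      have "\<bar>Im z - Im w\<bar> \<le> v / 4" using that abs_Im_le_cmod[of "z - w"] by (auto simp: dist_norm norm_minus_commute)
      moreover have "\<bar>Im w\<bar> \<le> v / 2" using w abs_Im_le_cmod[of "w - of_real \<phi>"] by (auto simp: dist_norm norm_minus_commute)
      ultimately show ?thesis using v by linarith
    qed
    show "f holomorphic_on ball w (v/4)" using sub by (intro holomorphic_on_subset[OF f]) auto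
    show "continuous_on (cball w (v/4)) f" using sub
      by (intro holomorphic_on_imp_continuous_on holomorphic_on_subset[OF f]) auto
    fix z assume "norm (w - z) = v / 4"
    then have "\<bar>Im z\<bar> < v" using sub[of z] by (auto simp: dist_norm)
    then show "norm (f z) \<le> B" by (intro B) auto
  qed (use v in auto)
  have "norm ((deriv ^^ 1) f (of_real \<phi>)) \<le> fact 1 * B / (v / 4) ^ 1"
    by (rule cauchy) (use v in auto)
  then show "norm (deriv f (of_real \<phi>)) \<le> 4 * B / v" by (simp add: mult.commute)
  have "norm ((deriv ^^ 0) f (of_real \<phi> + b) - (\<Sum>i\<le>1. (deriv ^^ i) f (of_real \<phi>) * (of_real \<phi> + b - of_real \<phi>) ^ i / fact i))
     \<le> (32 * B / v\<^sup>2) * norm (of_real \<phi> + b - of_real \<phi>) ^ Suc 1 / fact 1"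
  proof (rule complex_Taylor[where S="cball (of_real \<phi>) (v/2)"])
    fix i :: nat and x :: complex assume x: "x \<in> cball (of_real \<phi>) (v/2)"
    have x': "\<bar>Im x\<bar> < v" using x abs_Im_le_cmod[of "x - of_real \<phi>"] v by (auto simp: dist_norm norm_minus_commute)
    have "(deriv ^^ i) f holomorphic_on {z. \<bar>Im z\<bar> < v}" using f op by (rule holomorphic_higher_deriv)
    then have "((deriv ^^ i) f has_field_derivative deriv ((deriv ^^ i) f) x) (at x)"
      using x' op by (intro holomorphic_derivI) auto
    then show "((deriv ^^ i) f has_field_derivative (deriv ^^ Suc i) f x) (at x within cball (of_real \<phi>) (v/2))"
      by (simp add: has_field_derivative_at_within)
    show "norm ((deriv ^^ Suc 1) f x) \<le> 32 * B / v\<^sup>2"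
      using cauchy[OF x, of 2] by (simp add: numeral_2_eq_2 power2_eq_square field_simps)
  qed (use v b in \<open>auto simp: dist_norm\<close>)
  then show "norm (f (of_real \<phi> + b) - f (of_real \<phi>) - deriv f (of_real \<phi>) * b) \<le> (32 * B / v\<^sup>2) * (norm b)\<^sup>2"
    by (simp add: numeral_2_eq_2 algebra_simps)
qed

lemma sin_times_sinh_ge:
  fixes s :: real assumes "\<bar>s\<bar> \<le> 1"
  shows "s\<^sup>2 / 2 \<le> sin s * sinh s"
proof -
  have pos: "s\<^sup>2 / 2 \<le> sin s * sinh s" if "0 \<le> s" "s \<le> 1" for s :: real
  proof -
    have c: "cos x \<ge> 1/2" if "0 \<le> x" "x \<le> 1" for x :: real
    proof -
      have "cos (pi / 3) \<le> cos x" using that pi_gt3 by (intro cos_monotone_0_pi_le) auto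
      then show ?thesis by (simp add: cos_60)
    qed
    have "sin 0 - 0 / 2 \<le> sin s - s / 2"
    proof (rule DERIV_nonneg_imp_nondecreasing[OF that(1)])
      fix x :: real assume x: "0 \<le> x" "x \<le> s"
      have "((\<lambda>s. sin s - s / 2) has_real_derivative cos x - 1/2) (at x)"
        by (auto intro!: derivative_eq_intros)
      moreover have "0 \<le> cos x - 1/2" using c[of x] x that by simp
      ultimately show "\<exists>y. ((\<lambda>s. sin s - s / 2) has_real_derivative y) (at x) \<and> 0 \<le> y" by blast
    qed
    then have "s / 2 \<le> sin s" by simp
    moreover have "sinh 0 - 0 \<le> sinh s - s"
    proof (rule DERIV_nonneg_imp_nondecreasing[OF that(1)])
      fix x :: real
      have "((\<lambda>s. sinh s - s) has_real_derivative cosh x - 1) (at x)"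
        by (auto intro!: derivative_eq_intros)
      moreover have "0 \<le> cosh x - 1" using cosh_real_ge_1[of x] by simp
      ultimately show "\<exists>y. ((\<lambda>s. sinh s - s) has_real_derivative y) (at x) \<and> 0 \<le> y" by blast
    qed
    ultimately have "(s / 2) * s \<le> sin s * sinh s" using that by (intro mult_mono) auto
    then show ?thesis by (simp add: power2_eq_square)
  qed
  show ?thesis using pos[of s] pos[of "-s"] assms by (cases "0 \<le> s") auto
qed

lemma cos_minus_quadratic:
  fixes b :: complex assumes "norm b \<le> 1"
  shows "norm (cos b - 1 + b\<^sup>2 / 2) \<le> (norm b) ^ 4" and "norm (sin b - b) \<le> 3 * (norm b)\<^sup>2"
proof -
  have im: "\<bar>Im b\<bar> \<le> 1" using abs_Im_le_cmod[of b] assms by linarith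
  have e: "exp \<bar>Im b\<bar> \<le> 3" using im exp_le by (meson exp_le_cancel_iff order_trans)
  have set3: "{..3::nat} = {0,1,2,3}" and set1: "{..1::nat} = {0,1}" by auto
  have "norm (cos b - (\<Sum>k\<le>3. complex_of_real (cos_coeff k) * b ^ k)) \<le> exp \<bar>Im b\<bar> * norm b ^ Suc 3 / fact 3"
    by (rule Taylor_cos)
  also have "(\<Sum>k\<le>3. complex_of_real (cos_coeff k) * b ^ k) = 1 - b\<^sup>2 / 2"
    unfolding set3 by (simp add: cos_coeff_def)
  also have "exp \<bar>Im b\<bar> * norm b ^ Suc 3 / fact 3 = exp \<bar>Im b\<bar> * norm b ^ 4 / 6"
    by (simp add: fact_numeral)
  also have "\<dots> \<le> 3 * norm b ^ 4 / 6"
    using e by (intro divide_right_mono mult_right_mono) auto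
  also have "\<dots> \<le> norm b ^ 4" by simp
  finally show "norm (cos b - 1 + b\<^sup>2 / 2) \<le> (norm b) ^ 4" by (simp add: algebra_simps)
  have "norm (sin b - (\<Sum>k\<le>1. complex_of_real (sin_coeff k) * b ^ k)) \<le> exp \<bar>Im b\<bar> * norm b ^ Suc 1 / fact 1"
    by (rule Taylor_sin)
  also have "(\<Sum>k\<le>1. complex_of_real (sin_coeff k) * b ^ k) = b"
    unfolding set1 by (simp add: sin_coeff_def)
  also have "exp \<bar>Im b\<bar> * norm b ^ Suc 1 / fact 1 \<le> 3 * (norm b)\<^sup>2"
    using mult_right_mono[OF e, of "(norm b)\<^sup>2"] by (simp add: power2_eq_square)
  finally show "norm (sin b - b) \<le> 3 * (norm b)\<^sup>2" .
qed

text \<open>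
On the diagonal \<open>b = (1 - \<i>) s\<close> one has \<open>\<i> b\<^sup>2 = 2 s\<^sup>2\<close>, so the quadratic part of the phase is the
Gaussian \<open>exp(-\<kappa> s\<^sup>2)\<close>. The fourth order remainder of the cosine costs \<open>\<kappa> s^4\<close>, which half of the
Gaussian absorbs at the price of a factor \<open>1/\<kappa>\<close>.
\<close>
lemma phase_near_saddle:
  fixes s \<kappa> :: real
  assumes s: "\<bar>s\<bar> \<le> 1/2" and k: "\<kappa> \<ge> 1"
  defines "b \<equiv> of_real s * (1 - \<i>)"
  shows "norm (exp (\<i> * of_real \<kappa> * cos b)) \<le> exp (- \<kappa> * s\<^sup>2 / 2)"
    and "norm (exp (\<i> * of_real \<kappa> * cos b) - exp (\<i> * of_real \<kappa>) * of_real (exp (- \<kappa> * s\<^sup>2))) \<le> 256 / \<kappa> * exp (- \<kappa> / 4 * s\<^sup>2)"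
proof -
  have ri: "Re b = s" "Im b = - s" by (auto simp: b_def)
  have nb2: "(norm b)\<^sup>2 = 2 * s\<^sup>2" by (simp add: cmod_power2 ri)
  have nb4: "(norm b) ^ 4 = 4 * s ^ 4"
  proof -
    have "(norm b) ^ 4 = ((norm b)\<^sup>2)\<^sup>2" by simp
    then show ?thesis unfolding nb2 by (simp add: power_mult_distrib)
  qed
  have b2: "b\<^sup>2 = - 2 * \<i> * of_real (s\<^sup>2)" by (simp add: b_def power_mult_distrib power2_eq_square algebra_simps)
  have nb1: "norm b \<le> 1"
  proof -
    have "s\<^sup>2 \<le> (1/2)\<^sup>2" using s by (subst abs_le_square_iff[symmetric]) auto
    then have "(norm b)\<^sup>2 \<le> 1\<^sup>2" unfolding nb2 by (simp add: power2_eq_square)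
    then show ?thesis by (rule power2_le_imp_le) simp
  qed
  have "\<kappa> * (s\<^sup>2 / 2) \<le> \<kappa> * (sin s * sinh s)" using s k by (intro mult_left_mono sin_times_sinh_ge) auto
  then show n1: "norm (exp (\<i> * of_real \<kappa> * cos b)) \<le> exp (- \<kappa> * s\<^sup>2 / 2)"
    unfolding norm_exp_i_cos ri by (simp add: mult.assoc)
  let ?z = "\<i> * of_real \<kappa> * (cos b - 1)" and ?w = "complex_of_real (- \<kappa> * s\<^sup>2)"
  have "\<i> * of_real \<kappa> * cos b = \<i> * of_real \<kappa> + ?z" by (simp add: algebra_simps)
  then have "exp (\<i> * of_real \<kappa> * cos b) = exp (\<i> * of_real \<kappa>) * exp ?z" by (simp only: exp_add)
  moreover have "complex_of_real (exp (- \<kappa> * s\<^sup>2)) = exp ?w" by (rule exp_of_real[symmetric])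
  ultimately have "norm (exp (\<i> * of_real \<kappa> * cos b) - exp (\<i> * of_real \<kappa>) * of_real (exp (- \<kappa> * s\<^sup>2))) = norm (exp ?z - exp ?w)"
    by (simp only: right_diff_distrib[symmetric] norm_mult norm_exp_i_times mult_1_left)
  also have "\<dots> \<le> exp (- \<kappa> * s\<^sup>2 / 2) * norm (?z - ?w)"
  proof (rule norm_exp_diff_le)
    have "Re ?z = Re (\<i> * of_real \<kappa> * cos b)" by (simp add: algebra_simps)
    then show "Re ?z \<le> - \<kappa> * s\<^sup>2 / 2" using n1 unfolding norm_exp_eq_Re by (simp only: exp_le_cancel_iff)
    show "Re ?w \<le> - \<kappa> * s\<^sup>2 / 2" using k by simp
  qed
  also have "?z - ?w = \<i> * of_real \<kappa> * (cos b - 1 + b\<^sup>2 / 2)"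
    unfolding b2 by (simp add: algebra_simps)
  also have "norm \<dots> \<le> \<kappa> * (4 * s ^ 4)"
    using cos_minus_quadratic(1)[OF nb1] k unfolding nb4 by (simp add: norm_mult)
  also have "exp (- \<kappa> * s\<^sup>2 / 2) * (\<kappa> * (4 * s ^ 4)) = 4 * (\<kappa> * s ^ 4 * exp (- \<kappa> * s\<^sup>2 / 2))" by simp
  also have "\<dots> \<le> 4 * (64 / \<kappa> * exp (- \<kappa> / 4 * s\<^sup>2))"
    using k by (intro mult_left_mono power_times_gaussian_le) auto
  finally show "norm (exp (\<i> * of_real \<kappa> * cos b) - exp (\<i> * of_real \<kappa>) * of_real (exp (- \<kappa> * s\<^sup>2))) \<le> 256 / \<kappa> * exp (- \<kappa> / 4 * s\<^sup>2)"
    by simp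
qed

lemma gaussian_integral_le:
  fixes \<kappa> :: real assumes "\<kappa> > 0"
  shows "(\<lambda>s. exp (- \<kappa> / 4 * s\<^sup>2)) integrable_on {a..b}"
    and "1 / \<kappa> * integral {a..b} (\<lambda>s. exp (- \<kappa> / 4 * s\<^sup>2)) \<le> 4 * \<kappa> powr (-3/2)"
proof -
  let ?g = "\<lambda>s::real. exp (- \<kappa> / 4 * s\<^sup>2)"
  have g: "integrable lborel ?g" "(LBINT s. ?g s) = sqrt (pi / (\<kappa> / 4))"
    using gaussian_integral[of "\<kappa> / 4"] assms by simp_all
  then have U: "?g integrable_on UNIV" "integral UNIV ?g = sqrt (pi / (\<kappa> / 4))"
    by (auto simp: integrable_on_lborel integral_lborel)
  show i: "?g integrable_on {a..b}" using U(1) integrable_on_subinterval by blast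
  have "integral {a..b} ?g \<le> integral UNIV ?g"
    by (rule integral_subset_le) (use U i in auto)
  also have "\<dots> \<le> 4 / sqrt \<kappa>"
  proof -
    have "sqrt (pi / (\<kappa> / 4)) \<le> sqrt (16 / \<kappa>)"
      using pi_less_4 assms by (intro real_sqrt_le_mono) (simp add: field_simps)
    then show ?thesis using U(2) by (simp add: real_sqrt_divide)
  qed
  finally have "1 / \<kappa> * integral {a..b} ?g \<le> 1 / \<kappa> * (4 / sqrt \<kappa>)"
    using assms by (intro mult_left_mono) auto
  also have "\<dots> = 4 * \<kappa> powr (-3/2)"
    unfolding powr_three_halves[OF assms] by simp
  finally show "1 / \<kappa> * integral {a..b} ?g \<le> 4 * \<kappa> powr (-3/2)" .
qed

text \<open>
Near the saddle point \<open>f\<close> is replaced by \<open>f(\<phi>) + f'(\<phi>) sin(z - \<phi>)\<close>. The sine instead of the linear term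
is chosen because \<open>sin b exp(\<i> \<kappa> cos b)\<close> has an elementary primitive, which takes the same value at
both ends \<open>\<plusminus>(1 - \<i>) \<delta>\<close>; the first order term contributes nothing, and the rest is of second order.
\<close>
lemma saddle_centre:
  fixes F f :: "complex \<Rightarrow> complex"
  assumes F: "\<And>z. \<bar>Im z\<bar> \<le> v \<Longrightarrow> (F has_field_derivative f z * exp (\<i> * of_real \<kappa> * cos (z - of_real \<phi>))) (at z within {z. \<bar>Im z\<bar> \<le> v})"
    and hol: "f holomorphic_on {z. \<bar>Im z\<bar> < v}" and f: "\<And>z. \<bar>Im z\<bar> \<le> v \<Longrightarrow> norm (f z) \<le> B"
    and d: "0 < \<delta>" "\<delta> \<le> v / 4" "\<delta> \<le> 1 / 2" and k: "\<kappa> \<ge> 1"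
  shows "norm (F (Complex (\<phi> + \<delta>) (- \<delta>)) - F (Complex (\<phi> - \<delta>) \<delta>)
            - (1 - \<i>) * f (of_real \<phi>) * exp (\<i> * of_real \<kappa>) * of_real (integral {-\<delta>..\<delta>} (\<lambda>s. exp (- \<kappa> * s\<^sup>2))))
         \<le> 8 * B * (256 + 256 / v\<^sup>2 + 96 / v) * \<kappa> powr (-3/2)"
proof -
  have v: "v > 0" using d by linarith
  define f0 where "f0 = f (of_real \<phi>)"
  define f1 where "f1 = deriv f (of_real \<phi>)"
  have B: "0 \<le> B" using order_trans[OF norm_ge_zero f[of 0]] v by simp
  define b where "b = (\<lambda>s::real. of_real s * (1 - \<i>))"
  define E where "E = (\<lambda>s. exp (\<i> * of_real \<kappa> * cos (b s)))"
  define M where "M = (256 + 256 / v\<^sup>2 + 96 / v) * B"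
  define g where "g = (\<lambda>s. (1 - \<i>) * (f (of_real \<phi> + b s) - f1 * sin (b s)) * E s - (1 - \<i>) * f0 * exp (\<i> * of_real \<kappa>) * of_real (exp (- \<kappa> * s\<^sup>2)))"
  have nb2: "(norm (b s))\<^sup>2 = 2 * s\<^sup>2" for s by (simp add: b_def norm_mult power_mult_distrib cmod_power2)
  have nb: "norm (b s) \<le> 2 * \<bar>s\<bar>" for s
  proof (rule power2_le_imp_le)
    show "(norm (b s))\<^sup>2 \<le> (2 * \<bar>s\<bar>)\<^sup>2" unfolding nb2 by (simp add: power_mult_distrib)
  qed auto
  let ?H = "\<lambda>s. F (of_real \<phi> + b s) - f1 * (\<i> / of_real \<kappa>) * E s"
  have der: "((\<lambda>s. ?H s) has_vector_derivative (1 - \<i>) * (f (of_real \<phi> + b s) - f1 * sin (b s)) * E s) (at s within {-\<delta>..\<delta>})"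
    if s: "s \<in> {-\<delta>..\<delta>}" for s
  proof -
    have db: "((\<lambda>s. of_real \<phi> + b s) has_vector_derivative (1 - \<i>)) (at s within {-\<delta>..\<delta>})"
      unfolding b_def by (auto intro!: derivative_eq_intros simp: has_vector_derivative_def scaleR_conv_of_real)
    have sub: "(\<lambda>s. of_real \<phi> + b s) ` {-\<delta>..\<delta>} \<subseteq> {z. \<bar>Im z\<bar> \<le> v}"
      using d by (auto simp: b_def)
    have "(F has_field_derivative f (of_real \<phi> + b s) * E s) (at (of_real \<phi> + b s) within (\<lambda>s. of_real \<phi> + b s) ` {-\<delta>..\<delta>})"
    proof -
      have "\<bar>Im (of_real \<phi> + b s)\<bar> \<le> v" using sub s by blast
      from DERIV_subset[OF F[OF this] sub] show ?thesis by (simp add: E_def)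
    qed
    from field_vector_diff_chain_within[OF db this]
    have 1: "((\<lambda>s. F (of_real \<phi> + b s)) has_vector_derivative (1 - \<i>) * (f (of_real \<phi> + b s) * E s)) (at s within {-\<delta>..\<delta>})"
      by (simp add: o_def)
    have db': "(b has_vector_derivative (1 - \<i>)) (at s within {-\<delta>..\<delta>})"
      unfolding b_def by (auto intro!: derivative_eq_intros simp: has_vector_derivative_def scaleR_conv_of_real)
    have "((\<lambda>z. f1 * (\<i> / of_real \<kappa>) * exp (\<i> * of_real \<kappa> * cos z)) has_field_derivative
        f1 * (sin (b s) * E s)) (at (b s) within b ` {-\<delta>..\<delta>})"
      unfolding E_def using k by (auto intro!: derivative_eq_intros simp: field_simps)
    from field_vector_diff_chain_within[OF db' this]
    have 2: "((\<lambda>s. f1 * (\<i> / of_real \<kappa>) * E s) has_vector_derivative (1 - \<i>) * (f1 * (sin (b s) * E s))) (at s within {-\<delta>..\<delta>})"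
      by (simp add: o_def E_def)
    show ?thesis using has_vector_derivative_diff[OF 1 2] by (simp add: algebra_simps)
  qed
  have "((\<lambda>s. (1 - \<i>) * (f (of_real \<phi> + b s) - f1 * sin (b s)) * E s) has_integral ?H \<delta> - ?H (-\<delta>)) {-\<delta>..\<delta>}"
    using d der by (intro fundamental_theorem_of_calculus) auto
  moreover have "E (-\<delta>) = E \<delta>" unfolding E_def b_def by simp
  moreover have "of_real \<phi> + b \<delta> = Complex (\<phi> + \<delta>) (- \<delta>)" "of_real \<phi> + b (-\<delta>) = Complex (\<phi> - \<delta>) \<delta>"
    by (auto simp: b_def complex_eq_iff)
  ultimately have I1: "((\<lambda>s. (1 - \<i>) * (f (of_real \<phi> + b s) - f1 * sin (b s)) * E s) has_integral
     F (Complex (\<phi> + \<delta>) (- \<delta>)) - F (Complex (\<phi> - \<delta>) \<delta>)) {-\<delta>..\<delta>}" by simp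
  have "(\<lambda>s. exp (- \<kappa> * s\<^sup>2)) integrable_on {-\<delta>..\<delta>}"
    by (intro integrable_continuous_interval continuous_intros)
  from has_integral_mult_right[OF has_integral_of_real[OF integrable_integral[OF this]]]
  have I2: "((\<lambda>s. (1 - \<i>) * f0 * exp (\<i> * of_real \<kappa>) * of_real (exp (- \<kappa> * s\<^sup>2))) has_integral
     (1 - \<i>) * f0 * exp (\<i> * of_real \<kappa>) * of_real (integral {-\<delta>..\<delta>} (\<lambda>s. exp (- \<kappa> * s\<^sup>2)))) {-\<delta>..\<delta>}" .
  have I: "(g has_integral (F (Complex (\<phi> + \<delta>) (- \<delta>)) - F (Complex (\<phi> - \<delta>) \<delta>)
     - (1 - \<i>) * f0 * exp (\<i> * of_real \<kappa>) * of_real (integral {-\<delta>..\<delta>} (\<lambda>s. exp (- \<kappa> * s\<^sup>2))))) {-\<delta>..\<delta>}"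
    unfolding g_def by (rule has_integral_diff[OF I1 I2])
  have gb: "norm (g s) \<le> 2 * M / \<kappa> * exp (- \<kappa> / 4 * s\<^sup>2)" if s: "s \<in> {-\<delta>..\<delta>}" for s
  proof -
    have s1: "\<bar>s\<bar> \<le> 1 / 2" and s2: "norm (b s) \<le> v / 2" and s3: "norm (b s) \<le> 1"
      using s d nb[of s] by auto
    have i2: "norm (1 - \<i>) \<le> 2" using norm_triangle_ineq4[of 1 \<i>] by simp
    define r where "r = f (of_real \<phi> + b s) - f0 - f1 * sin (b s)"
    have "r = (f (of_real \<phi> + b s) - f0 - f1 * b s) - f1 * (sin (b s) - b s)"
      by (simp add: r_def algebra_simps)
    then have "norm r \<le> norm (f (of_real \<phi> + b s) - f0 - f1 * b s) + norm f1 * norm (sin (b s) - b s)"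
      by (metis norm_triangle_ineq4 norm_mult)
    also have "\<dots> \<le> (32 * B / v\<^sup>2) * (norm (b s))\<^sup>2 + (4 * B / v) * (3 * (norm (b s))\<^sup>2)"
      unfolding f0_def f1_def using holomorphic_strip_Taylor[OF hol f v s2] cos_minus_quadratic(2)[OF s3] B v
      by (intro add_mono mult_mono) auto
    also have "\<dots> = (64 * B / v\<^sup>2 + 24 * B / v) * s\<^sup>2" unfolding nb2 by (simp add: algebra_simps)
    finally have r: "norm r \<le> (64 * B / v\<^sup>2 + 24 * B / v) * s\<^sup>2" .
    have "g s = (1 - \<i>) * (f0 * (E s - exp (\<i> * of_real \<kappa>) * of_real (exp (- \<kappa> * s\<^sup>2))) + r * E s)"
      by (simp add: g_def r_def algebra_simps)
    then have "norm (g s) \<le> norm (1 - \<i>) * (norm f0 * norm (E s - exp (\<i> * of_real \<kappa>) * of_real (exp (- \<kappa> * s\<^sup>2))) + norm r * norm (E s))"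
      by (metis (no_types, lifting) mult_left_mono norm_ge_zero norm_mult norm_triangle_ineq)
    also have "\<dots> \<le> 2 * (B * (256 / \<kappa> * exp (- \<kappa> / 4 * s\<^sup>2)) + (64 * B / v\<^sup>2 + 24 * B / v) * s\<^sup>2 * exp (- \<kappa> * s\<^sup>2 / 2))"
      unfolding E_def b_def f0_def
      using phase_near_saddle[OF s1 k] r i2 f[of "of_real \<phi>"] v B by (intro mult_mono add_mono) auto
    also have "\<dots> \<le> 2 * (B * (256 / \<kappa> * exp (- \<kappa> / 4 * s\<^sup>2)) + (64 * B / v\<^sup>2 + 24 * B / v) * (4 / \<kappa> * exp (- \<kappa> / 4 * s\<^sup>2)))"
      using k B v power_times_gaussian_le(1)[of \<kappa> s] unfolding mult.assoc by (intro mult_left_mono add_left_mono) (auto simp: algebra_simps)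
    also have "\<dots> = 2 * M / \<kappa> * exp (- \<kappa> / 4 * s\<^sup>2)" by (simp add: M_def algebra_simps add_divide_distrib)
    finally show ?thesis .
  qed
  have k0: "\<kappa> > 0" using k by simp
  have Iinth: "((\<lambda>s. 2 * M / \<kappa> * exp (- \<kappa> / 4 * s\<^sup>2)) has_integral 2 * M / \<kappa> * integral {-\<delta>..\<delta>} (\<lambda>s. exp (- \<kappa> / 4 * s\<^sup>2))) {-\<delta>..\<delta>}"
    by (intro has_integral_mult_right integrable_integral gaussian_integral_le(1) k0)
  have "norm (integral {-\<delta>..\<delta>} g) \<le> integral {-\<delta>..\<delta>} (\<lambda>s. 2 * M / \<kappa> * exp (- \<kappa> / 4 * s\<^sup>2))"
    by (rule integral_norm_bound_integral[OF has_integral_integrable[OF I] has_integral_integrable[OF Iinth] gb])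
  also have "\<dots> = 2 * M * (1 / \<kappa> * integral {-\<delta>..\<delta>} (\<lambda>s. exp (- \<kappa> / 4 * s\<^sup>2)))"
    unfolding integral_unique[OF Iinth] by simp
  also have "\<dots> \<le> 2 * M * (4 * \<kappa> powr (-3/2))"
    using B v by (intro mult_left_mono gaussian_integral_le(2) k0) (auto simp: M_def)
  also have "\<dots> = 8 * B * (256 + 256 / v\<^sup>2 + 96 / v) * \<kappa> powr (-3/2)" by (simp add: M_def)
  finally show ?thesis unfolding integral_unique[OF I] f0_def .
qed

text \<open>
The constant depends on the width of the strip and on the bound of \<open>f\<close> only. The three parts of the path
are the two arms, which are exponentially small, and the centre.
\<close>
lemma saddle_point_contribution:
  fixes v B :: real
  assumes v: "v > 0" and B: "B \<ge> 0"
  obtains C where "C \<ge> 0"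
    "\<And>F f \<phi> \<kappa>. \<lbrakk>\<And>z. \<bar>Im z\<bar> \<le> v \<Longrightarrow> (F has_field_derivative f z * exp (\<i> * of_real \<kappa> * cos (z - of_real \<phi>))) (at z within {z. \<bar>Im z\<bar> \<le> v});
      f holomorphic_on {z. \<bar>Im z\<bar> < v}; \<And>z. \<bar>Im z\<bar> \<le> v \<Longrightarrow> norm (f z) \<le> B; 0 \<le> \<phi>; \<phi> \<le> pi / 2; \<kappa> \<ge> 1\<rbrakk> \<Longrightarrow>
      norm (F (Complex (3 * pi / 4) (- v)) - F (Complex (- pi / 4) v)
        - f (of_real \<phi>) * ((1 - \<i>) * exp (\<i> * of_real \<kappa>) * of_real (sqrt (pi / \<kappa>)))) \<le> C * \<kappa> powr (-3/2)"
proof -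
  define \<delta> where "\<delta> = min (v / 4) (1 / 2)"
  have d: "0 < \<delta>" "\<delta> \<le> v / 4" "\<delta> \<le> 1 / 2" "\<delta> \<le> v" "\<delta> \<le> pi / 4"
    using v pi_gt3 by (auto simp: \<delta>_def)
  define c where "c = sin \<delta> * sinh \<delta>"
  have c: "c > 0" unfolding c_def using d pi_gt3 by (intro mult_pos_pos sin_gt_zero) auto
  define C1 where "C1 = B * (2 / c\<^sup>2) * (pi + v)"
  define C2 where "C2 = 8 * B * (256 + 256 / v\<^sup>2 + 96 / v)"
  define C3 where "C3 = 2 * B * (sqrt (2 * pi) * (8 / \<delta>^4))"
  show ?thesis
  proof
    show "C1 + C2 + C3 + C1 \<ge> 0" using v B d c by (auto simp: C1_def C2_def C3_def)
    fix F f \<phi> \<kappa>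
    assume F: "\<And>z. \<bar>Im z\<bar> \<le> v \<Longrightarrow> (F has_field_derivative f z * exp (\<i> * of_real \<kappa> * cos (z - of_real \<phi>))) (at z within {z. \<bar>Im z\<bar> \<le> v})"
      and hol: "f holomorphic_on {z. \<bar>Im z\<bar> < v}" and f: "\<And>z. \<bar>Im z\<bar> \<le> v \<Longrightarrow> norm (f z) \<le> B"
      and phi: "0 \<le> \<phi>" "\<phi> \<le> pi / 2" and k: "\<kappa> \<ge> 1"
    let ?P = "Complex (\<phi> - \<delta>) \<delta>" and ?Q = "Complex (\<phi> + \<delta>) (-\<delta>)"
    let ?A = "Complex (- pi / 4) v" and ?E = "Complex (3 * pi / 4) (- v)"
    let ?I = "integral {-\<delta>..\<delta>} (\<lambda>s. exp (- \<kappa> * s\<^sup>2))"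
    let ?w = "(1 - \<i>) * f (of_real \<phi>) * exp (\<i> * of_real \<kappa>)"
    let ?r = "\<kappa> powr (-3/2)"
    have k0: "\<kappa> \<ge> 0" using k by simp
    have e: "B * exp (- c * \<kappa>) * (pi + v) \<le> C1 * ?r"
    proof -
      have "B * exp (- c * \<kappa>) * (pi + v) \<le> B * (2 / c\<^sup>2 * ?r) * (pi + v)"
        using exp_decay_three_halves[OF c k] B v by (intro mult_right_mono mult_left_mono) auto
      also have "\<dots> = C1 * ?r" by (simp add: C1_def)
      finally show ?thesis .
    qed
    have 1: "norm (F ?P - F ?A) \<le> C1 * ?r"
      using saddle_arms(1)[OF F f d(1) d(4) d(5) phi k0] e unfolding c_def by (rule order_trans)
    have 2: "norm (F ?E - F ?Q) \<le> C1 * ?r"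
      using saddle_arms(2)[OF F f d(1) d(4) d(5) phi k0] e unfolding c_def by (rule order_trans)
    have 3: "norm (F ?Q - F ?P - ?w * of_real ?I) \<le> C2 * ?r"
      unfolding C2_def by (rule saddle_centre[OF F hol f d(1) d(2) d(3) k])
    have "norm ?w \<le> 2 * B"
    proof -
      have "norm (1 - \<i>) \<le> 2" using norm_triangle_ineq4[of 1 \<i>] by simp
      then have "norm (1 - \<i>) * norm (f (of_real \<phi>)) \<le> 2 * B" using f[of "of_real \<phi>"] v by (intro mult_mono) auto
      then show ?thesis by (simp add: norm_mult)
    qed
    moreover have "norm (of_real (?I - sqrt (pi / \<kappa>)) :: complex) \<le> sqrt (2 * pi) * (8 / \<delta>^4) * ?r"
      unfolding norm_of_real by (rule gaussian_truncation[OF d(1) k])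
    ultimately have "norm (?w * of_real (?I - sqrt (pi / \<kappa>))) \<le> 2 * B * (sqrt (2 * pi) * (8 / \<delta>^4) * ?r)"
      unfolding norm_mult[of ?w] using B by (intro mult_mono) auto
    then have 4: "norm (?w * of_real ?I - ?w * of_real (sqrt (pi / \<kappa>))) \<le> C3 * ?r"
      by (simp add: C3_def algebra_simps)
    have "F ?E - F ?A - ?w * of_real (sqrt (pi / \<kappa>)) = (F ?E - F ?Q) + (F ?Q - F ?P - ?w * of_real ?I)
        + (?w * of_real ?I - ?w * of_real (sqrt (pi / \<kappa>))) + (F ?P - F ?A)"
      by simp
    also have "norm \<dots> \<le> C1 * ?r + C2 * ?r + C3 * ?r + C1 * ?r"
      by (intro norm_triangle_le add_mono 1 2 3 4)
    finally show "norm (F ?E - F ?A - f (of_real \<phi>) * ((1 - \<i>) * exp (\<i> * of_real \<kappa>) * of_real (sqrt (pi / \<kappa>)))) \<le> (C1 + C2 + C3 + C1) * ?r"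
      by (simp add: algebra_simps)
  qed
qed

text \<open>
Cauchy's theorem on the half strip \<open>{v \<le> Re z, 0 \<le> Im z \<le> \<pi>/4}\<close>: the vertical ends vanish at
infinity by the doubly exponential decay, and the upper side carries the stronger decay that comes from
its distance \<open>\<pi>/4\<close> to the ray. What remains of the ray is the short vertical edge at its start.
\<close>
lemma ray_shift:
  fixes Q :: "complex \<Rightarrow> complex" and v B c \<kappa> :: real and N :: nat
  defines "W \<equiv> {z. v \<le> Re z \<and> 0 \<le> Im z \<and> Im z \<le> pi / 4}"
  assumes v: "v > 0" and B: "B \<ge> 0" and c: "c > 0"
    and cont: "continuous_on W Q" and hol: "Q holomorphic_on interior W"
    and b: "\<And>z. z \<in> W \<Longrightarrow> norm (Q z) \<le> B * exp (N * Re z) * exp (- c * sinh (Re z))"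
    and b2: "\<And>z. z \<in> W \<Longrightarrow> Im z = pi / 4 \<Longrightarrow> norm (Q z) \<le> B * exp (N * Re z) * exp (- \<kappa> * sinh (Re z))"
    and k: "\<kappa> \<ge> real N + 1"
  shows "(\<lambda>x. Q (of_real x)) absolutely_integrable_on {v<..}"
    and "norm (integral {v<..} (\<lambda>x. Q (of_real x)) - \<i> * integral {0..pi/4} (\<lambda>u. Q (Complex v u))) \<le> B * exp (N * v) * exp (- \<kappa> * sinh v)"
proof -
  have sinh_lin: "sinh x \<ge> sinh v + (x - v)" if "x \<ge> v" for x
  proof -
    have "sinh v - v \<le> sinh x - x"
    proof (rule DERIV_nonneg_imp_nondecreasing[OF that])
      fix x :: real
      have "((\<lambda>s. sinh s - s) has_real_derivative cosh x - 1) (at x)"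
        by (auto intro!: derivative_eq_intros)
      moreover have "0 \<le> cosh x - 1" using cosh_real_ge_1[of x] by simp
      ultimately show "\<exists>y. ((\<lambda>s. sinh s - s) has_real_derivative y) (at x) \<and> 0 \<le> y" by blast
    qed
    then show ?thesis by simp
  qed
  have convW: "convex W"
  proof -
    have "W = {z. v \<le> Re z} \<inter> ({z. 0 \<le> Im z} \<inter> {z. Im z \<le> pi / 4})" by (auto simp: W_def)
    then show ?thesis by (simp only: convex_Int convex_halfspace_Re_ge convex_halfspace_Im_ge convex_halfspace_Im_le)
  qed
  obtain P where P: "\<And>z. z \<in> W \<Longrightarrow> (P has_field_derivative Q z) (at z within W)"
  proof (rule holomorphic_convex_primitive[OF convW, of "{}" Q])
    fix x assume "x \<in> interior W - {}"
    then show "Q field_differentiable at x" using hol by (auto intro: holomorphic_on_imp_differentiable_at)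
  qed (use cont in auto)
  have ray: "((\<lambda>x. Q (Complex x u)) has_integral P (Complex b u) - P (Complex a u)) {a..b}"
    if "v \<le> a" "a \<le> b" "0 \<le> u" "u \<le> pi / 4" for a b u
  proof (rule fundamental_theorem_of_calculus[OF that(2)])
    fix x assume x: "x \<in> {a..b}"
    have g: "((\<lambda>x. Complex x u) has_vector_derivative 1) (at x within {a..b})"
      unfolding Complex_eq by (auto intro!: derivative_eq_intros simp: has_vector_derivative_def scaleR_conv_of_real)
    have im: "(\<lambda>x. Complex x u) ` {a..b} \<subseteq> W" using that by (auto simp: W_def)
    have "Complex x u \<in> W" using im x by blast
    from field_vector_diff_chain_within[OF g DERIV_subset[OF P[OF this] im]]
    show "((\<lambda>x. P (Complex x u)) has_vector_derivative Q (Complex x u)) (at x within {a..b})" by (simp add: o_def)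
  qed
  have side: "((\<lambda>u. \<i> * Q (Complex x u)) has_integral P (Complex x (pi/4)) - P (Complex x 0)) {0..pi/4}"
    if "v \<le> x" for x
  proof (rule fundamental_theorem_of_calculus)
    fix u assume u: "u \<in> {0..pi/4}"
    have g: "((\<lambda>u. Complex x u) has_vector_derivative \<i>) (at u within {0..pi/4})"
      unfolding Complex_eq by (auto intro!: derivative_eq_intros simp: has_vector_derivative_def scaleR_conv_of_real)
    have im: "(\<lambda>u. Complex x u) ` {0..pi/4} \<subseteq> W" using that by (auto simp: W_def)
    have "Complex x u \<in> W" using im u by blast
    from field_vector_diff_chain_within[OF g DERIV_subset[OF P[OF this] im]]
    show "((\<lambda>u. P (Complex x u)) has_vector_derivative \<i> * Q (Complex x u)) (at u within {0..pi/4})" by (simp add: o_def)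
  qed auto
  have exp_bound: "exp (N * x) * exp (- m * sinh x) \<le> exp (N * v) * exp (- m * sinh v) * exp (- (x - v))"
    if "x \<ge> v" "m \<ge> N + 1" for x m :: real
  proof -
    have "m * (sinh v + (x - v)) \<le> m * sinh x" using sinh_lin[OF that(1)] that(2) by (intro mult_left_mono) auto
    moreover have "(N + 1) * (x - v) \<le> m * (x - v)" using that by (intro mult_right_mono) auto
    ultimately have "N * x + - m * sinh x \<le> N * v + - m * sinh v + - (x - v)" by (simp add: algebra_simps)
    then show ?thesis by (simp only: exp_add[symmetric] exp_le_cancel_iff)
  qed
  define M where "M = B * exp ((real N + 1)\<^sup>2 / c)"
  have growth: "B * exp (N * x) * exp (- c * sinh x) \<le> M * exp (- x)" if "x \<ge> 0" for x :: real
  proof -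
    have "x\<^sup>2 / 4 \<le> (exp x - 1) / 2" using exp_lower_Taylor_quadratic[OF that] that by simp
    also have "\<dots> \<le> sinh x" using that by (simp add: sinh_def field_simps)
    finally have "c * (x\<^sup>2 / 4) \<le> c * sinh x" using c by (intro mult_left_mono) auto
    moreover have "(real N + 1) * x \<le> c * (x\<^sup>2 / 4) + (real N + 1)\<^sup>2 / c"
    proof -
      have "0 \<le> (c * x - 2 * (real N + 1))\<^sup>2" by simp
      then have "4 * c * ((real N + 1) * x) \<le> (c * x)\<^sup>2 + 4 * (real N + 1)\<^sup>2"
        by (simp add: power2_eq_square algebra_simps)
      also have "\<dots> = 4 * c * (c * (x\<^sup>2 / 4) + (real N + 1)\<^sup>2 / c)"
        using c by (simp add: power2_eq_square field_simps)
      finally show ?thesis using c by simp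
    qed
    ultimately have "real N * x + - c * sinh x \<le> (real N + 1)\<^sup>2 / c + - x" by (simp add: algebra_simps)
    then have "exp (N * x) * exp (- c * sinh x) \<le> exp ((real N + 1)\<^sup>2 / c) * exp (- x)"
      by (simp only: exp_add[symmetric] exp_le_cancel_iff)
    from mult_left_mono[OF this B] show ?thesis unfolding M_def by (simp only: mult.assoc)
  qed
  have contv: "continuous_on {v..} (\<lambda>x. Q (of_real x))"
    by (rule continuous_on_compose2[OF cont]) (auto simp: W_def intro!: continuous_intros)
  have int: "(\<lambda>x. Q (of_real x)) absolutely_integrable_on {v..}"
  proof (rule measurable_bounded_by_integrable_imp_absolutely_integrable)
    show "(\<lambda>x. M * exp (- x)) integrable_on {v..}"
      using integrable_on_exp_minus_to_infinity[of 1 v] by (intro integrable_on_mult_right) simp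
    show "(\<lambda>x. Q (of_real x)) \<in> borel_measurable (lebesgue_on {v..})"
      using contv by (rule continuous_imp_measurable_on_sets_lebesgue) auto
    fix x assume "x \<in> {v..}"
    then show "norm (Q (of_real x)) \<le> M * exp (- x)"
      using b[of "of_real x"] growth[of x] v by (auto simp: W_def)
  qed auto
  show "(\<lambda>x. Q (of_real x)) absolutely_integrable_on {v<..}"
    by (rule set_integrable_subset[OF int]) auto
  have "((\<lambda>X. LINT x:{v..X}|lebesgue. Q (of_real x)) \<longlongrightarrow> (LINT x:{v..}|lebesgue. Q (of_real x))) at_top"
    by (rule tendsto_set_lebesgue_integral_at_top[OF _ int]) auto
  moreover have "(LINT x:{v..X}|lebesgue. Q (of_real x)) = integral {v..X} (\<lambda>x. Q (of_real x))" for X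
    by (intro set_lebesgue_integral_eq_integral set_integrable_subset[OF int]) auto
  moreover have "(LINT x:{v..}|lebesgue. Q (of_real x)) = integral {v<..} (\<lambda>x. Q (of_real x))"
  proof -
    have "integral {v..} (\<lambda>x. Q (of_real x)) = integral {v<..} (\<lambda>x. Q (of_real x))"
      by (rule integral_spike_set) (rule negligible_subset[of "{v}"], auto)+
    then show ?thesis using set_lebesgue_integral_eq_integral(2)[OF int] by simp
  qed
  ultimately have lim: "((\<lambda>X. integral {v..X} (\<lambda>x. Q (of_real x))) \<longlongrightarrow> integral {v<..} (\<lambda>x. Q (of_real x))) at_top"
    by simp
  let ?J = "\<i> * integral {0..pi/4} (\<lambda>u. Q (Complex v u))"
  define K where "K = B * exp (N * v) * exp (- \<kappa> * sinh v)"
  have K0: "K \<ge> 0" using B by (simp add: K_def)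
  have bound: "norm (integral {v..X} (\<lambda>x. Q (of_real x)) - ?J) \<le> K + M * exp (- X)" if X: "X \<ge> v" for X
  proof -
    have of: "Complex x 0 = of_real x" for x by (simp add: complex_eq_iff)
    have e1: "integral {v..X} (\<lambda>x. Q (of_real x)) = P (Complex X 0) - P (Complex v 0)"
      using ray[of v X 0] X by (simp add: has_integral_iff of)
    have e2: "?J = P (Complex v (pi/4)) - P (Complex v 0)"
      using side[of v] by (simp add: has_integral_iff)
    have e3: "norm (P (Complex X (pi/4)) - P (Complex v (pi/4))) \<le> K"
    proof -
      have r: "((\<lambda>x. Q (Complex x (pi/4))) has_integral P (Complex X (pi/4)) - P (Complex v (pi/4))) {v..X}"
        using ray[of v X "pi/4"] X by simp
      have s: "((\<lambda>x. K * exp (- (x - v))) has_integral (- K * exp (- (X - v))) - (- K * exp (- (v - v)))) {v..X}"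
        using X by (intro fundamental_theorem_of_calculus)
          (auto intro!: derivative_eq_intros simp: has_real_derivative_iff_has_vector_derivative[symmetric])
      have "norm (integral {v..X} (\<lambda>x. Q (Complex x (pi/4)))) \<le> integral {v..X} (\<lambda>x. K * exp (- (x - v)))"
      proof (rule integral_norm_bound_integral[OF has_integral_integrable[OF r] has_integral_integrable[OF s]])
        fix x assume x: "x \<in> {v..X}"
        have "norm (Q (Complex x (pi/4))) \<le> B * (exp (N * x) * exp (- \<kappa> * sinh x))"
          using b2[of "Complex x (pi/4)"] x by (simp add: W_def mult.assoc)
        also have "\<dots> \<le> B * (exp (N * v) * exp (- \<kappa> * sinh v) * exp (- (x - v)))"
          using x k B by (intro mult_left_mono exp_bound) auto
        finally show "norm (Q (Complex x (pi/4))) \<le> K * exp (- (x - v))" by (simp add: K_def mult.assoc)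
      qed
      also have "\<dots> = K - K * exp (- (X - v))" using integral_unique[OF s] by simp
      also have "\<dots> \<le> K" using K0 by simp
      finally show ?thesis unfolding integral_unique[OF r] .
    qed
    have e4: "norm (P (Complex X (pi/4)) - P (Complex X 0)) \<le> M * exp (- X)"
    proof -
      have M0: "0 \<le> M * exp (- X)" using B by (simp add: M_def)
      have sd: "((\<lambda>u. \<i> * Q (Complex X u)) has_integral P (Complex X (pi/4)) - P (Complex X 0)) (cbox 0 (pi/4))"
        using side[OF X] by simp
      have bd: "norm (\<i> * Q (Complex X u)) \<le> M * exp (- X)" if "u \<in> cbox 0 (pi/4)" for u
      proof -
        have "Complex X u \<in> W" using X that by (auto simp: W_def)
        then show ?thesis
          using b[of "Complex X u"] growth[of X] v X by (simp add: norm_mult)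
      qed
      have "norm (P (Complex X (pi/4)) - P (Complex X 0)) \<le> M * exp (- X) * (pi / 4)"
        using has_integral_bound[OF M0 sd bd] by simp
      also have "\<dots> \<le> M * exp (- X) * 1"
        using M0 pi_less_4 by (intro mult_left_mono) auto
      finally show ?thesis by simp
    qed
    have "integral {v..X} (\<lambda>x. Q (of_real x)) - ?J = (P (Complex X (pi/4)) - P (Complex v (pi/4))) - (P (Complex X (pi/4)) - P (Complex X 0))"
      unfolding e1 e2 by simp
    also have "norm \<dots> \<le> K + M * exp (- X)"
      using norm_triangle_ineq4 e3 e4 by (smt (verit))
    finally show ?thesis .
  qed
  have "norm (integral {v<..} (\<lambda>x. Q (of_real x)) - ?J) \<le> K + M * 0"
  proof (rule tendsto_le[OF _ _ tendsto_norm[OF tendsto_diff[OF lim tendsto_const]]])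
    have "((\<lambda>X::real. exp (- X)) \<longlongrightarrow> 0) at_top"
      by (rule filterlim_compose[OF exp_at_bot filterlim_uminus_at_bot_at_top])
    then show "((\<lambda>X. K + M * exp (- X)) \<longlongrightarrow> K + M * 0) at_top"
      by (intro tendsto_intros)
    show "\<forall>\<^sub>F X in at_top. norm (integral {v..X} (\<lambda>x. Q (of_real x)) - ?J) \<le> K + M * exp (- X)"
      using eventually_ge_at_top[of v] by eventually_elim (rule bound)
  qed auto
  then show "norm (integral {v<..} (\<lambda>x. Q (of_real x)) - ?J) \<le> B * exp (N * v) * exp (- \<kappa> * sinh v)"
    by (simp add: K_def)
qed

section \<open>Square roots along the complex angle\<close>

lemma primitive_along_line:
  fixes F q :: "complex \<Rightarrow> complex" and p c :: complex
  assumes F: "\<And>z. z \<in> T \<Longrightarrow> (F has_field_derivative q z) (at z within T)"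
    and im: "\<And>s. s \<in> {a..b} \<Longrightarrow> p + of_real s * c \<in> T" and ab: "a \<le> b"
  shows "((\<lambda>s. c * q (p + of_real s * c)) has_integral F (p + of_real b * c) - F (p + of_real a * c)) {a..b}"
proof (rule fundamental_theorem_of_calculus[OF ab])
  fix s assume s: "s \<in> {a..b}"
  have g: "((\<lambda>s. p + of_real s * c) has_vector_derivative c) (at s within {a..b})"
    by (auto intro!: derivative_eq_intros simp: has_vector_derivative_def scaleR_conv_of_real)
  have "(\<lambda>s. p + of_real s * c) ` {a..b} \<subseteq> T" using im by auto
  from field_vector_diff_chain_within[OF g DERIV_subset[OF F[OF im[OF s]] this]]
  show "((\<lambda>s. F (p + of_real s * c)) has_vector_derivative c * q (p + of_real s * c)) (at s within {a..b})"
    by (simp add: o_def)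
qed

text \<open>
At the origin the principal root is continuous although the slit ends there; the paths used later pass
through the branch point itself.
\<close>
lemma isCont_csqrt_slit:
  assumes "z \<notin> \<real>\<^sub>\<le>\<^sub>0 \<or> z = 0"
  shows "isCont csqrt z"
proof (cases "z = 0")
  case True
  have "((\<lambda>z. sqrt (norm z)) \<longlongrightarrow> sqrt (norm (0::complex))) (at (0::complex))"
    by (intro tendsto_intros)
  then have "((\<lambda>z. norm (csqrt z)) \<longlongrightarrow> 0) (at (0::complex))" by simp
  then have "(csqrt \<longlongrightarrow> 0) (at (0::complex))" by (rule tendsto_norm_zero_cancel)
  then show ?thesis using True by (simp add: isCont_def)
qed (use assms continuous_at_csqrt in auto)

lemma continuous_on_csqrt_slit:
  assumes "continuous_on A g" "\<And>z. z \<in> A \<Longrightarrow> g z \<notin> \<real>\<^sub>\<le>\<^sub>0 \<or> g z = 0"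
  shows "continuous_on A (\<lambda>z. csqrt (g z))"
proof (rule continuous_on_compose2[of "{z. z \<notin> \<real>\<^sub>\<le>\<^sub>0 \<or> z = 0}" csqrt])
  show "continuous_on {z. z \<notin> \<real>\<^sub>\<le>\<^sub>0 \<or> z = 0} csqrt"
    by (auto intro!: continuous_at_imp_continuous_on isCont_csqrt_slit)
qed (use assms in auto)

text \<open>
The slowly varying part of an integrand, as a function of the horizontal frequency \<open>x\<close> and of the
two vertical rates \<open>m\<close> (lower medium) and \<open>s\<close> (upper medium). The exponents \<open>i\<close>, \<open>j\<close>, \<open>l\<close> record the derivatives
that were taken in the source coordinates.
\<close>
definition amp :: "nat \<Rightarrow> nat \<Rightarrow> nat \<Rightarrow> real \<Rightarrow> real \<Rightarrow> real \<Rightarrow> complex \<Rightarrow> complex \<Rightarrow> complex \<Rightarrow> complex" where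
  "amp i j l y a b x m s = x ^ i * m ^ j * s ^ l * exp (- (\<i> * x * of_real y) - s * of_real a - m * of_real b)"

lemma amp_norm_le:
  assumes "norm x \<le> M" "norm m \<le> M" "norm s \<le> M" and r: "Re (- (\<i> * x * of_real y) - s * of_real a - m * of_real b) \<le> E"
  shows "norm (amp i j l y a b x m s) \<le> M ^ (i + j + l) * exp E"
proof -
  have M: "0 \<le> M" using assms(1) norm_ge_zero order_trans by blast
  have "norm (amp i j l y a b x m s) = norm x ^ i * norm m ^ j * norm s ^ l * exp (Re (- (\<i> * x * of_real y) - s * of_real a - m * of_real b))"
    unfolding amp_def norm_mult norm_power norm_exp_eq_Re ..
  also have "\<dots> \<le> M ^ i * M ^ j * M ^ l * exp E"
    using assms M by (intro mult_mono power_mono) auto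
  finally show ?thesis by (simp add: power_add)
qed

lemma amp_bounded:
  assumes M: "norm x \<le> M" "norm m \<le> M" "norm s \<le> M" and R: "\<bar>y\<bar> \<le> R" "\<bar>a\<bar> \<le> R" "\<bar>b\<bar> \<le> R"
  shows "norm (amp i j l y a b x m s) \<le> M ^ (i + j + l) * exp (3 * (M * R))"
proof (rule amp_norm_le[OF M])
  have M0: "0 \<le> M" using M norm_ge_zero order_trans by blast
  have "norm (- (\<i> * x * of_real y) - s * of_real a - m * of_real b) \<le> norm x * \<bar>y\<bar> + norm s * \<bar>a\<bar> + norm m * \<bar>b\<bar>"
    by (rule order_trans[OF norm_triangle_ineq4], rule add_mono[OF order_trans[OF norm_triangle_ineq4]]) (simp_all add: norm_mult)
  also have "\<dots> \<le> M * R + M * R + M * R"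
    using assms M0 by (intro add_mono mult_mono) auto
  finally show "Re (- (\<i> * x * of_real y) - s * of_real a - m * of_real b) \<le> 3 * (M * R)"
    using complex_Re_le_cmod[of "- (\<i> * x * of_real y) - s * of_real a - m * of_real b"] by linarith
qed

text \<open>
The jump of an integrand across the branch cut is controlled by the jump of the vertical rate \<open>s\<close>.
\<close>
lemma amp_lipschitz:
  assumes M: "norm x \<le> M" "norm m \<le> M" "norm s \<le> M" "norm s' \<le> M" "1 \<le> M"
    and R: "\<bar>y\<bar> \<le> R" "\<bar>a\<bar> \<le> R" "\<bar>b\<bar> \<le> R"
  shows "norm (amp i j l y a b x m s - amp i j l y a b x m s') \<le> (real l + R) * (M ^ (i + j + l) * exp (3 * (M * R))) * norm (s - s')"
proof (rule field_differentiable_bound[where S="cball 0 M" and f'="\<lambda>s. of_nat l * amp i j (l - 1) y a b x m s - of_real a * amp i j l y a b x m s"])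
  fix z :: complex assume "z \<in> cball 0 M"
  then have z: "norm z \<le> M" by simp
  show "(amp i j l y a b x m has_field_derivative of_nat l * amp i j (l - 1) y a b x m z - of_real a * amp i j l y a b x m z) (at z within cball 0 M)"
    unfolding amp_def by (auto intro!: derivative_eq_intros simp: algebra_simps)
  have R0: "0 \<le> R" using R by auto
  have "norm (amp i j (l - 1) y a b x m z) \<le> M ^ (i + j + (l - 1)) * exp (3 * (M * R))"
    by (rule amp_bounded[OF M(1,2) z R])
  also have "\<dots> \<le> M ^ (i + j + l) * exp (3 * (M * R))"
    using M by (intro mult_right_mono power_increasing) auto
  finally have 1: "norm (amp i j (l - 1) y a b x m z) \<le> M ^ (i + j + l) * exp (3 * (M * R))" .
  have "norm (of_nat l * amp i j (l - 1) y a b x m z - of_real a * amp i j l y a b x m z)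
     \<le> real l * norm (amp i j (l - 1) y a b x m z) + \<bar>a\<bar> * norm (amp i j l y a b x m z)"
    by (rule order_trans[OF norm_triangle_ineq4]) (simp add: norm_mult)
  also have "\<dots> \<le> real l * (M ^ (i + j + l) * exp (3 * (M * R))) + R * (M ^ (i + j + l) * exp (3 * (M * R)))"
    using 1 amp_bounded[OF M(1,2) z R] R R0 by (intro add_mono mult_mono) auto
  finally show "norm (of_nat l * amp i j (l - 1) y a b x m z - of_real a * amp i j l y a b x m z)
      \<le> (real l + R) * (M ^ (i + j + l) * exp (3 * (M * R)))"
    by (simp add: algebra_simps)
qed (use M in auto)

lemma Re_sin_cosh: "Re (sin z) = sin (Re z) * cosh (Im z)"
  by (simp add: Re_sin cosh_def)

lemma Im_sin_sinh: "Im (sin z) = cos (Re z) * sinh (Im z)"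
  by (simp add: Im_sin sinh_def field_simps)

lemma cos_sq_diff: "(cos z)\<^sup>2 - (cos w)\<^sup>2 = - sin (z + w) * sin (z - w)" for z w :: complex
proof -
  have "sin (z + w) * sin (z - w) = (sin z)\<^sup>2 * (cos w)\<^sup>2 - (cos z)\<^sup>2 * (sin w)\<^sup>2"
    by (simp add: sin_add sin_diff algebra_simps power2_eq_square)
  then show ?thesis by (simp add: sin_squared_eq algebra_simps)
qed

section \<open>
\<open>k\<close> belongs to the medium of the observer, \<open>K\<close> to the other one. The inequality places the branch points of
\<open>S(k cos z, K)\<close> off the real axis.
\<close>

locale wave_numbers =
  fixes k K :: real
  assumes k_pos: "0 < k" and k_less_K: "k < K"
begin

definition v0 :: real where "v0 = arcosh (K / k)"

lemma cosh_v0: "cosh v0 = K / k"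
  using k_pos k_less_K unfolding v0_def by (intro cosh_arcosh_real) simp

lemma v0_pos: "v0 > 0"
  using k_pos k_less_K unfolding v0_def by (intro arcosh_real_gt_1_iff[THEN iffD2]) auto

lemma K_pos: "K > 0"
  using k_pos k_less_K by simp

text \<open>
\<open>S(k cos z, K)\<close> continued from the real axis to the strip below the branch points, and (\<open>s_up\<close>) from
the imaginary axis to the region above them. Both are square roots of \<open>k\<^sup>2 cos\<^sup>2 z - K\<^sup>2\<close>, and both vanish at
the branch points \<open>\<plusminus>\<i> v0\<close>.
\<close>
definition s_low :: "complex \<Rightarrow> complex" where
  "s_low z = - \<i> * csqrt ((of_real K)\<^sup>2 - (of_real k * cos z)\<^sup>2)"

definition s_up :: "complex \<Rightarrow> complex" where
  "s_up z = csqrt ((of_real k * cos z)\<^sup>2 - (of_real K)\<^sup>2)"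

lemma Re_cos_sq: "Re ((of_real K)\<^sup>2 - (of_real k * cos z)\<^sup>2) \<ge> k\<^sup>2 * ((cosh v0)\<^sup>2 - (cosh (Im z))\<^sup>2)"
proof -
  have "Re ((of_real K)\<^sup>2 - (of_real k * cos z)\<^sup>2) = K\<^sup>2 - k\<^sup>2 * ((cos (Re z))\<^sup>2 * (cosh (Im z))\<^sup>2 - (sin (Re z))\<^sup>2 * (sinh (Im z))\<^sup>2)"
    by (simp add: power_mult_distrib Re_cos_cosh Im_cos_sinh power2_eq_square algebra_simps)
  moreover have "(cos (Re z))\<^sup>2 * (cosh (Im z))\<^sup>2 - (sin (Re z))\<^sup>2 * (sinh (Im z))\<^sup>2 \<le> 1 * (cosh (Im z))\<^sup>2 - 0"
    by (intro diff_mono mult_right_mono) (auto simp: abs_square_le_1)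
  then have "k\<^sup>2 * ((cos (Re z))\<^sup>2 * (cosh (Im z))\<^sup>2 - (sin (Re z))\<^sup>2 * (sinh (Im z))\<^sup>2) \<le> k\<^sup>2 * (cosh (Im z))\<^sup>2"
    by (intro mult_left_mono) auto
  moreover have "K\<^sup>2 = k\<^sup>2 * (cosh v0)\<^sup>2" using k_pos by (simp add: cosh_v0 power_divide)
  ultimately show ?thesis by (simp only: right_diff_distrib)
qed

text \<open>
In the strip the radicand has nonnegative real part, so it can only meet the slit at the origin.
\<close>
lemma strip_slit:
  assumes "\<bar>Im z\<bar> \<le> v0"
  shows "(of_real K)\<^sup>2 - (of_real k * cos z)\<^sup>2 \<notin> \<real>\<^sub>\<le>\<^sub>0 \<or> (of_real K)\<^sup>2 - (of_real k * cos z)\<^sup>2 = 0"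
proof -
  have "cosh (Im z) \<le> cosh v0" using assms cosh_real_abs[of "Im z"] cosh_real_nonneg_le_iff[of "\<bar>Im z\<bar>" v0] v0_pos by auto
  then have "(cosh (Im z))\<^sup>2 \<le> (cosh v0)\<^sup>2" by (intro power_mono) auto
  then have "0 \<le> k\<^sup>2 * ((cosh v0)\<^sup>2 - (cosh (Im z))\<^sup>2)" by simp
  then have "0 \<le> Re ((of_real K)\<^sup>2 - (of_real k * cos z)\<^sup>2)" using Re_cos_sq[of z] by linarith
  then show ?thesis by (auto simp: complex_nonpos_Reals_iff complex_eq_iff)
qed

lemma strip_slit_open:
  assumes "\<bar>Im z\<bar> < v0"
  shows "(of_real K)\<^sup>2 - (of_real k * cos z)\<^sup>2 \<notin> \<real>\<^sub>\<le>\<^sub>0"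
proof -
  have "cosh (Im z) < cosh v0" using assms cosh_real_abs[of "Im z"] cosh_real_nonneg_less_iff[of "\<bar>Im z\<bar>" v0] v0_pos by auto
  then have "(cosh (Im z))\<^sup>2 < (cosh v0)\<^sup>2" by (intro power_strict_mono) auto
  then have "0 < k\<^sup>2 * ((cosh v0)\<^sup>2 - (cosh (Im z))\<^sup>2)" using k_pos by simp
  then have "0 < Re ((of_real K)\<^sup>2 - (of_real k * cos z)\<^sup>2)" using Re_cos_sq[of z] by linarith
  then show ?thesis by (auto simp: complex_nonpos_Reals_iff)
qed

lemma trig_norm_le:
  "norm (of_real k * cos z) \<le> k * cosh (Im z)" "norm (- \<i> * of_real k * sin z) \<le> k * cosh (Im z)"
  using norm_cos_le_cosh[of z] norm_sin_le_cosh[of z] k_pos by (auto simp: norm_mult)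

lemma s_norm:
  "norm (s_low z) = sqrt (norm ((of_real k * cos z)\<^sup>2 - (of_real K)\<^sup>2))"
  "norm (s_up z) = sqrt (norm ((of_real k * cos z)\<^sup>2 - (of_real K)\<^sup>2))"
  by (auto simp: s_low_def s_up_def norm_mult norm_minus_commute)

lemma s_norm_le:
  "norm (s_low z) \<le> K + k * cosh (Im z)" "norm (s_up z) \<le> K + k * cosh (Im z)"
proof -
  have "norm ((of_real k * cos z)\<^sup>2 - (of_real K)\<^sup>2) \<le> (k * cosh (Im z))\<^sup>2 + K\<^sup>2"
    by (rule order_trans[OF norm_triangle_ineq4])
       (use trig_norm_le(1)[of z] in \<open>auto simp: norm_power simp del: norm_mult intro: power_mono\<close>)
  also have "\<dots> \<le> (K + k * cosh (Im z))\<^sup>2"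
    using k_pos K_pos by (simp add: power2_sum)
  finally show "norm (s_low z) \<le> K + k * cosh (Im z)" "norm (s_up z) \<le> K + k * cosh (Im z)"
    unfolding s_norm using k_pos K_pos by (auto intro!: real_le_lsqrt)
qed

lemma strip_norm_le:
  assumes "\<bar>Im z\<bar> \<le> v0"
  shows "norm (of_real k * cos z) \<le> 2 * K + 1" "norm (- \<i> * of_real k * sin z) \<le> 2 * K + 1"
    "norm (s_low z) \<le> 2 * K + 1" "norm (s_up z) \<le> 2 * K + 1"
proof -
  have "cosh (Im z) \<le> cosh v0" using assms cosh_real_abs[of "Im z"] cosh_real_nonneg_le_iff[of "\<bar>Im z\<bar>" v0] v0_pos by auto
  then have "k * cosh (Im z) \<le> k * cosh v0" using k_pos by (intro mult_left_mono) auto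
  also have "\<dots> = K" using k_pos by (simp add: cosh_v0)
  finally have *: "k * cosh (Im z) \<le> K" .
  show "norm (of_real k * cos z) \<le> 2 * K + 1" "norm (- \<i> * of_real k * sin z) \<le> 2 * K + 1"
    "norm (s_low z) \<le> 2 * K + 1" "norm (s_up z) \<le> 2 * K + 1"
    using * trig_norm_le[of z] s_norm_le[of z] K_pos by linarith+
qed

text \<open>
The radicand vanishes to first order at the branch point, so both square roots are \<open>O(sqrt u)\<close> at distance
\<open>u\<close> from it.
\<close>
lemma branch_jump:
  assumes "u \<ge> 0"
  shows "norm ((of_real k * cos (Complex (- u) v0))\<^sup>2 - (of_real K)\<^sup>2) \<le> k\<^sup>2 * cosh (2 * v0) * u"
proof -
  have K: "complex_of_real K = of_real k * cos (Complex 0 v0)"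
    using k_pos by (simp add: complex_eq_iff Re_cos_cosh Im_cos_sinh cosh_v0)
  have "(of_real k * cos (Complex (- u) v0))\<^sup>2 - (of_real K)\<^sup>2 = (of_real k)\<^sup>2 * ((cos (Complex (- u) v0))\<^sup>2 - (cos (Complex 0 v0))\<^sup>2)"
    unfolding K by (simp add: power_mult_distrib algebra_simps)
  also have "\<dots> = - (of_real k)\<^sup>2 * (sin (Complex (- u) (2 * v0)) * sin (of_real (- u)))"
  proof -
    have "Complex (- u) v0 + Complex 0 v0 = Complex (- u) (2 * v0)" "Complex (- u) v0 - Complex 0 v0 = of_real (- u)"
      by (auto simp: complex_eq_iff)
    then show ?thesis unfolding cos_sq_diff by simp
  qed
  also have "norm \<dots> = k\<^sup>2 * (norm (sin (Complex (- u) (2 * v0))) * norm (sin (complex_of_real (- u))))"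
    by (simp add: norm_mult norm_power)
  also have "\<dots> \<le> k\<^sup>2 * (cosh (2 * v0) * u)"
  proof (intro mult_left_mono mult_mono)
    show "norm (sin (Complex (- u) (2 * v0))) \<le> cosh (2 * v0)" using norm_sin_le_cosh[of "Complex (- u) (2 * v0)"] by simp
    show "norm (sin (complex_of_real (- u))) \<le> u"
      using abs_sin_x_le_abs_x[of u] assms by (simp only: sin_of_real norm_of_real) simp
  qed auto
  finally show ?thesis by (simp add: mult.assoc)
qed

end

section \<open>Edge integrals and the two amplitudes\<close>

lemma half_le_sin:
  fixes u :: real assumes "0 \<le> u" "u \<le> 1" shows "u / 2 \<le> sin u"
proof -
  have "u / 2 \<le> sin u"
  proof -
    have "sin 0 - 0 / 2 \<le> sin u - u / 2"
    proof (rule DERIV_nonneg_imp_nondecreasing[OF assms(1)])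
      fix x :: real assume x: "0 \<le> x" "x \<le> u"
      have "((\<lambda>s. sin s - s / 2) has_real_derivative cos x - 1/2) (at x)"
        by (auto intro!: derivative_eq_intros)
      moreover have "cos (pi / 3) \<le> cos x" using x assms pi_gt3 by (intro cos_monotone_0_pi_le) auto
      then have "0 \<le> cos x - 1/2" by (simp add: cos_60)
      ultimately show "\<exists>y. ((\<lambda>s. sin s - s / 2) has_real_derivative y) (at x) \<and> 0 \<le> y" by blast
    qed
    then show ?thesis by simp
  qed
  then show ?thesis .
qed

text \<open>
The factor \<open>sqrt u\<close> improves the trivial bound \<open>1/m\<close> of the edge integral to \<open>m^(-3/2)\<close>.
\<close>
lemma square_root_edge_integral:
  fixes g :: "real \<Rightarrow> 'a::euclidean_space"
  assumes int: "g integrable_on {0..d}" and m: "m > 0" and J: "J \<ge> 0" and d: "d \<ge> 0"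
    and b: "\<And>u. u \<in> {0..d} \<Longrightarrow> norm (g u) \<le> J * sqrt u * exp (- m * u)"
  shows "norm (integral {0..d} g) \<le> 2 * J * m powr (-3/2)"
proof -
  have r: "((\<lambda>u. J / sqrt m * exp (- (m / 2) * u)) has_integral
      (- (2 * J / (m * sqrt m)) * exp (- (m / 2) * d)) - (- (2 * J / (m * sqrt m)) * exp (- (m / 2) * 0))) {0..d}"
    using d m by (intro fundamental_theorem_of_calculus)
      (auto intro!: derivative_eq_intros simp: has_real_derivative_iff_has_vector_derivative[symmetric] field_simps)
  have "norm (integral {0..d} g) \<le> integral {0..d} (\<lambda>u. J / sqrt m * exp (- (m / 2) * u))"
  proof (rule integral_norm_bound_integral[OF int has_integral_integrable[OF r]])
    fix u assume u: "u \<in> {0..d}"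
    have "m * u \<le> exp (m * u)" using exp_ge_add_one_self[of "m * u"] by linarith
    then have "sqrt (m * u) \<le> sqrt (exp (m * u))" by simp
    also have "sqrt (exp (m * u)) = exp (m * u / 2)"
      by (rule real_sqrt_unique) (simp_all add: power2_eq_square mult_exp_exp)
    finally have "sqrt (m * u) * exp (- m * u) \<le> exp (m * u / 2) * exp (- m * u)" by (intro mult_right_mono) auto
    also have "\<dots> = exp (- (m / 2) * u)" by (simp add: mult_exp_exp)
    finally have "sqrt u * exp (- m * u) \<le> exp (- (m / 2) * u) / sqrt m"
      using m by (simp add: real_sqrt_mult field_simps)
    then have "J * (sqrt u * exp (- m * u)) \<le> J * (exp (- (m / 2) * u) / sqrt m)" using J by (rule mult_left_mono)
    then show "norm (g u) \<le> J / sqrt m * exp (- (m / 2) * u)" using b[OF u] by (simp add: mult.assoc)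
  qed
  also have "\<dots> = 2 * J / (m * sqrt m) - 2 * J / (m * sqrt m) * exp (- (m / 2) * d)"
    unfolding integral_unique[OF r] by simp
  also have "\<dots> \<le> 2 * J / (m * sqrt m)" using J m by simp
  also have "\<dots> = 2 * J * m powr (-3/2)" unfolding powr_three_halves[OF m] by simp
  finally show ?thesis .
qed

lemma amp_cnj: "cnj (amp i j l y a b x m s) = (- 1) ^ i * amp i j l y a b (- cnj x) (cnj m) (cnj s)"
  by (simp add: amp_def exp_cnj power_mult_distrib[symmetric] flip: mult.assoc)

lemma amp_continuous_on [continuous_intros]:
  "continuous_on A x \<Longrightarrow> continuous_on A m \<Longrightarrow> continuous_on A s \<Longrightarrow> continuous_on A (\<lambda>z. amp i j l y a b (x z) (m z) (s z))"
  unfolding amp_def by (intro continuous_intros)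

lemma amp_holomorphic_on [holomorphic_intros]:
  "x holomorphic_on A \<Longrightarrow> m holomorphic_on A \<Longrightarrow> s holomorphic_on A \<Longrightarrow> (\<lambda>z. amp i j l y a b (x z) (m z) (s z)) holomorphic_on A"
  unfolding amp_def by (intro holomorphic_intros)

context wave_numbers
begin

text \<open>
With \<open>\<kappa> = k \<rho>\<close> this is \<open>exp(\<i> \<xi> t - S(\<xi>,k) h)\<close> at \<open>\<xi> = k cos z\<close>, \<open>(t, h) = \<rho> (cos \<phi>, sin \<phi>)\<close>.
\<close>
definition phase :: "real \<Rightarrow> real \<Rightarrow> complex \<Rightarrow> complex" where
  "phase \<kappa> \<phi> z = exp (\<i> * of_real \<kappa> * cos (z - of_real \<phi>))"

definition amp_low where
  "amp_low i j l y a b z = amp i j l y a b (of_real k * cos z) (- \<i> * of_real k * sin z) (s_low z)"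

definition amp_up where
  "amp_up i j l y a b z = amp i j l y a b (of_real k * cos z) (- \<i> * of_real k * sin z) (s_up z)"

lemma norm_phase: "norm (phase \<kappa> \<phi> z) = exp (\<kappa> * sin (Re z - \<phi>) * sinh (Im z))"
  unfolding phase_def norm_exp_i_cos by simp

lemma amp_low_continuous: "continuous_on {z. \<bar>Im z\<bar> \<le> v0} (amp_low i j l y a b)"
  unfolding amp_low_def s_low_def
  by (intro continuous_intros continuous_on_csqrt_slit) (use strip_slit in auto)

lemma amp_low_holomorphic: "amp_low i j l y a b holomorphic_on {z. \<bar>Im z\<bar> < v0}"
  unfolding amp_low_def s_low_def by (intro holomorphic_intros) (use strip_slit_open in auto)

definition ampbound :: "nat \<Rightarrow> real \<Rightarrow> real" where
  "ampbound N R = (2 * K + 1) ^ N * exp (3 * ((2 * K + 1) * R))"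

lemma ampbound_nonneg: "0 \<le> ampbound N R"
  using K_pos by (simp add: ampbound_def)

lemma amp_low_bounded:
  assumes "\<bar>y\<bar> \<le> R" "\<bar>a\<bar> \<le> R" "\<bar>b\<bar> \<le> R" "\<bar>Im z\<bar> \<le> v0"
  shows "norm (amp_low i j l y a b z) \<le> ampbound (i + j + l) R"
  unfolding amp_low_def ampbound_def
  using assms strip_norm_le[OF assms(4)] by (intro amp_bounded) auto

lemma sin_shift_ge:
  assumes "0 \<le> u" "u \<le> pi / 4" "0 < \<phi>" "\<phi> \<le> pi / 2"
  shows "sin u \<le> sin (u + \<phi>)" "u / 2 \<le> sin (u + \<phi>)"
proof -
  show 1: "sin u \<le> sin (u + \<phi>)"
  proof (cases "u = 0")
    case True
    then show ?thesis using assms by (simp add: sin_ge_zero)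
  next
    case False
    then show ?thesis using assms by (intro sin_ge_between) auto
  qed
  show "u / 2 \<le> sin (u + \<phi>)" using 1 half_le_sin[of u] assms pi_less_4 by simp
qed

text \<open>
The half strip beyond the branch point, turned by a right angle: \<open>\<i> z\<close> runs through the region to the left
of the imaginary axis above \<open>\<i> v0\<close>.
\<close>
definition corner :: "complex set" where
  "corner = {z. v0 \<le> Re z \<and> 0 \<le> Im z \<and> Im z \<le> pi / 4}"

lemma corner_Im:
  assumes "z \<in> corner"
  shows "Re ((of_real k * cos (\<i> * z))\<^sup>2 - (of_real K)\<^sup>2) \<ge> 0 \<or> Im z > 0"
    "Im z > 0 \<Longrightarrow> Im ((of_real k * cos (\<i> * z))\<^sup>2 - (of_real K)\<^sup>2) > 0"
    "Im z = 0 \<Longrightarrow> Im ((of_real k * cos (\<i> * z))\<^sup>2 - (of_real K)\<^sup>2) = 0"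
proof -
  have re: "Re (cos (\<i> * z)) = cos (Im z) * cosh (Re z)" and im: "Im (cos (\<i> * z)) = sin (Im z) * sinh (Re z)"
    by (simp_all add: Re_cos_cosh Im_cos_sinh)
  have Im: "Im ((of_real k * cos (\<i> * z))\<^sup>2 - (of_real K)\<^sup>2) = 2 * k\<^sup>2 * ((cos (Im z) * cosh (Re z)) * (sin (Im z) * sinh (Re z)))"
    by (simp add: power2_eq_square re im)
  show "Im ((of_real k * cos (\<i> * z))\<^sup>2 - (of_real K)\<^sup>2) > 0" if "Im z > 0"
  proof -
    have "Im z < pi / 2" "Im z < pi" using assms pi_gt_zero unfolding corner_def mem_Collect_eq by linarith+
    then have "cos (Im z) > 0" "sin (Im z) > 0" using that by (auto intro!: cos_gt_zero sin_gt_zero)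
    moreover have "sinh (Re z) > 0" using assms v0_pos by (auto simp: corner_def)
    ultimately show ?thesis unfolding Im using k_pos by simp
  qed
  show "Im ((of_real k * cos (\<i> * z))\<^sup>2 - (of_real K)\<^sup>2) = 0" if "Im z = 0" unfolding Im by (simp add: that)
  show "Re ((of_real k * cos (\<i> * z))\<^sup>2 - (of_real K)\<^sup>2) \<ge> 0 \<or> Im z > 0"
  proof (cases "Im z > 0")
    case False
    then have z: "Im z = 0" using assms by (auto simp: corner_def)
    have "K \<le> k * cosh (Re z)"
    proof -
      have "cosh v0 \<le> cosh (Re z)" using assms v0_pos by (subst cosh_real_nonneg_le_iff) (auto simp: corner_def)
      then show ?thesis using k_pos by (simp add: cosh_v0 field_simps)
    qed
    then have "K\<^sup>2 \<le> (k * cosh (Re z))\<^sup>2" using K_pos by (intro power_mono) auto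
    moreover have "Re ((of_real k * cos (\<i> * z))\<^sup>2) = (k * cosh (Re z))\<^sup>2"
      by (simp add: power2_eq_square re im z)
    ultimately show ?thesis by (simp add: power2_eq_square)
  qed simp
qed

lemma amp_up_continuous: "continuous_on corner (\<lambda>z. amp_up i j l y a b (\<i> * z))"
  unfolding amp_up_def s_up_def
proof (intro continuous_intros continuous_on_csqrt_slit)
  fix z assume z: "z \<in> corner"
  let ?w = "(of_real k * cos (\<i> * z))\<^sup>2 - (of_real K)\<^sup>2"
  have "0 \<le> Im z" using z by (simp add: corner_def)
  then consider "Im z > 0" | "Im z = 0" by linarith
  then show "?w \<notin> \<real>\<^sub>\<le>\<^sub>0 \<or> ?w = 0"
  proof cases
    case 1
    then have "Im ?w \<noteq> 0" using corner_Im(2)[OF z 1] by (metis less_irrefl)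
    then show ?thesis unfolding complex_nonpos_Reals_iff by blast
  next
    case 2
    have "Im ?w = 0" "Re ?w \<ge> 0" using corner_Im(1)[OF z] corner_Im(3)[OF z 2] 2 by auto
    then show ?thesis unfolding complex_nonpos_Reals_iff complex_eq_iff zero_complex.sel by linarith
  qed
qed

lemma corner_interior: "interior corner \<subseteq> {z \<in> corner. Im z > 0}"
proof -
  have "interior corner \<subseteq> interior {z. inner \<i> z \<ge> 0}"
    by (rule interior_mono) (auto simp: corner_def inner_complex_def)
  also have "\<dots> = {z. Im z > 0}" by (subst interior_halfspace_ge) (auto simp: inner_complex_def)
  finally show ?thesis using interior_subset[of corner] by blast
qed

lemma amp_up_holomorphic: "(\<lambda>z. amp_up i j l y a b (\<i> * z)) holomorphic_on interior corner"
  unfolding amp_up_def s_up_def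
proof (intro holomorphic_intros)
  fix z assume "z \<in> interior corner"
  then have z: "z \<in> corner" "Im z > 0" using corner_interior by auto
  let ?w = "(of_real k * cos (\<i> * z))\<^sup>2 - (of_real K)\<^sup>2"
  have "Im ?w \<noteq> 0" using corner_Im(2)[OF z] by (metis less_irrefl)
  then show "?w \<notin> \<real>\<^sub>\<le>\<^sub>0" unfolding complex_nonpos_Reals_iff by blast
qed

text \<open>
The factor \<open>exp(-\<i> \<xi> y)\<close> grows like \<open>exp(R k sinh(Re z))\<close>, but half of the decay of the phase function pays for
it as soon as \<open>\<kappa> \<ge> 2 R k\<close>; this is where bounded sources enter.
\<close>
lemma amp_up_bounded:
  assumes z: "z \<in> corner" and y: "\<bar>y\<bar> \<le> R" and ab: "0 \<le> a" "0 \<le> b" and phi: "0 < \<phi>" "\<phi> \<le> pi / 2"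
    and kap: "\<kappa> \<ge> 2 * R * k"
  shows "norm (amp_up i j l y a b (\<i> * z) * phase \<kappa> \<phi> (\<i> * z))
    \<le> (2 * K + 1) ^ (i + j + l) * exp (real (i + j + l) * Re z) * exp (- (\<kappa> / 2 * sin (Im z + \<phi>)) * sinh (Re z))"
proof -
  have z': "v0 \<le> Re z" "0 \<le> Im z" "Im z \<le> pi / 4" and r0: "0 \<le> Re z" using z v0_pos by (auto simp: corner_def)
  have R0: "0 \<le> R" using y by auto
  have ch: "cosh (Re z) \<le> exp (Re z)" using r0 by (simp add: cosh_def field_simps)
  have e1: "1 \<le> exp (Re z)" using r0 by simp
  have sh: "0 \<le> sinh (Re z)" using r0 by simp
  have kc: "k * cosh (Re z) \<le> K * exp (Re z)" using ch k_pos k_less_K by (intro mult_mono) auto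
  have "K * 1 \<le> K * exp (Re z)" using e1 K_pos by (intro mult_left_mono) auto
  then have M: "K + k * cosh (Re z) \<le> (2 * K + 1) * exp (Re z)"
  proof -
    have "K + k * cosh (Re z) \<le> 2 * (K * exp (Re z))" using kc \<open>K * 1 \<le> K * exp (Re z)\<close> by linarith
    also have "\<dots> \<le> (2 * K + 1) * exp (Re z)" by (simp add: algebra_simps)
    finally show ?thesis .
  qed
  have M': "k * cosh (Re z) \<le> (2 * K + 1) * exp (Re z)" using M K_pos by linarith
  have "Re (s_up (\<i> * z)) \<ge> 0" unfolding s_up_def
    using csqrt_principal[of "(of_real k * cos (\<i> * z))\<^sup>2 - (of_real K)\<^sup>2"] by (auto simp del: csqrt.sel)
  moreover have "Re (- \<i> * of_real k * sin (\<i> * z)) \<ge> 0"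
  proof -
    have "cos (Im z) \<ge> 0" using z' by (intro cos_ge_zero) auto
    then show ?thesis using sh k_pos by (simp add: Im_sin_sinh)
  qed
  ultimately have "- (Re (s_up (\<i> * z)) * a) \<le> 0" "- (Re (- \<i> * of_real k * sin (\<i> * z)) * b) \<le> 0"
    using ab by simp_all
  moreover have "y * (k * (sin (Im z) * sinh (Re z))) \<le> R * (k * (sin (Im z) * sinh (Re z)))"
    using y k_pos sh sin_ge_zero[of "Im z"] z' by (intro mult_right_mono mult_nonneg_nonneg) auto
  ultimately have re: "Re (- (\<i> * (of_real k * cos (\<i> * z)) * of_real y) - s_up (\<i> * z) * of_real a - (- \<i> * of_real k * sin (\<i> * z)) * of_real b)
     \<le> R * (k * (sin (Im z) * sinh (Re z)))"
    by (simp add: Im_cos_sinh mult.commute mult.left_commute)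
  have "norm (amp_up i j l y a b (\<i> * z)) \<le> ((2 * K + 1) * exp (Re z)) ^ (i + j + l) * exp (R * (k * (sin (Im z) * sinh (Re z))))"
    unfolding amp_up_def
    by (rule amp_norm_le) (use trig_norm_le[of "\<i> * z"] s_norm_le[of "\<i> * z"] M M' re in auto)
  also have "\<dots> = (2 * K + 1) ^ (i + j + l) * exp (real (i + j + l) * Re z) * exp (R * (k * (sin (Im z) * sinh (Re z))))"
    by (simp only: power_mult_distrib exp_of_nat_mult)
  finally have n1: "norm (amp_up i j l y a b (\<i> * z)) \<le> \<dots>" .
  have "norm (amp_up i j l y a b (\<i> * z) * phase \<kappa> \<phi> (\<i> * z)) \<le> (2 * K + 1) ^ (i + j + l) * exp (real (i + j + l) * Re z) *
      exp (R * (k * (sin (Im z) * sinh (Re z)))) * exp (- \<kappa> * sin (Im z + \<phi>) * sinh (Re z))"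
    unfolding norm_mult norm_phase
  proof (rule mult_mono[OF n1])
    have "sin (Re (\<i> * z) - \<phi>) = - sin (Im z + \<phi>)" by (simp flip: sin_minus)
    then show "exp (\<kappa> * sin (Re (\<i> * z) - \<phi>) * sinh (Im (\<i> * z))) \<le> exp (- \<kappa> * sin (Im z + \<phi>) * sinh (Re z))" by simp
  qed (use K_pos in auto)
  also have "\<dots> = (2 * K + 1) ^ (i + j + l) * exp (real (i + j + l) * Re z) *
      exp ((R * k * sin (Im z) - \<kappa> * sin (Im z + \<phi>)) * sinh (Re z))"
    by (simp add: mult_exp_exp algebra_simps)
  also have "\<dots> \<le> (2 * K + 1) ^ (i + j + l) * exp (real (i + j + l) * Re z) * exp (- (\<kappa> / 2 * sin (Im z + \<phi>)) * sinh (Re z))"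
  proof -
    have "R * k * sin (Im z) \<le> R * k * sin (Im z + \<phi>)"
      using sin_shift_ge(1)[of "Im z" \<phi>] z' phi R0 k_pos by (intro mult_left_mono) auto
    also have "\<dots> \<le> \<kappa> / 2 * sin (Im z + \<phi>)"
      using kap z' phi by (intro mult_right_mono sin_ge_zero) auto
    finally have "(R * k * sin (Im z) - \<kappa> * sin (Im z + \<phi>)) * sinh (Re z) \<le> - (\<kappa> / 2 * sin (Im z + \<phi>)) * sinh (Re z)"
      using sh by (intro mult_right_mono) auto
    then show ?thesis using K_pos by (intro mult_left_mono) auto
  qed
  finally show ?thesis .
qed

section \<open>Deformation of the path\<close>

lemma tail_shift:
  assumes y: "\<bar>y\<bar> \<le> R" and ab: "0 \<le> a" "0 \<le> b" and phi: "0 < \<phi>" "\<phi> \<le> pi / 2"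
    and kap: "\<kappa> \<ge> 2 * R * k" "\<kappa> \<ge> 4 * (real (i + j + l) + 1)"
  defines "Q \<equiv> \<lambda>z. amp_up i j l y a b (\<i> * z) * phase \<kappa> \<phi> (\<i> * z)"
  shows "(\<lambda>v. Q (of_real v)) absolutely_integrable_on {v0<..}"
    and "norm (integral {v0<..} (\<lambda>v. Q (of_real v)) - \<i> * integral {0..pi/4} (\<lambda>u. Q (Complex v0 u)))
      \<le> (2 * K + 1) ^ (i + j + l) * exp (real (i + j + l) * v0) * (2 / (sinh v0 / 4)\<^sup>2 * \<kappa> powr (-3/2))"
proof -
  let ?N = "i + j + l"
  define d where "d = min \<phi> (pi / 4)"
  have d: "0 < d" "d \<le> pi / 4" "d \<le> \<phi>" using phi by (auto simp: d_def)
  have k0: "\<kappa> > 0" "\<kappa> \<ge> 1" using kap(2) by auto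
  have sd: "sin d > 0" using d by (intro sin_gt_zero) auto
  have sh: "0 < sinh v0" using v0_pos by simp
  have Qb: "norm (Q z) \<le> (2 * K + 1) ^ ?N * exp (real ?N * Re z) * exp (- m * sinh (Re z))"
    if z: "z \<in> corner" and m: "m \<le> \<kappa> / 2 * sin (Im z + \<phi>)" for z m
  proof -
    have "0 \<le> sinh (Re z)" using z v0_pos by (auto simp: corner_def)
    then have "- (\<kappa> / 2 * sin (Im z + \<phi>)) * sinh (Re z) \<le> - m * sinh (Re z)" using m by (intro mult_right_mono) auto
    then have "(2 * K + 1) ^ ?N * exp (real ?N * Re z) * exp (- (\<kappa> / 2 * sin (Im z + \<phi>)) * sinh (Re z))
      \<le> (2 * K + 1) ^ ?N * exp (real ?N * Re z) * exp (- m * sinh (Re z))"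
      using K_pos by (intro mult_left_mono) auto
    with amp_up_bounded[OF z y ab phi kap(1), of i j l] show ?thesis unfolding Q_def by (rule order_trans)
  qed
  have b1: "norm (Q z) \<le> (2 * K + 1) ^ ?N * exp (real ?N * Re z) * exp (- (\<kappa> / 2 * sin d) * sinh (Re z))"
    if "z \<in> corner" for z
    using that k0 d phi by (intro Qb mult_left_mono sin_ge_between) (auto simp: corner_def)
  have b2: "norm (Q z) \<le> (2 * K + 1) ^ ?N * exp (real ?N * Re z) * exp (- (\<kappa> / 4) * sinh (Re z))"
    if "z \<in> corner" "Im z = pi / 4" for z
  proof (rule Qb[OF that(1)])
    have "1 / 2 \<le> sin (pi / 4)" using half_le_sin[of 1] sin_45 real_le_rsqrt[of 1 2] by simp
    also have "\<dots> \<le> sin (Im z + \<phi>)" using that phi by (intro sin_ge_between) auto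
    finally have "\<kappa> / 2 * (1 / 2) \<le> \<kappa> / 2 * sin (Im z + \<phi>)" using k0 by (intro mult_left_mono) auto
    then show "\<kappa> / 4 \<le> \<kappa> / 2 * sin (Im z + \<phi>)" by simp
  qed
  have cont: "continuous_on corner Q" and hol: "Q holomorphic_on interior corner"
    unfolding Q_def phase_def
    by (intro continuous_intros amp_up_continuous) (intro holomorphic_intros amp_up_holomorphic)
  have kn: "real ?N + 1 \<le> \<kappa> / 4" using kap(2) by simp
  have c0: "\<kappa> / 2 * sin d > 0" using k0 sd by simp
  have B0: "0 \<le> (2 * K + 1) ^ ?N" using K_pos by simp
  note rot = ray_shift[OF v0_pos B0 c0, folded corner_def, OF cont hol b1 b2 kn]
  show "(\<lambda>v. Q (of_real v)) absolutely_integrable_on {v0<..}" by (rule rot(1)) auto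
  have "norm (integral {v0<..} (\<lambda>v. Q (of_real v)) - \<i> * integral {0..pi/4} (\<lambda>u. Q (Complex v0 u)))
     \<le> (2 * K + 1) ^ ?N * exp (real ?N * v0) * exp (- (\<kappa> / 4) * sinh v0)" by (rule rot(2)) auto
  also have "\<dots> = (2 * K + 1) ^ ?N * exp (real ?N * v0) * exp (- (sinh v0 / 4) * \<kappa>)" by (simp add: mult.commute)
  also have "\<dots> \<le> (2 * K + 1) ^ ?N * exp (real ?N * v0) * (2 / (sinh v0 / 4)\<^sup>2 * \<kappa> powr (-3/2))"
    using B0 sh k0 by (intro mult_left_mono exp_decay_three_halves) auto
  finally show "norm (integral {v0<..} (\<lambda>v. Q (of_real v)) - \<i> * integral {0..pi/4} (\<lambda>u. Q (Complex v0 u))) \<le> \<dots>" .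
qed

lemma cnj_trig: "cnj (cos z) = cos (cnj z)" "cnj (sin z) = sin (cnj z)"
  by (simp_all add: complex_eq_iff Re_cos_cosh Im_cos_sinh Re_sin_cosh Im_sin_sinh)

text \<open>
The right end of the path is the mirror image of the left one under \<open>z \<mapsto> \<pi> + cnj z\<close>, and the integrand
is conjugated up to the sign \<open>(-1)^i\<close>. Only the left end has to be treated.
\<close>
lemma reflected_integrand:
  "(- 1) ^ i * cnj (amp i j l y a b (of_real k * cos z) (- \<i> * of_real k * sin z) s * phase \<kappa> \<phi> z)
    = amp i j l y a b (of_real k * cos (of_real pi + cnj z)) (- \<i> * of_real k * sin (of_real pi + cnj z)) (cnj s) * phase \<kappa> \<phi> (of_real pi + cnj z)"
proof -
  have "cnj (phase \<kappa> \<phi> z) = phase \<kappa> \<phi> (of_real pi + cnj z)"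
  proof -
    have e: "of_real pi + cnj z - of_real \<phi> = of_real pi + cnj (z - of_real \<phi>)" by simp
    show ?thesis unfolding phase_def e cos_add exp_cnj by (simp add: cnj_trig flip: cos_of_real sin_of_real)
  qed
  moreover have "(- 1) ^ i * ((- 1) ^ i * w) = w" for w :: complex
    by (simp flip: mult.assoc power_mult_distrib)
  ultimately show ?thesis
    by (simp add: amp_cnj cnj_trig cos_add sin_add)
qed

text \<open>
On the horizontal segments at height \<open>\<plusminus>v0\<close> the integrands of the deformed path and of the shifted
tails differ only in the branch of the square root.
\<close>
lemma jump_bounds:
  fixes i j l :: nat
  assumes u: "0 \<le> u" "u \<le> pi / 4" and phi: "0 < \<phi>" "\<phi> \<le> pi / 2" and kap: "\<kappa> \<ge> 0"
    and R: "\<bar>y\<bar> \<le> R" "\<bar>a\<bar> \<le> R" "\<bar>b\<bar> \<le> R"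
  defines "J \<equiv> (real l + R) * ampbound (i + j + l) R * (2 * sqrt (k\<^sup>2 * cosh (2 * v0)))"
    and "z \<equiv> Complex (- u) v0" and "z' \<equiv> Complex (pi - u) (- v0)"
  shows "norm (amp_up i j l y a b z * phase \<kappa> \<phi> z - amp_low i j l y a b z * phase \<kappa> \<phi> z) \<le> J * sqrt u * exp (- (sinh v0 / 2 * \<kappa>) * u)"
    and "norm (amp_low i j l y a b z' * phase \<kappa> \<phi> z' - (- 1) ^ i * cnj (amp_up i j l y a b z * phase \<kappa> \<phi> z)) \<le> J * sqrt u * exp (- (sinh v0 / 2 * \<kappa>) * u)"
proof -
  have z'z: "z' = of_real pi + cnj z" by (simp add: z_def z'_def complex_eq_iff)
  have sh: "0 < sinh v0" using v0_pos by simp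
  have R0: "0 \<le> R" using R by auto
  have iz: "\<bar>Im z\<bar> \<le> v0" "\<bar>Im z'\<bar> \<le> v0" using v0_pos by (auto simp: z_def z'_def)
  have cosz': "(of_real k * cos z')\<^sup>2 - (of_real K)\<^sup>2 = cnj ((of_real k * cos z)\<^sup>2 - (of_real K)\<^sup>2)"
    unfolding z'z by (simp add: cos_add cnj_trig)
  have s_small: "norm (s_up z) \<le> sqrt (k\<^sup>2 * cosh (2 * v0)) * sqrt u" "norm (s_low z) \<le> sqrt (k\<^sup>2 * cosh (2 * v0)) * sqrt u"
    "norm (s_low z') \<le> sqrt (k\<^sup>2 * cosh (2 * v0)) * sqrt u"
    using branch_jump[OF u(1)] unfolding s_norm cosz' complex_mod_cnj by (simp_all add: z_def flip: real_sqrt_mult)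
  have ph: "norm (phase \<kappa> \<phi> z) \<le> exp (- (sinh v0 / 2 * \<kappa>) * u)"
  proof -
    have "sin (- u - \<phi>) = - sin (u + \<phi>)" by (simp flip: sin_minus)
    then have "norm (phase \<kappa> \<phi> z) = exp (- (\<kappa> * sinh v0) * sin (u + \<phi>))"
      unfolding norm_phase by (simp add: z_def mult_ac)
    also have "\<dots> \<le> exp (- (\<kappa> * sinh v0) * (u / 2))"
    proof -
      have "(\<kappa> * sinh v0) * (u / 2) \<le> (\<kappa> * sinh v0) * sin (u + \<phi>)"
        using sin_shift_ge(2)[OF u phi] kap sh by (intro mult_left_mono) auto
      then show ?thesis by simp
    qed
    finally show ?thesis by (simp add: mult_ac)
  qed
  have J1: "(real l + R) * ampbound (i + j + l) R * (norm (s - s')) \<le> J * sqrt u"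
    if "norm s \<le> sqrt (k\<^sup>2 * cosh (2 * v0)) * sqrt u" "norm s' \<le> sqrt (k\<^sup>2 * cosh (2 * v0)) * sqrt u" for s s' :: complex
  proof -
    have "norm (s - s') \<le> 2 * sqrt (k\<^sup>2 * cosh (2 * v0)) * sqrt u"
      using norm_triangle_ineq4[of s s'] that by linarith
    then have "(real l + R) * ampbound (i + j + l) R * (norm (s - s')) \<le> (real l + R) * ampbound (i + j + l) R * (2 * sqrt (k\<^sup>2 * cosh (2 * v0)) * sqrt u)"
      using R0 ampbound_nonneg by (intro mult_left_mono) auto
    then show ?thesis by (simp add: J_def mult.assoc)
  qed
  have K1: "1 \<le> 2 * K + 1" using K_pos by simp
  have "norm (amp_up i j l y a b z - amp_low i j l y a b z) \<le> J * sqrt u"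
    unfolding amp_up_def amp_low_def
    by (rule order_trans[OF amp_lipschitz[OF strip_norm_le(1,2,4,3)[OF iz(1)] K1 R, folded ampbound_def] J1[OF s_small(1,2)]])
  then have "norm (amp_up i j l y a b z - amp_low i j l y a b z) * norm (phase \<kappa> \<phi> z) \<le> J * sqrt u * exp (- (sinh v0 / 2 * \<kappa>) * u)"
    using ph by (rule mult_mono) (use R0 ampbound_nonneg in \<open>auto simp: J_def u\<close>)
  then show "norm (amp_up i j l y a b z * phase \<kappa> \<phi> z - amp_low i j l y a b z * phase \<kappa> \<phi> z) \<le> J * sqrt u * exp (- (sinh v0 / 2 * \<kappa>) * u)"
    by (simp add: norm_mult left_diff_distrib[symmetric])
  have refl: "(- 1) ^ i * cnj (amp_up i j l y a b z * phase \<kappa> \<phi> z)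
     = amp i j l y a b (of_real k * cos z') (- \<i> * of_real k * sin z') (cnj (s_up z)) * phase \<kappa> \<phi> z'"
    unfolding amp_up_def z'z by (rule reflected_integrand)
  have ph': "norm (phase \<kappa> \<phi> z') = norm (phase \<kappa> \<phi> z)"
    unfolding norm_phase z'z by (simp add: sin_diff sin_add cos_add algebra_simps)
  have "norm (amp_low i j l y a b z' - amp i j l y a b (of_real k * cos z') (- \<i> * of_real k * sin z') (cnj (s_up z))) \<le> J * sqrt u"
    unfolding amp_low_def
  proof (rule order_trans[OF amp_lipschitz[OF strip_norm_le(1,2,3)[OF iz(2)] _ K1 R, folded ampbound_def] J1])
    show "norm (cnj (s_up z)) \<le> 2 * K + 1" using strip_norm_le(4)[OF iz(1)] by simp
  qed (use s_small in auto)
  then have "norm (amp_low i j l y a b z' - amp i j l y a b (of_real k * cos z') (- \<i> * of_real k * sin z') (cnj (s_up z))) * norm (phase \<kappa> \<phi> z')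
      \<le> J * sqrt u * exp (- (sinh v0 / 2 * \<kappa>) * u)"
    using ph unfolding ph' by (rule mult_mono) (use R0 ampbound_nonneg in \<open>auto simp: J_def u\<close>)
  then show "norm (amp_low i j l y a b z' * phase \<kappa> \<phi> z' - (- 1) ^ i * cnj (amp_up i j l y a b z * phase \<kappa> \<phi> z)) \<le> J * sqrt u * exp (- (sinh v0 / 2 * \<kappa>) * u)"
    unfolding refl by (simp add: norm_mult left_diff_distrib[symmetric])
qed

text \<open>
Adding the saddle point contribution, the two horizontal segments and the two shifted tails: the segments and
the tails cancel up to the jump of the square root.
\<close>
lemma contour_asymptotics:
  fixes i j l :: nat and R :: real
  assumes R0: "0 \<le> R"
  obtains C \<kappa>0 where "C \<ge> 0" "\<kappa>0 \<ge> 1"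
    "\<And>y a b \<phi> \<kappa>. \<lbrakk>\<bar>y\<bar> \<le> R; 0 \<le> a; a \<le> R; 0 \<le> b; b \<le> R; 0 < \<phi>; \<phi> \<le> pi / 2; \<kappa> \<ge> \<kappa>0\<rbrakk> \<Longrightarrow>
      norm (integral {0..v0} (\<lambda>v. amp_low i j l y a b (Complex 0 v) * phase \<kappa> \<phi> (Complex 0 v))
        + \<i> * integral {0..pi} (\<lambda>x. amp_low i j l y a b (of_real x) * phase \<kappa> \<phi> (of_real x))
        + integral {0..v0} (\<lambda>v. amp_low i j l y a b (Complex pi (- v)) * phase \<kappa> \<phi> (Complex pi (- v)))
        + integral {v0<..} (\<lambda>v. amp_up i j l y a b (\<i> * of_real v) * phase \<kappa> \<phi> (\<i> * of_real v))
        + (- 1) ^ i * cnj (integral {v0<..} (\<lambda>v. amp_up i j l y a b (\<i> * of_real v) * phase \<kappa> \<phi> (\<i> * of_real v)))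
        - \<i> * (amp_low i j l y a b (of_real \<phi>) * ((1 - \<i>) * exp (\<i> * of_real \<kappa>) * of_real (sqrt (pi / \<kappa>)))))
      \<le> C * \<kappa> powr (-3/2)"
proof -
  let ?N = "i + j + l"
  obtain C1 where C1: "C1 \<ge> 0" and saddle:
    "\<And>F f \<phi> \<kappa>. \<lbrakk>\<And>z. \<bar>Im z\<bar> \<le> v0 \<Longrightarrow> (F has_field_derivative f z * exp (\<i> * of_real \<kappa> * cos (z - of_real \<phi>))) (at z within {z. \<bar>Im z\<bar> \<le> v0});
      f holomorphic_on {z. \<bar>Im z\<bar> < v0}; \<And>z. \<bar>Im z\<bar> \<le> v0 \<Longrightarrow> norm (f z) \<le> ampbound ?N R; 0 \<le> \<phi>; \<phi> \<le> pi / 2; \<kappa> \<ge> 1\<rbrakk> \<Longrightarrow>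
      norm (F (Complex (3 * pi / 4) (- v0)) - F (Complex (- pi / 4) v0)
        - f (of_real \<phi>) * ((1 - \<i>) * exp (\<i> * of_real \<kappa>) * of_real (sqrt (pi / \<kappa>)))) \<le> C1 * \<kappa> powr (-3/2)"
    using saddle_point_contribution[OF v0_pos ampbound_nonneg[of ?N R]] by blast
  define J where "J = (real l + R) * ampbound ?N R * (2 * sqrt (k\<^sup>2 * cosh (2 * v0)))"
  have J0: "J \<ge> 0" using R0 ampbound_nonneg by (simp add: J_def)
  define C2 where "C2 = 2 * J * (sinh v0 / 2) powr (-3/2)"
  define C3 where "C3 = (2 * K + 1) ^ ?N * exp (real ?N * v0) * (2 / (sinh v0 / 4)\<^sup>2)"
  define \<kappa>0 where "\<kappa>0 = max (2 * R * k) (4 * (real ?N + 1))"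
  have sh: "0 < sinh v0" using v0_pos by simp
  show ?thesis
  proof
    show "C1 + C2 + C2 + C3 + C3 \<ge> 0" using C1 J0 K_pos by (auto simp: C2_def C3_def)
    show "\<kappa>0 \<ge> 1" by (simp add: \<kappa>0_def)
    fix y a b \<phi> \<kappa>
    assume y: "\<bar>y\<bar> \<le> R" and a: "0 \<le> a" "a \<le> R" and b: "0 \<le> b" "b \<le> R" and phi: "0 < \<phi>" "\<phi> \<le> pi / 2" and kap: "\<kappa> \<ge> \<kappa>0"
    have kap': "\<kappa> \<ge> 2 * R * k" "\<kappa> \<ge> 4 * (real ?N + 1)" "\<kappa> \<ge> 1" "\<kappa> \<ge> 0" "\<kappa> > 0" using kap by (auto simp: \<kappa>0_def)
    have ab: "\<bar>a\<bar> \<le> R" "\<bar>b\<bar> \<le> R" using a b by auto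
    let ?r = "\<kappa> powr (-3/2)"
    define g where "g = amp_low i j l y a b"
    define q where "q = (\<lambda>z. g z * phase \<kappa> \<phi> z)"
    define qu where "qu = (\<lambda>z. amp_up i j l y a b z * phase \<kappa> \<phi> z)"
    define T where "T = integral {v0<..} (\<lambda>v. qu (\<i> * of_real v))"
    define m where "m = amp_low i j l y a b (of_real \<phi>) * ((1 - \<i>) * exp (\<i> * of_real \<kappa>) * of_real (sqrt (pi / \<kappa>)))"
    let ?S = "{z. \<bar>Im z\<bar> \<le> v0}"
    have op: "open {z. \<bar>Im z\<bar> < v0}" by (intro open_Collect_less continuous_intros)
    have convS: "convex ?S"
    proof -
      have "?S = {z. - v0 \<le> Im z} \<inter> {z. Im z \<le> v0}" by auto
      then show ?thesis by (simp only: convex_Int convex_halfspace_Im_ge convex_halfspace_Im_le)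
    qed
    have intS: "interior ?S \<subseteq> {z. \<bar>Im z\<bar> < v0}"
    proof -
      have sub: "interior ?S \<subseteq> interior {z. inner \<i> z \<ge> - v0} \<inter> interior {z. inner \<i> z \<le> v0}"
        by (intro Int_greatest interior_mono) (auto simp: inner_complex_def)
      have eq: "interior {z. inner \<i> z \<ge> - v0} = {z. inner \<i> z > - v0}" "interior {z. inner \<i> z \<le> v0} = {z. inner \<i> z < v0}"
        by (intro interior_halfspace_ge interior_halfspace_le; simp)+
      have "{z. inner \<i> z > - v0} \<inter> {z. inner \<i> z < v0} \<subseteq> {z. \<bar>Im z\<bar> < v0}"
        by (auto simp: inner_complex_def)
      then show ?thesis using sub unfolding eq by (rule order_trans[rotated])
    qed
    have qcont: "continuous_on ?S q"
      unfolding q_def g_def phase_def by (intro continuous_intros amp_low_continuous)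
    have qhol: "q holomorphic_on {z. \<bar>Im z\<bar> < v0}"
      unfolding q_def g_def phase_def by (intro holomorphic_intros amp_low_holomorphic)
    obtain F where F: "\<And>z. z \<in> ?S \<Longrightarrow> (F has_field_derivative q z) (at z within ?S)"
    proof (rule holomorphic_convex_primitive[OF convS, of "{}" q])
      fix x assume "x \<in> interior ?S - {}"
      then have "x \<in> {z. \<bar>Im z\<bar> < v0}" using intS by blast
      then show "q field_differentiable at x" using holomorphic_on_imp_differentiable_at[OF qhol op] by blast
    qed (use qcont in auto)
    have l1: "((\<lambda>s. \<i> * q (0 + of_real s * \<i>)) has_integral F (0 + of_real v0 * \<i>) - F (0 + of_real 0 * \<i>)) {0..v0}"
      by (rule primitive_along_line[OF F]) (use v0_pos in auto)
    have l2: "((\<lambda>s. 1 * q (0 + of_real s * 1)) has_integral F (0 + of_real pi * 1) - F (0 + of_real 0 * 1)) {0..pi}"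
      by (rule primitive_along_line[OF F]) (use v0_pos in auto)
    have l3: "((\<lambda>s. (- \<i>) * q (of_real pi + of_real s * (- \<i>))) has_integral F (of_real pi + of_real v0 * (- \<i>)) - F (of_real pi + of_real 0 * (- \<i>))) {0..v0}"
      by (rule primitive_along_line[OF F]) (use v0_pos in auto)
    have l4: "((\<lambda>s. (- 1) * q (Complex 0 v0 + of_real s * (- 1))) has_integral F (Complex 0 v0 + of_real (pi / 4) * (- 1)) - F (Complex 0 v0 + of_real 0 * (- 1))) {0..pi/4}"
      by (rule primitive_along_line[OF F]) (use v0_pos in auto)
    have l5: "((\<lambda>s. (- 1) * q (Complex pi (- v0) + of_real s * (- 1))) has_integral F (Complex pi (- v0) + of_real (pi / 4) * (- 1)) - F (Complex pi (- v0) + of_real 0 * (- 1))) {0..pi/4}"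
      by (rule primitive_along_line[OF F]) (use v0_pos in auto)
    have pts: "0 + of_real s * \<i> = Complex 0 s" "of_real pi + of_real s * (- \<i>) = Complex pi (- s)"
      "Complex 0 v0 + of_real s * (- 1) = Complex (- s) v0" "Complex pi (- v0) + of_real s * (- 1) = Complex (pi - s) (- v0)" for s
      by (auto simp: complex_eq_iff)
    define A1 where "A1 = integral {0..v0} (\<lambda>v. q (Complex 0 v))"
    define A2 where "A2 = integral {0..pi} (\<lambda>x. q (of_real x))"
    define A3 where "A3 = integral {0..v0} (\<lambda>v. q (Complex pi (- v)))"
    define H1 where "H1 = integral {0..pi/4} (\<lambda>u. q (Complex (- u) v0))"
    define H2 where "H2 = integral {0..pi/4} (\<lambda>u. q (Complex (pi - u) (- v0)))"
    have E1: "\<i> * A1 = F (Complex 0 v0) - F 0"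
      using integral_unique[OF l1] unfolding pts A1_def by (simp add: zero_complex.code[symmetric])
    have E2: "A2 = F (of_real pi) - F 0"
      using integral_unique[OF l2] unfolding A2_def by simp
    have E3: "- \<i> * A3 = F (Complex pi (- v0)) - F (of_real pi)"
      using integral_unique[OF l3] unfolding pts A3_def by (simp add: complex_of_real_def)
    have E4: "- H1 = F (Complex (- pi / 4) v0) - F (Complex 0 v0)"
      using integral_unique[OF l4] unfolding pts H1_def by simp
    have E5: "- H2 = F (Complex (3 * pi / 4) (- v0)) - F (Complex pi (- v0))"
      using integral_unique[OF l5] unfolding pts H2_def by simp
    have contS: "continuous_on A (\<lambda>u. q (h u))" if "continuous_on A h" "\<And>u. u \<in> A \<Longrightarrow> \<bar>Im (h u)\<bar> \<le> v0" for A :: "real set" and h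
      by (rule continuous_on_compose2[OF qcont that(1)]) (use that(2) in auto)
    have contlow: "continuous_on {0..pi/4} (\<lambda>u. q (Complex (- u) v0))" "continuous_on {0..pi/4} (\<lambda>u. q (Complex (pi - u) (- v0)))"
      unfolding Complex_eq by (intro contS continuous_intros; use v0_pos in simp)+
    have contup: "continuous_on {0..pi/4} (\<lambda>u. qu (Complex (- u) v0))"
    proof -
      have "continuous_on corner (\<lambda>z. qu (\<i> * z))"
        unfolding qu_def phase_def by (intro continuous_intros amp_up_continuous)
      then have "continuous_on {0..pi/4} (\<lambda>u. qu (\<i> * Complex v0 u))"
        by (rule continuous_on_compose2) (auto simp: corner_def Complex_eq intro!: continuous_intros)
      moreover have "\<i> * Complex v0 u = Complex (- u) v0" for u by (simp add: complex_eq_iff)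
      ultimately show ?thesis by simp
    qed
    (* On the segment from the branch point to the left, i times the corner variable is the point -u + i v0. *)
    define HU where "HU = integral {0..pi/4} (\<lambda>u. qu (Complex (- u) v0))"
    have tail: "norm (T - \<i> * HU) \<le> C3 * ?r"
    proof -
      have "\<i> * Complex v0 u = Complex (- u) v0" for u by (simp add: complex_eq_iff)
      then show ?thesis
        using tail_shift(2)[OF y a(1) b(1) phi kap'(1,2)] by (simp add: T_def HU_def qu_def C3_def mult.assoc)
    qed
    have m0: "sinh v0 / 2 * \<kappa> > 0" using sh kap' by simp
    have C2r: "2 * J * (sinh v0 / 2 * \<kappa>) powr (-3/2) = C2 * ?r"
      unfolding C2_def by (subst powr_mult) (use sh kap' in auto)
    have "norm (integral {0..pi/4} (\<lambda>u. qu (Complex (- u) v0) - q (Complex (- u) v0))) \<le> 2 * J * (sinh v0 / 2 * \<kappa>) powr (-3/2)"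
    proof (rule square_root_edge_integral[OF _ m0 J0])
      show "(\<lambda>u. qu (Complex (- u) v0) - q (Complex (- u) v0)) integrable_on {0..pi/4}"
        by (intro integrable_continuous_interval continuous_intros contup contlow)
      fix u assume "u \<in> {0..pi/4}"
      then show "norm (qu (Complex (- u) v0) - q (Complex (- u) v0)) \<le> J * sqrt u * exp (- (sinh v0 / 2 * \<kappa>) * u)"
        unfolding J_def qu_def q_def g_def by (intro jump_bounds(1) phi kap' y ab) auto
    qed simp
    also have "integral {0..pi/4} (\<lambda>u. qu (Complex (- u) v0) - q (Complex (- u) v0)) = HU - H1"
      unfolding HU_def H1_def by (intro integral_diff integrable_continuous_interval contup contlow)
    finally have jump1: "norm (HU - H1) \<le> C2 * ?r" unfolding C2r .
    have "norm (integral {0..pi/4} (\<lambda>u. q (Complex (pi - u) (- v0)) - (- 1) ^ i * cnj (qu (Complex (- u) v0)))) \<le> 2 * J * (sinh v0 / 2 * \<kappa>) powr (-3/2)"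
    proof (rule square_root_edge_integral[OF _ m0 J0])
      show "(\<lambda>u. q (Complex (pi - u) (- v0)) - (- 1) ^ i * cnj (qu (Complex (- u) v0))) integrable_on {0..pi/4}"
        by (intro integrable_continuous_interval continuous_intros contup contlow)
      fix u assume "u \<in> {0..pi/4}"
      then show "norm (q (Complex (pi - u) (- v0)) - (- 1) ^ i * cnj (qu (Complex (- u) v0))) \<le> J * sqrt u * exp (- (sinh v0 / 2 * \<kappa>) * u)"
        unfolding J_def qu_def q_def g_def by (intro jump_bounds(2) phi kap' y ab) auto
    qed simp
    also have "integral {0..pi/4} (\<lambda>u. q (Complex (pi - u) (- v0)) - (- 1) ^ i * cnj (qu (Complex (- u) v0))) = H2 - (- 1) ^ i * cnj HU"
    proof -
      have "((\<lambda>u. (- 1) ^ i * cnj (qu (Complex (- u) v0))) has_integral (- 1) ^ i * cnj HU) {0..pi/4}"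
        unfolding HU_def by (intro has_integral_mult_right has_integral_cnj[THEN iffD2, unfolded o_def] integrable_integral integrable_continuous_interval contup)
      moreover have "((\<lambda>u. q (Complex (pi - u) (- v0))) has_integral H2) {0..pi/4}"
        unfolding H2_def by (intro integrable_integral integrable_continuous_interval contlow)
      ultimately show ?thesis by (intro integral_unique has_integral_diff)
    qed
    finally have jump2: "norm (H2 - (- 1) ^ i * cnj HU) \<le> C2 * ?r" unfolding C2r .
    have main: "norm (F (Complex (3 * pi / 4) (- v0)) - F (Complex (- pi / 4) v0) - m) \<le> C1 * ?r"
      unfolding m_def
    proof (rule saddle)
      fix z assume "\<bar>Im z\<bar> \<le> v0"
      then show "(F has_field_derivative amp_low i j l y a b z * exp (\<i> * of_real \<kappa> * cos (z - of_real \<phi>))) (at z within ?S)"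
        using F[of z] by (simp add: q_def g_def phase_def)
      show "norm (amp_low i j l y a b z) \<le> ampbound ?N R" by (rule amp_low_bounded) fact+
    qed (use phi kap' amp_low_holomorphic in auto)
    have "A1 = - \<i> * (\<i> * A1)" "A3 = \<i> * (- \<i> * A3)" by (simp_all flip: mult.assoc)
    then have "A1 + \<i> * A2 + A3 = \<i> * (F (Complex pi (- v0)) - F (Complex 0 v0))"
      unfolding E1 E2 E3 by (simp add: algebra_simps)
    also have "F (Complex pi (- v0)) = F (Complex (3 * pi / 4) (- v0)) + H2" using E5 by (simp add: algebra_simps)
    also have "F (Complex 0 v0) = F (Complex (- pi / 4) v0) + H1" using E4 by (simp add: algebra_simps)
    (* The five brackets: saddle point, the two jumps across the branch, and the errors of the two shifted tails. *)
    finally have "A1 + \<i> * A2 + A3 + T + (- 1) ^ i * cnj T - \<i> * m =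
        \<i> * (F (Complex (3 * pi / 4) (- v0)) - F (Complex (- pi / 4) v0) - m) + \<i> * (HU - H1)
        + \<i> * (H2 - (- 1) ^ i * cnj HU) + (T - \<i> * HU) + (- 1) ^ i * cnj (T - \<i> * HU)"
      by (simp add: algebra_simps)
    also have "norm \<dots> \<le> C1 * ?r + C2 * ?r + C2 * ?r + C3 * ?r + C3 * ?r"
    proof (intro norm_triangle_le add_mono)
      show "norm ((- 1) ^ i * cnj (T - \<i> * HU)) \<le> C3 * ?r" using tail unfolding norm_mult norm_power complex_mod_cnj by simp
    qed (use main jump1 jump2 tail in \<open>simp_all add: norm_mult\<close>)
    finally show "norm (integral {0..v0} (\<lambda>v. amp_low i j l y a b (Complex 0 v) * phase \<kappa> \<phi> (Complex 0 v))
        + \<i> * integral {0..pi} (\<lambda>x. amp_low i j l y a b (of_real x) * phase \<kappa> \<phi> (of_real x))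
        + integral {0..v0} (\<lambda>v. amp_low i j l y a b (Complex pi (- v)) * phase \<kappa> \<phi> (Complex pi (- v)))
        + integral {v0<..} (\<lambda>v. amp_up i j l y a b (\<i> * of_real v) * phase \<kappa> \<phi> (\<i> * of_real v))
        + (- 1) ^ i * cnj (integral {v0<..} (\<lambda>v. amp_up i j l y a b (\<i> * of_real v) * phase \<kappa> \<phi> (\<i> * of_real v)))
        - \<i> * (amp_low i j l y a b (of_real \<phi>) * ((1 - \<i>) * exp (\<i> * of_real \<kappa>) * of_real (sqrt (pi / \<kappa>)))))
      \<le> (C1 + C2 + C2 + C3 + C3) * ?r"
      by (simp add: A1_def A2_def A3_def q_def g_def T_def qu_def m_def algebra_simps)
  qed
qed

end

section \<open>From the frequency to the complex angle\<close>

lemma S_measurable: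
  assumes "a > 0" shows "(\<lambda>\<xi>::real. S (of_real \<xi>) a) \<in> borel_measurable borel"
  unfolding S_of_real[OF assms] by measurable

lemma S_even: "a > 0 \<Longrightarrow> S (of_real (- \<xi>)) a = S (of_real \<xi>) a"
  using S_of_real[of a "-\<xi>"] S_of_real[of a \<xi>] by simp

lemma S_power2: "a > 0 \<Longrightarrow> (S (of_real \<xi>) a)\<^sup>2 = of_real (\<xi>\<^sup>2 - a\<^sup>2)"
proof -
  assume a: "a > 0"
  show ?thesis
  proof (cases "\<bar>\<xi>\<bar> \<ge> a")
    case True
    then have "a\<^sup>2 \<le> \<xi>\<^sup>2" using a by (subst abs_le_square_iff[symmetric]) simp
    then show ?thesis using True unfolding S_of_real[OF a] by (simp flip: of_real_power)
  next
    case False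
    then have "\<xi>\<^sup>2 \<le> a\<^sup>2" using a by (subst abs_le_square_iff[symmetric]) simp
    then show ?thesis using False unfolding S_of_real[OF a] by (simp add: power_mult_distrib flip: of_real_power)
  qed
qed

lemma absolutely_integrable_on_cong:
  "(\<And>x. x \<in> A \<Longrightarrow> f x = g x) \<Longrightarrow> f absolutely_integrable_on A \<longleftrightarrow> g absolutely_integrable_on A"
  by (intro set_integrable_cong) auto

context wave_numbers
begin

lemma cos_substitution:
  fixes f :: "real \<Rightarrow> complex"
  shows "(\<lambda>x. (k * sin x) *\<^sub>R f (k * cos x)) absolutely_integrable_on {0<..<pi} \<and>
           integral {0<..<pi} (\<lambda>x. (k * sin x) *\<^sub>R f (k * cos x)) = b
     \<longleftrightarrow> f absolutely_integrable_on {-k<..<k} \<and> integral {-k<..<k} f = b"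
proof -
  have im: "(\<lambda>x. k * cos x) ` {0<..<pi} = {-k<..<k}"
  proof (intro equalityI subsetI)
    fix z assume "z \<in> (\<lambda>x. k * cos x) ` {0<..<pi}"
    then obtain x where x: "0 < x" "x < pi" "z = k * cos x" by auto
    have c1: "cos x < cos 0" by (rule cos_monotone_0_pi) (use x in simp_all)
    have c2: "cos pi < cos x" by (rule cos_monotone_0_pi) (use x in simp_all)
    from mult_strict_left_mono[OF c1 k_pos] mult_strict_left_mono[OF c2 k_pos] show "z \<in> {-k<..<k}" using x by simp
  next
    fix z assume z: "z \<in> {-k<..<k}"
    then have z': "- 1 < z / k" "z / k < 1" using k_pos by (simp_all add: pos_less_divide_eq pos_divide_less_eq)
    have "z = k * cos (arccos (z / k))" using z' k_pos by simp
    moreover have "arccos (z / k) \<in> {0<..<pi}" using arccos_lt_bounded[OF z'] by simp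
    ultimately show "z \<in> (\<lambda>x. k * cos x) ` {0<..<pi}" by blast
  qed
  have cv: "(\<lambda>x. \<bar>- k * sin x\<bar> *\<^sub>R f (k * cos x)) absolutely_integrable_on {0<..<pi} \<and>
           integral {0<..<pi} (\<lambda>x. \<bar>- k * sin x\<bar> *\<^sub>R f (k * cos x)) = b
     \<longleftrightarrow> f absolutely_integrable_on (\<lambda>x. k * cos x) ` {0<..<pi} \<and> integral ((\<lambda>x. k * cos x) ` {0<..<pi}) f = b"
  proof (rule has_absolute_integral_change_of_variables_real[where f=f and g="\<lambda>x. k * cos x" and h="\<lambda>x. - k * sin x"])
    show "((\<lambda>x. k * cos x) has_field_derivative - k * sin x) (at x within {0<..<pi})" for x
      by (auto intro!: derivative_eq_intros)
    show "inj_on (\<lambda>x. k * cos x) {0<..<pi}"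
    proof (rule inj_onI)
      fix x y :: real assume "x \<in> {0<..<pi}" "y \<in> {0<..<pi}" "k * cos x = k * cos y"
      then have "0 \<le> x" "x \<le> pi" "0 \<le> y" "y \<le> pi" "cos x = cos y" using k_pos by simp_all
      then show "x = y" by (rule cos_inj_pi)
    qed
  qed auto
  have e: "\<bar>- k * sin x\<bar> *\<^sub>R f (k * cos x) = (k * sin x) *\<^sub>R f (k * cos x)" if "x \<in> {0<..<pi}" for x
    using that k_pos sin_ge_zero[of x] by (simp add: abs_mult)
  have "(\<lambda>x. \<bar>- k * sin x\<bar> *\<^sub>R f (k * cos x)) absolutely_integrable_on {0<..<pi} \<longleftrightarrow> (\<lambda>x. (k * sin x) *\<^sub>R f (k * cos x)) absolutely_integrable_on {0<..<pi}"
    by (rule absolutely_integrable_on_cong) (rule e)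
  moreover have "integral {0<..<pi} (\<lambda>x. \<bar>- k * sin x\<bar> *\<^sub>R f (k * cos x)) = integral {0<..<pi} (\<lambda>x. (k * sin x) *\<^sub>R f (k * cos x))"
    by (rule integral_cong) (rule e)
  ultimately show ?thesis using cv unfolding im by (simp only:)
qed

text \<open>
Stated as an equivalence, so that integrability of the frequency integral is obtained from that of the
integral over the complex angle.
\<close>
lemma cosh_substitution:
  fixes f :: "real \<Rightarrow> complex"
  shows "(\<lambda>x. (k * sinh x) *\<^sub>R f (k * cosh x)) absolutely_integrable_on {0<..} \<and>
           integral {0<..} (\<lambda>x. (k * sinh x) *\<^sub>R f (k * cosh x)) = b
     \<longleftrightarrow> f absolutely_integrable_on {k<..} \<and> integral {k<..} f = b"
proof -
  have im: "(\<lambda>x. k * cosh x) ` {0<..} = {k<..}"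
  proof (intro equalityI subsetI)
    fix z assume "z \<in> (\<lambda>x. k * cosh x) ` {0<..}"
    then obtain x where x: "0 < x" "z = k * cosh x" by auto
    then have "cosh 0 < cosh x" by (subst cosh_real_nonneg_less_iff) auto
    then have "k * cosh 0 < k * cosh x" using k_pos by simp
    then show "z \<in> {k<..}" using x by simp
  next
    fix z assume z: "z \<in> {k<..}"
    then have "1 < z / k" using k_pos by (simp add: field_simps)
    then have "z = k * cosh (arcosh (z / k))" "arcosh (z / k) > 0" using k_pos by simp_all
    then show "z \<in> (\<lambda>x. k * cosh x) ` {0<..}" by (intro image_eqI[of _ _ "arcosh (z / k)"]) auto
  qed
  have cv: "(\<lambda>x. \<bar>k * sinh x\<bar> *\<^sub>R f (k * cosh x)) absolutely_integrable_on {0<..} \<and>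
           integral {0<..} (\<lambda>x. \<bar>k * sinh x\<bar> *\<^sub>R f (k * cosh x)) = b
     \<longleftrightarrow> f absolutely_integrable_on (\<lambda>x. k * cosh x) ` {0<..} \<and> integral ((\<lambda>x. k * cosh x) ` {0<..}) f = b"
  proof (rule has_absolute_integral_change_of_variables_real[where f=f and g="\<lambda>x. k * cosh x" and h="\<lambda>x. k * sinh x"])
    show "((\<lambda>x. k * cosh x) has_field_derivative k * sinh x) (at x within {0<..})" for x
      by (auto intro!: derivative_eq_intros)
    show "inj_on (\<lambda>x. k * cosh x) {0<..}"
    proof (rule inj_onI)
      fix x y :: real assume "x \<in> {0<..}" "y \<in> {0<..}" "k * cosh x = k * cosh y"
      then show "x = y" using k_pos arcosh_cosh_real[of x] arcosh_cosh_real[of y] by simp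
    qed
  qed auto
  have e: "\<bar>k * sinh x\<bar> *\<^sub>R f (k * cosh x) = (k * sinh x) *\<^sub>R f (k * cosh x)" if "x \<in> {0<..}" for x
    using that k_pos by (simp add: abs_mult)
  have "(\<lambda>x. \<bar>k * sinh x\<bar> *\<^sub>R f (k * cosh x)) absolutely_integrable_on {0<..} \<longleftrightarrow> (\<lambda>x. (k * sinh x) *\<^sub>R f (k * cosh x)) absolutely_integrable_on {0<..}"
    by (rule absolutely_integrable_on_cong) (rule e)
  moreover have "integral {0<..} (\<lambda>x. \<bar>k * sinh x\<bar> *\<^sub>R f (k * cosh x)) = integral {0<..} (\<lambda>x. (k * sinh x) *\<^sub>R f (k * cosh x))"
    by (rule integral_cong) (rule e)
  ultimately show ?thesis using cv unfolding im by (simp only:)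
qed

lemma minus_cosh_substitution:
  fixes f :: "real \<Rightarrow> complex"
  shows "(\<lambda>x. (k * sinh x) *\<^sub>R f (- (k * cosh x))) absolutely_integrable_on {0<..} \<and>
           integral {0<..} (\<lambda>x. (k * sinh x) *\<^sub>R f (- (k * cosh x))) = b
     \<longleftrightarrow> f absolutely_integrable_on {..<-k} \<and> integral {..<-k} f = b"
proof -
  have im: "uminus ` {k<..} = {..<-k}"
    by (auto intro!: image_eqI[where x="- x" for x])
  have "(\<lambda>x. \<bar>- 1\<bar> *\<^sub>R f (- x)) absolutely_integrable_on {k<..} \<and>
           integral {k<..} (\<lambda>x. \<bar>- 1\<bar> *\<^sub>R f (- x)) = b
     \<longleftrightarrow> f absolutely_integrable_on uminus ` {k<..} \<and> integral (uminus ` {k<..}) f = b"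
    by (rule has_absolute_integral_change_of_variables_real[where f=f and g=uminus and h="\<lambda>x. - 1"]) (auto intro!: derivative_eq_intros)
  then show ?thesis using cosh_substitution[of "\<lambda>x. f (- x)" b] unfolding im by simp
qed

lemma absolutely_integrable_three_pieces:
  fixes f :: "real \<Rightarrow> complex"
  assumes 1: "f absolutely_integrable_on {-k<..<k}" "integral {-k<..<k} f = I1"
    and 2: "f absolutely_integrable_on {k<..}" "integral {k<..} f = I2"
    and 3: "f absolutely_integrable_on {..<-k}" "integral {..<-k} f = I3"
  shows "f absolutely_integrable_on UNIV" "integral UNIV f = I1 + I2 + I3"
proof -
  have "f absolutely_integrable_on ({-k<..<k} \<union> {k<..})"
    by (rule set_integrable_Un[OF 1(1) 2(1)]) auto
  then have "f absolutely_integrable_on ({-k<..<k} \<union> {k<..} \<union> {..<-k})"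
    by (rule set_integrable_Un[OF _ 3(1)]) auto
  moreover have "f absolutely_integrable_on {-k, k}"
    by (rule absolutely_integrable_negligible) simp
  ultimately have "f absolutely_integrable_on (({-k<..<k} \<union> {k<..} \<union> {..<-k}) \<union> {-k, k})"
    by (rule set_integrable_Un) auto
  moreover have "(({-k<..<k} \<union> {k<..} \<union> {..<-k}) \<union> {-k, k}) = UNIV" by auto
  ultimately show U: "f absolutely_integrable_on UNIV" by simp
  have h: "(f has_integral I1) {-k<..<k}" "(f has_integral I2) {k<..}" "(f has_integral I3) {..<-k}"
    using 1 2 3 by (auto simp: has_integral_iff set_lebesgue_integral_eq_integral(1))
  have "(f has_integral (I1 + I2)) ({-k<..<k} \<union> {k<..})"
    by (rule has_integral_Un[OF h(1,2)]) (rule negligible_subset[of "{}"], auto)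
  then have "(f has_integral (I1 + I2 + I3)) ({-k<..<k} \<union> {k<..} \<union> {..<-k})"
    by (rule has_integral_Un[OF _ h(3)]) (rule negligible_subset[of "{}"], use k_pos in auto)
  moreover have "(f has_integral (I1 + I2 + I3)) ({-k<..<k} \<union> {k<..} \<union> {..<-k}) \<longleftrightarrow> (f has_integral (I1 + I2 + I3)) UNIV"
  proof (rule has_integral_spike_set_eq)
    show "negligible {x \<in> UNIV - ({-k<..<k} \<union> {k<..} \<union> {..<-k}). f x \<noteq> 0}"
      by (rule negligible_subset[of "{-k,k}"]) auto
  qed simp
  ultimately have "(f has_integral (I1 + I2 + I3)) UNIV" by blast
  then show "integral UNIV f = I1 + I2 + I3" by (rule integral_unique)
qed

text \<open>
At \<open>\<xi> = \<plusminus>k\<close> the denominator vanishes and the quotient is zero by convention; this changes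
nothing in the integral.
\<close>
definition spectral :: "nat \<Rightarrow> nat \<Rightarrow> nat \<Rightarrow> real \<Rightarrow> real \<Rightarrow> real \<Rightarrow> real \<Rightarrow> real \<Rightarrow> real \<Rightarrow> complex" where
  "spectral i j l y a b t h \<xi> = amp i j l y a b (of_real \<xi>) (S (of_real \<xi>) k) (S (of_real \<xi>) K)
     * exp (- S (of_real \<xi>) k * of_real h + \<i> * of_real (\<xi> * t)) / S (of_real \<xi>) k"

lemma spectral_measurable [measurable]: "spectral i j l y a b t h \<in> borel_measurable borel"
proof -
  note [measurable] = S_measurable[OF k_pos] S_measurable[OF K_pos]
  show ?thesis unfolding spectral_def amp_def by measurable
qed

lemma lborel_from_pieces:
  fixes f :: "real \<Rightarrow> complex"
  assumes "f \<in> borel_measurable borel" "f absolutely_integrable_on UNIV"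
  shows "integrable lborel f" "(LBINT \<xi>. f \<xi>) = integral UNIV f"
proof -
  have "integrable lebesgue f" using assms(2) by (simp add: set_integrable_def)
  then show i: "integrable lborel f" using assms(1) by (simp add: integrable_completion)
  show "(LBINT \<xi>. f \<xi>) = integral UNIV f" using integral_lborel[OF i] by simp
qed

lemma s_low_real:
  assumes "\<bar>k * cos x\<bar> \<le> K"
  shows "s_low (of_real x) = S (of_real (k * cos x)) K"
proof -
  have "(k * cos x)\<^sup>2 \<le> K\<^sup>2" using assms K_pos by (subst abs_le_square_iff[symmetric]) simp
  moreover have "(of_real K)\<^sup>2 - (of_real k * cos (of_real x))\<^sup>2 = complex_of_real (K\<^sup>2 - (k * cos x)\<^sup>2)"
    by (simp add: cos_of_real)
  ultimately have "s_low (of_real x) = - \<i> * of_real (sqrt (K\<^sup>2 - (k * cos x)\<^sup>2))"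
    unfolding s_low_def by (simp only: of_real_sqrt diff_ge_0_iff_ge)
  moreover have "K\<^sup>2 = (k * cos x)\<^sup>2" if "K \<le> \<bar>k * cos x\<bar>"
  proof -
    have "K = \<bar>k * cos x\<bar>" using that assms by simp
    then show ?thesis by (metis power2_abs)
  qed
  ultimately show ?thesis unfolding S_of_real[OF K_pos] by auto
qed

text \<open>
The Jacobian \<open>k sin z\<close> equals \<open>\<i> S(k cos z, k)\<close>, which removes the singular denominator. The five
formulas are the pieces of the path: the real segment, the two vertical segments below the branch points
and the two tails beyond them.
\<close>
lemma spectral_substitutions:
  fixes \<rho> \<phi> y a b :: real and i j l :: nat
  assumes phi: "0 < \<phi>" "\<phi> < pi"
  defines "f \<equiv> spectral i j l y a b (\<rho> * cos \<phi>) (\<rho> * sin \<phi>)"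
  shows "0 < x \<Longrightarrow> x < pi \<Longrightarrow> (k * sin x) *\<^sub>R f (k * cos x) = \<i> * (amp_low i j l y a b (of_real x) * phase (k * \<rho>) \<phi> (of_real x))"
    and "0 < v \<Longrightarrow> v \<le> v0 \<Longrightarrow> (k * sinh v) *\<^sub>R f (k * cosh v) = amp_low i j l y a b (Complex 0 v) * phase (k * \<rho>) \<phi> (Complex 0 v)"
    and "0 < v \<Longrightarrow> v \<le> v0 \<Longrightarrow> (k * sinh v) *\<^sub>R f (- (k * cosh v)) = amp_low i j l y a b (Complex pi (- v)) * phase (k * \<rho>) \<phi> (Complex pi (- v))"
    and "v0 < v \<Longrightarrow> (k * sinh v) *\<^sub>R f (k * cosh v) = amp_up i j l y a b (\<i> * of_real v) * phase (k * \<rho>) \<phi> (\<i> * of_real v)"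
    and "v0 < v \<Longrightarrow> (k * sinh v) *\<^sub>R f (- (k * cosh v)) = (- 1) ^ i * cnj (amp_up i j l y a b (\<i> * of_real v) * phase (k * \<rho>) \<phi> (\<i> * of_real v))"
proof -
  have trig: "cos (Complex 0 v) = of_real (cosh v)" "sin (Complex 0 v) = \<i> * of_real (sinh v)"
    "cos (Complex pi (- v)) = - of_real (cosh v)" "sin (Complex pi (- v)) = \<i> * of_real (sinh v)" for v
    by (simp_all add: complex_eq_iff Re_cos_cosh Im_cos_sinh Re_sin_cosh Im_sin_sinh)
  have iv: "\<i> * of_real v = Complex 0 v" for v by (simp add: complex_eq_iff)
  have key: "(k * r) *\<^sub>R f \<xi> = amp i j l y a b (of_real \<xi>) m s * c * E"
    if m: "S (of_real \<xi>) k = m" "of_real (k * r) = m * c" "m \<noteq> 0" and s: "S (of_real \<xi>) K = s"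
     and E: "exp (- m * of_real (\<rho> * sin \<phi>) + \<i> * of_real (\<xi> * (\<rho> * cos \<phi>))) = E" for r \<xi> m s c E
    using that by (simp add: f_def spectral_def scaleR_conv_of_real field_simps)
  have Kv: "k * cosh v \<le> K" if "0 < v" "v \<le> v0" for v
  proof -
    have "cosh v \<le> cosh v0" using that by (subst cosh_real_nonneg_le_iff) auto
    then show ?thesis using k_pos by (simp add: cosh_v0 field_simps)
  qed
  have Kv': "K \<le> k * cosh v" if "v0 < v" for v
  proof -
    have "cosh v0 \<le> cosh v" using that v0_pos by (subst cosh_real_nonneg_le_iff) auto
    then show ?thesis using k_pos by (simp add: cosh_v0 field_simps)
  qed
  have Sk: "S (of_real (k * cosh v)) k = of_real (k * sinh v)" "S (of_real (- (k * cosh v))) k = of_real (k * sinh v)" if "0 < v" for v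
  proof -
    have "k * 1 \<le> k * cosh v" using k_pos cosh_real_ge_1[of v] by (intro mult_left_mono) auto
    moreover have "(k * cosh v)\<^sup>2 - k\<^sup>2 = (k * sinh v)\<^sup>2" by (simp add: power_mult_distrib cosh_square_eq algebra_simps)
    moreover have "sqrt ((k * sinh v)\<^sup>2) = k * sinh v" using k_pos that by (simp add: real_sqrt_unique)
    moreover have "k \<le> \<bar>k * cosh v\<bar>" using calculation(1) abs_ge_self[of "k * cosh v"] by linarith
    ultimately show 1: "S (of_real (k * cosh v)) k = of_real (k * sinh v)"
      unfolding S_of_real[OF k_pos] by (simp only: if_True)
    show "S (of_real (- (k * cosh v))) k = of_real (k * sinh v)" unfolding S_even[OF k_pos] by (rule 1)
  qed
  have sh: "k * sinh v > 0" if "0 < v" for v using that k_pos by simp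
  have slow: "s_low (Complex 0 v) = S (of_real (k * cosh v)) K" "s_low (Complex pi (- v)) = S (of_real (- (k * cosh v))) K"
    if "0 < v" "v \<le> v0" for v
  proof -
    have "(k * cosh v)\<^sup>2 \<le> K\<^sup>2" using Kv[OF that] k_pos by (intro power_mono) auto
    then have e: "csqrt (of_real (K\<^sup>2 - (k * cosh v)\<^sup>2)) = of_real (sqrt (K\<^sup>2 - (k * cosh v)\<^sup>2))"
      by (simp only: of_real_sqrt diff_ge_0_iff_ge)
    have "K\<^sup>2 = (k * cosh v)\<^sup>2" if "K \<le> \<bar>k * cosh v\<bar>"
    proof -
      have "K = \<bar>k * cosh v\<bar>" using that Kv[OF \<open>0 < v\<close> \<open>v \<le> v0\<close>] k_pos by (simp add: abs_mult)
      then show ?thesis by (metis power2_abs)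
    qed
    then have S: "S (of_real (k * cosh v)) K = - \<i> * of_real (sqrt (K\<^sup>2 - (k * cosh v)\<^sup>2))"
      unfolding S_of_real[OF K_pos] by auto
    show "s_low (Complex 0 v) = S (of_real (k * cosh v)) K" "s_low (Complex pi (- v)) = S (of_real (- (k * cosh v))) K"
      unfolding s_low_def trig S_even[OF K_pos] S e[symmetric] by (simp_all add: power_mult_distrib)
  qed
  have sup: "s_up (Complex 0 v) = S (of_real (k * cosh v)) K" if "v0 < v" for v
  proof -
    have "K\<^sup>2 \<le> (k * cosh v)\<^sup>2" using Kv'[OF that] K_pos by (intro power_mono) auto
    then have e: "csqrt (of_real ((k * cosh v)\<^sup>2 - K\<^sup>2)) = of_real (sqrt ((k * cosh v)\<^sup>2 - K\<^sup>2))"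
      by (simp only: of_real_sqrt diff_ge_0_iff_ge)
    have "K \<le> \<bar>k * cosh v\<bar>" using Kv'[OF that] abs_ge_self[of "k * cosh v"] by linarith
    then have "S (of_real (k * cosh v)) K = of_real (sqrt ((k * cosh v)\<^sup>2 - K\<^sup>2))"
      unfolding S_of_real[OF K_pos] by (simp only: if_True)
    then show ?thesis unfolding s_up_def trig e[symmetric] by (simp add: power_mult_distrib)
  qed
  show "(k * sin x) *\<^sub>R f (k * cos x) = \<i> * (amp_low i j l y a b (of_real x) * phase (k * \<rho>) \<phi> (of_real x))" if x: "0 < x" "x < pi"
  proof -
    have sx: "sin x > 0" using x by (rule sin_gt_zero)
    have cx: "\<bar>k * cos x\<bar> \<le> k * 1" unfolding abs_mult using k_pos by (intro mult_mono) auto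
    have sq: "k\<^sup>2 - (k * cos x)\<^sup>2 = (k * sin x)\<^sup>2" by (simp add: power_mult_distrib sin_squared_eq algebra_simps)
    have "(k * cos x)\<^sup>2 < k\<^sup>2" using sq sx k_pos by (smt (verit) mult_pos_pos zero_less_power)
    then have "\<bar>k * cos x\<bar> < k" using k_pos by (intro power2_less_imp_less[of "\<bar>k * cos x\<bar>" k]) simp_all
    then have m: "S (of_real (k * cos x)) k = - \<i> * of_real (k * sin x)"
      unfolding S_of_real[OF k_pos] sq using k_pos sx by simp
    have "(k * sin x) *\<^sub>R f (k * cos x) = amp i j l y a b (of_real (k * cos x)) (- \<i> * of_real (k * sin x)) (s_low (of_real x)) * \<i> * phase (k * \<rho>) \<phi> (of_real x)"
    proof (rule key[OF m])
      show "S (of_real (k * cos x)) K = s_low (of_real x)" using s_low_real[of x] cx k_less_K by simp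
      show "- \<i> * of_real (k * sin x) \<noteq> 0" using k_pos sx by simp
      have "cos (complex_of_real x - of_real \<phi>) = of_real (cos x * cos \<phi> + sin x * sin \<phi>)"
        by (simp add: cos_diff flip: cos_of_real sin_of_real)
      then show "exp (- (- \<i> * of_real (k * sin x)) * of_real (\<rho> * sin \<phi>) + \<i> * of_real (k * cos x * (\<rho> * cos \<phi>))) = phase (k * \<rho>) \<phi> (of_real x)"
        unfolding phase_def by (simp add: algebra_simps)
    qed (simp add: complex_eq_iff)
    moreover have "of_real k * cos (of_real x) = complex_of_real (k * cos x)" "- \<i> * of_real k * sin (of_real x) = - \<i> * complex_of_real (k * sin x)"
      by (simp_all add: cos_of_real sin_of_real)
    ultimately show ?thesis unfolding amp_low_def by (simp only: mult_ac)
  qed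
  have ph0: "exp (- of_real (k * sinh v) * of_real (\<rho> * sin \<phi>) + \<i> * of_real (k * cosh v * (\<rho> * cos \<phi>))) = phase (k * \<rho>) \<phi> (Complex 0 v)"
    "exp (- of_real (k * sinh v) * of_real (\<rho> * sin \<phi>) + \<i> * of_real (- (k * cosh v) * (\<rho> * cos \<phi>))) = phase (k * \<rho>) \<phi> (Complex pi (- v))" for v
    unfolding phase_def cos_diff trig by (simp_all add: cos_of_real sin_of_real algebra_simps)
  have tr: "of_real k * cos (Complex 0 v) = complex_of_real (k * cosh v)" "- \<i> * of_real k * sin (Complex 0 v) = complex_of_real (k * sinh v)"
    "of_real k * cos (Complex pi (- v)) = complex_of_real (- (k * cosh v))" "- \<i> * of_real k * sin (Complex pi (- v)) = complex_of_real (k * sinh v)" for v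
    unfolding trig by (simp_all add: complex_eq_iff)
  have key1: "(k * sinh v) *\<^sub>R f \<xi> = amp i j l y a b (of_real \<xi>) (of_real (k * sinh v)) s * E"
    if "0 < v" "S (of_real \<xi>) k = of_real (k * sinh v)" "S (of_real \<xi>) K = s"
      "exp (- of_real (k * sinh v) * of_real (\<rho> * sin \<phi>) + \<i> * of_real (\<xi> * (\<rho> * cos \<phi>))) = E" for v \<xi> s E
    using key[OF that(2) _ _ that(3,4), of "sinh v" 1] sh[OF that(1)] k_pos that(1) by (simp del: of_real_mult)
  show "(k * sinh v) *\<^sub>R f (k * cosh v) = amp_low i j l y a b (Complex 0 v) * phase (k * \<rho>) \<phi> (Complex 0 v)"
    "(k * sinh v) *\<^sub>R f (- (k * cosh v)) = amp_low i j l y a b (Complex pi (- v)) * phase (k * \<rho>) \<phi> (Complex pi (- v))"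
    if v: "0 < v" "v \<le> v0"
    unfolding amp_low_def tr
    by (rule key1[OF v(1) Sk(1)[OF v(1)] slow(1)[OF v, symmetric] ph0(1)],
        rule key1[OF v(1) Sk(2)[OF v(1)] slow(2)[OF v, symmetric] ph0(2)])
  show "(k * sinh v) *\<^sub>R f (k * cosh v) = amp_up i j l y a b (\<i> * of_real v) * phase (k * \<rho>) \<phi> (\<i> * of_real v)" if v: "v0 < v"
  proof -
    have v1: "0 < v" using v v0_pos by simp
    show ?thesis unfolding iv amp_up_def tr by (rule key1[OF v1 Sk(1)[OF v1] sup[OF v, symmetric] ph0(1)])
  qed
  show "(k * sinh v) *\<^sub>R f (- (k * cosh v)) = (- 1) ^ i * cnj (amp_up i j l y a b (\<i> * of_real v) * phase (k * \<rho>) \<phi> (\<i> * of_real v))" if v: "v0 < v"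
  proof -
    have v1: "0 < v" using v v0_pos by simp
    have pc: "of_real pi + cnj (Complex 0 v) = Complex pi (- v)" by (simp add: complex_eq_iff)
    have "cnj (s_up (Complex 0 v)) = S (of_real (- (k * cosh v))) K"
    proof -
      have "K \<le> \<bar>k * cosh v\<bar>" using Kv'[OF v] abs_ge_self[of "k * cosh v"] by linarith
      then have "S (of_real (k * cosh v)) K = of_real (sqrt ((k * cosh v)\<^sup>2 - K\<^sup>2))"
        unfolding S_of_real[OF K_pos] by (simp only: if_True)
      then show ?thesis unfolding S_even[OF K_pos] sup[OF v] by (simp only: complex_cnj_complex_of_real)
    qed
    from key1[OF v1 Sk(2)[OF v1] this[symmetric] ph0(2)]
    show ?thesis unfolding iv amp_up_def unfolding reflected_integrand pc unfolding tr .
  qed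
qed

lemma spectral_integral_pieces:
  fixes \<rho> \<phi> y a b :: real and i j l :: nat
  assumes phi: "0 < \<phi>" "\<phi> \<le> pi / 2"
    and int: "(\<lambda>v. amp_up i j l y a b (\<i> * of_real v) * phase (k * \<rho>) \<phi> (\<i> * of_real v)) absolutely_integrable_on {v0<..}"
  defines "T \<equiv> integral {v0<..} (\<lambda>v. amp_up i j l y a b (\<i> * of_real v) * phase (k * \<rho>) \<phi> (\<i> * of_real v))"
  shows "(LBINT \<xi>. spectral i j l y a b (\<rho> * cos \<phi>) (\<rho> * sin \<phi>) \<xi>) =
        integral {0..v0} (\<lambda>v. amp_low i j l y a b (Complex 0 v) * phase (k * \<rho>) \<phi> (Complex 0 v))
        + \<i> * integral {0..pi} (\<lambda>x. amp_low i j l y a b (of_real x) * phase (k * \<rho>) \<phi> (of_real x))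
        + integral {0..v0} (\<lambda>v. amp_low i j l y a b (Complex pi (- v)) * phase (k * \<rho>) \<phi> (Complex pi (- v)))
        + T + (- 1) ^ i * cnj T"
proof -
  define f where "f = spectral i j l y a b (\<rho> * cos \<phi>) (\<rho> * sin \<phi>)"
  define q where "q = (\<lambda>z. amp_low i j l y a b z * phase (k * \<rho>) \<phi> z)"
  define qu where "qu = (\<lambda>v::real. amp_up i j l y a b (\<i> * of_real v) * phase (k * \<rho>) \<phi> (\<i> * of_real v))"
  have phi': "\<phi> < pi" using phi pi_gt_zero by linarith
  note sub = spectral_substitutions[OF phi(1) phi', where i=i and j=j and l=l and y=y and a=a and b=b and \<rho>=\<rho>, folded f_def]
  have qcont: "continuous_on {z. \<bar>Im z\<bar> \<le> v0} q"
    unfolding q_def phase_def by (intro continuous_intros amp_low_continuous)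
  have c1: "continuous_on {0..v0} (\<lambda>v. q (Complex 0 v))" "continuous_on {0..v0} (\<lambda>v. q (Complex pi (- v)))"
    "continuous_on {0..pi} (\<lambda>x. \<i> * q (of_real x))"
    unfolding Complex_eq by (intro continuous_intros continuous_on_compose2[OF qcont]; use v0_pos in auto)+
  have closed_to_open: "g absolutely_integrable_on A \<and> integral A g = integral {c..d} g"
    if "continuous_on {c..d} g" "A = {c<..d} \<or> A = {c<..<d}" for g :: "real \<Rightarrow> complex" and A c d
  proof
    have "g absolutely_integrable_on {c..d}" using that(1) by (intro absolutely_integrable_continuous_real)
    then show "g absolutely_integrable_on A" by (rule set_integrable_subset) (use that in auto)
    show "integral A g = integral {c..d} g"
    proof (rule integral_spike_set)
      show "negligible {x \<in> A - {c..d}. g x \<noteq> 0}" by (rule negligible_subset[of "{}"]) (use that in auto)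
      show "negligible {x \<in> {c..d} - A. g x \<noteq> 0}" by (rule negligible_subset[of "{c,d}"]) (use that in auto)
    qed
  qed
  have tail: "g absolutely_integrable_on {0<..} \<and> integral {0<..} g = integral {0..v0} h + I"
    if h: "continuous_on {0..v0} h" "\<And>v. 0 < v \<Longrightarrow> v \<le> v0 \<Longrightarrow> g v = h v"
      and u: "u absolutely_integrable_on {v0<..}" "integral {v0<..} u = I" "\<And>v. v0 < v \<Longrightarrow> g v = u v" for g h u :: "real \<Rightarrow> complex" and I
  proof -
    have 1: "g absolutely_integrable_on {0<..v0}" "integral {0<..v0} g = integral {0..v0} h"
    proof -
      have hh: "h absolutely_integrable_on {0<..v0} \<and> integral {0<..v0} h = integral {0..v0} h"
        by (rule closed_to_open[OF h(1)]) simp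
      have "g absolutely_integrable_on {0<..v0} \<longleftrightarrow> h absolutely_integrable_on {0<..v0}"
        by (rule absolutely_integrable_on_cong) (use h(2) in auto)
      moreover have "integral {0<..v0} g = integral {0<..v0} h"
        by (rule integral_cong) (use h(2) in auto)
      ultimately show "g absolutely_integrable_on {0<..v0}" "integral {0<..v0} g = integral {0..v0} h" using hh by auto
    qed
    have 2: "g absolutely_integrable_on {v0<..}" "integral {v0<..} g = I"
    proof -
      have "g absolutely_integrable_on {v0<..} \<longleftrightarrow> u absolutely_integrable_on {v0<..}"
        by (rule absolutely_integrable_on_cong) (use u(3) in auto)
      moreover have "integral {v0<..} g = integral {v0<..} u"
        by (rule integral_cong) (use u(3) in auto)
      ultimately show "g absolutely_integrable_on {v0<..}" "integral {v0<..} g = I" using u by auto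
    qed
    have un: "{0<..v0} \<union> {v0<..} = {0<..}" using v0_pos by auto
    have "g absolutely_integrable_on ({0<..v0} \<union> {v0<..})"
      by (rule set_integrable_Un[OF 1(1) 2(1)]) auto
    moreover have "(g has_integral (integral {0..v0} h + I)) ({0<..v0} \<union> {v0<..})"
    proof (rule has_integral_Un)
      show "(g has_integral integral {0..v0} h) {0<..v0}"
        using integrable_integral[OF set_lebesgue_integral_eq_integral(1)[OF 1(1)]] 1(2) by simp
      show "(g has_integral I) {v0<..}"
        using integrable_integral[OF set_lebesgue_integral_eq_integral(1)[OF 2(1)]] 2(2) by simp
      show "negligible ({0<..v0} \<inter> {v0<..})" by (rule negligible_subset[of "{}"]) auto
    qed
    ultimately show ?thesis unfolding un by (auto dest: integral_unique)
  qed
  have "(\<lambda>x. (k * sin x) *\<^sub>R f (k * cos x)) absolutely_integrable_on {0<..<pi} \<and>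
     integral {0<..<pi} (\<lambda>x. (k * sin x) *\<^sub>R f (k * cos x)) = \<i> * integral {0..pi} (\<lambda>x. q (of_real x))"
  proof -
    have e: "(k * sin x) *\<^sub>R f (k * cos x) = \<i> * q (of_real x)" if "x \<in> {0<..<pi}" for x
      using sub(1)[of x] that by (simp add: q_def)
    have "(\<lambda>x. (k * sin x) *\<^sub>R f (k * cos x)) absolutely_integrable_on {0<..<pi} \<longleftrightarrow> (\<lambda>x. \<i> * q (of_real x)) absolutely_integrable_on {0<..<pi}"
      by (rule absolutely_integrable_on_cong) (rule e)
    moreover have "integral {0<..<pi} (\<lambda>x. (k * sin x) *\<^sub>R f (k * cos x)) = integral {0<..<pi} (\<lambda>x. \<i> * q (of_real x))"
      by (rule integral_cong) (rule e)
    moreover have "(\<lambda>x. \<i> * q (of_real x)) absolutely_integrable_on {0<..<pi} \<and> integral {0<..<pi} (\<lambda>x. \<i> * q (of_real x)) = integral {0..pi} (\<lambda>x. \<i> * q (of_real x))"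
      by (rule closed_to_open[OF c1(3)]) simp
    ultimately show ?thesis by simp
  qed
  note p1 = cos_substitution[THEN iffD1, OF this]
  have "(\<lambda>x. (k * sinh x) *\<^sub>R f (k * cosh x)) absolutely_integrable_on {0<..} \<and>
     integral {0<..} (\<lambda>x. (k * sinh x) *\<^sub>R f (k * cosh x)) = integral {0..v0} (\<lambda>v. q (Complex 0 v)) + T"
    by (rule tail[OF c1(1) _ int]) (auto simp: T_def q_def sub(2,4))
  note p2 = cosh_substitution[THEN iffD1, OF this]
  have int': "(\<lambda>v. (- 1) ^ i * cnj (qu v)) absolutely_integrable_on {v0<..}"
    using absolutely_integrable_linear[OF int bounded_linear_cnj] unfolding qu_def[symmetric] o_def
    by (rule set_integrable_mult_right)
  have "integral {v0<..} (\<lambda>v. (- 1) ^ i * cnj (qu v)) = (- 1) ^ i * cnj T"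
  proof -
    have "(qu has_integral T) {v0<..}"
      using integrable_integral[OF set_lebesgue_integral_eq_integral(1)[OF int]] unfolding T_def qu_def .
    then show ?thesis by (intro integral_unique has_integral_mult_right has_integral_cnj[THEN iffD2, unfolded o_def])
  qed
  then have "(\<lambda>x. (k * sinh x) *\<^sub>R f (- (k * cosh x))) absolutely_integrable_on {0<..} \<and>
     integral {0<..} (\<lambda>x. (k * sinh x) *\<^sub>R f (- (k * cosh x))) = integral {0..v0} (\<lambda>v. q (Complex pi (- v))) + (- 1) ^ i * cnj T"
    by (intro tail[OF c1(2) _ int']) (auto simp: q_def qu_def sub(3,5))
  note p3 = minus_cosh_substitution[THEN iffD1, OF this]
  have U: "f absolutely_integrable_on UNIV" "integral UNIV f = \<i> * integral {0..pi} (\<lambda>x. q (of_real x))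
     + (integral {0..v0} (\<lambda>v. q (Complex 0 v)) + T) + (integral {0..v0} (\<lambda>v. q (Complex pi (- v))) + (- 1) ^ i * cnj T)"
    using absolutely_integrable_three_pieces[of f] p1 p2 p3 by blast+
  have "(LBINT \<xi>. f \<xi>) = integral UNIV f"
    by (rule lborel_from_pieces(2)[OF _ U(1)]) (simp add: f_def)
  then show ?thesis unfolding U(2) by (simp add: f_def q_def)
qed

section \<open>
Both vertical rates are even functions of the frequency.
\<close>

lemma spectral_reflect:
  "spectral i j l y a b t h (- \<xi>) = (- 1) ^ i * spectral i j l (- y) a b (- t) h \<xi>"
proof -
  have "(- complex_of_real \<xi>) ^ i = (- 1) ^ i * complex_of_real \<xi> ^ i" by (rule power_minus)
  then show ?thesis unfolding spectral_def amp_def S_even[OF k_pos] S_even[OF K_pos] by simp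
qed

lemma spectral_integral_reflect:
  "(LBINT \<xi>. spectral i j l y a b t h \<xi>) = (- 1) ^ i * (LBINT \<xi>. spectral i j l (- y) a b (- t) h \<xi>)"
proof -
  have "(LBINT \<xi>. spectral i j l y a b t h \<xi>) = (LBINT \<xi>. spectral i j l y a b t h (0 + (- 1) * \<xi>))"
    using lborel_integral_real_affine[of "- 1" "spectral i j l y a b t h" 0] by simp
  also have "\<dots> = (LBINT \<xi>. (- 1) ^ i * spectral i j l (- y) a b (- t) h \<xi>)"
    using spectral_reflect[of i j l y a b t h] by simp
  also have "\<dots> = (- 1) ^ i * (LBINT \<xi>. spectral i j l (- y) a b (- t) h \<xi>)"
    by (rule integral_mult_right_zero)
  finally show ?thesis .
qed

lemma amp_low_reflect: "amp_low i j l y a b (of_real (pi - x)) = (- 1) ^ i * amp_low i j l (- y) a b (of_real x)"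
proof -
  have "(- (of_real k * cos (complex_of_real x))) ^ i = (- 1) ^ i * (of_real k * cos (complex_of_real x)) ^ i" by (rule power_minus)
  moreover have "cos (of_real (pi - x)) = - cos (complex_of_real x)" "sin (of_real (pi - x)) = sin (complex_of_real x)"
    by (simp_all add: cos_of_real sin_of_real del: of_real_diff)
  ultimately show ?thesis by (simp add: amp_low_def amp_def s_low_def)
qed

text \<open>
Angles beyond \<open>\<pi>/2\<close> are reduced to the others by \<open>\<xi> \<mapsto> -\<xi>\<close>, which replaces \<open>\<phi>\<close> by \<open>\<pi> - \<phi>\<close>.
\<close>
theorem spectral_asymptotics:
  fixes R :: real
  assumes R0: "0 \<le> R"
  obtains C \<rho>0 where "C \<ge> 0" "\<rho>0 > 0"
    "\<And>y a b \<phi> \<rho>. \<lbrakk>\<bar>y\<bar> \<le> R; 0 \<le> a; a \<le> R; 0 \<le> b; b \<le> R; 0 < \<phi>; \<phi> < pi; \<rho> \<ge> \<rho>0\<rbrakk> \<Longrightarrow>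
      norm ((LBINT \<xi>. spectral i j l y a b (\<rho> * cos \<phi>) (\<rho> * sin \<phi>) \<xi>)
        - amp_low i j l y a b (of_real \<phi>) * ((1 + \<i>) * exp (\<i> * of_real (k * \<rho>)) * of_real (sqrt (pi / (k * \<rho>)))))
      \<le> C * \<rho> powr (-3/2)"
proof -
  obtain C \<kappa>0 where C: "C \<ge> 0" "\<kappa>0 \<ge> 1" and main:
    "\<And>y a b \<phi> \<kappa>. \<lbrakk>\<bar>y\<bar> \<le> R; 0 \<le> a; a \<le> R; 0 \<le> b; b \<le> R; 0 < \<phi>; \<phi> \<le> pi / 2; \<kappa> \<ge> \<kappa>0\<rbrakk> \<Longrightarrow>
      norm (integral {0..v0} (\<lambda>v. amp_low i j l y a b (Complex 0 v) * phase \<kappa> \<phi> (Complex 0 v))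
        + \<i> * integral {0..pi} (\<lambda>x. amp_low i j l y a b (of_real x) * phase \<kappa> \<phi> (of_real x))
        + integral {0..v0} (\<lambda>v. amp_low i j l y a b (Complex pi (- v)) * phase \<kappa> \<phi> (Complex pi (- v)))
        + integral {v0<..} (\<lambda>v. amp_up i j l y a b (\<i> * of_real v) * phase \<kappa> \<phi> (\<i> * of_real v))
        + (- 1) ^ i * cnj (integral {v0<..} (\<lambda>v. amp_up i j l y a b (\<i> * of_real v) * phase \<kappa> \<phi> (\<i> * of_real v)))
        - \<i> * (amp_low i j l y a b (of_real \<phi>) * ((1 - \<i>) * exp (\<i> * of_real \<kappa>) * of_real (sqrt (pi / \<kappa>)))))
      \<le> C * \<kappa> powr (-3/2)"
    using contour_asymptotics[OF R0, of i j l] by blast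
  define \<rho>0 where "\<rho>0 = max (\<kappa>0 / k) (max (2 * R) (4 * (real (i + j + l) + 1) / k))"
  have half: "norm ((LBINT \<xi>. spectral i j l y a b (\<rho> * cos \<phi>) (\<rho> * sin \<phi>) \<xi>)
        - amp_low i j l y a b (of_real \<phi>) * ((1 + \<i>) * exp (\<i> * of_real (k * \<rho>)) * of_real (sqrt (pi / (k * \<rho>)))))
      \<le> C * k powr (-3/2) * \<rho> powr (-3/2)"
    if *: "\<bar>y\<bar> \<le> R" "0 \<le> a" "a \<le> R" "0 \<le> b" "b \<le> R" and phi: "0 < \<phi>" "\<phi> \<le> pi / 2" and r: "\<rho> \<ge> \<rho>0" for y a b \<phi> \<rho>
  proof -
    have "\<kappa>0 / k \<le> \<rho>" "2 * R \<le> \<rho>" "4 * (real (i + j + l) + 1) / k \<le> \<rho>" using r by (auto simp: \<rho>0_def)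
    then have kap: "k * \<rho> \<ge> \<kappa>0" "k * \<rho> \<ge> 2 * R * k" "k * \<rho> \<ge> 4 * (real (i + j + l) + 1)"
      using k_pos by (simp_all only: pos_divide_le_eq mult.commute[of k] mult_right_mono less_imp_le)
    have "0 < k * \<rho>" using kap(1) C(2) by linarith
    then have r0: "\<rho> > 0" using k_pos by (simp add: zero_less_mult_iff)
    note int = tail_shift(1)[OF *(1) *(2) *(4) phi kap(2,3)]
    have i1: "\<i> * (w * ((1 - \<i>) * e * s)) = w * ((1 + \<i>) * e * s)" for w e s :: complex by (simp add: algebra_simps)
    have "norm ((LBINT \<xi>. spectral i j l y a b (\<rho> * cos \<phi>) (\<rho> * sin \<phi>) \<xi>)
        - amp_low i j l y a b (of_real \<phi>) * ((1 + \<i>) * exp (\<i> * of_real (k * \<rho>)) * of_real (sqrt (pi / (k * \<rho>)))))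
      \<le> C * (k * \<rho>) powr (-3/2)"
      unfolding spectral_integral_pieces[OF phi int] using main[OF * phi kap(1)] unfolding i1 .
    also have "(k * \<rho>) powr (-3/2) = k powr (-3/2) * \<rho> powr (-3/2)"
      by (rule powr_mult)
    finally show ?thesis by (simp add: mult.assoc)
  qed
  show ?thesis
  proof
    show "C * k powr (-3/2) \<ge> 0" using C by simp
    have "0 < \<kappa>0 / k" using C k_pos by simp
    then show "\<rho>0 > 0" unfolding \<rho>0_def by linarith
    fix y a b \<phi> \<rho>
    assume *: "\<bar>y\<bar> \<le> R" "0 \<le> a" "a \<le> R" "0 \<le> b" "b \<le> R" and phi: "0 < \<phi>" "\<phi> < pi" and r: "\<rho> \<ge> \<rho>0"
    show "norm ((LBINT \<xi>. spectral i j l y a b (\<rho> * cos \<phi>) (\<rho> * sin \<phi>) \<xi>)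
        - amp_low i j l y a b (of_real \<phi>) * ((1 + \<i>) * exp (\<i> * of_real (k * \<rho>)) * of_real (sqrt (pi / (k * \<rho>)))))
      \<le> C * k powr (-3/2) * \<rho> powr (-3/2)"
    proof (cases "\<phi> \<le> pi / 2")
      case True
      then show ?thesis using half[OF * phi(1) True r] by simp
    next
      case False
      define \<psi> where "\<psi> = pi - \<phi>"
      have psi: "0 < \<psi>" "\<psi> \<le> pi / 2" using phi False by (auto simp: \<psi>_def)
      have ph: "\<phi> = pi - \<psi>" by (simp add: \<psi>_def)
      have y: "\<bar>- y\<bar> \<le> R" using * by simp
      let ?w = "(1 + \<i>) * exp (\<i> * of_real (k * \<rho>)) * complex_of_real (sqrt (pi / (k * \<rho>)))"
      let ?L = "LBINT \<xi>. spectral i j l (- y) a b (\<rho> * cos \<psi>) (\<rho> * sin \<psi>) \<xi>"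
      have e: "(LBINT \<xi>. spectral i j l y a b (\<rho> * cos \<phi>) (\<rho> * sin \<phi>) \<xi>) - amp_low i j l y a b (of_real \<phi>) * ?w
        = (- 1) ^ i * (?L - amp_low i j l (- y) a b (of_real \<psi>) * ?w)"
        unfolding ph amp_low_reflect spectral_integral_reflect[of i j l y] by (simp add: algebra_simps)
      show ?thesis unfolding e norm_mult norm_power using half[OF y *(2-5) psi r] by simp
    qed
  qed
qed

section \<open>Integrability and differentiation under the integral sign\<close>

text \<open>
The singularities at \<open>\<plusminus>k\<close> are inverse square roots. They disappear in the variable of the
complex angle, which also gives integrability here.
\<close>
lemma inverse_S_exp_integrable:
  assumes c: "c > 0"
  shows "integrable lborel (\<lambda>\<xi>::real. exp (- c * \<bar>\<xi>\<bar>) / norm (S (of_real \<xi>) k))"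
proof -
  define f :: "real \<Rightarrow> complex" where "f = (\<lambda>\<xi>. of_real (exp (- c * \<bar>\<xi>\<bar>) / norm (S (of_real \<xi>) k)))"
  note [measurable] = S_measurable[OF k_pos]
  have meas: "f \<in> borel_measurable borel" unfolding f_def by measurable
  have nS: "norm (S (of_real \<xi>) k) = sqrt \<bar>\<xi>\<^sup>2 - k\<^sup>2\<bar>" for \<xi>
  proof -
    have "(norm (S (of_real \<xi>) k))\<^sup>2 = \<bar>\<xi>\<^sup>2 - k\<^sup>2\<bar>"
      unfolding norm_power[symmetric] S_power2[OF k_pos] norm_of_real ..
    then show ?thesis by (metis norm_ge_zero real_sqrt_unique)
  qed
  have "f absolutely_integrable_on {-k<..<k}"
  proof -
    have e: "(k * sin x) *\<^sub>R f (k * cos x) = of_real (exp (- c * \<bar>k * cos x\<bar>))" if "x \<in> {0<..<pi}" for x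
    proof -
      have "sin x > 0" using that by (auto intro: sin_gt_zero)
      moreover have "\<bar>(k * cos x)\<^sup>2 - k\<^sup>2\<bar> = (k * sin x)\<^sup>2"
      proof -
        have "(k * cos x)\<^sup>2 - k\<^sup>2 = - ((k * sin x)\<^sup>2)" by (simp add: power_mult_distrib sin_squared_eq algebra_simps)
        then show ?thesis by simp
      qed
      ultimately show ?thesis using k_pos by (simp add: f_def nS scaleR_conv_of_real)
    qed
    have "(\<lambda>x. complex_of_real (exp (- c * \<bar>k * cos x\<bar>))) absolutely_integrable_on {0..pi}"
      by (intro absolutely_integrable_continuous_real continuous_intros)
    then have "(\<lambda>x. complex_of_real (exp (- c * \<bar>k * cos x\<bar>))) absolutely_integrable_on {0<..<pi}"
      by (rule set_integrable_subset) auto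
    then have "(\<lambda>x. (k * sin x) *\<^sub>R f (k * cos x)) absolutely_integrable_on {0<..<pi}"
      by (subst absolutely_integrable_on_cong[of _ _ "\<lambda>x. complex_of_real (exp (- c * \<bar>k * cos x\<bar>))"]) (rule e)
    then show ?thesis using cos_substitution by blast
  qed
  moreover have tail: "(\<lambda>x. (k * sinh x) *\<^sub>R f (k * cosh x)) absolutely_integrable_on {0<..}"
      "(\<lambda>x. (k * sinh x) *\<^sub>R f (- (k * cosh x))) absolutely_integrable_on {0<..}"
  proof -
    have e: "(k * sinh x) *\<^sub>R f (k * cosh x) = of_real (exp (- c * (k * cosh x)))"
       "(k * sinh x) *\<^sub>R f (- (k * cosh x)) = of_real (exp (- c * (k * cosh x)))" if "x \<in> {0<..}" for x
    proof -
      have "(k * cosh x)\<^sup>2 - k\<^sup>2 = (k * sinh x)\<^sup>2" by (simp add: power_mult_distrib cosh_square_eq algebra_simps)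
      then show "(k * sinh x) *\<^sub>R f (k * cosh x) = of_real (exp (- c * (k * cosh x)))"
       "(k * sinh x) *\<^sub>R f (- (k * cosh x)) = of_real (exp (- c * (k * cosh x)))"
        using k_pos that by (simp_all add: f_def nS scaleR_conv_of_real abs_mult)
    qed
    have "(\<lambda>x. complex_of_real (exp (- c * (k * cosh x)))) absolutely_integrable_on {0<..}"
    proof (rule measurable_bounded_by_integrable_imp_absolutely_integrable)
      have "(\<lambda>x. exp (- (c * k) * x)) integrable_on {0..}"
        using c k_pos by (intro integrable_on_exp_minus_to_infinity) simp
      then show "(\<lambda>x. exp (- (c * k) * x)) integrable_on {0<..}"
        by (rule integrable_spike_set) (rule negligible_subset[of "{0}"], auto)+
      show "(\<lambda>x. complex_of_real (exp (- c * (k * cosh x)))) \<in> borel_measurable (lebesgue_on {0<..})"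
        by (intro continuous_imp_measurable_on_sets_lebesgue continuous_intros) auto
      fix x :: real assume "x \<in> {0<..}"
      then have "x \<le> cosh x"
      proof -
        have "1 + x + x\<^sup>2 / 2 \<le> exp x" using \<open>x \<in> {0<..}\<close> by (intro exp_lower_Taylor_quadratic) simp
        moreover have "0 \<le> (x - 1)\<^sup>2" by simp
        then have "2 * x \<le> 1 + x\<^sup>2" by (simp add: power2_diff)
        ultimately have "2 * x \<le> exp x + exp (- x)" using exp_gt_zero[of "- x"] by linarith
        then show ?thesis by (simp add: cosh_def)
      qed
      then have "(c * k) * x \<le> (c * k) * cosh x" using c k_pos by (intro mult_left_mono) auto
      then show "norm (complex_of_real (exp (- c * (k * cosh x)))) \<le> exp (- (c * k) * x)" by (simp add: mult.assoc)
    qed auto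
    note d = this
    show "(\<lambda>x. (k * sinh x) *\<^sub>R f (k * cosh x)) absolutely_integrable_on {0<..}"
      using d by (subst absolutely_integrable_on_cong[of _ _ "\<lambda>x. complex_of_real (exp (- c * (k * cosh x)))"]) (rule e(1))
    show "(\<lambda>x. (k * sinh x) *\<^sub>R f (- (k * cosh x))) absolutely_integrable_on {0<..}"
      using d by (subst absolutely_integrable_on_cong[of _ _ "\<lambda>x. complex_of_real (exp (- c * (k * cosh x)))"]) (rule e(2))
  qed
  ultimately have "f absolutely_integrable_on UNIV"
    using absolutely_integrable_three_pieces(1)[of f] cosh_substitution[of f] minus_cosh_substitution[of f] by blast
  then have "integrable lborel f" by (rule lborel_from_pieces(1)[OF meas])
  then have "integrable lborel (\<lambda>\<xi>. norm (f \<xi>))" by (rule integrable_norm)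
  moreover have "(\<lambda>\<xi>. norm (f \<xi>)) = (\<lambda>\<xi>. exp (- c * \<bar>\<xi>\<bar>) / norm (S (of_real \<xi>) k))"
    by (rule ext) (simp add: f_def norm_divide norm_mult)
  ultimately show ?thesis by simp
qed

end

lemma norm_lebesgue_integral_le:
  fixes f :: "'m \<Rightarrow> complex" and g :: "'m \<Rightarrow> real"
  assumes "integrable M f" "integrable M g" "\<And>x. norm (f x) \<le> g x"
  shows "norm (integral\<^sup>L M f) \<le> integral\<^sup>L M g"
  by (rule order_trans[OF integral_norm_bound integral_mono[OF integrable_norm[OF assms(1)] assms(2,3)]])

text \<open>
If the exponent is linear in the parameter then \<open>|exp z - 1 - z| \<le> |z|\<^sup>2 exp |z|\<close> bounds the
Taylor remainder by an integrable multiple of \<open>|v|\<^sup>2\<close>. No domination of difference quotients is required.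
\<close>
lemma has_derivative_exp_integral:
  fixes c :: "'m \<Rightarrow> complex" and L :: "'m \<Rightarrow> 'e::real_normed_vector \<Rightarrow> complex" and m :: "'m \<Rightarrow> real"
  assumes meas: "c \<in> borel_measurable M" "\<And>v. (\<lambda>x. L x v) \<in> borel_measurable M" "m \<in> borel_measurable M"
    and lin: "\<And>x. linear (L x)" and bound: "\<And>x v. norm (L x v) \<le> m x * norm v" and m0: "\<And>x. 0 \<le> m x"
    and eps: "\<epsilon> > 0" and int: "integrable M (\<lambda>x. norm (c x) * (1 + m x)\<^sup>2 * exp (\<epsilon> * m x))"
  shows "((\<lambda>v. \<integral>x. c x * exp (L x v) \<partial>M) has_derivative (\<lambda>v. \<integral>x. c x * L x v \<partial>M)) (at 0)"
proof -
  note [measurable] = meas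
  let ?G = "\<lambda>x. norm (c x) * (1 + m x)\<^sup>2 * exp (\<epsilon> * m x)"
  define B where "B = (\<integral>x. ?G x \<partial>M)"
  have G: "norm (c x) * w \<le> ?G x" if "w \<le> (1 + m x)\<^sup>2 * exp (\<epsilon> * m x)" for x w
    using mult_left_mono[OF that, of "norm (c x)"] by (simp add: mult.assoc)
  have e1: "1 \<le> exp (\<epsilon> * m x)" for x using m0[of x] eps by simp
  have p: "1 \<le> (1 + m x)\<^sup>2" "m x \<le> (1 + m x)\<^sup>2" "(m x)\<^sup>2 \<le> (1 + m x)\<^sup>2" for x
    using m0[of x] by (auto simp: power2_eq_square algebra_simps)
  have pe: "w \<le> (1 + m x)\<^sup>2 * exp (\<epsilon> * m x)" if "w \<le> (1 + m x)\<^sup>2" for w x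
    using mult_mono[OF that e1[of x]] by simp
  have i0: "integrable M c"
  proof (rule Bochner_Integration.integrable_bound[OF int])
    show "AE x in M. norm (c x) \<le> norm (?G x)"
      using G[of 1, OF pe[OF p(1)]] by (auto intro!: AE_I2 order_trans[OF _ abs_ge_self])
  qed simp
  have i1: "integrable M (\<lambda>x. c x * L x v)" for v
  proof (rule Bochner_Integration.integrable_bound)
    show "integrable M (\<lambda>x. norm v * ?G x)" by (intro integrable_mult_right int)
    show "AE x in M. norm (c x * L x v) \<le> norm (norm v * ?G x)"
    proof (rule AE_I2)
      fix x
      have "norm (c x * L x v) \<le> norm (c x) * (m x * norm v)" unfolding norm_mult by (intro mult_left_mono bound) auto
      also have "\<dots> = norm v * (norm (c x) * m x)" by simp
      also have "\<dots> \<le> norm v * ?G x" by (intro mult_left_mono G pe p) auto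
      finally show "norm (c x * L x v) \<le> norm (norm v * ?G x)" by simp
    qed
  qed simp
  have nz: "norm (exp z - 1 - z) \<le> exp (norm z) * (norm z)\<^sup>2" for z :: complex
  proof -
    have "{..1::nat} = {0, 1}" by auto
    then have "norm (exp z - 1 - z) = norm (exp z - (\<Sum>k\<le>1. z ^ k / fact k))" by (simp add: diff_diff_eq)
    also have "\<dots> \<le> exp \<bar>Re z\<bar> * (norm z) ^ (Suc 1) / fact 1" by (rule Taylor_exp)
    also have "\<dots> \<le> exp (norm z) * (norm z)\<^sup>2"
      using abs_Re_le_cmod[of z] by (simp add: power2_eq_square mult_right_mono)
    finally show ?thesis .
  qed
  have r: "norm (c x * (exp (L x v) - 1 - L x v)) \<le> (norm v)\<^sup>2 * ?G x" if v: "norm v \<le> \<epsilon>" for x v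
  proof -
    have b1: "norm (L x v) \<le> \<epsilon> * m x"
      using bound[of x v] mult_left_mono[OF v m0[of x]] by (simp add: mult.commute)
    have "norm (exp (L x v) - 1 - L x v) \<le> exp (\<epsilon> * m x) * (m x * norm v)\<^sup>2"
      using b1 bound[of x v] by (intro order_trans[OF nz] mult_mono power_mono) auto
    also have "\<dots> = (norm v)\<^sup>2 * ((m x)\<^sup>2 * exp (\<epsilon> * m x))" by (simp add: power_mult_distrib)
    also have "\<dots> \<le> (norm v)\<^sup>2 * ((1 + m x)\<^sup>2 * exp (\<epsilon> * m x))" using p(3)[of x] by (intro mult_left_mono mult_right_mono) auto
    finally have "norm (c x) * norm (exp (L x v) - 1 - L x v) \<le> norm (c x) * ((norm v)\<^sup>2 * ((1 + m x)\<^sup>2 * exp (\<epsilon> * m x)))"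
      by (rule mult_left_mono) simp
    then show ?thesis by (simp add: norm_mult mult_ac)
  qed
  have i2: "integrable M (\<lambda>x. c x * (exp (L x v) - 1 - L x v))" if v: "norm v \<le> \<epsilon>" for v
  proof (rule Bochner_Integration.integrable_bound)
    show "integrable M (\<lambda>x. (norm v)\<^sup>2 * ?G x)" by (intro integrable_mult_right int)
    show "AE x in M. norm (c x * (exp (L x v) - 1 - L x v)) \<le> norm ((norm v)\<^sup>2 * ?G x)"
      using r[OF v] by (auto intro!: AE_I2 order_trans[OF _ abs_ge_self])
  qed simp
  show ?thesis
  proof (rule has_derivativeI_sandwich[OF eps])
    show "bounded_linear (\<lambda>v. \<integral>x. c x * L x v \<partial>M)"
    proof (rule bounded_linear_intro)
      fix v w show "(\<integral>x. c x * L x (v + w) \<partial>M) = (\<integral>x. c x * L x v \<partial>M) + (\<integral>x. c x * L x w \<partial>M)"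
        by (simp add: linear_add[OF lin] distrib_left i1)
    next
      fix r v show "(\<integral>x. c x * L x (r *\<^sub>R v) \<partial>M) = r *\<^sub>R (\<integral>x. c x * L x v \<partial>M)"
        by (simp add: linear_scale[OF lin])
    next
      fix v
      have "norm (\<integral>x. c x * L x v \<partial>M) \<le> (\<integral>x. norm v * ?G x \<partial>M)"
      proof (rule norm_lebesgue_integral_le[OF i1])
        fix x
        have "norm (c x * L x v) \<le> norm (c x) * (m x * norm v)" unfolding norm_mult by (intro mult_left_mono bound) auto
        also have "\<dots> = norm v * (norm (c x) * m x)" by simp
        also have "\<dots> \<le> norm v * ?G x" by (intro mult_left_mono G pe p) auto
        finally show "norm (c x * L x v) \<le> norm v * ?G x" .
      qed (intro integrable_mult_right int)
      then show "norm (\<integral>x. c x * L x v \<partial>M) \<le> norm v * B" by (simp add: B_def)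
    qed
    show "((\<lambda>v. norm v * B) \<longlongrightarrow> 0) (at 0 within UNIV)"
      by (rule tendsto_eq_intros | simp)+
    fix v :: 'e assume v: "v \<in> UNIV" "v \<noteq> 0" "dist v 0 < \<epsilon>"
    then have v': "norm v \<le> \<epsilon>" by simp
    have L0: "L x 0 = 0" for x by (rule linear_0[OF lin])
    have split: "c x * exp (L x v) = c x * (exp (L x v) - 1 - L x v) + c x + c x * L x v" for x by (simp add: algebra_simps)
    have "(\<integral>x. c x * exp (L x v) \<partial>M) - (\<integral>x. c x * exp (L x 0) \<partial>M) - (\<integral>x. c x * L x (v - 0) \<partial>M)
       = (\<integral>x. c x * (exp (L x v) - 1 - L x v) \<partial>M)"
      unfolding split[of _] L0 using i0 i1 i2[OF v'] by simp
    also have "norm \<dots> \<le> (\<integral>x. (norm v)\<^sup>2 * ?G x \<partial>M)"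
      by (rule norm_lebesgue_integral_le[OF i2[OF v'] _ r[OF v']]) (intro integrable_mult_right int)
    also have "\<dots> = (norm v)\<^sup>2 * B" by (simp add: B_def)
    finally show "norm ((\<integral>x. c x * exp (L x v) \<partial>M) - (\<integral>x. c x * exp (L x 0) \<partial>M) - (\<integral>x. c x * L x (v - 0) \<partial>M)) / norm (v - 0) \<le> norm v * B"
      using v by (simp add: divide_le_eq power2_eq_square mult_ac)
  qed
qed

context wave_numbers
begin

lemma norm_S_le: "a > 0 \<Longrightarrow> norm (S (of_real \<xi>) a) \<le> \<bar>\<xi>\<bar> + a"
proof -
  assume a: "a > 0"
  have "(norm (S (of_real \<xi>) a))\<^sup>2 = \<bar>\<xi>\<^sup>2 - a\<^sup>2\<bar>"
    unfolding norm_power[symmetric] S_power2[OF a] norm_of_real ..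
  also have "\<dots> \<le> \<xi>\<^sup>2 + a\<^sup>2" using zero_le_power2[of \<xi>] zero_le_power2[of a] by linarith
  also have "\<dots> \<le> (\<bar>\<xi>\<bar> + a)\<^sup>2" using a by (simp add: power2_sum)
  finally show ?thesis by (rule power2_le_imp_le) (use a in simp)
qed

lemma Re_S_ge: "a > 0 \<Longrightarrow> \<bar>\<xi>\<bar> - a \<le> Re (S (of_real \<xi>) a)" "a > 0 \<Longrightarrow> 0 \<le> Re (S (of_real \<xi>) a)"
proof -
  assume a: "a > 0"
  have "\<bar>\<xi>\<bar> - a \<le> sqrt (\<xi>\<^sup>2 - a\<^sup>2)" if "\<bar>\<xi>\<bar> \<ge> a"
  proof (rule real_le_rsqrt)
    have "(\<bar>\<xi>\<bar> - a)\<^sup>2 = \<xi>\<^sup>2 + a\<^sup>2 - 2 * (a * \<bar>\<xi>\<bar>)" by (simp add: power2_diff)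
    also have "a * a \<le> a * \<bar>\<xi>\<bar>" using a that by (intro mult_left_mono) auto
    then have "\<xi>\<^sup>2 + a\<^sup>2 - 2 * (a * \<bar>\<xi>\<bar>) \<le> \<xi>\<^sup>2 - a\<^sup>2" by (simp add: power2_eq_square)
    finally show "(\<bar>\<xi>\<bar> - a)\<^sup>2 \<le> \<xi>\<^sup>2 - a\<^sup>2" .
  qed
  then show "\<bar>\<xi>\<bar> - a \<le> Re (S (of_real \<xi>) a)" unfolding S_of_real[OF a] by auto
  have "a\<^sup>2 \<le> \<xi>\<^sup>2" if "\<bar>\<xi>\<bar> \<ge> a" using that a by (subst abs_le_square_iff[symmetric]) simp
  then show "0 \<le> Re (S (of_real \<xi>) a)" unfolding S_of_real[OF a] by auto
qed

text \<open>
A bound for the derivative of the exponents in the source coordinates.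
\<close>
definition rate :: "real \<Rightarrow> real" where
  "rate \<xi> = \<bar>\<xi>\<bar> + norm (S (of_real \<xi>) k) + norm (S (of_real \<xi>) K)"

text \<open>
As \<open>h > 0\<close>, the factor \<open>exp(-S(\<xi>,k) h)\<close> beats all powers and a small exponential in the rate. The value
\<open>h/12\<close> leaves room for the three summands of the rate.
\<close>
lemma spectral_dominated:
  assumes h: "h > 0" and ab: "0 \<le> a" "0 \<le> b"
  shows "integrable lborel (\<lambda>\<xi>. norm (spectral i j l y a b t h \<xi>) * (1 + rate \<xi>)\<^sup>2 * exp (h / 12 * rate \<xi>))"
proof -
  note [measurable] = S_measurable[OF k_pos] S_measurable[OF K_pos]
  define n where "n = i + j + l + 2"
  define \<delta> where "\<delta> = min 1 (h / 12 / real n)"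
  have n0: "real n > 0" by (simp add: n_def)
  have d: "\<delta> > 0" "\<delta> \<le> 1" "real n * \<delta> \<le> h / 12"
    using h n0 by (auto simp: \<delta>_def min_def field_simps)
  define C where "C = (1 / \<delta>) ^ n * exp (h * k + h * K)"
  have rate0: "0 \<le> rate \<xi>" for \<xi> by (simp add: rate_def)
  show ?thesis
  proof (rule Bochner_Integration.integrable_bound)
    show "integrable lborel (\<lambda>\<xi>. C * (exp (- (h / 2) * \<bar>\<xi>\<bar>) / norm (S (of_real \<xi>) k)))"
      using h by (intro integrable_mult_right inverse_S_exp_integrable) simp
    show "AE \<xi> in lborel. norm (norm (spectral i j l y a b t h \<xi>) * (1 + rate \<xi>)\<^sup>2 * exp (h / 12 * rate \<xi>)) \<le> norm (C * (exp (- (h / 2) * \<bar>\<xi>\<bar>) / norm (S (of_real \<xi>) k)))"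
    proof (rule AE_I2)
      fix \<xi> :: real
      let ?m = "S (of_real \<xi>) k" and ?s = "S (of_real \<xi>) K"
      have r1: "norm (amp i j l y a b (of_real \<xi>) ?m ?s) \<le> (1 + rate \<xi>) ^ (i + j + l) * exp 0"
      proof (rule amp_norm_le)
        have "0 \<le> Re ?s * a" "0 \<le> Re ?m * b"
          using Re_S_ge(2)[OF k_pos, of \<xi>] Re_S_ge(2)[OF K_pos, of \<xi>] ab by simp_all
        then show "Re (- (\<i> * of_real \<xi> * of_real y) - ?s * of_real a - ?m * of_real b) \<le> 0" by simp
      qed (auto simp: rate_def)
      have r2: "norm (exp (- ?m * of_real h + \<i> * of_real (\<xi> * t))) \<le> exp (h * k - h * \<bar>\<xi>\<bar>)"
      proof -
        have "h * (\<bar>\<xi>\<bar> - k) \<le> h * Re ?m" using h Re_S_ge(1)[OF k_pos] by (intro mult_left_mono) auto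
        then show ?thesis by (simp add: norm_exp_eq_Re algebra_simps)
      qed
      have "norm (spectral i j l y a b t h \<xi>) \<le> (1 + rate \<xi>) ^ (i + j + l) * exp (h * k - h * \<bar>\<xi>\<bar>) / norm ?m"
        unfolding spectral_def norm_divide norm_mult using r1 r2 rate0[of \<xi>]
        by (intro divide_right_mono mult_mono) auto
      then have "norm (spectral i j l y a b t h \<xi>) * (1 + rate \<xi>)\<^sup>2 * exp (h / 12 * rate \<xi>) \<le>
          ((1 + rate \<xi>) ^ (i + j + l) * exp (h * k - h * \<bar>\<xi>\<bar>) / norm ?m) * (1 + rate \<xi>)\<^sup>2 * exp (h / 12 * rate \<xi>)"
        by (intro mult_right_mono) auto
      also have "\<dots> = (1 + rate \<xi>) ^ n * (exp (h * k - h * \<bar>\<xi>\<bar>) * exp (h / 12 * rate \<xi>)) / norm ?m"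
        by (simp add: n_def power_add power2_eq_square)
      also have "\<dots> \<le> ((1 / \<delta>) ^ n * exp (h / 12 * rate \<xi>)) * (exp (h * k - h * \<bar>\<xi>\<bar>) * exp (h / 12 * rate \<xi>)) / norm ?m"
      proof (intro divide_right_mono mult_right_mono)
        have "1 + rate \<xi> \<le> 1 / \<delta> * (1 + \<delta> * rate \<xi>)" using d by (simp add: field_simps)
        also have "\<dots> \<le> 1 / \<delta> * exp (\<delta> * rate \<xi>)" using d by (intro mult_left_mono exp_ge_add_one_self) auto
        finally have "(1 + rate \<xi>) ^ n \<le> (1 / \<delta> * exp (\<delta> * rate \<xi>)) ^ n" using rate0[of \<xi>] by (intro power_mono) auto
        also have "\<dots> = (1 / \<delta>) ^ n * exp (real n * \<delta> * rate \<xi>)"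
          by (simp only: power_mult_distrib exp_of_nat_mult[symmetric] mult.assoc)
        also have "\<dots> \<le> (1 / \<delta>) ^ n * exp (h / 12 * rate \<xi>)"
          using d mult_right_mono[OF d(3) rate0[of \<xi>]] by (intro mult_left_mono) (simp_all only: exp_le_cancel_iff, simp)
        finally show "(1 + rate \<xi>) ^ n \<le> (1 / \<delta>) ^ n * exp (h / 12 * rate \<xi>)" .
      qed auto
      also have "\<dots> = (1 / \<delta>) ^ n * exp (h * k - h * \<bar>\<xi>\<bar> + h / 6 * rate \<xi>) / norm ?m"
        by (simp add: mult_exp_exp)
      also have "\<dots> \<le> (1 / \<delta>) ^ n * (exp (h * k + h * K) * exp (- (h / 2) * \<bar>\<xi>\<bar>)) / norm ?m"
      proof -
        have "rate \<xi> \<le> 3 * \<bar>\<xi>\<bar> + 2 * K"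
          using norm_S_le[OF k_pos, of \<xi>] norm_S_le[OF K_pos, of \<xi>] k_less_K by (simp add: rate_def)
        then have "h / 6 * rate \<xi> \<le> h / 6 * (3 * \<bar>\<xi>\<bar> + 2 * K)" using h by (intro mult_left_mono) auto
        moreover have "h * K > 0" using h K_pos by simp
        ultimately have "h * k - h * \<bar>\<xi>\<bar> + h / 6 * rate \<xi> \<le> h * k + h * K + - (h / 2) * \<bar>\<xi>\<bar>"
          by (simp add: algebra_simps)
        then show ?thesis unfolding exp_add[symmetric] using d by (intro divide_right_mono mult_left_mono) auto
      qed
      also have "\<dots> = C * (exp (- (h / 2) * \<bar>\<xi>\<bar>) / norm ?m)" by (simp add: C_def)
      finally have f: "norm (spectral i j l y a b t h \<xi>) * (1 + rate \<xi>)\<^sup>2 * exp (h / 12 * rate \<xi>) \<le> C * (exp (- (h / 2) * \<bar>\<xi>\<bar>) / norm ?m)" .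
      have nn: "0 \<le> norm (spectral i j l y a b t h \<xi>) * (1 + rate \<xi>)\<^sup>2 * exp (h / 12 * rate \<xi>)" by simp
      show "norm (norm (spectral i j l y a b t h \<xi>) * (1 + rate \<xi>)\<^sup>2 * exp (h / 12 * rate \<xi>)) \<le> norm (C * (exp (- (h / 2) * \<bar>\<xi>\<bar>) / norm (S (of_real \<xi>) k)))"
        unfolding real_norm_def abs_of_nonneg[OF nn] by (rule order_trans[OF f abs_ge_self])
    qed
  qed (simp add: rate_def)
qed

lemma spectral_integrable:
  assumes "h > 0" "0 \<le> a" "0 \<le> b"
  shows "integrable lborel (spectral i j l y a b t h)"
proof (rule Bochner_Integration.integrable_bound[OF spectral_dominated[OF assms]])
  show "AE \<xi> in lborel. norm (spectral i j l y a b t h \<xi>) \<le> norm (norm (spectral i j l y a b t h \<xi>) * (1 + rate \<xi>)\<^sup>2 * exp (h / 12 * rate \<xi>))"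
  proof (rule AE_I2)
    fix \<xi>
    have r: "0 \<le> rate \<xi>" by (simp add: rate_def)
    then have "1 * 1 \<le> (1 + rate \<xi>)\<^sup>2 * exp (h / 12 * rate \<xi>)"
      using assms by (intro mult_mono) auto
    then have "norm (spectral i j l y a b t h \<xi>) * (1 * 1) \<le> norm (spectral i j l y a b t h \<xi>) * ((1 + rate \<xi>)\<^sup>2 * exp (h / 12 * rate \<xi>))"
      by (rule mult_left_mono) simp
    then show "norm (spectral i j l y a b t h \<xi>) \<le> norm (norm (spectral i j l y a b t h \<xi>) * (1 + rate \<xi>)\<^sup>2 * exp (h / 12 * rate \<xi>))"
      by (simp add: mult.assoc abs_mult)
  qed
qed simp

section \<open>The Green function as a combination of spectral integrals\<close>

definition spectral_integral :: "nat \<Rightarrow> nat \<Rightarrow> nat \<Rightarrow> real \<Rightarrow> real \<Rightarrow> real \<Rightarrow> real \<Rightarrow> real \<Rightarrow> complex" where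
  "spectral_integral i j l y a b t h = (LBINT \<xi>. spectral i j l y a b t h \<xi>)"

text \<open>
The factors \<open>\<alpha>\<close> and \<open>\<beta>\<close> treat both positions of the source at once: \<open>(1, 0)\<close> for a source above
the interface and \<open>(0, -1)\<close> for a source below it.
\<close>
lemma spectral_integral_has_derivative:
  fixes y0 :: "real^2" and \<alpha> \<beta> t h :: real
  assumes h: "h > 0" and ab: "0 \<le> \<alpha> * y0 $ 2" "0 \<le> \<beta> * y0 $ 2" and le: "\<bar>\<alpha>\<bar> \<le> 1" "\<bar>\<beta>\<bar> \<le> 1"
  shows "((\<lambda>y. spectral_integral i j l (y $ 1) (\<alpha> * y $ 2) (\<beta> * y $ 2) t h) has_derivative
      (\<lambda>v. of_real (v $ 1) * (- \<i> * spectral_integral (Suc i) j l (y0 $ 1) (\<alpha> * y0 $ 2) (\<beta> * y0 $ 2) t h)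
        - of_real (v $ 2) * (of_real \<alpha> * spectral_integral i j (Suc l) (y0 $ 1) (\<alpha> * y0 $ 2) (\<beta> * y0 $ 2) t h
           + of_real \<beta> * spectral_integral i (Suc j) l (y0 $ 1) (\<alpha> * y0 $ 2) (\<beta> * y0 $ 2) t h))) (at y0)"
proof -
  note [measurable] = S_measurable[OF k_pos] S_measurable[OF K_pos]
  define sp where "sp = (\<lambda>i j l. spectral i j l (y0 $ 1) (\<alpha> * y0 $ 2) (\<beta> * y0 $ 2) t h)"
  define L :: "real \<Rightarrow> real^2 \<Rightarrow> complex" where
    "L = (\<lambda>\<xi> v. - (\<i> * of_real \<xi> * of_real (v $ 1)) - S (of_real \<xi>) K * of_real (\<alpha> * v $ 2) - S (of_real \<xi>) k * of_real (\<beta> * v $ 2))"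
  have sint: "integrable lborel (sp i j l)" for i j l
    unfolding sp_def by (rule spectral_integrable[OF h ab])
  have shift: "spectral i j l ((y0 + v) $ 1) (\<alpha> * (y0 + v) $ 2) (\<beta> * (y0 + v) $ 2) t h \<xi> = sp i j l \<xi> * exp (L \<xi> v)" for v \<xi>
  proof -
    have "- (\<i> * of_real \<xi> * of_real ((y0 + v) $ 1)) - S (of_real \<xi>) K * of_real (\<alpha> * (y0 + v) $ 2) - S (of_real \<xi>) k * of_real (\<beta> * (y0 + v) $ 2)
      = (- (\<i> * of_real \<xi> * of_real (y0 $ 1)) - S (of_real \<xi>) K * of_real (\<alpha> * y0 $ 2) - S (of_real \<xi>) k * of_real (\<beta> * y0 $ 2)) + L \<xi> v"
      by (simp add: L_def algebra_simps)
    then show ?thesis unfolding sp_def spectral_def amp_def by (simp only: exp_add) (simp add: mult_ac)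
  qed
  have D: "((\<lambda>v. \<integral>\<xi>. sp i j l \<xi> * exp (L \<xi> v) \<partial>lborel) has_derivative (\<lambda>v. \<integral>\<xi>. sp i j l \<xi> * L \<xi> v \<partial>lborel)) (at 0)"
  proof (rule has_derivative_exp_integral[where m=rate and \<epsilon>="h / 12"])
    show "sp i j l \<in> borel_measurable lborel" using sint[of i j l] by (rule borel_measurable_integrable)
    show "(\<lambda>\<xi>. L \<xi> v) \<in> borel_measurable lborel" for v unfolding L_def by measurable
    show "rate \<in> borel_measurable lborel" unfolding rate_def by measurable
    show "linear (L \<xi>)" for \<xi>
      by (rule linearI) (simp_all add: L_def algebra_simps scaleR_conv_of_real[where 'a=complex])
    show "0 \<le> rate \<xi>" for \<xi> by (simp add: rate_def)
    show "integrable lborel (\<lambda>\<xi>. norm (sp i j l \<xi>) * (1 + rate \<xi>)\<^sup>2 * exp (h / 12 * rate \<xi>))"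
      unfolding sp_def by (rule spectral_dominated[OF h ab])
    show "0 < h / 12" using h by simp
    fix \<xi> :: real and v :: "real^2"
    have v1: "\<bar>v $ 1\<bar> \<le> norm v" "\<bar>v $ 2\<bar> \<le> norm v" by (rule component_le_norm_cart)+
    have v2: "\<bar>\<alpha> * v $ 2\<bar> \<le> 1 * norm v" "\<bar>\<beta> * v $ 2\<bar> \<le> 1 * norm v"
      unfolding abs_mult using le v1 by (intro mult_mono; simp)+
    have "norm (L \<xi> v) \<le> \<bar>\<xi>\<bar> * \<bar>v $ 1\<bar> + norm (S (of_real \<xi>) K) * \<bar>\<alpha> * v $ 2\<bar> + norm (S (of_real \<xi>) k) * \<bar>\<beta> * v $ 2\<bar>"
      unfolding L_def
      by (rule order_trans[OF norm_triangle_ineq4], rule add_mono[OF order_trans[OF norm_triangle_ineq4]])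
         (simp_all add: norm_mult abs_mult)
    also have "\<dots> \<le> \<bar>\<xi>\<bar> * norm v + norm (S (of_real \<xi>) K) * (1 * norm v) + norm (S (of_real \<xi>) k) * (1 * norm v)"
      using v1 v2 by (intro add_mono mult_left_mono) auto
    finally show "norm (L \<xi> v) \<le> rate \<xi> * norm v" by (simp add: rate_def algebra_simps)
  qed
  have pw: "sp i j l \<xi> * L \<xi> v = of_real (v $ 1) * (- \<i> * sp (Suc i) j l \<xi>) - of_real (v $ 2) * (of_real \<alpha> * sp i j (Suc l) \<xi> + of_real \<beta> * sp i (Suc j) l \<xi>)" for v \<xi>
  proof -
    have "sp (Suc i) j l \<xi> = of_real \<xi> * sp i j l \<xi>" "sp i j (Suc l) \<xi> = S (of_real \<xi>) K * sp i j l \<xi>"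
      "sp i (Suc j) l \<xi> = S (of_real \<xi>) k * sp i j l \<xi>"
      by (simp_all add: sp_def spectral_def amp_def)
    then show ?thesis by (simp add: L_def algebra_simps)
  qed
  have val: "(\<integral>\<xi>. sp i j l \<xi> * L \<xi> v \<partial>lborel) = of_real (v $ 1) * (- \<i> * (LBINT \<xi>. sp (Suc i) j l \<xi>))
     - of_real (v $ 2) * (of_real \<alpha> * (LBINT \<xi>. sp i j (Suc l) \<xi>) + of_real \<beta> * (LBINT \<xi>. sp i (Suc j) l \<xi>))" for v
    unfolding pw by (subst Bochner_Integration.integral_diff) (auto intro!: integrable_mult_right integrable_add sint simp: sint)
  define g where "g = (\<lambda>v. spectral_integral i j l ((y0 + v) $ 1) (\<alpha> * (y0 + v) $ 2) (\<beta> * (y0 + v) $ 2) t h)"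
  define g' where "g' = (\<lambda>v::real^2. of_real (v $ 1) * (- \<i> * (LBINT \<xi>. sp (Suc i) j l \<xi>))
     - of_real (v $ 2) * (of_real \<alpha> * (LBINT \<xi>. sp i j (Suc l) \<xi>) + of_real \<beta> * (LBINT \<xi>. sp i (Suc j) l \<xi>)))"
  have "(g has_derivative g') (at (y0 - y0))"
    using D unfolding val shift[symmetric] spectral_integral_def[symmetric] g_def[symmetric] g'_def[symmetric] by simp
  moreover have "((\<lambda>y. y - y0) has_derivative (\<lambda>v. v)) (at y0)" by (auto intro!: derivative_eq_intros)
  ultimately have "((\<lambda>y. g (y - y0)) has_derivative (\<lambda>v. g' v)) (at y0)"
    by (intro has_derivative_compose[of "\<lambda>y. y - y0" "\<lambda>v. v" y0 UNIV g g'])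
  then show ?thesis by (simp add: g_def g'_def sp_def spectral_integral_def)
qed

text \<open>
The two rates satisfy \<open>S(\<xi>,k)\<^sup>2 - S(\<xi>,K)\<^sup>2 = K\<^sup>2 - k\<^sup>2\<close>, which makes the denominators
constant after rationalisation.
\<close>
lemma S_sum_nonzero: "S (of_real \<xi>) K + S (of_real \<xi>) k \<noteq> 0"
  and S_quotient: "1 / (S (of_real \<xi>) K + S (of_real \<xi>) k) = (S (of_real \<xi>) k - S (of_real \<xi>) K) / of_real (K\<^sup>2 - k\<^sup>2)"
proof -
  have e: "(S (of_real \<xi>) K + S (of_real \<xi>) k) * (S (of_real \<xi>) k - S (of_real \<xi>) K) = of_real (K\<^sup>2 - k\<^sup>2)"
    using S_power2[OF k_pos, of \<xi>] S_power2[OF K_pos, of \<xi>] by (simp add: algebra_simps power2_eq_square)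
  have "k\<^sup>2 < K\<^sup>2" using k_pos k_less_K by (intro power_strict_mono) auto
  then have n: "complex_of_real (K\<^sup>2 - k\<^sup>2) \<noteq> 0" by (simp only: of_real_eq_0_iff)
  then show nz: "S (of_real \<xi>) K + S (of_real \<xi>) k \<noteq> 0" using e by (metis mult_zero_left)
  show "1 / (S (of_real \<xi>) K + S (of_real \<xi>) k) = (S (of_real \<xi>) k - S (of_real \<xi>) K) / of_real (K\<^sup>2 - k\<^sup>2)"
    using n nz unfolding e[symmetric] by auto
qed

lemma S_k_nonzero: "AE \<xi> in lborel. S (of_real \<xi>) k \<noteq> 0"
proof -
  have "AE \<xi> in lborel. \<xi> \<noteq> k" "AE \<xi> in lborel. \<xi> \<noteq> - k" by (rule AE_lborel_singleton)+
  then show ?thesis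
  proof eventually_elim
    case (elim \<xi>)
    then have "\<xi>\<^sup>2 \<noteq> k\<^sup>2" by (simp add: power2_eq_iff)
    then have "(S (of_real \<xi>) k)\<^sup>2 \<noteq> 0" unfolding S_power2[OF k_pos] of_real_eq_0_iff by simp
    then show ?case by auto
  qed
qed

lemma green_upper:
  fixes x y :: "real^2"
  assumes x: "x $ 2 < 0" and y: "y \<in> upper_half"
  shows "layered_green K k x y = 1 / (2 * of_real pi * of_real (K\<^sup>2 - k\<^sup>2)) *
    (spectral_integral 0 2 0 (y $ 1) (y $ 2) 0 (x $ 1) (- x $ 2) - spectral_integral 0 1 1 (y $ 1) (y $ 2) 0 (x $ 1) (- x $ 2))"
proof -
  let ?f = "\<lambda>\<xi>. exp (- S (of_real \<xi>) K * of_real (y $ 2) + S (of_real \<xi>) k * of_real (x $ 2))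
                 / (S (of_real \<xi>) K + S (of_real \<xi>) k) * exp (\<i> * of_real (\<xi> * (x $ 1 - y $ 1)))"
  let ?g = "\<lambda>\<xi>. 1 / of_real (K\<^sup>2 - k\<^sup>2) * (spectral 0 2 0 (y $ 1) (y $ 2) 0 (x $ 1) (- x $ 2) \<xi> - spectral 0 1 1 (y $ 1) (y $ 2) 0 (x $ 1) (- x $ 2) \<xi>)"
  note [measurable] = S_measurable[OF k_pos] S_measurable[OF K_pos]
  have i: "integrable lborel (spectral i j l (y $ 1) (y $ 2) 0 (x $ 1) (- x $ 2))" for i j l
    using x y by (intro spectral_integrable) (auto simp: upper_half_def)
  have "(LBINT \<xi>. ?f \<xi>) = (LBINT \<xi>. ?g \<xi>)"
  proof (rule integral_cong_AE)
    show "?f \<in> borel_measurable lborel" "?g \<in> borel_measurable lborel" by measurable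
    show "AE \<xi> in lborel. ?f \<xi> = ?g \<xi>"
      using S_k_nonzero
    proof eventually_elim
      case (elim \<xi>)
      let ?m = "S (of_real \<xi>) k" and ?s = "S (of_real \<xi>) K"
      let ?E = "exp (- ?s * of_real (y $ 2) + ?m * of_real (x $ 2)) * exp (\<i> * of_real (\<xi> * (x $ 1 - y $ 1)))"
      have E: "exp (- (\<i> * of_real \<xi> * of_real (y $ 1)) - ?s * of_real (y $ 2) - ?m * of_real 0) * exp (- ?m * of_real (- x $ 2) + \<i> * of_real (\<xi> * x $ 1)) = ?E"
        unfolding exp_add[symmetric] by (rule arg_cong[where f=exp]) (simp add: algebra_simps)
      have "?f \<xi> = ?E * (1 / (?s + ?m))" by simp
      also have "\<dots> = ?E * ((?m - ?s) / of_real (K\<^sup>2 - k\<^sup>2))" unfolding S_quotient ..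
      also have "\<dots> = 1 / of_real (K\<^sup>2 - k\<^sup>2) * ((?m\<^sup>2 * ?E) / ?m - (?m * ?s * ?E) / ?m)"
        using elim by (simp add: power2_eq_square algebra_simps diff_divide_distrib)
      also have "\<dots> = ?g \<xi>"
        unfolding spectral_def amp_def E[symmetric] by (simp add: mult.assoc)
      finally show ?case .
    qed
  qed
  also have "\<dots> = 1 / of_real (K\<^sup>2 - k\<^sup>2) * (spectral_integral 0 2 0 (y $ 1) (y $ 2) 0 (x $ 1) (- x $ 2) - spectral_integral 0 1 1 (y $ 1) (y $ 2) 0 (x $ 1) (- x $ 2))"
    unfolding spectral_integral_def by (simp only: integral_mult_right_zero Bochner_Integration.integral_diff[OF i i])
  finally show ?thesis using y by (simp add: layered_green_def)
qed

lemma green_lower: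
  fixes x y :: "real^2"
  assumes x: "x $ 2 < 0" and y: "y \<in> lower_half"
  shows "layered_green K k x y = \<i> / 4 * hankel1_0 (k * norm (x - y)) + 1 / (4 * of_real pi * of_real (K\<^sup>2 - k\<^sup>2)) *
    (spectral_integral 0 2 0 (y $ 1) 0 (- y $ 2) (x $ 1) (- x $ 2) - 2 * spectral_integral 0 1 1 (y $ 1) 0 (- y $ 2) (x $ 1) (- x $ 2)
      + spectral_integral 0 0 2 (y $ 1) 0 (- y $ 2) (x $ 1) (- x $ 2))"
proof -
  let ?f = "\<lambda>\<xi>. (S (of_real \<xi>) k - S (of_real \<xi>) K) / (S (of_real \<xi>) K + S (of_real \<xi>) k)
                 * (exp (- S (of_real \<xi>) k * of_real \<bar>x $ 2 + y $ 2\<bar>) / S (of_real \<xi>) k)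
                 * exp (\<i> * of_real (\<xi> * (x $ 1 - y $ 1)))"
  let ?sp = "\<lambda>i j l. spectral i j l (y $ 1) 0 (- y $ 2) (x $ 1) (- x $ 2)"
  let ?g = "\<lambda>\<xi>. 1 / of_real (K\<^sup>2 - k\<^sup>2) * (?sp 0 2 0 \<xi> - 2 * ?sp 0 1 1 \<xi> + ?sp 0 0 2 \<xi>)"
  have y2: "y $ 2 < 0" using y by (simp add: lower_half_def)
  have i: "integrable lborel (?sp i j l)" for i j l
    using x y2 by (intro spectral_integrable) auto
  have "?f \<xi> = ?g \<xi>" for \<xi>
  proof -
    let ?m = "S (of_real \<xi>) k" and ?s = "S (of_real \<xi>) K"
    let ?E = "exp (- ?m * of_real \<bar>x $ 2 + y $ 2\<bar>) * exp (\<i> * of_real (\<xi> * (x $ 1 - y $ 1)))"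
    have E: "exp (- (\<i> * of_real \<xi> * of_real (y $ 1)) - ?s * of_real 0 - ?m * of_real (- y $ 2)) * exp (- ?m * of_real (- x $ 2) + \<i> * of_real (\<xi> * x $ 1)) = ?E"
      unfolding exp_add[symmetric] using x y2 by (intro arg_cong[where f=exp]) (simp add: algebra_simps)
    have "?f \<xi> = ?E * (?m - ?s) * (1 / (?s + ?m)) / ?m" by simp
    also have "\<dots> = ?E * (?m - ?s) * ((?m - ?s) / of_real (K\<^sup>2 - k\<^sup>2)) / ?m" unfolding S_quotient ..
    also have "\<dots> = 1 / of_real (K\<^sup>2 - k\<^sup>2) * ((?m\<^sup>2 * ?E) / ?m - 2 * ((?m * ?s * ?E) / ?m) + (?s\<^sup>2 * ?E) / ?m)"
    proof -
      have "E * (m - s) * ((m - s) / D) / m = 1 / D * ((m\<^sup>2 * E) / m - 2 * ((m * s * E) / m) + (s\<^sup>2 * E) / m)" for E m s D :: complex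
        by (simp add: power2_eq_square algebra_simps diff_divide_distrib add_divide_distrib)
      then show ?thesis .
    qed
    also have "\<dots> = ?g \<xi>"
      unfolding spectral_def amp_def E[symmetric] by (simp add: mult.assoc)
    finally show ?thesis .
  qed
  then have "(LBINT \<xi>. ?f \<xi>) = (LBINT \<xi>. ?g \<xi>)" by simp
  also have "\<dots> = 1 / of_real (K\<^sup>2 - k\<^sup>2) * (spectral_integral 0 2 0 (y $ 1) 0 (- y $ 2) (x $ 1) (- x $ 2) - 2 * spectral_integral 0 1 1 (y $ 1) 0 (- y $ 2) (x $ 1) (- x $ 2)
      + spectral_integral 0 0 2 (y $ 1) 0 (- y $ 2) (x $ 1) (- x $ 2))"
    unfolding spectral_integral_def using i[of 0 2 0] i[of 0 1 1] i[of 0 0 2] by simp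
  finally show ?thesis using y2 by (simp add: layered_green_def upper_half_def)
qed

end

section \<open>Bessel's equation of order zero\<close>

text \<open>
With \<open>p = t u'\<close> Bessel's equation reads \<open>u' = p/t\<close>, \<open>p' = -t u\<close>. The energy \<open>u\<^sup>2 + (p/t)\<^sup>2\<close>
is decreasing, and it tends to zero at the origin: \<open>p = O(t\<^sup>2)\<close> because \<open>p\<close> vanishes there and \<open>u\<close> is bounded.
\<close>
lemma bessel_zero_unique:
  fixes u p :: "real \<Rightarrow> real"
  assumes u: "\<And>t. t > 0 \<Longrightarrow> (u has_real_derivative p t / t) (at t)"
    and p: "\<And>t. t > 0 \<Longrightarrow> (p has_real_derivative - t * u t) (at t)"
    and u0: "(u \<longlongrightarrow> 0) (at_right 0)" and p0: "(p \<longlongrightarrow> 0) (at_right 0)"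
    and t: "t > 0"
  shows "u t = 0" "p t = 0"
proof -
  have pb: "eventually (\<lambda>t. \<bar>p t\<bar> \<le> t\<^sup>2 / 2) (at_right 0)"
  proof -
    have "eventually (\<lambda>t. \<bar>u t\<bar> < 1) (at_right 0)"
      using order_tendstoD[OF tendsto_rabs[OF u0]] by simp
    then obtain d where d: "d > 0" "\<And>t. 0 < t \<Longrightarrow> t < d \<Longrightarrow> \<bar>u t\<bar> < 1"
      by (auto simp: eventually_at_right_field)
    have "\<bar>p t\<bar> \<le> t\<^sup>2 / 2" if t: "0 < t" "t < d" for t
    proof -
      have le: "\<bar>p t - p s\<bar> \<le> t\<^sup>2 / 2 - s\<^sup>2 / 2" if s: "0 < s" "s < t" for s
      proof -
        have "p s - s\<^sup>2 / 2 \<ge> p t - t\<^sup>2 / 2"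
        proof (rule DERIV_nonpos_imp_nonincreasing[of s t "\<lambda>x. p x - x\<^sup>2 / 2"])
          fix x assume x: "s \<le> x" "x \<le> t"
          have "((\<lambda>x. p x - x\<^sup>2 / 2) has_real_derivative - x * u x - x) (at x)"
            using x s by (auto intro!: derivative_eq_intros p)
          moreover have "- x * u x - x \<le> 0"
          proof -
            have "x * \<bar>u x\<bar> \<le> x * 1" using d(2)[of x] x s t by (intro mult_left_mono) auto
            moreover have "- x * u x \<le> x * \<bar>u x\<bar>" using x s by (simp add: abs_if mult_le_0_iff)
            ultimately show ?thesis by linarith
          qed
          ultimately show "\<exists>y. ((\<lambda>x. p x - x\<^sup>2 / 2) has_real_derivative y) (at x) \<and> y \<le> 0" by blast
        qed (use s in auto)
        moreover have "p s + s\<^sup>2 / 2 \<le> p t + t\<^sup>2 / 2"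
        proof (rule DERIV_nonneg_imp_nondecreasing[of s t "\<lambda>x. p x + x\<^sup>2 / 2"])
          fix x assume x: "s \<le> x" "x \<le> t"
          have "((\<lambda>x. p x + x\<^sup>2 / 2) has_real_derivative - x * u x + x) (at x)"
            using x s by (auto intro!: derivative_eq_intros p)
          moreover have "0 \<le> - x * u x + x"
          proof -
            have "x * u x \<le> x * 1" using d(2)[of x] x s t by (intro mult_left_mono) auto
            then show ?thesis by simp
          qed
          ultimately show "\<exists>y. ((\<lambda>x. p x + x\<^sup>2 / 2) has_real_derivative y) (at x) \<and> 0 \<le> y" by blast
        qed (use s in auto)
        ultimately show ?thesis by (simp add: abs_le_iff)
      qed
      have "\<bar>p t - 0\<bar> \<le> t\<^sup>2 / 2 - 0\<^sup>2 / 2"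
      proof (rule tendsto_le[of "at_right 0"])
        show "((\<lambda>s. \<bar>p t - p s\<bar>) \<longlongrightarrow> \<bar>p t - 0\<bar>) (at_right 0)" by (intro tendsto_intros p0)
        show "((\<lambda>s. t\<^sup>2 / 2 - s\<^sup>2 / 2) \<longlongrightarrow> t\<^sup>2 / 2 - 0\<^sup>2 / 2) (at_right 0)" by (intro tendsto_intros) auto
        show "eventually (\<lambda>s. \<bar>p t - p s\<bar> \<le> t\<^sup>2 / 2 - s\<^sup>2 / 2) (at_right 0)"
          using t le by (auto simp: eventually_at_right_field intro!: exI[of _ t])
      qed simp
      then show ?thesis by simp
    qed
    then show ?thesis using d(1) by (auto simp: eventually_at_right_field)
  qed
  define E where "E = (\<lambda>t. (u t)\<^sup>2 + (p t / t)\<^sup>2)"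
  have E0: "(E \<longlongrightarrow> 0) (at_right 0)"
  proof -
    have "((\<lambda>t. p t / t) \<longlongrightarrow> 0) (at_right 0)"
    proof (rule Lim_null_comparison)
      show "eventually (\<lambda>t. norm (p t / t) \<le> t / 2) (at_right 0)"
        using pb eventually_at_right_less[of 0]
      proof eventually_elim
        case (elim t)
        then show ?case by (simp add: power2_eq_square divide_le_eq)
      qed
      show "((\<lambda>t. t / 2) \<longlongrightarrow> (0::real)) (at_right 0)"
        by (rule tendsto_eq_intros | simp)+
    qed
    then show ?thesis unfolding E_def using tendsto_add[OF tendsto_power[OF u0, of 2] tendsto_power[of "\<lambda>t. p t / t" 0 _ 2]] by simp
  qed
  have mono: "E t \<le> E s" if "0 < s" "s \<le> t" for s t
  proof (rule DERIV_nonpos_imp_nonincreasing[OF that(2)])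
    fix x assume x: "s \<le> x" "x \<le> t"
    then have x0: "x > 0" using that by simp
    have "(E has_real_derivative 2 * u x * (p x / x) + 2 * (p x / x) * (((- x * u x) * x - p x * 1) / (x * x))) (at x)"
      unfolding E_def using x0 u[OF x0] p[OF x0] by (auto intro!: derivative_eq_intros simp: mult_ac)
    also have "2 * u x * (p x / x) + 2 * (p x / x) * (((- x * u x) * x - p x * 1) / (x * x)) = - 2 * (p x)\<^sup>2 / x ^ 3"
      using x0 by (simp add: field_simps power2_eq_square power3_eq_cube)
    finally show "\<exists>y. (E has_real_derivative y) (at x) \<and> y \<le> 0" using x0 by (auto intro!: exI[of _ "- 2 * (p x)\<^sup>2 / x ^ 3"])
  qed
  have "E t \<le> 0"
  proof (rule tendsto_lowerbound[OF E0])
    show "eventually (\<lambda>s. E t \<le> E s) (at_right 0)"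
      using mono t by (auto simp: eventually_at_right_field intro!: exI[of _ t])
  qed simp
  then show "u t = 0" "p t = 0" using t by (auto simp: E_def sum_power2_le_zero_iff)
qed

text \<open>
Coefficients of \<open>J0\<close> and of the regular part of \<open>Y0\<close>, as power series in \<open>x = t\<^sup>2/4\<close>.
\<close>
definition bessel_a :: "nat \<Rightarrow> real" where "bessel_a m = (- 1) ^ m / (fact m)\<^sup>2"
definition bessel_b :: "nat \<Rightarrow> real" where "bessel_b m = (- 1) ^ (m + 1) * harm m / (fact m)\<^sup>2"

lemma harm_le: "(harm m :: real) \<le> real m"
proof (induction m)
  case 0
  then show ?case by (simp add: harm_def)
next
  case (Suc m)
  have "inverse (real (Suc m)) \<le> 1" by (rule inverse_le_1_iff[THEN iffD2]) simp
  then show ?case using Suc unfolding harm_Suc by simp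
qed

lemma bessel_summable: "summable (\<lambda>m. bessel_a m * x ^ m)" "summable (\<lambda>m. bessel_b m * x ^ m)"
proof -
  have f: "(1::real) \<le> fact m" for m by (rule fact_ge_1)
  have a: "\<bar>bessel_a m\<bar> \<le> 1 / fact m" for m
  proof -
    have "fact m * 1 \<le> (fact m * fact m :: real)" using f by (intro mult_left_mono) auto
    then show ?thesis by (simp add: bessel_a_def power_abs power2_eq_square divide_simps)
  qed
  have b: "\<bar>bessel_b m\<bar> \<le> 1 / fact m" for m
  proof -
    have "harm m \<le> (fact m :: real)"
    proof -
      have "real m \<le> fact m" using fact_ge_self[of m] by (metis of_nat_fact of_nat_le_iff)
      then show ?thesis using harm_le[of m] by linarith
    qed
    moreover have "(harm m :: real) \<ge> 0" by (rule harm_nonneg)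
    ultimately have "\<bar>(- 1) ^ (m + 1) * harm m\<bar> \<le> (fact m :: real)" by (simp add: abs_mult power_abs)
    then have "\<bar>bessel_b m\<bar> \<le> fact m / (fact m)\<^sup>2" unfolding bessel_b_def by (simp add: divide_right_mono del: power_Suc)
    then show ?thesis by (simp add: power2_eq_square)
  qed
  have s: "summable (\<lambda>m. (1 / fact m) * \<bar>x\<bar> ^ m)"
    using summable_exp[of "\<bar>x\<bar>"] by (simp add: field_simps)
  have "norm (bessel_a n * x ^ n) \<le> 1 / fact n * \<bar>x\<bar> ^ n" "norm (bessel_b n * x ^ n) \<le> 1 / fact n * \<bar>x\<bar> ^ n" for n
    unfolding real_norm_def abs_mult power_abs by (intro mult_right_mono a b; simp)+
  then show "summable (\<lambda>m. bessel_a m * x ^ m)" "summable (\<lambda>m. bessel_b m * x ^ m)"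
    by (auto intro: summable_comparison_test'[OF s])
qed

lemma bessel_Suc:
  "bessel_a (Suc m) = - bessel_a m / (real m + 1)\<^sup>2"
  "bessel_b (Suc m) = (bessel_a m / (real m + 1) - bessel_b m) / (real m + 1)\<^sup>2"
proof -
  have f: "(fact (Suc m) :: real)\<^sup>2 = (real m + 1)\<^sup>2 * (fact m)\<^sup>2"
    by (simp add: power_mult_distrib add.commute)
  show "bessel_a (Suc m) = - bessel_a m / (real m + 1)\<^sup>2"
    unfolding bessel_a_def f by (simp add: mult.commute)
  have "bessel_b (Suc m) = ((- 1) ^ m * harm m + (- 1) ^ m / (real m + 1)) / (fact m)\<^sup>2 / (real m + 1)\<^sup>2"
    unfolding bessel_b_def f harm_Suc by (simp add: distrib_left divide_inverse mult_ac add.commute)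
  also have "((- 1) ^ m * harm m + (- 1) ^ m / (real m + 1)) / (fact m)\<^sup>2 = bessel_a m / (real m + 1) - bessel_b m"
    unfolding bessel_a_def bessel_b_def by (simp add: add_divide_distrib)
  finally show "bessel_b (Suc m) = (bessel_a m / (real m + 1) - bessel_b m) / (real m + 1)\<^sup>2" .
qed

lemma diffs_plus: "diffs c m + real m * diffs c m = (real m + 1)\<^sup>2 * c (Suc m)" for c :: "nat \<Rightarrow> real"
  by (simp add: diffs_def power2_eq_square algebra_simps)

lemma bessel_a_rec: "diffs bessel_a m + real m * diffs bessel_a m = - bessel_a m"
proof -
  have "real m + 1 \<noteq> 0" by linarith
  then show ?thesis unfolding diffs_plus bessel_Suc by simp
qed

lemma bessel_b_rec: "diffs bessel_b m + real m * diffs bessel_b m = - bessel_b m - diffs bessel_a m"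
proof -
  have n: "real m + 1 \<noteq> 0" by linarith
  have "diffs bessel_a m = (real m + 1) * bessel_a (Suc m)" by (simp add: diffs_def add.commute)
  also have "\<dots> = - (bessel_a m / (real m + 1))" unfolding bessel_Suc using n by (simp add: power2_eq_square)
  finally show ?thesis unfolding diffs_plus bessel_Suc(2) using n by simp
qed

text \<open>
Bessel's equation in \<open>x = t\<^sup>2/4\<close> only involves the operators \<open>d/dx\<close> and \<open>d/dx x d/dx\<close>.
\<close>
lemma power_series_euler_derivative:
  fixes c :: "nat \<Rightarrow> real"
  assumes s: "\<And>x. summable (\<lambda>m. c m * x ^ m)"
  shows "((\<lambda>x. \<Sum>m. c m * x ^ m) has_real_derivative (\<Sum>m. diffs c m * x ^ m)) (at x)"
    and "((\<lambda>x. x * (\<Sum>m. diffs c m * x ^ m)) has_real_derivative (\<Sum>m. (diffs c m + real m * diffs c m) * x ^ m)) (at x)"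
    and "summable (\<lambda>m. diffs c m * x ^ m)" and "summable (\<lambda>m. (diffs c m + real m * diffs c m) * x ^ m)"
proof -
  have s1: "summable (\<lambda>m. diffs c m * x ^ m)" for x using s by (rule termdiff_converges_all)
  have s2: "summable (\<lambda>m. diffs (diffs c) m * x ^ m)" for x using s1 by (rule termdiff_converges_all)
  show "summable (\<lambda>m. diffs c m * x ^ m)" by (rule s1)
  show "((\<lambda>x. \<Sum>m. c m * x ^ m) has_real_derivative (\<Sum>m. diffs c m * x ^ m)) (at x)"
    using s by (rule termdiffs_strong_converges_everywhere)
  have d: "((\<lambda>x. \<Sum>m. diffs c m * x ^ m) has_real_derivative (\<Sum>m. diffs (diffs c) m * x ^ m)) (at x)"
    using s1 by (rule termdiffs_strong_converges_everywhere)
  have t: "(\<lambda>m. real m * diffs c m * x ^ m) sums (x * (\<Sum>m. diffs (diffs c) m * x ^ m))"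
  proof -
    have "(\<lambda>m. diffs (diffs c) m * x ^ m * x) sums ((\<Sum>m. diffs (diffs c) m * x ^ m) * x)"
      by (intro sums_mult2 summable_sums s2)
    then have "(\<lambda>m. real (Suc m) * diffs c (Suc m) * x ^ Suc m) sums ((\<Sum>m. diffs (diffs c) m * x ^ m) * x)"
      by (simp add: diffs_def[of "diffs c"] mult_ac)
    from sums_Suc[of "\<lambda>m. real m * diffs c m * x ^ m", OF this] show ?thesis by (simp add: mult.commute)
  qed
  have st: "(\<lambda>m. (diffs c m + real m * diffs c m) * x ^ m) sums ((\<Sum>m. diffs c m * x ^ m) + x * (\<Sum>m. diffs (diffs c) m * x ^ m))"
    using sums_add[OF summable_sums[OF s1[of x]] t] by (simp add: algebra_simps)
  then show "summable (\<lambda>m. (diffs c m + real m * diffs c m) * x ^ m)" by (rule sums_summable)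
  show "((\<lambda>x. x * (\<Sum>m. diffs c m * x ^ m)) has_real_derivative (\<Sum>m. (diffs c m + real m * diffs c m) * x ^ m)) (at x)"
    unfolding sums_unique[OF st, symmetric] using d by (auto intro!: derivative_eq_intros)
qed

definition bessel_A :: "real \<Rightarrow> real" where "bessel_A x = (\<Sum>m. bessel_a m * x ^ m)"
definition bessel_B :: "real \<Rightarrow> real" where "bessel_B x = (\<Sum>m. bessel_b m * x ^ m)"
definition bessel_A' :: "real \<Rightarrow> real" where "bessel_A' x = (\<Sum>m. diffs bessel_a m * x ^ m)"
definition bessel_B' :: "real \<Rightarrow> real" where "bessel_B' x = (\<Sum>m. diffs bessel_b m * x ^ m)"

lemma bessel_AB_derivs:
  "(bessel_A has_real_derivative bessel_A' x) (at x)" "(bessel_B has_real_derivative bessel_B' x) (at x)"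
  "((\<lambda>x. x * bessel_A' x) has_real_derivative - bessel_A x) (at x)"
  "((\<lambda>x. x * bessel_B' x) has_real_derivative - bessel_B x - bessel_A' x) (at x)"
proof -
  note a = power_series_euler_derivative[of bessel_a, OF bessel_summable(1)]
  note b = power_series_euler_derivative[of bessel_b, OF bessel_summable(2)]
  show "(bessel_A has_real_derivative bessel_A' x) (at x)" "(bessel_B has_real_derivative bessel_B' x) (at x)"
    unfolding bessel_A_def[abs_def] bessel_A'_def bessel_B_def[abs_def] bessel_B'_def by (rule a(1) b(1))+
  have "(\<Sum>m. (diffs bessel_a m + real m * diffs bessel_a m) * x ^ m) = - bessel_A x"
    unfolding bessel_a_rec bessel_A_def using suminf_minus[OF bessel_summable(1)[of x]] by simp
  then show "((\<lambda>x. x * bessel_A' x) has_real_derivative - bessel_A x) (at x)"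
    using a(2)[of x] unfolding bessel_A'_def[abs_def] by simp
  have "(\<Sum>m. (diffs bessel_b m + real m * diffs bessel_b m) * x ^ m) = - bessel_B x - bessel_A' x"
  proof -
    have "(\<lambda>m. - (bessel_b m * x ^ m) - diffs bessel_a m * x ^ m) sums (- bessel_B x - bessel_A' x)"
      unfolding bessel_B_def bessel_A'_def
      by (intro sums_diff sums_minus summable_sums bessel_summable a(3))
    then show ?thesis unfolding bessel_b_rec by (simp add: left_diff_distrib sums_iff)
  qed
  then show "((\<lambda>x. x * bessel_B' x) has_real_derivative - bessel_B x - bessel_A' x) (at x)"
    using b(2)[of x] unfolding bessel_B'_def[abs_def] by simp
qed

lemma bessel_J0_eq: "bessel_J0 t = bessel_A (t\<^sup>2 / 4)"
  and bessel_Y0_eq: "bessel_Y0 t = 2 / pi * ((ln (t / 2) + euler_mascheroni) * bessel_A (t\<^sup>2 / 4) + bessel_B (t\<^sup>2 / 4))"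
proof -
  have e: "(t / 2) ^ (2 * m) = (t\<^sup>2 / 4) ^ m" for m by (simp add: power_mult power_divide)
  show J: "bessel_J0 t = bessel_A (t\<^sup>2 / 4)" unfolding bessel_J0_def bessel_A_def bessel_a_def e ..
  show "bessel_Y0 t = 2 / pi * ((ln (t / 2) + euler_mascheroni) * bessel_A (t\<^sup>2 / 4) + bessel_B (t\<^sup>2 / 4))"
    unfolding bessel_Y0_def J unfolding bessel_B_def bessel_b_def e by (simp add: algebra_simps)
qed

text \<open>
\<open>t J0'(t)\<close> and (\<open>bessel_Yp\<close>) \<open>t Y0'(t)\<close>.
\<close>
definition bessel_Jp :: "real \<Rightarrow> real" where "bessel_Jp t = 2 * (t\<^sup>2 / 4 * bessel_A' (t\<^sup>2 / 4))"
definition bessel_Yp :: "real \<Rightarrow> real" where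
  "bessel_Yp t = 2 / pi * (bessel_A (t\<^sup>2 / 4) + (ln (t / 2) + euler_mascheroni) * bessel_Jp t + 2 * (t\<^sup>2 / 4 * bessel_B' (t\<^sup>2 / 4)))"

lemma bessel_system:
  assumes t: "t > 0"
  shows "(bessel_J0 has_real_derivative bessel_Jp t / t) (at t)" "(bessel_Jp has_real_derivative - t * bessel_J0 t) (at t)"
    "(bessel_Y0 has_real_derivative bessel_Yp t / t) (at t)" "(bessel_Yp has_real_derivative - t * bessel_Y0 t) (at t)"
proof -
  let ?x = "\<lambda>t::real. t\<^sup>2 / 4"
  have x: "(?x has_real_derivative t / 2) (at t)" by (auto intro!: derivative_eq_intros)
  note chain = DERIV_chain2[OF _ x]
  have A: "((\<lambda>t. bessel_A (?x t)) has_real_derivative bessel_Jp t / t) (at t)"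
    using chain[OF bessel_AB_derivs(1)] t by (simp add: bessel_Jp_def power2_eq_square mult_ac)
  have B: "((\<lambda>t. bessel_B (?x t)) has_real_derivative 2 * (?x t * bessel_B' (?x t)) / t) (at t)"
    using chain[OF bessel_AB_derivs(2)] t by (simp add: power2_eq_square mult_ac)
  have A2: "(bessel_Jp has_real_derivative - t * bessel_A (?x t)) (at t)"
    using DERIV_cmult[OF chain[OF bessel_AB_derivs(3)], of 2] unfolding bessel_Jp_def[abs_def] by (simp add: mult_ac)
  have B2: "((\<lambda>t. 2 * (?x t * bessel_B' (?x t))) has_real_derivative - t * bessel_B (?x t) - t * bessel_A' (?x t)) (at t)"
    using DERIV_cmult[OF chain[OF bessel_AB_derivs(4)], of 2] by (simp add: algebra_simps)
  have L: "((\<lambda>t. ln (t / 2) + euler_mascheroni) has_real_derivative 1 / t) (at t)"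
    using t by (auto intro!: derivative_eq_intros)
  show "(bessel_J0 has_real_derivative bessel_Jp t / t) (at t)" unfolding bessel_J0_eq[abs_def] by (rule A)
  show "(bessel_Jp has_real_derivative - t * bessel_J0 t) (at t)" unfolding bessel_J0_eq by (rule A2)
  have "((\<lambda>t. 2 / pi * ((ln (t / 2) + euler_mascheroni) * bessel_A (?x t) + bessel_B (?x t))) has_real_derivative
     2 / pi * ((1 / t * bessel_A (?x t) + bessel_Jp t / t * (ln (t / 2) + euler_mascheroni)) + 2 * (?x t * bessel_B' (?x t)) / t)) (at t)"
    by (intro DERIV_cmult DERIV_add DERIV_mult L A B)
  then show "(bessel_Y0 has_real_derivative bessel_Yp t / t) (at t)"
    unfolding bessel_Y0_eq[abs_def] bessel_Yp_def by (simp add: algebra_simps add_divide_distrib)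
  have "((\<lambda>t. 2 / pi * (bessel_A (?x t) + (ln (t / 2) + euler_mascheroni) * bessel_Jp t + 2 * (?x t * bessel_B' (?x t)))) has_real_derivative
     2 / pi * (bessel_Jp t / t + (1 / t * bessel_Jp t + (- t * bessel_A (?x t)) * (ln (t / 2) + euler_mascheroni)) + (- t * bessel_B (?x t) - t * bessel_A' (?x t)))) (at t)"
    by (intro DERIV_cmult DERIV_add DERIV_mult L A A2 B2)
  moreover have "bessel_Jp t / t = t * bessel_A' (?x t) / 2" using t by (simp add: bessel_Jp_def power2_eq_square)
  ultimately show "(bessel_Yp has_real_derivative - t * bessel_Y0 t) (at t)"
    unfolding bessel_Yp_def[abs_def] bessel_Y0_eq by (simp add: algebra_simps)
qed

lemma bessel_at_zero:
  "((\<lambda>t. bessel_J0 t) \<longlongrightarrow> 1) (at_right 0)" "(bessel_Jp \<longlongrightarrow> 0) (at_right 0)"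
  "((\<lambda>t. bessel_Y0 t - 2 / pi * (ln (t / 2) + euler_mascheroni)) \<longlongrightarrow> 0) (at_right 0)"
  "(bessel_Yp \<longlongrightarrow> 2 / pi) (at_right 0)"
proof -
  have cA: "isCont bessel_A x" "isCont bessel_B x" for x
    using bessel_AB_derivs DERIV_isCont by blast+
  have cA': "isCont bessel_A' x" "isCont bessel_B' x" for x
  proof -
    note a = power_series_euler_derivative[of bessel_a, OF bessel_summable(1)]
    note b = power_series_euler_derivative[of bessel_b, OF bessel_summable(2)]
    show "isCont bessel_A' x" "isCont bessel_B' x" unfolding bessel_A'_def[abs_def] bessel_B'_def[abs_def]
      by (rule DERIV_isCont[OF power_series_euler_derivative(1)], rule a(3) b(3))+
  qed
  have A0: "bessel_A 0 = 1" and B0: "bessel_B 0 = 0"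
    by (simp_all add: bessel_A_def bessel_B_def powser_zero[of bessel_a] powser_zero[of bessel_b]) (simp_all add: bessel_a_def bessel_b_def harm_def)
  have x: "((\<lambda>t::real. t\<^sup>2 / 4) \<longlongrightarrow> 0) (at_right 0)"
    by (rule tendsto_eq_intros | simp)+
  have tA: "((\<lambda>t. bessel_A (t\<^sup>2 / 4)) \<longlongrightarrow> 1) (at_right 0)" using isCont_tendsto_compose[OF cA(1) x] A0 by simp
  have tB: "((\<lambda>t. bessel_B (t\<^sup>2 / 4)) \<longlongrightarrow> 0) (at_right 0)" using isCont_tendsto_compose[OF cA(2) x] B0 by simp
  have tA': "((\<lambda>t. bessel_A' (t\<^sup>2 / 4)) \<longlongrightarrow> bessel_A' 0) (at_right 0)" by (rule isCont_tendsto_compose[OF cA'(1) x])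
  have tB': "((\<lambda>t. bessel_B' (t\<^sup>2 / 4)) \<longlongrightarrow> bessel_B' 0) (at_right 0)" by (rule isCont_tendsto_compose[OF cA'(2) x])
  show "((\<lambda>t. bessel_J0 t) \<longlongrightarrow> 1) (at_right 0)" unfolding bessel_J0_eq by (rule tA)
  show Jp: "(bessel_Jp \<longlongrightarrow> 0) (at_right 0)"
    unfolding bessel_Jp_def[abs_def] using tendsto_mult_left[OF tendsto_mult[OF x tA'], of 2] by simp
  have lnt: "((\<lambda>t. (ln (t / 2) + euler_mascheroni) * t\<^sup>2) \<longlongrightarrow> (0::real)) (at_right 0)"
    by real_asymp
  have quot: "((\<lambda>t. (bessel_A (t\<^sup>2 / 4) - 1) / t\<^sup>2) \<longlongrightarrow> bessel_A' 0 / 4) (at_right 0)"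
  proof -
    have "((\<lambda>h. (bessel_A (0 + h) - bessel_A 0) / h) \<longlongrightarrow> bessel_A' 0) (at 0)"
      using bessel_AB_derivs(1)[of 0] unfolding DERIV_def by simp
    moreover have "filterlim (\<lambda>t::real. t\<^sup>2 / 4) (at 0) (at_right 0)"
      unfolding filterlim_at using x by (auto simp: eventually_at_right_less eventually_at_right_field intro!: exI[of _ 1])
    ultimately have "((\<lambda>t. (bessel_A (t\<^sup>2 / 4) - 1) / (t\<^sup>2 / 4)) \<longlongrightarrow> bessel_A' 0) (at_right 0)"
      using filterlim_compose A0 by fastforce
    from tendsto_mult_left[OF this, of "1/4"]
    have "((\<lambda>t. 1 / 4 * ((bessel_A (t\<^sup>2 / 4) - 1) / (t\<^sup>2 / 4))) \<longlongrightarrow> 1 / 4 * bessel_A' 0) (at_right 0)" .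
    moreover have "(\<lambda>t. 1 / 4 * ((bessel_A (t\<^sup>2 / 4) - 1) / (t\<^sup>2 / 4))) = (\<lambda>t. (bessel_A (t\<^sup>2 / 4) - 1) / t\<^sup>2)"
      by (rule ext) (simp add: divide_simps)
    ultimately have "((\<lambda>t. (bessel_A (t\<^sup>2 / 4) - 1) / t\<^sup>2) \<longlongrightarrow> 1 / 4 * bessel_A' 0) (at_right 0)" by (simp only:)
    then show ?thesis by simp
  qed
  have ln_small: "((\<lambda>t. (ln (t / 2) + euler_mascheroni) * (bessel_A (t\<^sup>2 / 4) - 1)) \<longlongrightarrow> 0) (at_right 0)"
  proof (rule Lim_transform_eventually)
    show "((\<lambda>t. ((ln (t / 2) + euler_mascheroni) * t\<^sup>2) * ((bessel_A (t\<^sup>2 / 4) - 1) / t\<^sup>2)) \<longlongrightarrow> 0) (at_right 0)"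
      using tendsto_mult[OF lnt quot] by simp
    show "\<forall>\<^sub>F t in at_right 0. ((ln (t / 2) + euler_mascheroni) * t\<^sup>2) * ((bessel_A (t\<^sup>2 / 4) - 1) / t\<^sup>2) = (ln (t / 2) + euler_mascheroni) * (bessel_A (t\<^sup>2 / 4) - 1)"
      using eventually_at_right_less[of 0] by eventually_elim simp
  qed
  have "((\<lambda>t. 2 / pi * ((ln (t / 2) + euler_mascheroni) * (bessel_A (t\<^sup>2 / 4) - 1) + bessel_B (t\<^sup>2 / 4))) \<longlongrightarrow> 2 / pi * (0 + 0)) (at_right 0)"
    by (intro tendsto_intros ln_small tB)
  then show "((\<lambda>t. bessel_Y0 t - 2 / pi * (ln (t / 2) + euler_mascheroni)) \<longlongrightarrow> 0) (at_right 0)"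
    unfolding bessel_Y0_eq by (simp add: algebra_simps)
  have lnJp: "((\<lambda>t. (ln (t / 2) + euler_mascheroni) * bessel_Jp t) \<longlongrightarrow> 0) (at_right 0)"
  proof -
    have "(\<lambda>t. (ln (t / 2) + euler_mascheroni) * bessel_Jp t) = (\<lambda>t. ((ln (t / 2) + euler_mascheroni) * t\<^sup>2) * (1 / 2 * bessel_A' (t\<^sup>2 / 4)))"
      by (rule ext) (simp add: bessel_Jp_def)
    then show ?thesis using tendsto_mult[OF lnt tendsto_mult_left[OF tA', of "1/2"]] by simp
  qed
  have "((\<lambda>t. 2 / pi * (bessel_A (t\<^sup>2 / 4) + (ln (t / 2) + euler_mascheroni) * bessel_Jp t + 2 * (t\<^sup>2 / 4 * bessel_B' (t\<^sup>2 / 4)))) \<longlongrightarrow> 2 / pi * (1 + 0 + 2 * (0 * bessel_B' 0))) (at_right 0)"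
    by (intro tendsto_intros tA lnJp x tB')
  then show "(bessel_Yp \<longlongrightarrow> 2 / pi) (at_right 0)" unfolding bessel_Yp_def[abs_def] by simp
qed

section \<open>A Laplace integral for the Hankel function\<close>

text \<open>
This is \<open>csqrt(-p(\<tau>) - \<i>)\<close> for the exponent \<open>p(\<tau>) = \<i> - \<tau>\<^sup>2\<close>. Together they arise from
Hankel's contour integral by turning the path into the direction of steepest descent.
\<close>
definition hankel_root :: "real \<Rightarrow> complex" where "hankel_root \<tau> = csqrt (of_real (\<tau>\<^sup>2) - 2 * \<i>)"

definition hankel_exponent :: "real \<Rightarrow> complex" where "hankel_exponent \<tau> = \<i> - of_real (\<tau>\<^sup>2)"

text \<open>
The \<open>n\<close>-th derivative of the Laplace integral.
\<close>
definition hankel_laplace :: "nat \<Rightarrow> real \<Rightarrow> complex" where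
  "hankel_laplace n t = (LBINT \<tau>. hankel_exponent \<tau> ^ n / hankel_root \<tau> * exp (of_real t * hankel_exponent \<tau>))"

lemma hankel_root_slit: "of_real r - 2 * \<i> \<notin> \<real>\<^sub>\<le>\<^sub>0"
  by (simp add: complex_nonpos_Reals_iff)

lemma hankel_root_bound: "1 \<le> norm (hankel_root \<tau>)"
proof -
  have "2 \<le> norm (of_real (\<tau>\<^sup>2) - 2 * \<i>)"
    using abs_Im_le_cmod[of "of_real (\<tau>\<^sup>2) - 2 * \<i>"] by simp
  then have "sqrt 1 \<le> sqrt (norm (of_real (\<tau>\<^sup>2) - 2 * \<i>))" by (intro real_sqrt_le_mono) linarith
  then show ?thesis by (simp add: hankel_root_def)
qed

lemma hankel_root_nonzero: "hankel_root \<tau> \<noteq> 0"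
  using hankel_root_bound[of \<tau>] by auto

lemma hankel_root_continuous: "continuous_on A hankel_root"
  unfolding hankel_root_def by (intro continuous_on_csqrt_slit continuous_intros) (rule disjI1, rule hankel_root_slit)

lemma hankel_root_measurable [measurable]: "hankel_root \<in> borel_measurable borel"
  by (intro borel_measurable_continuous_onI hankel_root_continuous)

lemma hankel_exponent_continuous: "continuous_on A hankel_exponent"
  unfolding hankel_exponent_def by (intro continuous_intros)

lemma hankel_exponent_measurable [measurable]: "hankel_exponent \<in> borel_measurable borel"
  by (intro borel_measurable_continuous_onI hankel_exponent_continuous)

lemma hankel_exponent_bound: "norm (hankel_exponent \<tau>) \<le> 1 + \<tau>\<^sup>2"
  using norm_triangle_ineq4[of \<i> "of_real (\<tau>\<^sup>2)"] by (simp add: hankel_exponent_def del: of_real_power)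

lemma gaussian_polynomial_integrable:
  fixes t :: real
  assumes t: "t > 0"
  shows "integrable lborel (\<lambda>\<tau>::real. (2 + \<tau>\<^sup>2) ^ n * exp (- t * \<tau>\<^sup>2))"
proof (rule Bochner_Integration.integrable_bound)
  define \<delta> where "\<delta> = min (1/2) (t / (2 * (real n + 1)))"
  have d: "\<delta> > 0" using t by (simp add: \<delta>_def)
  have d: "\<delta> > 0" "\<delta> \<le> 1 / 2" "\<delta> \<le> t / (2 * (real n + 1))"
    by (rule d) (unfold \<delta>_def, rule min.cobounded1, rule min.cobounded2)
  have "real n * \<delta> \<le> (real n + 1) * (t / (2 * (real n + 1)))" using d by (intro mult_mono) auto
  also have "\<dots> = t / 2" by (simp add: field_simps)
  finally have nd: "real n * \<delta> \<le> t / 2" .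
  show "integrable lborel (\<lambda>\<tau>::real. (1 / \<delta>) ^ n * exp (- (t / 2) * \<tau>\<^sup>2))"
    using gaussian_integral(1)[of "t / 2"] t by (intro integrable_mult_right) simp
  show "AE \<tau> in lborel. norm ((2 + \<tau>\<^sup>2) ^ n * exp (- t * \<tau>\<^sup>2)) \<le> norm ((1 / \<delta>) ^ n * exp (- (t / 2) * \<tau>\<^sup>2))"
  proof (rule AE_I2)
    fix \<tau> :: real
    have "2 + \<tau>\<^sup>2 \<le> 1 / \<delta> * (1 + \<delta> * \<tau>\<^sup>2)" using d by (simp add: field_simps)
    also have "\<dots> \<le> 1 / \<delta> * exp (\<delta> * \<tau>\<^sup>2)" using d by (intro mult_left_mono exp_ge_add_one_self) auto
    finally have "(2 + \<tau>\<^sup>2) ^ n \<le> (1 / \<delta> * exp (\<delta> * \<tau>\<^sup>2)) ^ n" by (intro power_mono) auto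
    also have "\<dots> = (1 / \<delta>) ^ n * exp (real n * \<delta> * \<tau>\<^sup>2)"
      by (simp only: power_mult_distrib exp_of_nat_mult[symmetric] mult.assoc)
    also have "\<dots> \<le> (1 / \<delta>) ^ n * exp (t / 2 * \<tau>\<^sup>2)"
      using d mult_right_mono[OF nd, of "\<tau>\<^sup>2"] by (intro mult_left_mono) (simp_all only: exp_le_cancel_iff zero_le_power2, simp)
    finally have "(2 + \<tau>\<^sup>2) ^ n * exp (- t * \<tau>\<^sup>2) \<le> (1 / \<delta>) ^ n * exp (t / 2 * \<tau>\<^sup>2) * exp (- t * \<tau>\<^sup>2)"
      by (rule mult_right_mono) simp
    also have "\<dots> = (1 / \<delta>) ^ n * exp (- (t / 2) * \<tau>\<^sup>2)" by (simp add: mult_exp_exp field_simps)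
    finally show "norm ((2 + \<tau>\<^sup>2) ^ n * exp (- t * \<tau>\<^sup>2)) \<le> norm ((1 / \<delta>) ^ n * exp (- (t / 2) * \<tau>\<^sup>2))"
      using d by (simp add: abs_mult)
  qed
qed simp

lemma norm_hankel_exponential: "norm (exp (of_real t * hankel_exponent \<tau>)) = exp (- t * \<tau>\<^sup>2)"
  by (simp add: norm_exp_eq_Re hankel_exponent_def)

lemma hankel_laplace_integrable:
  assumes "t > 0"
  shows "integrable lborel (\<lambda>\<tau>. hankel_exponent \<tau> ^ n / hankel_root \<tau> * exp (of_real t * hankel_exponent \<tau>))"
proof (rule Bochner_Integration.integrable_bound[OF gaussian_polynomial_integrable[OF assms, of n]])
  show "AE \<tau> in lborel. norm (hankel_exponent \<tau> ^ n / hankel_root \<tau> * exp (of_real t * hankel_exponent \<tau>)) \<le> norm ((2 + \<tau>\<^sup>2) ^ n * exp (- t * \<tau>\<^sup>2))"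
  proof (rule AE_I2)
    fix \<tau> :: real
    have "norm (hankel_exponent \<tau> ^ n) / norm (hankel_root \<tau>) \<le> (2 + \<tau>\<^sup>2) ^ n / 1"
      unfolding norm_power using hankel_exponent_bound[of \<tau>] hankel_root_bound[of \<tau>] by (intro frac_le power_mono) auto
    then have "norm (hankel_exponent \<tau> ^ n / hankel_root \<tau> * exp (of_real t * hankel_exponent \<tau>)) \<le> (2 + \<tau>\<^sup>2) ^ n / 1 * exp (- t * \<tau>\<^sup>2)"
      unfolding norm_mult norm_divide norm_hankel_exponential by (rule mult_right_mono) simp
    then show "norm (hankel_exponent \<tau> ^ n / hankel_root \<tau> * exp (of_real t * hankel_exponent \<tau>)) \<le> norm ((2 + \<tau>\<^sup>2) ^ n * exp (- t * \<tau>\<^sup>2))"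
      unfolding div_by_1 real_norm_def by (rule order_trans[OF _ abs_ge_self])
  qed
qed simp

lemma hankel_laplace_derivative:
  assumes t: "t > 0"
  shows "(hankel_laplace n has_vector_derivative hankel_laplace (Suc n) t) (at t)"
proof -
  define c where "c = (\<lambda>\<tau>. hankel_exponent \<tau> ^ n / hankel_root \<tau> * exp (of_real t * hankel_exponent \<tau>))"
  define L where "L = (\<lambda>\<tau> v. of_real v * hankel_exponent \<tau>)"
  have c_meas: "c \<in> borel_measurable borel" unfolding c_def by measurable
  have "((\<lambda>v. \<integral>\<tau>. c \<tau> * exp (L \<tau> v) \<partial>lborel) has_derivative (\<lambda>v. \<integral>\<tau>. c \<tau> * L \<tau> v \<partial>lborel)) (at 0)"
  proof (rule has_derivative_exp_integral[where m="\<lambda>\<tau>. 1 + \<tau>\<^sup>2" and \<epsilon>="t / 2"])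
    show "c \<in> borel_measurable lborel" using c_meas by simp
    show "(\<lambda>\<tau>. L \<tau> v) \<in> borel_measurable lborel" for v unfolding L_def by measurable
    show "linear (L \<tau>)" for \<tau> by (rule linearI) (auto simp: L_def algebra_simps scaleR_conv_of_real)
    show "norm (L \<tau> v) \<le> (1 + \<tau>\<^sup>2) * norm v" for \<tau> v
      unfolding L_def norm_mult using mult_left_mono[OF hankel_exponent_bound[of \<tau>], of "\<bar>v\<bar>"] by (simp add: mult.commute)
    show "integrable lborel (\<lambda>\<tau>. norm (c \<tau>) * (1 + (1 + \<tau>\<^sup>2))\<^sup>2 * exp (t / 2 * (1 + \<tau>\<^sup>2)))"
    proof (rule Bochner_Integration.integrable_bound)
      show "integrable lborel (\<lambda>\<tau>::real. exp (t / 2) * ((2 + \<tau>\<^sup>2) ^ (n + 2) * exp (- (t / 2) * \<tau>\<^sup>2)))"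
        using t by (intro integrable_mult_right gaussian_polynomial_integrable) simp
      show "AE \<tau> in lborel. norm (norm (c \<tau>) * (1 + (1 + \<tau>\<^sup>2))\<^sup>2 * exp (t / 2 * (1 + \<tau>\<^sup>2))) \<le> norm (exp (t / 2) * ((2 + \<tau>\<^sup>2) ^ (n + 2) * exp (- (t / 2) * \<tau>\<^sup>2)))"
      proof (rule AE_I2)
        fix \<tau> :: real
        have "norm (hankel_exponent \<tau> ^ n) / norm (hankel_root \<tau>) \<le> (2 + \<tau>\<^sup>2) ^ n / 1"
          unfolding norm_power using hankel_exponent_bound[of \<tau>] hankel_root_bound[of \<tau>] by (intro frac_le power_mono) auto
        then have "norm (c \<tau>) \<le> (2 + \<tau>\<^sup>2) ^ n * exp (- t * \<tau>\<^sup>2)"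
          unfolding c_def norm_mult norm_divide norm_hankel_exponential by (intro mult_right_mono) auto
        then have "norm (c \<tau>) * ((1 + (1 + \<tau>\<^sup>2))\<^sup>2 * exp (t / 2 * (1 + \<tau>\<^sup>2))) \<le> ((2 + \<tau>\<^sup>2) ^ n * exp (- t * \<tau>\<^sup>2)) * ((1 + (1 + \<tau>\<^sup>2))\<^sup>2 * exp (t / 2 * (1 + \<tau>\<^sup>2)))"
          by (intro mult_right_mono) auto
        also have "\<dots> = (2 + \<tau>\<^sup>2) ^ (n + 2) * (exp (- t * \<tau>\<^sup>2) * exp (t / 2 * (1 + \<tau>\<^sup>2)))"
          by (simp add: power_add power2_eq_square)
        also have "exp (- t * \<tau>\<^sup>2) * exp (t / 2 * (1 + \<tau>\<^sup>2)) = exp (t / 2) * exp (- (t / 2) * \<tau>\<^sup>2)"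
          unfolding exp_add[symmetric] by (rule arg_cong[where f=exp]) (simp add: field_simps)
        finally show "norm (norm (c \<tau>) * (1 + (1 + \<tau>\<^sup>2))\<^sup>2 * exp (t / 2 * (1 + \<tau>\<^sup>2))) \<le> norm (exp (t / 2) * ((2 + \<tau>\<^sup>2) ^ (n + 2) * exp (- (t / 2) * \<tau>\<^sup>2)))"
          by (simp add: abs_mult mult_ac)
      qed
    qed (use c_meas in measurable)
  qed (use t in auto)
  moreover have "(\<integral>\<tau>. c \<tau> * L \<tau> v \<partial>lborel) = v *\<^sub>R hankel_laplace (Suc n) t" for v
  proof -
    have "(\<integral>\<tau>. c \<tau> * L \<tau> v \<partial>lborel) = (\<integral>\<tau>. of_real v * (hankel_exponent \<tau> ^ Suc n / hankel_root \<tau> * exp (of_real t * hankel_exponent \<tau>)) \<partial>lborel)"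
      by (rule Bochner_Integration.integral_cong) (simp_all add: c_def L_def)
    then show ?thesis by (simp only: integral_mult_right_zero hankel_laplace_def scaleR_conv_of_real)
  qed
  moreover have "(\<integral>\<tau>. c \<tau> * exp (L \<tau> v) \<partial>lborel) = hankel_laplace n (t + v)" for v
    unfolding hankel_laplace_def by (rule Bochner_Integration.integral_cong) (simp_all add: c_def L_def distrib_right exp_add)
  ultimately have "((\<lambda>v. hankel_laplace n (t + v)) has_derivative (\<lambda>v. v *\<^sub>R hankel_laplace (Suc n) t)) (at (t - t))" by simp
  moreover have "((\<lambda>y. y - t) has_derivative (\<lambda>v. v)) (at t)" by (auto intro!: derivative_eq_intros)
  ultimately have "((\<lambda>y. hankel_laplace n (t + (y - t))) has_derivative (\<lambda>v. v *\<^sub>R hankel_laplace (Suc n) t)) (at t)"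
    by (intro has_derivative_compose[of "\<lambda>y. y - t" "\<lambda>v. v" t UNIV "\<lambda>v. hankel_laplace n (t + v)"])
  then show ?thesis by (simp add: has_vector_derivative_def)
qed

text \<open>
The combination \<open>t p\<^sup>2 + p + t\<close>, divided by the root and multiplied by the exponential, is up to the factor \<open>-2\<close> the
derivative of \<open>\<tau> csqrt(\<tau>\<^sup>2 - 2\<i>) exp(t p)\<close>; the boundary terms vanish.
\<close>
lemma hankel_laplace_ODE:
  assumes t: "t > 0"
  shows "of_real t * hankel_laplace 2 t + hankel_laplace 1 t + of_real t * hankel_laplace 0 t = 0"
proof -
  define e where "e = (\<lambda>\<tau>. exp (of_real t * hankel_exponent \<tau>))"
  define G where "G = (\<lambda>\<tau>. of_real \<tau> * hankel_root \<tau> * e \<tau>)"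
  define g where "g = (\<lambda>\<tau>. - 2 * (of_real t * (hankel_exponent \<tau> ^ 2 / hankel_root \<tau> * e \<tau>) + (hankel_exponent \<tau> ^ 1 / hankel_root \<tau> * e \<tau>) + of_real t * (hankel_exponent \<tau> ^ 0 / hankel_root \<tau> * e \<tau>)))"
  have s2: "hankel_root \<tau> * hankel_root \<tau> = - hankel_exponent \<tau> - \<i>" for \<tau>
    using power2_csqrt[of "of_real (\<tau>\<^sup>2) - 2 * \<i>"] by (simp add: hankel_root_def hankel_exponent_def power2_eq_square)
  have \<tau>2: "complex_of_real \<tau> * of_real \<tau> = \<i> - hankel_exponent \<tau>" for \<tau> by (simp add: hankel_exponent_def power2_eq_square)
  have der: "(G has_vector_derivative g \<tau>) (at \<tau>)" for \<tau>
  proof -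
    have d\<tau>: "((\<lambda>\<tau>. complex_of_real \<tau>) has_vector_derivative 1) (at \<tau>)"
      by (rule has_vector_derivative_of_real[of "\<lambda>x. x" 1, simplified])
    have d\<tau>2: "((\<lambda>\<tau>. complex_of_real (\<tau>\<^sup>2)) has_vector_derivative of_real (2 * \<tau>)) (at \<tau>)"
      by (rule has_vector_derivative_of_real) (auto intro!: derivative_eq_intros)
    have ds: "(hankel_root has_vector_derivative of_real \<tau> / hankel_root \<tau>) (at \<tau>)"
    proof -
      have "((\<lambda>\<tau>. of_real (\<tau>\<^sup>2) - 2 * \<i>) has_vector_derivative of_real (2 * \<tau>)) (at \<tau>)"
        using has_vector_derivative_diff[OF d\<tau>2 has_vector_derivative_const[of "2 * \<i>"]] by simp
      from field_vector_diff_chain_at[OF this has_field_derivative_csqrt[OF hankel_root_slit]]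
      have "(hankel_root has_vector_derivative of_real (2 * \<tau>) * inverse (2 * hankel_root \<tau>)) (at \<tau>)"
        unfolding hankel_root_def o_def .
      then show ?thesis using hankel_root_nonzero[of \<tau>] by (simp add: field_simps)
    qed
    have de: "(e has_vector_derivative (of_real t * (- of_real (2 * \<tau>))) * e \<tau>) (at \<tau>)"
    proof -
      have "(hankel_exponent has_vector_derivative - of_real (2 * \<tau>)) (at \<tau>)"
        unfolding hankel_exponent_def using has_vector_derivative_diff[OF has_vector_derivative_const[of \<i>] d\<tau>2] by simp
      then have "((\<lambda>\<tau>. of_real t * hankel_exponent \<tau>) has_vector_derivative of_real t * (- of_real (2 * \<tau>))) (at \<tau>)"
        by (rule has_vector_derivative_mult_right)
      from field_vector_diff_chain_at[OF this DERIV_exp] show ?thesis unfolding e_def o_def .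
    qed
    have "(G has_vector_derivative (of_real \<tau> * hankel_root \<tau> * ((of_real t * (- of_real (2 * \<tau>))) * e \<tau>) + (of_real \<tau> * (of_real \<tau> / hankel_root \<tau>) + 1 * hankel_root \<tau>) * e \<tau>)) (at \<tau>)"
      unfolding G_def by (intro has_vector_derivative_mult d\<tau> ds de)
    also have "(of_real \<tau> * hankel_root \<tau> * ((of_real t * (- of_real (2 * \<tau>))) * e \<tau>) + (of_real \<tau> * (of_real \<tau> / hankel_root \<tau>) + 1 * hankel_root \<tau>) * e \<tau>)
      = (- 2 * of_real t * (of_real \<tau> * of_real \<tau>) * (hankel_root \<tau> * hankel_root \<tau>) + (of_real \<tau> * of_real \<tau> + hankel_root \<tau> * hankel_root \<tau>)) / hankel_root \<tau> * e \<tau>"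
      using hankel_root_nonzero[of \<tau>] by (simp add: field_simps)
    also have "- 2 * of_real t * (of_real \<tau> * of_real \<tau>) * (hankel_root \<tau> * hankel_root \<tau>) + (of_real \<tau> * of_real \<tau> + hankel_root \<tau> * hankel_root \<tau>)
      = - 2 * (of_real t * hankel_exponent \<tau> ^ 2 + hankel_exponent \<tau> ^ 1 + of_real t * hankel_exponent \<tau> ^ 0)"
      unfolding s2 \<tau>2 by (simp add: algebra_simps power2_eq_square)
    also have "\<dots> / hankel_root \<tau> * e \<tau> = g \<tau>"
      unfolding g_def by (simp add: algebra_simps add_divide_distrib diff_divide_distrib)
    finally show ?thesis .
  qed
  have gi: "integrable lborel g"
    unfolding g_def e_def by (intro integrable_mult_right Bochner_Integration.integrable_add hankel_laplace_integrable[OF t])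
  have gcont: "isCont g \<tau>" for \<tau>
  proof -
    have "continuous_on UNIV g" unfolding g_def e_def
      by (intro continuous_intros hankel_root_continuous hankel_exponent_continuous) (use hankel_root_nonzero in auto)
    then show ?thesis by (simp add: continuous_on_eq_continuous_at)
  qed
  have Gb: "norm (G \<tau>) \<le> (2 + \<tau>\<^sup>2)\<^sup>2 * exp (- t * \<tau>\<^sup>2)" for \<tau>
  proof -
    have "norm (hankel_root \<tau>) \<le> 2 + \<tau>\<^sup>2"
    proof -
      have "norm (hankel_root \<tau>) ^ 2 = norm (of_real (\<tau>\<^sup>2) - 2 * \<i>)" by (simp add: hankel_root_def)
      also have "\<dots> \<le> \<tau>\<^sup>2 + 2"
        using norm_triangle_ineq4[of "of_real (\<tau>\<^sup>2)" "2 * \<i>"] by (simp add: norm_mult del: of_real_power)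
      also have "\<dots> \<le> (2 + \<tau>\<^sup>2)\<^sup>2" using zero_le_power2[of \<tau>] by (simp add: power2_eq_square[of "2 + \<tau>\<^sup>2"] algebra_simps)
      finally show ?thesis by (rule power2_le_imp_le) simp
    qed
    moreover have "\<bar>\<tau>\<bar> \<le> 2 + \<tau>\<^sup>2"
    proof -
      have "0 \<le> (\<bar>\<tau>\<bar> - 1)\<^sup>2" by simp
      then show ?thesis by (simp add: power2_diff)
    qed
    ultimately have "\<bar>\<tau>\<bar> * norm (hankel_root \<tau>) \<le> (2 + \<tau>\<^sup>2) * (2 + \<tau>\<^sup>2)" by (intro mult_mono) auto
    then show ?thesis unfolding G_def norm_mult e_def norm_hankel_exponential by (simp add: power2_eq_square mult_right_mono)
  qed
  have lim: "((\<lambda>\<tau>::real. (2 + \<tau>\<^sup>2)\<^sup>2 * exp (- t * \<tau>\<^sup>2)) \<longlongrightarrow> 0) at_top" "((\<lambda>\<tau>::real. (2 + \<tau>\<^sup>2)\<^sup>2 * exp (- t * \<tau>\<^sup>2)) \<longlongrightarrow> 0) at_bot"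
    using t by real_asymp+
  have "(LBINT \<tau>=-\<infinity>..\<infinity>. g \<tau>) = 0 - 0"
  proof (rule interval_integral_FTC_integrable)
    show "(G has_vector_derivative g \<tau>) (at \<tau>)" for \<tau> by (rule der)
    show "((G \<circ> real_of_ereal) \<longlongrightarrow> 0) (at_right (-\<infinity>))"
      unfolding ereal_tendsto_simps by (rule Lim_null_comparison[OF always_eventually[OF allI[OF Gb]] lim(2)])
    show "((G \<circ> real_of_ereal) \<longlongrightarrow> 0) (at_left \<infinity>)"
      unfolding ereal_tendsto_simps by (rule Lim_null_comparison[OF always_eventually[OF allI[OF Gb]] lim(1)])
    show "set_integrable lborel (einterval (-\<infinity>) \<infinity>) g" using gi by (simp add: set_integrable_def)
  qed (use gcont in auto)
  then have "(LBINT \<tau>. g \<tau>) = 0" by (simp add: interval_lebesgue_integral_def set_lebesgue_integral_def)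
  moreover have "(LBINT \<tau>. g \<tau>) = - 2 * (of_real t * hankel_laplace 2 t + hankel_laplace 1 t + of_real t * hankel_laplace 0 t)"
    using hankel_laplace_integrable[OF t, of 2] hankel_laplace_integrable[OF t, of 1] hankel_laplace_integrable[OF t, of 0]
    unfolding g_def hankel_laplace_def e_def by (simp only: integral_mult_right_zero Bochner_Integration.integral_add integrable_mult_right Bochner_Integration.integrable_add)
  ultimately have "- 2 * (of_real t * hankel_laplace 2 t + hankel_laplace 1 t + of_real t * hankel_laplace 0 t) = 0" by (simp only:)
  then show ?thesis by (simp only: mult_eq_0_iff) simp
qed

section \<open>The Laplace integral at the origin\<close>

text \<open>
Convexity of the exponential gives \<open>\<plusminus>\<epsilon> ln s \<le> s powr (\<plusminus>\<epsilon>) - 1\<close>. After integration against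
\<open>exp(-s)\<close> both difference quotients of the Gamma function at \<open>1\<close> enclose the integral, and
their common limit is \<open>Gamma'(1) = -\<gamma>\<close>. This avoids differentiating Euler's integral.
\<close>
lemma exp_ln_integral:
  shows exp_ln_abs_integrable: "(\<lambda>s::real. exp (- s) * ln s) absolutely_integrable_on {0<..}"
    and "(\<lambda>s::real. exp (- s) * ln s) integrable_on {0<..}" "integral {0<..} (\<lambda>s::real. exp (- s) * ln s) = - euler_mascheroni"
proof -
  have G: "((\<lambda>s. s powr e * exp (- s)) has_integral Gamma (1 + e)) {0<..}" if "e > -1" for e :: real
  proof -
    have "((\<lambda>s. s powr ((1 + e) - 1) / exp s) has_integral Gamma (1 + e)) {0..}"
      using that by (intro Gamma_integral_real) simp
    then have "((\<lambda>s. s powr e * exp (- s)) has_integral Gamma (1 + e)) {0..}"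
      by (simp add: exp_minus divide_inverse)
    then show ?thesis
      by (subst has_integral_spike_set_eq[where T="{0..}"]) (auto intro: negligible_subset[of "{0}"])
  qed
  have up: "e * ln s \<le> s powr e - 1" if "s > 0" for s e :: real
  proof -
    have "s powr e = exp (e * ln s)" using that by (simp add: powr_def)
    then show ?thesis using exp_ge_add_one_self[of "e * ln s"] by linarith
  qed
  have lo: "1 - s powr (- e) \<le> e * ln s" if "s > 0" for s e :: real
    using up[OF that, of "- e"] by simp
  have G0: "((\<lambda>s::real. exp (- s)) has_integral 1) {0<..}"
    using has_integral_eq[OF _ G[of 0], of "\<lambda>s. exp (- s)"] by (simp add: Gamma_1)
  have g: "(\<lambda>s::real. s powr (1/2) * exp (- s)) integrable_on {0<..}" "(\<lambda>s::real. s powr (- (1/2)) * exp (- s)) integrable_on {0<..}"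
  proof -
    show "(\<lambda>s::real. s powr (1/2) * exp (- s)) integrable_on {0<..}" by (rule has_integral_integrable[OF G]) simp
    show "(\<lambda>s::real. s powr (- (1/2)) * exp (- s)) integrable_on {0<..}" by (rule has_integral_integrable[OF G]) simp
  qed
  have int: "(\<lambda>s::real. exp (- s) * ln s) absolutely_integrable_on {0<..}"
  proof (rule measurable_bounded_by_integrable_imp_absolutely_integrable)
    show "(\<lambda>s::real. 2 * (s powr (1/2) * exp (- s)) + 2 * (s powr (- (1/2)) * exp (- s))) integrable_on {0<..}"
      by (intro integrable_add integrable_on_mult_right g)
    show "(\<lambda>s::real. exp (- s) * ln s) \<in> borel_measurable (lebesgue_on {0<..})"
      by (intro continuous_imp_measurable_on_sets_lebesgue continuous_intros) auto
    fix s :: real assume s: "s \<in> {0<..}"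
    then have "1 / 2 * ln s \<le> s powr (1/2) - 1" "1 - s powr (- (1/2)) \<le> 1 / 2 * ln s" by (intro up lo; simp)+
    moreover have "0 \<le> s powr (1/2)" "0 \<le> s powr (- (1/2))" by (rule powr_ge_zero)+
    ultimately have "\<bar>ln s\<bar> \<le> 2 * s powr (1/2) + 2 * s powr (- (1/2))" by linarith
    then have "exp (- s) * \<bar>ln s\<bar> \<le> exp (- s) * (2 * s powr (1/2) + 2 * s powr (- (1/2)))" by (intro mult_left_mono) auto
    then show "norm (exp (- s) * ln s) \<le> 2 * (s powr (1/2) * exp (- s)) + 2 * (s powr (- (1/2)) * exp (- s))"
      by (simp add: abs_mult algebra_simps)
  qed auto
  show "(\<lambda>s::real. exp (- s) * ln s) absolutely_integrable_on {0<..}" by (rule int)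
  from int show I: "(\<lambda>s::real. exp (- s) * ln s) integrable_on {0<..}" by (rule set_lebesgue_integral_eq_integral(1))
  let ?I = "integral {0<..} (\<lambda>s::real. exp (- s) * ln s)"
  have le_up: "e * ?I \<le> Gamma (1 + e) - 1" if "e > -1" for e :: real
  proof -
    have 1: "((\<lambda>s. s powr e * exp (- s) - exp (- s)) has_integral (Gamma (1 + e) - 1)) {0<..}"
      by (intro has_integral_diff G G0 that)
    have 2: "((\<lambda>s. e * (exp (- s) * ln s)) has_integral e * ?I) {0<..}"
      by (intro has_integral_mult_right integrable_integral I)
    show ?thesis
    proof (rule has_integral_le[OF 2 1])
      fix s :: real assume "s \<in> {0<..}"
      then have "exp (- s) * (e * ln s) \<le> exp (- s) * (s powr e - 1)" using up[of s e] by (intro mult_left_mono) auto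
      then show "e * (exp (- s) * ln s) \<le> s powr e * exp (- s) - exp (- s)" by (simp add: algebra_simps)
    qed
  qed
  have D: "(Gamma has_real_derivative - euler_mascheroni) (at (1::real))"
    using has_field_derivative_Gamma[of "1::real"] by simp
  then have lim: "((\<lambda>h. (Gamma (1 + h) - Gamma 1) / h) \<longlongrightarrow> - euler_mascheroni) (at (0::real))"
    unfolding DERIV_def .
  have "?I \<le> - euler_mascheroni"
  proof (rule tendsto_lowerbound)
    show "((\<lambda>h. (Gamma (1 + h) - Gamma 1) / h) \<longlongrightarrow> - euler_mascheroni) (at_right (0::real))"
      using lim by (rule filterlim_at_split[THEN iffD1, THEN conjunct2])
    show "\<forall>\<^sub>F h in at_right 0. ?I \<le> (Gamma (1 + h) - Gamma 1) / h"
      using eventually_at_right_less[of 0]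
    proof eventually_elim
      case (elim h)
      then show ?case using le_up[of h] by (simp add: pos_le_divide_eq mult.commute)
    qed
  qed simp
  moreover have "- euler_mascheroni \<le> ?I"
  proof (rule tendsto_upperbound)
    show "((\<lambda>h. (Gamma (1 + h) - Gamma 1) / h) \<longlongrightarrow> - euler_mascheroni) (at_left (0::real))"
      using lim by (rule filterlim_at_split[THEN iffD1, THEN conjunct1])
    have "\<forall>\<^sub>F h in at_left (0::real). h \<in> {-1<..<0}" by (rule eventually_at_leftI[of "-1"]) auto
    then show "\<forall>\<^sub>F h in at_left 0. (Gamma (1 + h) - Gamma 1) / h \<le> ?I"
    proof eventually_elim
      case (elim h)
      then show ?case using le_up[of h] by (simp add: neg_divide_le_eq mult.commute)
    qed
  qed simp
  ultimately show "?I = - euler_mascheroni" by simp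
qed

text \<open>
With \<open>\<sigma> = sqrt t \<tau>\<close> the Laplace integral becomes \<open>\<integral> exp(-\<sigma>\<^sup>2) / csqrt(\<sigma>\<^sup>2 - 2\<i>t) d\<sigma>\<close>, in which the limit
\<open>t \<rightarrow> 0\<close> is singular at \<open>\<sigma> = 0\<close> only.
\<close>
definition scaled_root :: "real \<Rightarrow> real \<Rightarrow> complex" where "scaled_root t \<sigma> = csqrt (of_real (\<sigma>\<^sup>2) - 2 * \<i> * of_real t)"

lemma scaled_root_slit: "t > 0 \<Longrightarrow> of_real r - 2 * \<i> * of_real t \<notin> \<real>\<^sub>\<le>\<^sub>0"
  by (simp add: complex_nonpos_Reals_iff)

lemma scaled_root_scale: "t > 0 \<Longrightarrow> scaled_root t (sqrt t * \<tau>) = of_real (sqrt t) * hankel_root \<tau>"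
proof -
  assume t: "t > 0"
  have "of_real ((sqrt t * \<tau>)\<^sup>2) - 2 * \<i> * of_real t = of_real t * (of_real (\<tau>\<^sup>2) - 2 * \<i>)"
    using t by (simp add: power_mult_distrib algebra_simps flip: of_real_power)
  moreover have "csqrt (of_real t * w) = of_real (sqrt t) * csqrt w" if "w \<notin> \<real>\<^sub>\<le>\<^sub>0" for w
  proof (rule csqrt_unique)
    show "(of_real (sqrt t) * csqrt w)\<^sup>2 = of_real t * w" using t by (simp add: power_mult_distrib flip: of_real_power)
    show "0 < Re (of_real (sqrt t) * csqrt w) \<or> Re (of_real (sqrt t) * csqrt w) = 0 \<and> 0 \<le> Im (of_real (sqrt t) * csqrt w)"
      using csqrt_principal[of w] t by (auto simp del: csqrt.sel)
  qed
  ultimately show ?thesis using hankel_root_slit[of "\<tau>\<^sup>2"] by (simp add: scaled_root_def hankel_root_def)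
qed

lemma hankel_laplace_scaled:
  assumes t: "t > 0"
  shows "(LBINT \<sigma>. of_real (exp (- \<sigma>\<^sup>2)) / scaled_root t \<sigma>) = exp (- \<i> * of_real t) * hankel_laplace 0 t"
    "integrable lborel (\<lambda>\<sigma>. of_real (exp (- \<sigma>\<^sup>2)) / scaled_root t \<sigma>)"
proof -
  have st: "sqrt t \<noteq> 0" "\<bar>sqrt t\<bar> = sqrt t" using t by auto
  have "of_real (exp (- (0 + sqrt t * \<tau>)\<^sup>2)) / scaled_root t (0 + sqrt t * \<tau>) = of_real (1 / sqrt t) * (exp (- \<i> * of_real t) * (hankel_exponent \<tau> ^ 0 / hankel_root \<tau> * exp (of_real t * hankel_exponent \<tau>)))" for \<tau>
  proof -
    have "of_real t * hankel_exponent \<tau> = \<i> * of_real t + of_real (- (sqrt t * \<tau>)\<^sup>2)"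
      using t by (simp add: hankel_exponent_def power_mult_distrib algebra_simps)
    then have "exp (- \<i> * of_real t) * exp (of_real t * hankel_exponent \<tau>) = exp (of_real (- (sqrt t * \<tau>)\<^sup>2))"
      unfolding exp_add[symmetric] by simp
    then have "complex_of_real (exp (- (sqrt t * \<tau>)\<^sup>2)) = exp (- \<i> * of_real t) * exp (of_real t * hankel_exponent \<tau>)"
      by (simp only: exp_of_real)
    then show ?thesis by (simp add: scaled_root_scale[OF t])
  qed
  note e = this
  have "has_bochner_integral lborel (\<lambda>\<tau>. of_real (1 / sqrt t) * (exp (- \<i> * of_real t) * (hankel_exponent \<tau> ^ 0 / hankel_root \<tau> * exp (of_real t * hankel_exponent \<tau>)))) (of_real (1 / sqrt t) * (exp (- \<i> * of_real t) * hankel_laplace 0 t))"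
    unfolding hankel_laplace_def by (intro has_bochner_integral_mult_right has_bochner_integral_integrable hankel_laplace_integrable[OF t])
  then have "has_bochner_integral lborel (\<lambda>\<tau>. of_real (exp (- (0 + sqrt t * \<tau>)\<^sup>2)) / scaled_root t (0 + sqrt t * \<tau>)) ((exp (- \<i> * of_real t) * hankel_laplace 0 t) /\<^sub>R \<bar>sqrt t\<bar>)"
    unfolding e using t by (simp add: scaleR_conv_of_real divide_inverse)
  then have "has_bochner_integral lborel (\<lambda>\<sigma>. of_real (exp (- \<sigma>\<^sup>2)) / scaled_root t \<sigma>) (exp (- \<i> * of_real t) * hankel_laplace 0 t)"
    using lborel_has_bochner_integral_real_affine_iff[OF st(1), of "\<lambda>\<sigma>. of_real (exp (- \<sigma>\<^sup>2)) / scaled_root t \<sigma>" _ 0] by simp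
  then show "(LBINT \<sigma>. of_real (exp (- \<sigma>\<^sup>2)) / scaled_root t \<sigma>) = exp (- \<i> * of_real t) * hankel_laplace 0 t"
    "integrable lborel (\<lambda>\<sigma>. of_real (exp (- \<sigma>\<^sup>2)) / scaled_root t \<sigma>)" by (auto simp: has_bochner_integral_iff)
qed

lemma hankel_laplace_derivative_scaled:
  assumes t: "t > 0"
  shows "of_real t * hankel_laplace 1 t = \<i> * of_real t * hankel_laplace 0 t - exp (\<i> * of_real t) * (LBINT \<sigma>. of_real (\<sigma>\<^sup>2 * exp (- \<sigma>\<^sup>2)) / scaled_root t \<sigma>)"
proof -
  have st: "sqrt t \<noteq> 0" using t by auto
  have "of_real ((0 + sqrt t * \<tau>)\<^sup>2 * exp (- (0 + sqrt t * \<tau>)\<^sup>2)) / scaled_root t (0 + sqrt t * \<tau>)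
     = of_real (1 / sqrt t) * (of_real t * exp (- \<i> * of_real t) * (\<i> * (hankel_exponent \<tau> ^ 0 / hankel_root \<tau> * exp (of_real t * hankel_exponent \<tau>)) - (hankel_exponent \<tau> ^ 1 / hankel_root \<tau> * exp (of_real t * hankel_exponent \<tau>))))" for \<tau>
  proof -
    have "of_real t * hankel_exponent \<tau> = \<i> * of_real t + of_real (- (sqrt t * \<tau>)\<^sup>2)"
      using t by (simp add: hankel_exponent_def power_mult_distrib algebra_simps)
    then have "exp (- \<i> * of_real t) * exp (of_real t * hankel_exponent \<tau>) = exp (of_real (- (sqrt t * \<tau>)\<^sup>2))"
      unfolding exp_add[symmetric] by simp
    then have e: "complex_of_real (exp (- (sqrt t * \<tau>)\<^sup>2)) = exp (- \<i> * of_real t) * exp (of_real t * hankel_exponent \<tau>)"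
      by (simp only: exp_of_real)
    have q: "complex_of_real ((sqrt t * \<tau>)\<^sup>2) = of_real t * (\<i> - hankel_exponent \<tau>)" using t by (simp add: hankel_exponent_def power_mult_distrib)
    show ?thesis unfolding add_0_left of_real_mult[of "(sqrt t * \<tau>)\<^sup>2"] q e scaled_root_scale[OF t]
      by (simp add: algebra_simps diff_divide_distrib)
  qed
  note e = this
  have "has_bochner_integral lborel (\<lambda>\<tau>. of_real (1 / sqrt t) * (of_real t * exp (- \<i> * of_real t) * (\<i> * (hankel_exponent \<tau> ^ 0 / hankel_root \<tau> * exp (of_real t * hankel_exponent \<tau>)) - (hankel_exponent \<tau> ^ 1 / hankel_root \<tau> * exp (of_real t * hankel_exponent \<tau>)))))
    (of_real (1 / sqrt t) * (of_real t * exp (- \<i> * of_real t) * (\<i> * hankel_laplace 0 t - hankel_laplace 1 t)))"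
    unfolding hankel_laplace_def by (intro has_bochner_integral_mult_right has_bochner_integral_diff has_bochner_integral_integrable hankel_laplace_integrable[OF t])
  then have "has_bochner_integral lborel (\<lambda>\<tau>. of_real ((0 + sqrt t * \<tau>)\<^sup>2 * exp (- (0 + sqrt t * \<tau>)\<^sup>2)) / scaled_root t (0 + sqrt t * \<tau>)) ((of_real t * exp (- \<i> * of_real t) * (\<i> * hankel_laplace 0 t - hankel_laplace 1 t)) /\<^sub>R \<bar>sqrt t\<bar>)"
    unfolding e using t by (simp add: scaleR_conv_of_real divide_inverse)
  then have "has_bochner_integral lborel (\<lambda>\<sigma>. of_real (\<sigma>\<^sup>2 * exp (- \<sigma>\<^sup>2)) / scaled_root t \<sigma>) (of_real t * exp (- \<i> * of_real t) * (\<i> * hankel_laplace 0 t - hankel_laplace 1 t))"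
    using lborel_has_bochner_integral_real_affine_iff[OF st, of "\<lambda>\<sigma>. of_real (\<sigma>\<^sup>2 * exp (- \<sigma>\<^sup>2)) / scaled_root t \<sigma>" _ 0] by simp
  then have I: "(LBINT \<sigma>. of_real (\<sigma>\<^sup>2 * exp (- \<sigma>\<^sup>2)) / scaled_root t \<sigma>) = of_real t * exp (- \<i> * of_real t) * (\<i> * hankel_laplace 0 t - hankel_laplace 1 t)"
    by (auto simp: has_bochner_integral_iff)
  have E: "exp (\<i> * of_real t) * exp (- \<i> * of_real t) = 1" unfolding exp_add[symmetric] by simp
  have "exp (\<i> * of_real t) * (LBINT \<sigma>. of_real (\<sigma>\<^sup>2 * exp (- \<sigma>\<^sup>2)) / scaled_root t \<sigma>) =
     (exp (\<i> * of_real t) * exp (- \<i> * of_real t)) * (of_real t * (\<i> * hankel_laplace 0 t - hankel_laplace 1 t))"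
    unfolding I by (simp only: mult_ac)
  then show ?thesis unfolding E by (simp add: algebra_simps)
qed

lemma scaled_root_bound: "t > 0 \<Longrightarrow> \<bar>\<sigma>\<bar> \<le> norm (scaled_root t \<sigma>)"
proof -
  assume t: "t > 0"
  have "\<sigma>\<^sup>2 \<le> norm (of_real (\<sigma>\<^sup>2) - 2 * \<i> * of_real t)"
    using abs_Re_le_cmod[of "of_real (\<sigma>\<^sup>2) - 2 * \<i> * of_real t"] by simp
  then have "sqrt (\<sigma>\<^sup>2) \<le> sqrt (norm (of_real (\<sigma>\<^sup>2) - 2 * \<i> * of_real t))" by (rule real_sqrt_le_mono)
  then show ?thesis by (simp add: scaled_root_def)
qed

lemma scaled_root_continuous: "t > 0 \<Longrightarrow> continuous_on A (scaled_root t)"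
  unfolding scaled_root_def by (intro continuous_on_csqrt_slit continuous_intros) (rule disjI1, rule scaled_root_slit)

lemma scaled_root_limit:
  assumes "\<sigma> > 0"
  shows "((\<lambda>t. scaled_root t \<sigma>) \<longlongrightarrow> of_real \<sigma>) (at_right 0)"
proof -
  have "isCont csqrt (of_real (\<sigma>\<^sup>2))" using assms by (intro continuous_at_csqrt) (simp add: complex_nonpos_Reals_iff)
  moreover have "((\<lambda>t. of_real (\<sigma>\<^sup>2) - 2 * \<i> * complex_of_real t) \<longlongrightarrow> of_real (\<sigma>\<^sup>2) - 2 * \<i> * of_real 0) (at_right 0)"
    by (intro tendsto_intros)
  then have "((\<lambda>t. of_real (\<sigma>\<^sup>2) - 2 * \<i> * complex_of_real t) \<longlongrightarrow> of_real (\<sigma>\<^sup>2)) (at_right 0)" by simp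
  ultimately have "((\<lambda>t. scaled_root t \<sigma>) \<longlongrightarrow> csqrt (of_real (\<sigma>\<^sup>2))) (at_right 0)"
    unfolding scaled_root_def by (rule isCont_tendsto_compose)
  moreover have "csqrt (of_real (\<sigma>\<^sup>2)) = of_real \<sigma>"
  proof -
    have "csqrt (of_real (\<sigma>\<^sup>2)) = of_real (sqrt (\<sigma>\<^sup>2))" by (rule of_real_sqrt[symmetric]) simp
    then show ?thesis using assms by simp
  qed
  ultimately show ?thesis by simp
qed

lemma gaussian_abs_moment: "integrable lborel (\<lambda>\<sigma>::real. \<bar>\<sigma>\<bar> * exp (- \<sigma>\<^sup>2))" "(LBINT \<sigma>::real. \<bar>\<sigma>\<bar> * exp (- \<sigma>\<^sup>2)) = (1::real)"
proof -
  have "has_bochner_integral lborel (\<lambda>x::real. indicator {0..} x *\<^sub>R (exp (- x\<^sup>2) * x)) (1 / 2)"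
    using gaussian_moment_1 by simp
  then have "has_bochner_integral lborel (\<lambda>x::real. indicator {0..} x *\<^sub>R (exp (- x\<^sup>2) * \<bar>x\<bar>)) (1 / 2)"
    by (rule has_bochner_integral_cong[THEN iffD1, rotated -1]) (auto split: split_indicator)
  then have "has_bochner_integral lborel (\<lambda>x::real. exp (- x\<^sup>2) * \<bar>x\<bar>) (2 *\<^sub>R (1 / 2))"
    by (rule has_bochner_integral_even_function) simp
  then show "integrable lborel (\<lambda>\<sigma>::real. \<bar>\<sigma>\<bar> * exp (- \<sigma>\<^sup>2))" "(LBINT \<sigma>::real. \<bar>\<sigma>\<bar> * exp (- \<sigma>\<^sup>2)) = (1::real)"
    by (auto simp: has_bochner_integral_iff mult.commute)
qed

lemma scaled_root_even: "scaled_root t (- \<sigma>) = scaled_root t \<sigma>" by (simp add: scaled_root_def)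

text \<open>
This is the limit of \<open>-t L'(t)\<close>; the singular point \<open>\<sigma> = 0\<close> is harmless because of the factor \<open>\<sigma>\<^sup>2\<close>.
\<close>
lemma scaled_second_moment_limit:
  "((\<lambda>t. LBINT \<sigma>. of_real (\<sigma>\<^sup>2 * exp (- \<sigma>\<^sup>2)) / scaled_root t \<sigma>) \<longlongrightarrow> 1) (at_right 0)"
proof (rule tendsto_at_right_sequentially[of 0 1])
  fix X :: "nat \<Rightarrow> real"
  assume X: "\<And>n. 0 < X n" "\<And>n. X n < 1" "X \<longlonglongrightarrow> 0"
  have Xr: "filterlim X (at_right 0) sequentially"
    using X by (intro filterlim_at_withinI) auto
  have meas: "(\<lambda>\<sigma>. of_real (\<sigma>\<^sup>2 * exp (- \<sigma>\<^sup>2)) / scaled_root (X n) \<sigma>) \<in> borel_measurable lborel" for n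
    using borel_measurable_continuous_onI[OF scaled_root_continuous[OF X(1)[of n]]] by measurable
  have "(\<lambda>n. LBINT \<sigma>. of_real (\<sigma>\<^sup>2 * exp (- \<sigma>\<^sup>2)) / scaled_root (X n) \<sigma>) \<longlonglongrightarrow> (LBINT \<sigma>. complex_of_real (\<bar>\<sigma>\<bar> * exp (- \<sigma>\<^sup>2)))"
  proof (rule integral_dominated_convergence[where w="\<lambda>\<sigma>. \<bar>\<sigma>\<bar> * exp (- \<sigma>\<^sup>2)"])
    have "AE \<sigma> in lborel. \<sigma> \<noteq> (0::real)" by (rule AE_lborel_singleton)
    then show "AE \<sigma> in lborel. (\<lambda>n. of_real (\<sigma>\<^sup>2 * exp (- \<sigma>\<^sup>2)) / scaled_root (X n) \<sigma>) \<longlonglongrightarrow> complex_of_real (\<bar>\<sigma>\<bar> * exp (- \<sigma>\<^sup>2))"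
    proof eventually_elim
      case (elim \<sigma>)
      have "((\<lambda>t. scaled_root t \<sigma>) \<longlongrightarrow> of_real \<bar>\<sigma>\<bar>) (at_right 0)"
        using scaled_root_limit[of "\<bar>\<sigma>\<bar>"] elim scaled_root_even[of _ \<sigma>] by (cases "\<sigma> > 0") auto
      then have "(\<lambda>n. scaled_root (X n) \<sigma>) \<longlonglongrightarrow> of_real \<bar>\<sigma>\<bar>" using Xr by (rule filterlim_compose)
      then have "(\<lambda>n. of_real (\<sigma>\<^sup>2 * exp (- \<sigma>\<^sup>2)) / scaled_root (X n) \<sigma>) \<longlonglongrightarrow> of_real (\<sigma>\<^sup>2 * exp (- \<sigma>\<^sup>2)) / of_real \<bar>\<sigma>\<bar>"
        using elim by (intro tendsto_divide tendsto_const) auto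
      moreover have "of_real (\<sigma>\<^sup>2 * exp (- \<sigma>\<^sup>2)) / of_real \<bar>\<sigma>\<bar> = complex_of_real (\<bar>\<sigma>\<bar> * exp (- \<sigma>\<^sup>2))"
        unfolding of_real_divide[symmetric] using elim by (auto simp: abs_if power2_eq_square)
      ultimately show ?case by (simp only:)
    qed
    show "AE \<sigma> in lborel. norm (complex_of_real (\<sigma>\<^sup>2 * exp (- \<sigma>\<^sup>2)) / scaled_root (X n) \<sigma>) \<le> \<bar>\<sigma>\<bar> * exp (- \<sigma>\<^sup>2)" for n
    proof (rule AE_I2)
      fix \<sigma> :: real
      show "norm (complex_of_real (\<sigma>\<^sup>2 * exp (- \<sigma>\<^sup>2)) / scaled_root (X n) \<sigma>) \<le> \<bar>\<sigma>\<bar> * exp (- \<sigma>\<^sup>2)"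
      proof (cases "\<sigma> = 0")
        case False
        have "norm (complex_of_real (\<sigma>\<^sup>2 * exp (- \<sigma>\<^sup>2)) / scaled_root (X n) \<sigma>) \<le> (\<sigma>\<^sup>2 * exp (- \<sigma>\<^sup>2)) / \<bar>\<sigma>\<bar>"
          unfolding norm_divide norm_of_real using False scaled_root_bound[OF X(1)] by (intro frac_le) auto
        also have "\<dots> = \<bar>\<sigma>\<bar> * exp (- \<sigma>\<^sup>2)" using False by (auto simp: abs_if power2_eq_square)
        finally show ?thesis .
      qed simp
    qed
  qed (use meas gaussian_abs_moment in \<open>auto intro!: borel_measurable_of_real\<close>)
  then show "(\<lambda>n. LBINT \<sigma>. of_real (\<sigma>\<^sup>2 * exp (- \<sigma>\<^sup>2)) / scaled_root (X n) \<sigma>) \<longlonglongrightarrow> 1"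
    by (simp only: integral_complex_of_real gaussian_abs_moment of_real_1)
qed simp

lemma gaussian_log_integral:
  "(\<lambda>\<sigma>::real. 4 * \<sigma> * exp (- \<sigma>\<^sup>2) * ln (2 * \<sigma>)) absolutely_integrable_on {0<..}"
  "integral {0<..} (\<lambda>\<sigma>::real. 4 * \<sigma> * exp (- \<sigma>\<^sup>2) * ln (2 * \<sigma>)) = 2 * ln 2 - euler_mascheroni"
proof -
  let ?f = "\<lambda>s::real. 2 * (exp (- s) * (ln 2 + ln s / 2))"
  have "?f absolutely_integrable_on {0<..} \<and> integral {0<..} ?f = 2 * ln 2 - euler_mascheroni"
  proof -
    have g: "((\<lambda>s::real. exp (- s)) has_integral 1) {0<..}"
    proof -
      have "((\<lambda>x::real. exp (- 1 * x)) has_integral exp (- 1 * 0) / 1) {0..}"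
        by (rule has_integral_exp_minus_to_infinity) simp
      then show ?thesis
        by (subst has_integral_spike_set_eq[where T="{0..}"]) (auto intro: negligible_subset[of "{0}"])
    qed
    have 2: "((\<lambda>s::real. exp (- s) * ln s) has_integral - euler_mascheroni) {0<..}"
      using integrable_integral[OF exp_ln_integral(2)] unfolding exp_ln_integral(3) .
    have "((\<lambda>s::real. 2 * ln 2 * exp (- s) + exp (- s) * ln s) has_integral (2 * ln 2 * 1 + - euler_mascheroni)) {0<..}"
      by (intro has_integral_add has_integral_mult_right g 2)
    then have "(?f has_integral (2 * ln 2 - euler_mascheroni)) {0<..}" by (simp add: algebra_simps)
    moreover have "?f absolutely_integrable_on {0<..}"
    proof -
      have "(\<lambda>s::real. 2 * ln 2 * exp (- s)) absolutely_integrable_on {0<..}"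
        using g by (intro nonnegative_absolutely_integrable_1) (auto intro!: integrable_on_mult_right)
      then have "(\<lambda>s::real. 2 * ln 2 * exp (- s) + exp (- s) * ln s) absolutely_integrable_on {0<..}"
        by (rule set_integral_add(1)[OF _ exp_ln_abs_integrable])
      then show ?thesis by (simp add: algebra_simps)
    qed
    ultimately show ?thesis by (simp add: has_integral_iff)
  qed
  then have sub: "?f absolutely_integrable_on ((\<lambda>\<sigma>. \<sigma>\<^sup>2) ` {0<..}) \<and> integral ((\<lambda>\<sigma>. \<sigma>\<^sup>2) ` {0<..}) ?f = 2 * ln 2 - euler_mascheroni"
  proof -
    have "(\<lambda>\<sigma>::real. \<sigma>\<^sup>2) ` {0<..} = {0<..}"
    proof (intro equalityI subsetI)
      fix s :: real assume "s \<in> {0<..}"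
      then show "s \<in> (\<lambda>\<sigma>. \<sigma>\<^sup>2) ` {0<..}" by (intro image_eqI[of _ _ "sqrt s"]) auto
    qed auto
    then show "?f absolutely_integrable_on {0<..} \<and> integral {0<..} ?f = 2 * ln 2 - euler_mascheroni \<Longrightarrow> ?thesis" by simp
  qed
  have "(\<lambda>\<sigma>. \<bar>2 * \<sigma>\<bar> *\<^sub>R ?f (\<sigma>\<^sup>2)) absolutely_integrable_on {0<..} \<and> integral {0<..} (\<lambda>\<sigma>. \<bar>2 * \<sigma>\<bar> *\<^sub>R ?f (\<sigma>\<^sup>2)) = 2 * ln 2 - euler_mascheroni"
    using sub
  proof (subst has_absolute_integral_change_of_variables_real[where f="?f" and g="\<lambda>\<sigma>. \<sigma>\<^sup>2" and h="\<lambda>\<sigma>. 2 * \<sigma>"])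
    show "inj_on (\<lambda>\<sigma>::real. \<sigma>\<^sup>2) {0<..}" by (rule inj_onI) (auto simp: power2_eq_iff)
  qed (auto intro!: derivative_eq_intros)
  moreover have e: "\<bar>2 * \<sigma>\<bar> *\<^sub>R ?f (\<sigma>\<^sup>2) = 4 * \<sigma> * exp (- \<sigma>\<^sup>2) * ln (2 * \<sigma>)" if "\<sigma> \<in> {0<..}" for \<sigma> :: real
    using that by (simp add: ln_mult ln_realpow)
  have "(\<lambda>\<sigma>. \<bar>2 * \<sigma>\<bar> *\<^sub>R ?f (\<sigma>\<^sup>2)) absolutely_integrable_on {0<..} \<longleftrightarrow> (\<lambda>\<sigma>::real. 4 * \<sigma> * exp (- \<sigma>\<^sup>2) * ln (2 * \<sigma>)) absolutely_integrable_on {0<..}"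
    by (rule absolutely_integrable_on_cong) (rule e)
  moreover have "integral {0<..} (\<lambda>\<sigma>. \<bar>2 * \<sigma>\<bar> *\<^sub>R ?f (\<sigma>\<^sup>2)) = integral {0<..} (\<lambda>\<sigma>::real. 4 * \<sigma> * exp (- \<sigma>\<^sup>2) * ln (2 * \<sigma>))"
    by (rule integral_cong) (rule e)
  ultimately show "(\<lambda>\<sigma>::real. 4 * \<sigma> * exp (- \<sigma>\<^sup>2) * ln (2 * \<sigma>)) absolutely_integrable_on {0<..}"
    "integral {0<..} (\<lambda>\<sigma>::real. 4 * \<sigma> * exp (- \<sigma>\<^sup>2) * ln (2 * \<sigma>)) = 2 * ln 2 - euler_mascheroni" by auto
qed

text \<open>
The logarithm of this function is a primitive of \<open>1 / csqrt(\<sigma>\<^sup>2 - 2\<i>t)\<close>.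
\<close>
definition log_argument :: "real \<Rightarrow> real \<Rightarrow> complex" where "log_argument t \<sigma> = of_real \<sigma> + scaled_root t \<sigma>"

lemma scaled_root_Re: "0 \<le> Re (scaled_root t \<sigma>)"
  unfolding scaled_root_def using csqrt_principal[of "of_real (\<sigma>\<^sup>2) - 2 * \<i> * of_real t"] by (auto simp del: csqrt.sel)

lemma log_argument_bounds:
  assumes t: "t > 0" and s: "\<sigma> \<ge> 0"
  shows "log_argument t \<sigma> \<notin> \<real>\<^sub>\<le>\<^sub>0" "\<sigma> \<le> norm (log_argument t \<sigma>)" "t \<le> 1 \<Longrightarrow> norm (log_argument t \<sigma>) \<le> 2 * \<sigma> + 2"
proof -
  have nz: "scaled_root t \<sigma> \<noteq> 0"
  proof
    assume "scaled_root t \<sigma> = 0"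
    then have "of_real (\<sigma>\<^sup>2) - 2 * \<i> * of_real t = 0" by (simp add: scaled_root_def del: of_real_power)
    then show False using t by (simp add: complex_eq_iff)
  qed
  show "log_argument t \<sigma> \<notin> \<real>\<^sub>\<le>\<^sub>0"
  proof
    assume "log_argument t \<sigma> \<in> \<real>\<^sub>\<le>\<^sub>0"
    then have "Re (scaled_root t \<sigma>) = 0" "Im (scaled_root t \<sigma>) = 0"
      using s scaled_root_Re[of t \<sigma>] by (auto simp: complex_nonpos_Reals_iff log_argument_def)
    then show False using nz by (simp add: complex_eq_iff)
  qed
  show "\<sigma> \<le> norm (log_argument t \<sigma>)"
    using complex_Re_le_cmod[of "log_argument t \<sigma>"] scaled_root_Re[of t \<sigma>] by (simp add: log_argument_def)
  show "norm (log_argument t \<sigma>) \<le> 2 * \<sigma> + 2" if t1: "t \<le> 1"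
  proof -
    have "(norm (scaled_root t \<sigma>))\<^sup>2 = norm (of_real (\<sigma>\<^sup>2) - 2 * \<i> * of_real t)" by (simp add: scaled_root_def del: of_real_power)
    also have "\<dots> \<le> \<sigma>\<^sup>2 + 2 * t"
      using norm_triangle_ineq4[of "of_real (\<sigma>\<^sup>2)" "2 * \<i> * of_real t"] t by (simp add: norm_mult del: of_real_power)
    also have "\<dots> \<le> (\<sigma> + 2)\<^sup>2" using s t1 by (simp add: power2_sum)
    finally have "norm (scaled_root t \<sigma>) \<le> \<sigma> + 2" by (rule power2_le_imp_le) (use s in simp)
    then show ?thesis using norm_triangle_ineq[of "of_real \<sigma>" "scaled_root t \<sigma>"] s by (simp add: log_argument_def)
  qed
qed

lemma Ln_log_argument_derivative:
  assumes t: "t > 0" and s: "\<sigma> > 0"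
  shows "((\<lambda>\<sigma>. Ln (log_argument t \<sigma>)) has_vector_derivative 1 / scaled_root t \<sigma>) (at \<sigma>)"
proof -
  have d1: "((\<lambda>\<sigma>. complex_of_real \<sigma>) has_vector_derivative 1) (at \<sigma>)"
    by (rule has_vector_derivative_of_real[of "\<lambda>x. x" 1, simplified])
  have d2: "((\<lambda>\<sigma>. complex_of_real (\<sigma>\<^sup>2)) has_vector_derivative of_real (2 * \<sigma>)) (at \<sigma>)"
    by (rule has_vector_derivative_of_real) (auto intro!: derivative_eq_intros)
  have nz: "scaled_root t \<sigma> \<noteq> 0" using scaled_root_bound[OF t, of \<sigma>] s by auto
  have "((\<lambda>\<sigma>. of_real (\<sigma>\<^sup>2) - 2 * \<i> * of_real t) has_vector_derivative of_real (2 * \<sigma>)) (at \<sigma>)"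
    using has_vector_derivative_diff[OF d2 has_vector_derivative_const[of "2 * \<i> * of_real t"]] by simp
  from field_vector_diff_chain_at[OF this has_field_derivative_csqrt[OF scaled_root_slit[OF t]]]
  have dz: "(scaled_root t has_vector_derivative of_real (2 * \<sigma>) * inverse (2 * scaled_root t \<sigma>)) (at \<sigma>)"
    unfolding scaled_root_def o_def .
  have dw: "(log_argument t has_vector_derivative 1 + of_real (2 * \<sigma>) * inverse (2 * scaled_root t \<sigma>)) (at \<sigma>)"
    unfolding log_argument_def by (intro has_vector_derivative_add d1 dz)
  have w: "log_argument t \<sigma> \<notin> \<real>\<^sub>\<le>\<^sub>0" using log_argument_bounds(1)[OF t] s by simp
  from field_vector_diff_chain_at[OF dw has_field_derivative_Ln[OF w]]
  have "((\<lambda>\<sigma>. Ln (log_argument t \<sigma>)) has_vector_derivative (1 + of_real (2 * \<sigma>) * inverse (2 * scaled_root t \<sigma>)) * inverse (log_argument t \<sigma>)) (at \<sigma>)"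
    unfolding o_def .
  moreover have "(1 + of_real (2 * \<sigma>) * inverse (2 * scaled_root t \<sigma>)) * inverse (log_argument t \<sigma>) = 1 / scaled_root t \<sigma>"
  proof -
    have "log_argument t \<sigma> \<noteq> 0" using w by (metis nonpos_Reals_zero_I)
    moreover have "1 + of_real (2 * \<sigma>) * inverse (2 * scaled_root t \<sigma>) = log_argument t \<sigma> / scaled_root t \<sigma>"
      using nz by (simp add: log_argument_def field_simps)
    moreover have "a / b * inverse a = 1 / b" if "a \<noteq> 0" for a b :: complex using that by simp
    ultimately show ?thesis by (simp only:)
  qed
  ultimately show ?thesis by (simp only:)
qed

text \<open>
A bound that does not depend on \<open>t\<close> and is integrable against \<open>\<sigma> exp(-\<sigma>\<^sup>2)\<close>.
\<close>
lemma norm_Ln_log_argument: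
  assumes t: "0 < t" "t \<le> 1" and s: "\<sigma> > 0"
  shows "norm (Ln (log_argument t \<sigma>)) \<le> \<bar>ln (2 * \<sigma>)\<bar> + (2 * \<sigma> + 6)"
proof -
  have w0: "log_argument t \<sigma> \<noteq> 0" using log_argument_bounds(1)[OF t(1), of \<sigma>] s by (metis less_imp_le nonpos_Reals_zero_I)
  have n: "\<sigma> \<le> norm (log_argument t \<sigma>)" "norm (log_argument t \<sigma>) \<le> 2 * \<sigma> + 2" using log_argument_bounds[OF t(1)] s t by auto
  have "norm (Ln (log_argument t \<sigma>)) \<le> \<bar>Re (Ln (log_argument t \<sigma>))\<bar> + \<bar>Im (Ln (log_argument t \<sigma>))\<bar>" by (rule cmod_le)
  also have "Re (Ln (log_argument t \<sigma>)) = ln (norm (log_argument t \<sigma>))" using w0 by (rule Re_Ln)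
  also have "\<bar>ln (norm (log_argument t \<sigma>))\<bar> \<le> \<bar>ln (2 * \<sigma>)\<bar> + 1 + (2 * \<sigma> + 1)"
  proof (rule abs_leI)
    have "ln (norm (log_argument t \<sigma>)) \<le> ln (2 * \<sigma> + 2)" using n w0 s by (subst ln_le_cancel_iff) auto
    also have "\<dots> \<le> 2 * \<sigma> + 1" using ln_le_minus_one[of "2 * \<sigma> + 2"] s by simp
    finally show "ln (norm (log_argument t \<sigma>)) \<le> \<bar>ln (2 * \<sigma>)\<bar> + 1 + (2 * \<sigma> + 1)" by linarith
    have "ln \<sigma> \<le> ln (norm (log_argument t \<sigma>))" using n w0 s by (subst ln_le_cancel_iff) auto
    moreover have "ln (2 * \<sigma>) = ln 2 + ln \<sigma>" using s by (simp add: ln_mult)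
    moreover have "ln (2::real) \<le> 1" using ln_le_minus_one[of 2] by simp
    ultimately show "- ln (norm (log_argument t \<sigma>)) \<le> \<bar>ln (2 * \<sigma>)\<bar> + 1 + (2 * \<sigma> + 1)" using s by linarith
  qed
  also have "\<bar>Im (Ln (log_argument t \<sigma>))\<bar> \<le> 4" using Im_Ln_le_pi[OF w0] mpi_less_Im_Ln[OF w0] pi_less_4 by linarith
  finally show ?thesis by simp
qed

lemma log_argument_continuous: "t > 0 \<Longrightarrow> continuous_on A (log_argument t)"
  unfolding log_argument_def by (intro continuous_intros scaled_root_continuous)

lemma Ln_log_argument_measurable:
  assumes "t > 0"
  shows "(\<lambda>\<sigma>. indicator {0<..} \<sigma> *\<^sub>R (of_real (c * \<sigma> * exp (- \<sigma>\<^sup>2)) * Ln (log_argument t \<sigma>))) \<in> borel_measurable lborel"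
proof -
  have "continuous_on {0<..} (\<lambda>\<sigma>. of_real (c * \<sigma> * exp (- \<sigma>\<^sup>2)) * Ln (log_argument t \<sigma>))"
    using log_argument_bounds(1)[OF assms] by (intro continuous_intros log_argument_continuous assms) auto
  from borel_measurable_continuous_on_indicator[OF _ this] show ?thesis by simp
qed

text \<open>
The constant \<open>20\<close> is any number with \<open>4 \<sigma> (2 \<sigma> + 6) \<le> 20 (2 + \<sigma>\<^sup>2)\<close>.
\<close>
definition log_bound :: "real \<Rightarrow> real" where
  "log_bound \<sigma> = \<bar>4 * \<sigma> * exp (- \<sigma>\<^sup>2) * ln (2 * \<sigma>)\<bar> + 20 * ((2 + \<sigma>\<^sup>2) ^ 1 * exp (- 1 * \<sigma>\<^sup>2))"

lemma log_bound_integrable: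
  "set_integrable lborel {0<..} log_bound"
  "set_integrable lborel {0<..} (\<lambda>\<sigma>::real. 4 * \<sigma> * exp (- \<sigma>\<^sup>2) * ln (2 * \<sigma>))"
proof -
  have m: "(\<lambda>\<sigma>::real. indicator {0<..} \<sigma> *\<^sub>R (4 * \<sigma> * exp (- \<sigma>\<^sup>2) * ln (2 * \<sigma>))) \<in> borel_measurable lborel"
    by measurable
  have c: "integrable (completion lborel) (\<lambda>\<sigma>::real. indicator {0<..} \<sigma> *\<^sub>R (4 * \<sigma> * exp (- \<sigma>\<^sup>2) * ln (2 * \<sigma>)))"
    using gaussian_log_integral(1) unfolding set_integrable_def .
  show i: "set_integrable lborel {0<..} (\<lambda>\<sigma>::real. 4 * \<sigma> * exp (- \<sigma>\<^sup>2) * ln (2 * \<sigma>))"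
    unfolding set_integrable_def by (rule iffD1[OF integrable_completion[OF m] c])
  have "integrable lborel (\<lambda>\<sigma>::real. 20 * ((2 + \<sigma>\<^sup>2) ^ 1 * exp (- 1 * \<sigma>\<^sup>2)))"
    by (intro integrable_mult_right gaussian_polynomial_integrable) simp
  then have "set_integrable lborel {0<..} (\<lambda>\<sigma>::real. 20 * ((2 + \<sigma>\<^sup>2) ^ 1 * exp (- 1 * \<sigma>\<^sup>2)))"
    unfolding set_integrable_def by (intro integrable_mult_indicator) auto
  then show "set_integrable lborel {0<..} log_bound"
    unfolding log_bound_def by (intro set_integral_add(1) set_integrable_abs i)
qed

lemma norm_Ln_log_argument_weighted:
  assumes t: "0 < t" "t \<le> 1" and s: "\<sigma> > 0"
  shows "norm (of_real (4 * \<sigma> * exp (- \<sigma>\<^sup>2)) * Ln (log_argument t \<sigma>)) \<le> log_bound \<sigma>"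
proof -
  have "norm (of_real (4 * \<sigma> * exp (- \<sigma>\<^sup>2)) * Ln (log_argument t \<sigma>)) \<le> 4 * \<sigma> * exp (- \<sigma>\<^sup>2) * (\<bar>ln (2 * \<sigma>)\<bar> + (2 * \<sigma> + 6))"
    unfolding norm_mult norm_of_real using norm_Ln_log_argument[OF t s] s by (intro mult_mono) auto
  also have "\<dots> = \<bar>4 * \<sigma> * exp (- \<sigma>\<^sup>2) * ln (2 * \<sigma>)\<bar> + (8 * \<sigma>\<^sup>2 + 24 * \<sigma>) * exp (- \<sigma>\<^sup>2)"
    using s by (simp add: abs_mult algebra_simps power2_eq_square)
  also have "(8 * \<sigma>\<^sup>2 + 24 * \<sigma>) * exp (- \<sigma>\<^sup>2) \<le> (20 * (2 + \<sigma>\<^sup>2)) * exp (- \<sigma>\<^sup>2)"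
  proof (intro mult_right_mono)
    have "0 \<le> (\<sigma> - 1)\<^sup>2" by simp
    then show "8 * \<sigma>\<^sup>2 + 24 * \<sigma> \<le> 20 * (2 + \<sigma>\<^sup>2)" using s by (simp add: power2_diff)
  qed simp
  finally show ?thesis unfolding log_bound_def by (simp only: power_one_right mult_minus1 mult.assoc)
qed

lemma Ln_log_argument_integrable:
  assumes t: "0 < t" "t \<le> 1"
  shows "set_integrable lborel {0<..} (\<lambda>\<sigma>. of_real (4 * \<sigma> * exp (- \<sigma>\<^sup>2)) * Ln (log_argument t \<sigma>))"
  unfolding set_integrable_def
proof (rule Bochner_Integration.integrable_bound)
  show "integrable lborel (\<lambda>\<sigma>. indicator {0<..} \<sigma> *\<^sub>R log_bound \<sigma>)"
    using log_bound_integrable(1) unfolding set_integrable_def .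
  show "AE \<sigma> in lborel. norm (indicator {0<..} \<sigma> *\<^sub>R (of_real (4 * \<sigma> * exp (- \<sigma>\<^sup>2)) * Ln (log_argument t \<sigma>)))
      \<le> norm (indicator {0<..} \<sigma> *\<^sub>R log_bound \<sigma>)"
  proof (rule AE_I2)
    fix \<sigma> :: real
    show "norm (indicator {0<..} \<sigma> *\<^sub>R (of_real (4 * \<sigma> * exp (- \<sigma>\<^sup>2)) * Ln (log_argument t \<sigma>)))
      \<le> norm (indicator {0<..} \<sigma> *\<^sub>R log_bound \<sigma>)"
      using norm_Ln_log_argument_weighted[OF t, of \<sigma>] by (cases "\<sigma> > 0") (auto simp del: of_real_mult)
  qed
qed (rule Ln_log_argument_measurable[OF t(1)])

lemma gauss_Ln_vanishes:
  assumes t: "0 < t" "t \<le> 1"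
  shows "((\<lambda>\<sigma>. of_real (exp (- \<sigma>\<^sup>2)) * Ln (log_argument t \<sigma>)) \<longlongrightarrow> 0) at_top"
proof (rule Lim_null_comparison)
  show "\<forall>\<^sub>F \<sigma> in at_top. norm (of_real (exp (- \<sigma>\<^sup>2)) * Ln (log_argument t \<sigma>)) \<le> exp (- \<sigma>\<^sup>2) * (\<bar>ln (2 * \<sigma>)\<bar> + (2 * \<sigma> + 6))"
    using eventually_gt_at_top[of 0]
  proof eventually_elim
    case (elim \<sigma>)
    then show ?case
      unfolding norm_mult norm_of_real using norm_Ln_log_argument[OF t elim] by (intro mult_mono) auto
  qed
  show "((\<lambda>\<sigma>::real. exp (- \<sigma>\<^sup>2) * (\<bar>ln (2 * \<sigma>)\<bar> + (2 * \<sigma> + 6))) \<longlongrightarrow> 0) at_top"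
    by real_asymp
qed

text \<open>
Integration by parts isolates the logarithmic singularity in the boundary term at \<open>\<sigma> = 0\<close> and leaves an
integral that converges as \<open>t \<rightarrow> 0\<close>.
\<close>
lemma hankel_laplace_by_parts:
  assumes t: "0 < t" "t \<le> 1"
  shows "exp (- \<i> * of_real t) * hankel_laplace 0 t = - 2 * Ln (log_argument t 0) + (LBINT \<sigma>:{0<..}. of_real (4 * \<sigma> * exp (- \<sigma>\<^sup>2)) * Ln (log_argument t \<sigma>))"
proof -
  define F where "F = (\<lambda>\<sigma>. complex_of_real (exp (- \<sigma>\<^sup>2)) * Ln (log_argument t \<sigma>))"
  define g where "g = (\<lambda>\<sigma>. complex_of_real (exp (- \<sigma>\<^sup>2)) / scaled_root t \<sigma>)"
  define q where "q = (\<lambda>\<sigma>. complex_of_real (4 * \<sigma> * exp (- \<sigma>\<^sup>2)) * Ln (log_argument t \<sigma>))"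
  have nz: "scaled_root t \<sigma> \<noteq> 0" if "\<sigma> > 0" for \<sigma> using scaled_root_bound[OF t(1), of \<sigma>] that by auto
  have dF: "(F has_vector_derivative g \<sigma> - q \<sigma> / 2) (at \<sigma>)" if s: "\<sigma> > 0" for \<sigma>
  proof -
    have "((\<lambda>\<sigma>. complex_of_real (exp (- \<sigma>\<^sup>2))) has_vector_derivative of_real (- 2 * \<sigma> * exp (- \<sigma>\<^sup>2))) (at \<sigma>)"
      by (rule has_vector_derivative_of_real) (auto intro!: derivative_eq_intros)
    from has_vector_derivative_mult[OF this Ln_log_argument_derivative[OF t(1) s]]
    show ?thesis unfolding F_def
      by (rule has_vector_derivative_eq_rhs) (simp add: g_def q_def)
  qed
  have cont: "isCont (\<lambda>\<sigma>. g \<sigma> - q \<sigma> / 2) \<sigma>" if s: "\<sigma> > 0" for \<sigma>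
  proof -
    have "continuous_on {0<..} (\<lambda>\<sigma>. g \<sigma> - q \<sigma> / 2)"
      unfolding g_def q_def using log_argument_bounds(1)[OF t(1)] nz
      by (intro continuous_intros scaled_root_continuous log_argument_continuous t) auto
    then show ?thesis using s by (simp add: continuous_on_eq_continuous_at)
  qed
  have gi: "integrable lborel g" unfolding g_def using hankel_laplace_scaled[OF t(1)] by auto
  have gs: "set_integrable lborel {0<..} g"
    unfolding set_integrable_def by (intro integrable_mult_indicator gi) auto
  have qs: "set_integrable lborel {0<..} q" unfolding q_def by (rule Ln_log_argument_integrable[OF t])
  have hs: "set_integrable lborel {0<..} (\<lambda>\<sigma>. g \<sigma> - q \<sigma> / 2)"
    by (intro set_integral_diff(1) gs set_integrable_divide qs)
  have e: "einterval 0 \<infinity> = {0<..}" by (auto simp: einterval_def zero_ereal_def)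
  have "isCont F 0"
  proof -
    have "continuous_on {0..} F"
      unfolding F_def using log_argument_bounds(1)[OF t(1)] by (intro continuous_intros log_argument_continuous t) auto
    have "isCont (log_argument t) 0" using log_argument_continuous[OF t(1), of UNIV] by (simp add: continuous_on_eq_continuous_at)
    then show ?thesis unfolding F_def using log_argument_bounds(1)[OF t(1), of 0] by (intro continuous_intros isCont_Ln') auto
  qed
  then have F0: "(F \<longlongrightarrow> F 0) (at_right 0)"
    by (simp add: isCont_def filterlim_at_split)
  have "(LBINT \<sigma>=0..\<infinity>. g \<sigma> - q \<sigma> / 2) = 0 - F 0"
  proof (rule interval_integral_FTC_integrable)
    show "((F \<circ> real_of_ereal) \<longlongrightarrow> F 0) (at_right 0)"
      using F0 by (simp add: ereal_tendsto_simps zero_ereal_def)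
    show "((F \<circ> real_of_ereal) \<longlongrightarrow> 0) (at_left \<infinity>)"
      using gauss_Ln_vanishes[OF t] by (simp add: ereal_tendsto_simps F_def)
    show "set_integrable lborel (einterval 0 \<infinity>) (\<lambda>\<sigma>. g \<sigma> - q \<sigma> / 2)" unfolding e by (rule hs)
  qed (auto intro!: dF cont simp: zero_ereal_def)
  then have 1: "(LBINT \<sigma>:{0<..}. g \<sigma> - q \<sigma> / 2) = - Ln (log_argument t 0)"
    by (simp add: interval_lebesgue_integral_le_eq e F_def)
  have 2: "(LBINT \<sigma>:{0<..}. g \<sigma> - q \<sigma> / 2) = (LBINT \<sigma>:{0<..}. g \<sigma>) - (LBINT \<sigma>:{0<..}. q \<sigma>) / 2"
    using set_integral_diff(2)[OF gs set_integrable_divide[of 2, OF qs]] by simp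
  have 3: "(LBINT \<sigma>. g \<sigma>) = 2 * (LBINT \<sigma>:{0<..}. g \<sigma>)"
  proof -
    have "has_bochner_integral lborel (\<lambda>\<sigma>. indicator {0<..} \<sigma> *\<^sub>R g \<sigma>) (LBINT \<sigma>:{0<..}. g \<sigma>)"
      using gs unfolding set_integrable_def set_lebesgue_integral_def by (rule has_bochner_integral_integrable)
    moreover have "AE \<sigma> in lborel. indicator {0<..} \<sigma> *\<^sub>R g \<sigma> = indicator {0..} \<sigma> *\<^sub>R g \<sigma>"
      using AE_lborel_singleton[of 0] by eventually_elim (auto split: split_indicator)
    ultimately have "has_bochner_integral lborel (\<lambda>\<sigma>. indicator {0..} \<sigma> *\<^sub>R g \<sigma>) (LBINT \<sigma>:{0<..}. g \<sigma>)"
      using gi by (subst (asm) has_bochner_integral_cong_AE) (auto intro!: borel_measurable_indicator borel_measurable_scaleR dest: borel_measurable_integrable)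
    then have "has_bochner_integral lborel g (2 *\<^sub>R (LBINT \<sigma>:{0<..}. g \<sigma>))"
      by (rule has_bochner_integral_even_function) (simp add: g_def scaled_root_even)
    then show ?thesis by (simp add: has_bochner_integral_iff scaleR_conv_of_real)
  qed
  have "(LBINT \<sigma>. g \<sigma>) = exp (- \<i> * of_real t) * hankel_laplace 0 t" unfolding g_def using hankel_laplace_scaled[OF t(1)] by auto
  moreover have "(LBINT \<sigma>. g \<sigma>) = - 2 * Ln (log_argument t 0) + (LBINT \<sigma>:{0<..}. q \<sigma>)"
    unfolding 3 using 1 2 by (simp add: field_simps)
  ultimately show ?thesis unfolding q_def by (simp only:)
qed

lemma Ln_log_argument_0:
  assumes t: "t > 0"
  shows "- 2 * Ln (log_argument t 0) = \<i> * of_real (pi / 2) - of_real (ln (2 * t))"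
proof -
  have e: "log_argument t 0 = csqrt (of_real (2 * t) * (- \<i>))" by (simp add: log_argument_def scaled_root_def mult.commute mult.left_commute)
  have L: "Ln (of_real (2 * t) * (- \<i>)) = of_real (ln (2 * t)) - \<i> * of_real (pi / 2)"
    using t Ln_of_real[of "2 * t"] by (subst Ln_times_of_real) auto
  have "log_argument t 0 = exp (Ln (of_real (2 * t) * (- \<i>)) / 2)"
    unfolding e using t by (intro csqrt_exp_Ln) auto
  then have x: "log_argument t 0 = exp ((of_real (ln (2 * t)) - \<i> * of_real (pi / 2)) / 2)" unfolding L .
  have "Ln (log_argument t 0) = (of_real (ln (2 * t)) - \<i> * of_real (pi / 2)) / 2"
  proof -
    have "Im ((of_real (ln (2 * t)) - \<i> * of_real (pi / 2)) / 2) = - (pi / 4)" by simp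
    then show ?thesis unfolding x using pi_gt_zero by (intro Ln_exp) linarith+
  qed
  then show ?thesis by (simp add: field_simps)
qed

lemma log_integral_limit:
  "((\<lambda>t. LBINT \<sigma>:{0<..}. of_real (4 * \<sigma> * exp (- \<sigma>\<^sup>2)) * Ln (log_argument t \<sigma>)) \<longlongrightarrow> of_real (2 * ln 2 - euler_mascheroni)) (at_right 0)"
proof (rule tendsto_at_right_sequentially[of 0 1])
  fix X :: "nat \<Rightarrow> real"
  assume X: "\<And>n. 0 < X n" "\<And>n. X n < 1" "X \<longlonglongrightarrow> 0"
  have Xr: "filterlim X (at_right 0) sequentially"
    using X by (intro filterlim_at_withinI) auto
  have "(\<lambda>n. LBINT \<sigma>:{0<..}. of_real (4 * \<sigma> * exp (- \<sigma>\<^sup>2)) * Ln (log_argument (X n) \<sigma>)) \<longlonglongrightarrow>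
      (LBINT \<sigma>:{0<..}. complex_of_real (4 * \<sigma> * exp (- \<sigma>\<^sup>2) * ln (2 * \<sigma>)))"
    unfolding set_lebesgue_integral_def
  proof (rule integral_dominated_convergence[where w="\<lambda>\<sigma>. indicator {0<..} \<sigma> *\<^sub>R log_bound \<sigma>"])
    show "(\<lambda>\<sigma>. indicator {0<..} \<sigma> *\<^sub>R complex_of_real (4 * \<sigma> * exp (- \<sigma>\<^sup>2) * ln (2 * \<sigma>))) \<in> borel_measurable lborel"
      by measurable
    show "integrable lborel (\<lambda>\<sigma>. indicator {0<..} \<sigma> *\<^sub>R log_bound \<sigma>)"
      using log_bound_integrable(1) unfolding set_integrable_def .
    show "AE \<sigma> in lborel. (\<lambda>n. indicator {0<..} \<sigma> *\<^sub>R (of_real (4 * \<sigma> * exp (- \<sigma>\<^sup>2)) * Ln (log_argument (X n) \<sigma>)))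
        \<longlonglongrightarrow> indicator {0<..} \<sigma> *\<^sub>R complex_of_real (4 * \<sigma> * exp (- \<sigma>\<^sup>2) * ln (2 * \<sigma>))"
    proof (rule AE_I2)
      fix \<sigma> :: real
      show "(\<lambda>n. indicator {0<..} \<sigma> *\<^sub>R (of_real (4 * \<sigma> * exp (- \<sigma>\<^sup>2)) * Ln (log_argument (X n) \<sigma>)))
        \<longlonglongrightarrow> indicator {0<..} \<sigma> *\<^sub>R complex_of_real (4 * \<sigma> * exp (- \<sigma>\<^sup>2) * ln (2 * \<sigma>))"
      proof (cases "\<sigma> > 0")
        case True
        have "(\<lambda>n. scaled_root (X n) \<sigma>) \<longlonglongrightarrow> of_real \<sigma>" using scaled_root_limit[OF True] Xr by (rule filterlim_compose)
        then have "(\<lambda>n. log_argument (X n) \<sigma>) \<longlonglongrightarrow> of_real \<sigma> + of_real \<sigma>" unfolding log_argument_def by (intro tendsto_intros)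
        then have w: "(\<lambda>n. log_argument (X n) \<sigma>) \<longlonglongrightarrow> of_real (2 * \<sigma>)" by simp
        have "complex_of_real (2 * \<sigma>) \<notin> \<real>\<^sub>\<le>\<^sub>0" using True by (simp add: complex_nonpos_Reals_iff)
        from tendsto_Ln[OF w this] have "(\<lambda>n. Ln (log_argument (X n) \<sigma>)) \<longlonglongrightarrow> Ln (of_real (2 * \<sigma>))" .
        moreover have "Ln (of_real (2 * \<sigma>)) = of_real (ln (2 * \<sigma>))" using True by (intro Ln_of_real) simp
        ultimately show ?thesis using True unfolding of_real_mult[of "4 * \<sigma> * exp (- \<sigma>\<^sup>2)"] by (intro tendsto_scaleR tendsto_mult tendsto_const) simp
      qed simp
    qed
    show "AE \<sigma> in lborel. norm (indicator {0<..} \<sigma> *\<^sub>R (of_real (4 * \<sigma> * exp (- \<sigma>\<^sup>2)) * Ln (log_argument (X n) \<sigma>))) \<le> indicator {0<..} \<sigma> *\<^sub>R log_bound \<sigma>" for n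
    proof (rule AE_I2)
      fix \<sigma> :: real
      show "norm (indicator {0<..} \<sigma> *\<^sub>R (of_real (4 * \<sigma> * exp (- \<sigma>\<^sup>2)) * Ln (log_argument (X n) \<sigma>))) \<le> indicator {0<..} \<sigma> *\<^sub>R log_bound \<sigma>"
        using norm_Ln_log_argument_weighted[OF X(1)[of n] less_imp_le[OF X(2)[of n]], of \<sigma>] by (cases "\<sigma> > 0") (auto simp del: of_real_mult)
    qed
  qed (rule Ln_log_argument_measurable[OF X(1)])
  moreover have "(LBINT \<sigma>:{0<..}. complex_of_real (4 * \<sigma> * exp (- \<sigma>\<^sup>2) * ln (2 * \<sigma>))) = of_real (2 * ln 2 - euler_mascheroni)"
    unfolding set_integral_complex_of_real
    unfolding set_borel_integral_eq_integral(2)[OF log_bound_integrable(2)] gaussian_log_integral(2) ..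
  ultimately show "(\<lambda>n. LBINT \<sigma>:{0<..}. of_real (4 * \<sigma> * exp (- \<sigma>\<^sup>2)) * Ln (log_argument (X n) \<sigma>)) \<longlonglongrightarrow> of_real (2 * ln 2 - euler_mascheroni)"
    by (simp only:)
qed simp

lemma hankel_laplace_at_zero:
  "((\<lambda>t. hankel_laplace 0 t + of_real (ln (2 * t))) \<longlongrightarrow> \<i> * of_real (pi / 2) + of_real (2 * ln 2 - euler_mascheroni)) (at_right 0)"
proof -
  let ?J = "\<lambda>t. LBINT \<sigma>:{0<..}. of_real (4 * \<sigma> * exp (- \<sigma>\<^sup>2)) * Ln (log_argument t \<sigma>)"
  have ev: "\<forall>\<^sub>F t::real in at_right 0. 0 < t \<and> t < 1" by (auto simp: eventually_at_right_field intro!: exI[of _ 1])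
  have eq: "hankel_laplace 0 t + of_real (ln (2 * t)) = exp (\<i> * of_real t) * (\<i> * of_real (pi / 2) + ?J t) - (exp (\<i> * of_real t) - 1) * of_real (ln (2 * t))"
    if "0 < t \<and> t < 1" for t
  proof -
    have "exp (\<i> * of_real t) * (exp (- \<i> * of_real t) * hankel_laplace 0 t) = hankel_laplace 0 t"
      unfolding mult.assoc[symmetric] exp_add[symmetric] by simp
    moreover have "exp (- \<i> * of_real t) * hankel_laplace 0 t = (\<i> * of_real (pi / 2) - of_real (ln (2 * t))) + ?J t"
      using hankel_laplace_by_parts[of t] that unfolding Ln_log_argument_0[OF conjunct1[OF that]] by simp
    ultimately have "hankel_laplace 0 t = exp (\<i> * of_real t) * ((\<i> * of_real (pi / 2) - of_real (ln (2 * t))) + ?J t)" by (simp only:)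
    then show ?thesis by (simp add: algebra_simps)
  qed
  have small: "((\<lambda>t. (exp (\<i> * complex_of_real t) - 1) * of_real (ln (2 * t))) \<longlongrightarrow> 0) (at_right 0)"
  proof (rule Lim_null_comparison)
    show "\<forall>\<^sub>F t in at_right 0. norm ((exp (\<i> * complex_of_real t) - 1) * of_real (ln (2 * t))) \<le> t * \<bar>ln (2 * t)\<bar>"
      using ev
    proof eventually_elim
      case (elim t)
      have "norm (exp (\<i> * complex_of_real t) - exp 0) \<le> exp 0 * norm (\<i> * complex_of_real t - 0)"
        by (rule norm_exp_diff_le) auto
      then have "norm (exp (\<i> * complex_of_real t) - 1) \<le> t" using elim by (simp add: norm_mult)
      then show ?case unfolding norm_mult norm_of_real by (intro mult_right_mono) auto
    qed
    show "((\<lambda>t::real. t * \<bar>ln (2 * t)\<bar>) \<longlongrightarrow> 0) (at_right 0)" by real_asymp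
  qed
  have "((\<lambda>t. exp (\<i> * of_real t)) \<longlongrightarrow> exp (\<i> * of_real 0)) (at_right 0)" by (intro tendsto_intros)
  then have "((\<lambda>t. exp (\<i> * of_real t) * (\<i> * of_real (pi / 2) + ?J t) - (exp (\<i> * of_real t) - 1) * of_real (ln (2 * t)))
      \<longlongrightarrow> exp (\<i> * of_real 0) * (\<i> * of_real (pi / 2) + of_real (2 * ln 2 - euler_mascheroni)) - 0) (at_right 0)"
    by (intro tendsto_diff tendsto_mult tendsto_add tendsto_const log_integral_limit small)
  then have "((\<lambda>t. exp (\<i> * of_real t) * (\<i> * of_real (pi / 2) + ?J t) - (exp (\<i> * of_real t) - 1) * of_real (ln (2 * t)))
      \<longlongrightarrow> \<i> * of_real (pi / 2) + of_real (2 * ln 2 - euler_mascheroni)) (at_right 0)" by simp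
  then show ?thesis
    by (rule tendsto_cong[THEN iffD1, rotated]) (use ev in eventually_elim, simp add: eq)
qed

section \<open>Identification and asymptotics of the Hankel function\<close>

lemma times_hankel_laplace_at_zero: "((\<lambda>t. of_real t * hankel_laplace 0 t) \<longlongrightarrow> 0) (at_right 0)"
proof -
  have 1: "((\<lambda>t. of_real t * (hankel_laplace 0 t + of_real (ln (2 * t)))) \<longlongrightarrow> of_real 0 * (\<i> * of_real (pi / 2) + of_real (2 * ln 2 - euler_mascheroni))) (at_right 0)"
    by (intro tendsto_mult tendsto_of_real hankel_laplace_at_zero tendsto_ident_at)
  have 2: "((\<lambda>t::real. t * ln (2 * t)) \<longlongrightarrow> 0) (at_right 0)" by real_asymp
  have "((\<lambda>t. of_real t * (hankel_laplace 0 t + of_real (ln (2 * t))) - of_real (t * ln (2 * t))) \<longlongrightarrow> of_real 0 * (\<i> * of_real (pi / 2) + of_real (2 * ln 2 - euler_mascheroni)) - of_real 0) (at_right 0)"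
    by (intro tendsto_diff 1 tendsto_of_real 2)
  then show ?thesis by (simp add: algebra_simps)
qed

lemma times_hankel_laplace_derivative_at_zero: "((\<lambda>t. of_real t * hankel_laplace 1 t) \<longlongrightarrow> - 1) (at_right 0)"
proof -
  have 1: "((\<lambda>t. exp (\<i> * complex_of_real t)) \<longlongrightarrow> exp (\<i> * complex_of_real 0)) (at_right 0)" by (intro tendsto_intros)
  have "((\<lambda>t. \<i> * (of_real t * hankel_laplace 0 t) - exp (\<i> * of_real t) * (LBINT \<sigma>. of_real (\<sigma>\<^sup>2 * exp (- \<sigma>\<^sup>2)) / scaled_root t \<sigma>)) \<longlongrightarrow> \<i> * 0 - exp (\<i> * of_real 0) * 1) (at_right 0)"
    by (intro tendsto_diff tendsto_mult tendsto_const times_hankel_laplace_at_zero 1 scaled_second_moment_limit)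
  then have "((\<lambda>t. \<i> * (of_real t * hankel_laplace 0 t) - exp (\<i> * of_real t) * (LBINT \<sigma>. of_real (\<sigma>\<^sup>2 * exp (- \<sigma>\<^sup>2)) / scaled_root t \<sigma>)) \<longlongrightarrow> - 1) (at_right 0)" by simp
  moreover have "\<forall>\<^sub>F t in at_right 0. \<i> * (of_real t * hankel_laplace 0 t) - exp (\<i> * of_real t) * (LBINT \<sigma>. of_real (\<sigma>\<^sup>2 * exp (- \<sigma>\<^sup>2)) / scaled_root t \<sigma>) = of_real t * hankel_laplace 1 t"
    using eventually_at_right_less[of 0]
  proof eventually_elim
    case (elim t)
    then show ?case unfolding hankel_laplace_derivative_scaled[OF elim] by (simp only: mult.assoc)
  qed
  ultimately show ?thesis by (rule tendsto_cong[THEN iffD1, rotated])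
qed

definition hankel_deriv :: "real \<Rightarrow> complex" where "hankel_deriv t = - 2 * \<i> / of_real pi * hankel_laplace 1 t"

lemma Re_Im_has_derivative:
  assumes "(f has_vector_derivative d) (at t)"
  shows "((\<lambda>t. Re (f t)) has_real_derivative Re d) (at t)" "((\<lambda>t. Im (f t)) has_real_derivative Im d) (at t)"
  using bounded_linear.has_vector_derivative[OF bounded_linear_Re assms] bounded_linear.has_vector_derivative[OF bounded_linear_Im assms]
  by (simp_all add: has_real_derivative_iff_has_vector_derivative)

text \<open>
Real and imaginary part of the difference solve Bessel's equation and satisfy the hypotheses of
\<open>bessel_zero_unique\<close> at the origin: the logarithms, the Euler constants and the limits of \<open>t u'\<close> agree.
\<close>
lemma hankel_eq_laplace:
  assumes t: "t > 0"
  shows "hankel1_0 t = - 2 * \<i> / of_real pi * hankel_laplace 0 t"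
proof -
  define c where "c = - 2 * \<i> / complex_of_real pi"
  define D where "D = (\<lambda>t. hankel1_0 t - c * hankel_laplace 0 t)"
  define p where "p = (\<lambda>t. Complex (bessel_Jp t) (bessel_Yp t) - c * (of_real t * hankel_laplace 1 t))"
  have L: "(hankel_laplace 0 has_vector_derivative hankel_laplace 1 t) (at t)" if "t > 0" for t
    using hankel_laplace_derivative[OF that, of 0] by simp
  have L1: "((\<lambda>t. of_real t * hankel_laplace 1 t) has_vector_derivative - (of_real t * hankel_laplace 0 t)) (at t)" if t: "t > 0" for t
  proof -
    have d: "((\<lambda>t. complex_of_real t) has_vector_derivative 1) (at t)"
      by (rule has_vector_derivative_of_real[of "\<lambda>x. x" 1, simplified])
    have "((\<lambda>t. of_real t * hankel_laplace 1 t) has_vector_derivative (of_real t * hankel_laplace 2 t + 1 * hankel_laplace 1 t)) (at t)"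
      by (rule has_vector_derivative_mult[OF d]) (use hankel_laplace_derivative[OF t, of 1] in \<open>simp add: numeral_2_eq_2\<close>)
    moreover have "of_real t * hankel_laplace 2 t + 1 * hankel_laplace 1 t = - (of_real t * hankel_laplace 0 t)"
      using hankel_laplace_ODE[OF t] by (simp add: eq_neg_iff_add_eq_0)
    ultimately show ?thesis by (simp only:)
  qed
  have dD: "(D has_vector_derivative p t / of_real t) (at t)" if t: "t > 0" for t
  proof -
    have "(hankel1_0 has_vector_derivative Complex (bessel_Jp t / t) (bessel_Yp t / t)) (at t)"
      using bessel_system(1,3)[OF t] unfolding hankel1_0_def[abs_def]
      by (simp add: has_vector_derivative_complex_iff has_real_derivative_iff_has_vector_derivative)
    then have "(D has_vector_derivative Complex (bessel_Jp t / t) (bessel_Yp t / t) - c * hankel_laplace 1 t) (at t)"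
      unfolding D_def by (intro has_vector_derivative_diff has_vector_derivative_mult_right L t)
    moreover have "Complex (bessel_Jp t / t) (bessel_Yp t / t) - c * hankel_laplace 1 t = p t / of_real t"
      using t by (simp add: p_def complex_eq_iff diff_divide_distrib Re_divide_of_real Im_divide_of_real)
    ultimately show ?thesis by (simp only:)
  qed
  have dp: "(p has_vector_derivative - (of_real t * D t)) (at t)" if t: "t > 0" for t
  proof -
    have "((\<lambda>t. Complex (bessel_Jp t) (bessel_Yp t)) has_vector_derivative Complex (- t * bessel_J0 t) (- t * bessel_Y0 t)) (at t)"
      using bessel_system(2,4)[OF t]
      by (simp add: has_vector_derivative_complex_iff has_real_derivative_iff_has_vector_derivative)
    then have "(p has_vector_derivative Complex (- t * bessel_J0 t) (- t * bessel_Y0 t) - c * - (of_real t * hankel_laplace 0 t)) (at t)"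
      unfolding p_def by (intro has_vector_derivative_diff has_vector_derivative_mult_right L1 t)
    moreover have "Complex (- t * bessel_J0 t) (- t * bessel_Y0 t) - c * - (of_real t * hankel_laplace 0 t) = - (of_real t * D t)"
      by (simp add: D_def hankel1_0_def complex_eq_iff algebra_simps)
    ultimately show ?thesis by (simp only:)
  qed
  (* ln (t/2) + gamma of Y0 matches ln (2 t) - (2 ln 2 - gamma) of the Laplace integral. *)
  have D0: "(D \<longlongrightarrow> 0) (at_right 0)"
  proof -
    let ?g = "\<lambda>t. 2 / pi * (ln (t / 2) + euler_mascheroni)"
    have "((\<lambda>t. Complex (bessel_J0 t) (bessel_Y0 t - ?g t) - c * (hankel_laplace 0 t + of_real (ln (2 * t))))
        \<longlongrightarrow> Complex 1 0 - c * (\<i> * of_real (pi / 2) + of_real (2 * ln 2 - euler_mascheroni))) (at_right 0)"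
      by (intro tendsto_diff tendsto_mult tendsto_const tendsto_Complex bessel_at_zero hankel_laplace_at_zero)
    then have "((\<lambda>t. Complex (bessel_J0 t) (bessel_Y0 t - ?g t) - c * (hankel_laplace 0 t + of_real (ln (2 * t))) - (Complex 1 0 - c * (\<i> * of_real (pi / 2) + of_real (2 * ln 2 - euler_mascheroni))))
        \<longlongrightarrow> 0) (at_right 0)" by (simp only: LIM_zero_iff)
    moreover have "\<forall>\<^sub>F t in at_right 0. Complex (bessel_J0 t) (bessel_Y0 t - ?g t) - c * (hankel_laplace 0 t + of_real (ln (2 * t))) - (Complex 1 0 - c * (\<i> * of_real (pi / 2) + of_real (2 * ln 2 - euler_mascheroni))) = D t"
      using eventually_at_right_less[of 0]
    proof eventually_elim
      case (elim t)
      have l: "ln (t / 2) = ln t - ln 2" "ln (2 * t) = ln 2 + ln t" using elim by (simp_all add: ln_div ln_mult)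
      have c: "c = Complex 0 (- (2 / pi))" by (simp add: c_def complex_eq_iff Re_divide_of_real Im_divide_of_real)
      show ?case unfolding D_def hankel1_0_def l c by (simp add: complex_eq_iff field_simps del: of_real_euler_mascheroni)
    qed
    ultimately show ?thesis by (rule tendsto_cong[THEN iffD1, rotated])
  qed
  have p0: "(p \<longlongrightarrow> 0) (at_right 0)"
  proof -
    have "(p \<longlongrightarrow> Complex 0 (2 / pi) - c * - 1) (at_right 0)"
      unfolding p_def by (intro tendsto_diff tendsto_mult tendsto_const tendsto_Complex bessel_at_zero times_hankel_laplace_derivative_at_zero)
    moreover have "Complex 0 (2 / pi) - c * - 1 = 0"
      by (simp add: c_def complex_eq_iff Re_divide_of_real Im_divide_of_real)
    ultimately show ?thesis by simp
  qed
  have "Re (D t) = 0"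
  proof (rule bessel_zero_unique(1)[OF _ _ _ _ t])
    show "((\<lambda>t. Re (D t)) has_real_derivative Re (p t) / t) (at t)" if "t > 0" for t
      using Re_Im_has_derivative(1)[OF dD[OF that]] by (simp add: Re_divide_of_real)
    show "((\<lambda>t. Re (p t)) has_real_derivative - t * Re (D t)) (at t)" if "t > 0" for t
      using Re_Im_has_derivative(1)[OF dp[OF that]] by simp
    show "((\<lambda>t. Re (D t)) \<longlongrightarrow> 0) (at_right 0)" "((\<lambda>t. Re (p t)) \<longlongrightarrow> 0) (at_right 0)"
      using tendsto_Re[OF D0] tendsto_Re[OF p0] by simp_all
  qed
  moreover have "Im (D t) = 0"
  proof (rule bessel_zero_unique(1)[OF _ _ _ _ t])
    show "((\<lambda>t. Im (D t)) has_real_derivative Im (p t) / t) (at t)" if "t > 0" for t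
      using Re_Im_has_derivative(2)[OF dD[OF that]] by (simp add: Im_divide_of_real)
    show "((\<lambda>t. Im (p t)) has_real_derivative - t * Im (D t)) (at t)" if "t > 0" for t
      using Re_Im_has_derivative(2)[OF dp[OF that]] by simp
    show "((\<lambda>t. Im (D t)) \<longlongrightarrow> 0) (at_right 0)" "((\<lambda>t. Im (p t)) \<longlongrightarrow> 0) (at_right 0)"
      using tendsto_Im[OF D0] tendsto_Im[OF p0] by simp_all
  qed
  ultimately have "D t = 0" by (simp add: complex_eq_iff)
  then show ?thesis by (simp only: D_def c_def right_minus_eq)
qed

lemma hankel_has_derivative:
  assumes t: "t > 0"
  shows "(hankel1_0 has_vector_derivative hankel_deriv t) (at t)"
proof -
  have "((\<lambda>t. - 2 * \<i> / of_real pi * hankel_laplace 0 t) has_vector_derivative hankel_deriv t) (at t)"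
    unfolding hankel_deriv_def using hankel_laplace_derivative[OF t, of 0] by (intro has_vector_derivative_mult_right) simp
  then show ?thesis
    by (rule has_vector_derivative_transform_within_open[where S="{0<..}"]) (use t in \<open>auto simp: hankel_eq_laplace\<close>)
qed

lemma hankel_root_0: "hankel_root 0 = 1 - \<i>"
proof -
  have "csqrt ((1 - \<i>)\<^sup>2) = 1 - \<i>" by (rule csqrt_square) simp
  moreover have "(1 - \<i>)\<^sup>2 = - 2 * \<i>" by (simp add: power2_eq_square algebra_simps)
  ultimately show ?thesis by (simp add: hankel_root_def)
qed

lemma inverse_hankel_root_diff: "norm (1 / hankel_root \<tau> - 1 / hankel_root 0) \<le> \<tau>\<^sup>2"
proof -
  have r: "0 \<le> Re (hankel_root \<tau>)"
    unfolding hankel_root_def using csqrt_principal[of "of_real (\<tau>\<^sup>2) - 2 * \<i>"] by (auto simp del: csqrt.sel)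
  have "hankel_root \<tau> * hankel_root \<tau> - hankel_root 0 * hankel_root 0 = of_real (\<tau>\<^sup>2)"
    using power2_csqrt[of "of_real (\<tau>\<^sup>2) - 2 * \<i>"] power2_csqrt[of "of_real (0\<^sup>2) - 2 * \<i>"] by (simp add: hankel_root_def power2_eq_square)
  then have "(hankel_root \<tau> - hankel_root 0) * (hankel_root \<tau> + hankel_root 0) = of_real (\<tau>\<^sup>2)" by (simp add: algebra_simps)
  then have "norm (hankel_root \<tau> - hankel_root 0) * norm (hankel_root \<tau> + hankel_root 0) = \<tau>\<^sup>2"
    by (metis norm_mult norm_of_real abs_of_nonneg zero_le_power2)
  moreover have "1 \<le> norm (hankel_root \<tau> + hankel_root 0)"
    using complex_Re_le_cmod[of "hankel_root \<tau> + hankel_root 0"] r by (simp add: hankel_root_0)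
  then have "norm (hankel_root \<tau> - hankel_root 0) * 1 \<le> norm (hankel_root \<tau> - hankel_root 0) * norm (hankel_root \<tau> + hankel_root 0)"
    by (intro mult_left_mono) auto
  ultimately have d: "norm (hankel_root \<tau> - hankel_root 0) \<le> \<tau>\<^sup>2" by simp
  have "1 / hankel_root \<tau> - 1 / hankel_root 0 = (hankel_root 0 - hankel_root \<tau>) / (hankel_root \<tau> * hankel_root 0)"
    using hankel_root_nonzero[of \<tau>] hankel_root_nonzero[of 0] by (simp add: field_simps)
  then have "norm (1 / hankel_root \<tau> - 1 / hankel_root 0) = norm (hankel_root \<tau> - hankel_root 0) / (norm (hankel_root \<tau>) * norm (hankel_root 0))"
    by (simp add: norm_divide norm_mult norm_minus_commute)
  also have "\<dots> \<le> \<tau>\<^sup>2 / (1 * 1)"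
    using d hankel_root_bound[of \<tau>] hankel_root_bound[of 0] by (intro frac_le mult_mono) auto
  finally show ?thesis by simp
qed

text \<open>
Both error terms of the Hankel asymptotics are Gaussian integrals with a factor \<open>O(\<tau>\<^sup>2)\<close>, which is
worth one power of \<open>1/t\<close>.
\<close>
lemma second_moment_le:
  fixes t :: real and f :: "real \<Rightarrow> complex"
  assumes t: "t > 0" and f: "f \<in> borel_measurable lborel" "\<And>\<tau>. norm (f \<tau>) \<le> \<tau>\<^sup>2"
  shows "norm (LBINT \<tau>. f \<tau> * exp (of_real t * hankel_exponent \<tau>)) \<le> 6 * t powr (-3/2)"
proof -
  have g: "integrable lborel (\<lambda>\<tau>::real. 2 / t * exp (- (t / 2) * \<tau>\<^sup>2))"
    using t by (intro integrable_mult_right gaussian_integral) simp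
  have b: "norm (f \<tau> * exp (of_real t * hankel_exponent \<tau>)) \<le> 2 / t * exp (- (t / 2) * \<tau>\<^sup>2)" for \<tau>
  proof -
    have "norm (f \<tau> * exp (of_real t * hankel_exponent \<tau>)) \<le> \<tau>\<^sup>2 * exp (- t * \<tau>\<^sup>2)"
      unfolding norm_mult norm_hankel_exponential using f(2) by (intro mult_right_mono) auto
    also have "\<dots> = 2 / t * ((t / 2 * \<tau>\<^sup>2) * exp (- (t / 2) * \<tau>\<^sup>2) * exp (- (t / 2) * \<tau>\<^sup>2))"
      using t by (simp add: mult.assoc exp_add[symmetric] field_simps)
    also have "\<dots> \<le> 2 / t * (1 * exp (- (t / 2) * \<tau>\<^sup>2))"
    proof (intro mult_left_mono mult_right_mono)
      have "t / 2 * \<tau>\<^sup>2 \<le> exp (t / 2 * \<tau>\<^sup>2)" using exp_ge_add_one_self[of "t / 2 * \<tau>\<^sup>2"] by linarith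
      then have "t / 2 * \<tau>\<^sup>2 * exp (- (t / 2) * \<tau>\<^sup>2) \<le> exp (t / 2 * \<tau>\<^sup>2) * exp (- (t / 2) * \<tau>\<^sup>2)" by (intro mult_right_mono) auto
      also have "\<dots> = 1" by (simp add: exp_add[symmetric])
      finally show "t / 2 * \<tau>\<^sup>2 * exp (- (t / 2) * \<tau>\<^sup>2) \<le> 1" .
    qed (use t in auto)
    finally show ?thesis by simp
  qed
  have "norm (LBINT \<tau>. f \<tau> * exp (of_real t * hankel_exponent \<tau>)) \<le> (LBINT \<tau>. 2 / t * exp (- (t / 2) * \<tau>\<^sup>2))"
    by (rule Bochner_Integration.integral_norm_bound_integral) (use g b f(1) t in \<open>auto intro!: Bochner_Integration.integrable_bound[OF g]\<close>)
  also have "\<dots> = 2 / t * sqrt (pi / (t / 2))" using gaussian_integral(2)[of "t / 2"] t by simp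
  also have "pi / (t / 2) = (2 * pi) * (1 / t)" by simp
  also have "sqrt \<dots> = sqrt (2 * pi) * (1 / sqrt t)" unfolding real_sqrt_mult by (simp add: real_sqrt_divide)
  also have "2 / t * (sqrt (2 * pi) * (1 / sqrt t)) = 2 * sqrt (2 * pi) * (1 / (t * sqrt t))" by simp
  also have "1 / (t * sqrt t) = t powr (-3/2)" by (rule powr_three_halves[OF t, symmetric])
  also have "2 * sqrt (2 * pi) * t powr (-3/2) \<le> 6 * t powr (-3/2)"
  proof (intro mult_right_mono)
    have "sqrt (2 * pi) \<le> 3" using pi_less_4 by (intro real_le_lsqrt) auto
    then show "2 * sqrt (2 * pi) \<le> 6" by simp
  qed simp
  finally show ?thesis .
qed

text \<open>
The root is replaced by its value \<open>1 - \<i>\<close> at \<open>\<tau> = 0\<close>; for the derivative one uses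
\<open>p(\<tau>) = \<i> - \<tau>\<^sup>2\<close>, so that differentiation is multiplication with \<open>\<i>\<close> up to a term of lower order.
\<close>
lemma hankel_asymptotics:
  assumes t: "t > 0"
  shows "norm (hankel1_0 t - (1 - \<i>) * exp (\<i> * of_real t) / of_real (sqrt (pi * t))) \<le> 6 * t powr (-3/2)" (is ?A)
    and "norm (hankel_deriv t - \<i> * ((1 - \<i>) * exp (\<i> * of_real t) / of_real (sqrt (pi * t)))) \<le> 12 * t powr (-3/2)" (is ?B)
proof -
  let ?e = "\<lambda>\<tau>. exp (of_real t * hankel_exponent \<tau>)"
  have i0: "integrable lborel (\<lambda>\<tau>. 1 / hankel_root \<tau> * ?e \<tau>)" and i1: "integrable lborel (\<lambda>\<tau>. hankel_exponent \<tau> / hankel_root \<tau> * ?e \<tau>)"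
    using hankel_laplace_integrable[OF t, of 0] hankel_laplace_integrable[OF t, of 1] by simp_all
  have e: "?e \<tau> = exp (\<i> * of_real t) * of_real (exp (- t * \<tau>\<^sup>2))" for \<tau>
    unfolding exp_of_real[symmetric] exp_add[symmetric] by (simp add: hankel_exponent_def algebra_simps)
  have hb: "has_bochner_integral lborel (\<lambda>\<tau>. 1 / hankel_root 0 * ?e \<tau>) (1 / hankel_root 0 * (exp (\<i> * of_real t) * of_real (sqrt (pi / t))))"
    unfolding e using gaussian_integral[OF t]
    by (intro has_bochner_integral_mult_right has_bochner_integral_of_real) (simp add: has_bochner_integral_iff)
  have "norm (LBINT \<tau>. (1 / hankel_root \<tau> - 1 / hankel_root 0) * ?e \<tau>) \<le> 6 * t powr (-3/2)"
    by (rule second_moment_le[OF t _ inverse_hankel_root_diff]) measurable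
  moreover have "(LBINT \<tau>. (1 / hankel_root \<tau> - 1 / hankel_root 0) * ?e \<tau>) = hankel_laplace 0 t - 1 / hankel_root 0 * (exp (\<i> * of_real t) * of_real (sqrt (pi / t)))"
    unfolding left_diff_distrib using i0 hb
    by (subst Bochner_Integration.integral_diff) (auto simp: hankel_laplace_def has_bochner_integral_iff)
  ultimately have 1: "norm (hankel_laplace 0 t - 1 / hankel_root 0 * (exp (\<i> * of_real t) * of_real (sqrt (pi / t)))) \<le> 6 * t powr (-3/2)" by (simp only:)
  have 2: "norm (LBINT \<tau>. of_real (\<tau>\<^sup>2) / hankel_root \<tau> * ?e \<tau>) \<le> 6 * t powr (-3/2)"
  proof (rule second_moment_le[OF t])
    show "norm (of_real (\<tau>\<^sup>2) / hankel_root \<tau>) \<le> \<tau>\<^sup>2" for \<tau>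
    proof -
      have "\<tau>\<^sup>2 / norm (hankel_root \<tau>) \<le> \<tau>\<^sup>2 / 1" using hankel_root_bound[of \<tau>] by (intro frac_le) auto
      then show ?thesis by (simp add: norm_divide del: of_real_power)
    qed
  qed measurable
  have "(LBINT \<tau>. of_real (\<tau>\<^sup>2) / hankel_root \<tau> * ?e \<tau>) = (LBINT \<tau>. \<i> * (1 / hankel_root \<tau> * ?e \<tau>) - hankel_exponent \<tau> / hankel_root \<tau> * ?e \<tau>)"
  proof (rule Bochner_Integration.integral_cong[OF refl])
    fix \<tau> :: real
    have "of_real (\<tau>\<^sup>2) = \<i> - hankel_exponent \<tau>" by (simp add: hankel_exponent_def)
    then show "of_real (\<tau>\<^sup>2) / hankel_root \<tau> * ?e \<tau> = \<i> * (1 / hankel_root \<tau> * ?e \<tau>) - hankel_exponent \<tau> / hankel_root \<tau> * ?e \<tau>"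
      by (simp only: diff_divide_distrib left_diff_distrib) simp
  qed
  also have "\<dots> = \<i> * hankel_laplace 0 t - hankel_laplace 1 t"
  proof -
    have "has_bochner_integral lborel (\<lambda>\<tau>. 1 / hankel_root \<tau> * ?e \<tau>) (hankel_laplace 0 t)" "has_bochner_integral lborel (\<lambda>\<tau>. hankel_exponent \<tau> / hankel_root \<tau> * ?e \<tau>) (hankel_laplace 1 t)"
      using i0 i1 by (simp_all add: has_bochner_integral_iff hankel_laplace_def)
    then have "has_bochner_integral lborel (\<lambda>\<tau>. \<i> * (1 / hankel_root \<tau> * ?e \<tau>) - hankel_exponent \<tau> / hankel_root \<tau> * ?e \<tau>) (\<i> * hankel_laplace 0 t - hankel_laplace 1 t)"
      by (intro has_bochner_integral_diff has_bochner_integral_mult_right)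
    then show ?thesis by (rule has_bochner_integral_integral_eq)
  qed
  finally have 3: "norm (\<i> * hankel_laplace 0 t - hankel_laplace 1 t) \<le> 6 * t powr (-3/2)" using 2 by (simp only:)
  define c where "c = - 2 * \<i> / complex_of_real pi"
  have nc: "norm c \<le> 1" using pi_gt3 by (simp add: c_def norm_mult norm_divide)
  have main: "c * (1 / hankel_root 0 * (exp (\<i> * of_real t) * of_real (sqrt (pi / t)))) = (1 - \<i>) * exp (\<i> * of_real t) / of_real (sqrt (pi * t))"
  proof -
    have "1 / (1 - \<i>) = (1 + \<i>) / 2" by (simp add: complex_eq_iff Re_divide Im_divide power2_eq_square)
    then have a: "c * (1 / hankel_root 0) = (1 - \<i>) / of_real pi" unfolding hankel_root_0 c_def by (simp add: field_simps)
    have "sqrt (pi / t) = pi * (1 / sqrt (pi * t))"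
      using t by (simp add: real_sqrt_mult real_sqrt_divide field_simps)
    then have b: "complex_of_real (sqrt (pi / t)) = of_real pi * (1 / of_real (sqrt (pi * t)))" by simp
    have "c * (1 / hankel_root 0 * (exp (\<i> * of_real t) * of_real (sqrt (pi / t)))) = (c * (1 / hankel_root 0)) * (exp (\<i> * of_real t) * of_real (sqrt (pi / t)))"
      by (simp only: mult.assoc)
    also have "\<dots> = (1 - \<i>) * exp (\<i> * of_real t) / of_real (sqrt (pi * t))"
      unfolding a b by (simp del: of_real_mult)
    finally show ?thesis .
  qed
  have "hankel1_0 t - (1 - \<i>) * exp (\<i> * of_real t) / of_real (sqrt (pi * t)) = c * (hankel_laplace 0 t - 1 / hankel_root 0 * (exp (\<i> * of_real t) * of_real (sqrt (pi / t))))"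
    unfolding hankel_eq_laplace[OF t] right_diff_distrib main unfolding c_def ..
  then have "norm (hankel1_0 t - (1 - \<i>) * exp (\<i> * of_real t) / of_real (sqrt (pi * t))) \<le> 1 * (6 * t powr (-3/2))"
    using mult_mono[OF nc 1] by (simp only: norm_mult norm_ge_zero)
  then show A: ?A by simp
  have "hankel_deriv t - \<i> * hankel1_0 t = - c * (\<i> * hankel_laplace 0 t - hankel_laplace 1 t)"
    unfolding hankel_eq_laplace[OF t] hankel_deriv_def c_def by (simp add: algebra_simps)
  then have "norm (hankel_deriv t - \<i> * hankel1_0 t) \<le> 1 * (6 * t powr (-3/2))"
    using mult_mono[OF nc 3] by (simp only: norm_mult norm_minus_cancel norm_ge_zero)
  moreover have "norm (\<i> * hankel1_0 t - \<i> * ((1 - \<i>) * exp (\<i> * of_real t) / of_real (sqrt (pi * t)))) \<le> 6 * t powr (-3/2)"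
    unfolding right_diff_distrib[symmetric] norm_mult using A by simp
  ultimately show ?B
    using norm_triangle_ineq[of "hankel_deriv t - \<i> * hankel1_0 t" "\<i> * hankel1_0 t - \<i> * ((1 - \<i>) * exp (\<i> * of_real t) / of_real (sqrt (pi * t)))"]
    unfolding add_diff_eq diff_add_cancel by linarith
qed

section \<open>Far field of the direct wave\<close>

text \<open>
With \<open>d = |r u - y|\<close> one has \<open>d\<^sup>2 - (r - u \<bullet> y)\<^sup>2 = |y|\<^sup>2 - (u \<bullet> y)\<^sup>2\<close>, which is bounded, while the
sum of the two roots is at least \<open>r\<close>.
\<close>
lemma distance_expansion:
  fixes u y :: "'a :: real_inner" and r R :: real
  assumes u: "norm u = 1" and y: "norm y \<le> R" and r: "r > 0" "r \<ge> 2 * R"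
  defines "d \<equiv> norm (r *\<^sub>R u - y)"
  shows "\<bar>d - r\<bar> \<le> R" "r / 2 \<le> d" "\<bar>d - (r - u \<bullet> y)\<bar> \<le> R\<^sup>2 / r"
proof -
  have R: "0 \<le> R" using y norm_ge_zero[of y] by linarith
  have nr: "norm (r *\<^sub>R u) = r" using u r by simp
  show a: "\<bar>d - r\<bar> \<le> R"
    using norm_triangle_ineq3[of "r *\<^sub>R u - y" "r *\<^sub>R u"] y unfolding d_def nr by simp
  then show b: "r / 2 \<le> d" using r by linarith
  have uy: "\<bar>u \<bullet> y\<bar> \<le> R" using Cauchy_Schwarz_ineq2[of u y] u y by simp
  then have c: "r / 2 \<le> r - u \<bullet> y" using r by linarith
  have "d\<^sup>2 = r\<^sup>2 - 2 * r * (u \<bullet> y) + (norm y)\<^sup>2"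
    unfolding d_def power2_norm_eq_inner using u
    by (simp add: inner_diff_left inner_diff_right inner_commute power2_eq_square norm_eq_1 algebra_simps)
  then have "d\<^sup>2 - (r - u \<bullet> y)\<^sup>2 = (norm y)\<^sup>2 - (u \<bullet> y)\<^sup>2" by (simp add: power2_diff algebra_simps)
  then have "(d - (r - u \<bullet> y)) * (d + (r - u \<bullet> y)) = (norm y)\<^sup>2 - (u \<bullet> y)\<^sup>2" by (simp add: power2_eq_square algebra_simps)
  moreover have "\<bar>(norm y)\<^sup>2 - (u \<bullet> y)\<^sup>2\<bar> \<le> R\<^sup>2"
  proof -
    have "(norm y)\<^sup>2 \<le> R\<^sup>2" using y by (intro power_mono) auto
    moreover have "(u \<bullet> y)\<^sup>2 \<le> R\<^sup>2" using power_mono[OF uy, of 2] by simp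
    ultimately show ?thesis using zero_le_power2[of "norm y"] zero_le_power2[of "u \<bullet> y"] by linarith
  qed
  ultimately have "\<bar>d - (r - u \<bullet> y)\<bar> * \<bar>d + (r - u \<bullet> y)\<bar> \<le> R\<^sup>2" by (simp add: abs_mult[symmetric])
  moreover have "\<bar>d - (r - u \<bullet> y)\<bar> * r \<le> \<bar>d - (r - u \<bullet> y)\<bar> * \<bar>d + (r - u \<bullet> y)\<bar>"
    using b c by (intro mult_left_mono) auto
  ultimately show "\<bar>d - (r - u \<bullet> y)\<bar> \<le> R\<^sup>2 / r" using r by (simp add: pos_le_divide_eq)
qed

lemma half_powr_three_halves_le:
  fixes k r d :: real
  assumes "k > 0" "r > 0" "r / 2 \<le> d"
  shows "(k * d) powr (-3/2) \<le> (k / 2) powr (-3/2) * r powr (-3/2)"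
proof -
  have "(k * d) powr (-3/2) \<le> (k / 2 * r) powr (-3/2)"
    using assms mult_left_mono[OF assms(3), of k] by (intro powr_mono2') auto
  also have "\<dots> = (k / 2) powr (-3/2) * r powr (-3/2)" by (rule powr_mult)
  finally show ?thesis .
qed

lemma spherical_phase_difference:
  fixes k r R d p :: real
  assumes k: "k > 0" and R: "0 \<le> R" and r: "r > 0" and d: "r / 2 \<le> d" "\<bar>d - r\<bar> \<le> R" "\<bar>d - p\<bar> \<le> R\<^sup>2 / r"
  shows "norm (exp (\<i> * of_real (k * d)) / of_real (sqrt (pi * (k * d))) - exp (\<i> * of_real (k * p)) / of_real (sqrt (pi * k * r)))
    \<le> (2 * R + k * R\<^sup>2) / sqrt k * r powr (-3/2)"
proof -
  have d0: "0 < d" using d r by linarith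
  let ?E = "exp (\<i> * complex_of_real (k * d))" and ?P = "exp (\<i> * complex_of_real (k * p))"
  have sq: "sqrt (pi * (k * d)) = sqrt (pi * k) * sqrt d" "sqrt (pi * k * r) = sqrt (pi * k) * sqrt r"
    by (simp_all add: real_sqrt_mult)
  have "\<bar>1 / sqrt d - 1 / sqrt r\<bar> \<le> 2 * R * r powr (-3/2)"
  proof -
    have "1 / sqrt d - 1 / sqrt r = (sqrt r - sqrt d) / (sqrt d * sqrt r)" using d0 r by (simp add: field_simps)
    also have "sqrt r - sqrt d = (r - d) / (sqrt r + sqrt d)"
    proof -
      have "(sqrt r - sqrt d) * (sqrt r + sqrt d) = r - d" using d0 r by (simp add: algebra_simps)
      moreover have "sqrt r + sqrt d > 0" using d0 r by (simp add: add_pos_pos)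
      ultimately show ?thesis by (simp add: field_simps)
    qed
    also have "\<bar>(r - d) / (sqrt r + sqrt d) / (sqrt d * sqrt r)\<bar> = \<bar>d - r\<bar> / ((sqrt r + sqrt d) * (sqrt d * sqrt r))"
      using d0 r by (simp add: abs_mult abs_minus_commute add_pos_pos)
    also have "\<dots> \<le> R / (1 / 2 * (r * sqrt r))"
    proof (intro frac_le)
      have "r / 2 * sqrt r \<le> d * sqrt r" using d r by (intro mult_right_mono) auto
      also have "\<dots> = sqrt d * (sqrt d * sqrt r)" using d0 by (simp add: mult.assoc[symmetric])
      also have "\<dots> \<le> (sqrt r + sqrt d) * (sqrt d * sqrt r)" using d0 r by (intro mult_right_mono) auto
      finally show "1 / 2 * (r * sqrt r) \<le> (sqrt r + sqrt d) * (sqrt d * sqrt r)" by simp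
    qed (use d r R in auto)
    also have "\<dots> = 2 * R * r powr (-3/2)" unfolding powr_three_halves[OF r] by simp
    finally show ?thesis .
  qed
  then have 1: "norm (?E * of_real (1 / sqrt d - 1 / sqrt r)) \<le> 2 * R * r powr (-3/2)"
    unfolding norm_mult norm_of_real by (simp add: norm_exp_eq_Re)
  have 2: "norm ((?E - ?P) * of_real (1 / sqrt r)) \<le> k * R\<^sup>2 * r powr (-3/2)"
  proof -
    have "norm (?E - ?P) \<le> exp 0 * norm (\<i> * complex_of_real (k * d) - \<i> * complex_of_real (k * p))"
      by (rule norm_exp_diff_le) auto
    also have "\<i> * complex_of_real (k * d) - \<i> * complex_of_real (k * p) = \<i> * of_real (k * (d - p))" by (simp add: algebra_simps)
    also have "exp 0 * norm (\<i> * complex_of_real (k * (d - p))) = k * \<bar>d - p\<bar>"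
      using k unfolding norm_mult norm_of_real by (simp add: abs_mult)
    also have "\<dots> \<le> k * (R\<^sup>2 / r)" using d k by (intro mult_left_mono) auto
    finally have "norm ((?E - ?P) * of_real (1 / sqrt r)) \<le> k * (R\<^sup>2 / r) * (1 / sqrt r)"
      unfolding norm_mult norm_of_real using k r by (intro mult_mono) auto
    then show ?thesis unfolding powr_three_halves[OF r] by simp
  qed
  have "?E / of_real (sqrt (pi * (k * d))) - ?P / of_real (sqrt (pi * k * r)) =
     of_real (1 / sqrt (pi * k)) * (?E * of_real (1 / sqrt d - 1 / sqrt r) + (?E - ?P) * of_real (1 / sqrt r))"
    unfolding sq by (simp add: algebra_simps)
  then have "norm (?E / of_real (sqrt (pi * (k * d))) - ?P / of_real (sqrt (pi * k * r)))
    = 1 / sqrt (pi * k) * norm (?E * of_real (1 / sqrt d - 1 / sqrt r) + (?E - ?P) * of_real (1 / sqrt r))"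
    using k by (simp only: norm_mult norm_of_real) simp
  also have "\<dots> \<le> 1 / sqrt k * (2 * R * r powr (-3/2) + k * R\<^sup>2 * r powr (-3/2))"
  proof (intro mult_mono)
    have "1 * k \<le> pi * k" using k pi_gt3 by (intro mult_right_mono) auto
    then show "1 / sqrt (pi * k) \<le> 1 / sqrt k" using k by (intro divide_left_mono) auto
    show "norm (?E * of_real (1 / sqrt d - 1 / sqrt r) + (?E - ?P) * of_real (1 / sqrt r)) \<le> 2 * R * r powr (-3/2) + k * R\<^sup>2 * r powr (-3/2)"
      using norm_triangle_ineq 1 2 by (rule order_trans[OF _ add_mono])
  qed (use k in auto)
  also have "\<dots> = (2 * R + k * R\<^sup>2) / sqrt k * r powr (-3/2)" by (simp add: algebra_simps add_divide_distrib)
  finally show ?thesis .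
qed

text \<open>
The leading term of \<open>H0(k |r u - y|)\<close>, where \<open>p = r - u \<bullet> y\<close>.
\<close>
definition plane_wave :: "real \<Rightarrow> real \<Rightarrow> real \<Rightarrow> complex" where
  "plane_wave k r p = (1 - \<i>) * (exp (\<i> * of_real (k * p)) / of_real (sqrt (pi * k * r)))"

definition direct_wave :: "real \<Rightarrow> 'a :: real_inner \<Rightarrow> 'a \<Rightarrow> complex" where
  "direct_wave k x y = \<i> / 4 * hankel1_0 (k * norm (x - y))"

definition direct_wave_grad :: "real \<Rightarrow> 'a :: real_inner \<Rightarrow> 'a \<Rightarrow> 'a \<Rightarrow> complex" where
  "direct_wave_grad k x y v = \<i> / 4 * (of_real k * hankel_deriv (k * norm (x - y)) * of_real ((y - x) \<bullet> v / norm (x - y)))"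

lemma direct_wave_has_derivative:
  fixes x y :: "'a :: real_inner"
  assumes k: "k > 0" and xy: "x \<noteq> y"
  shows "(direct_wave k x has_derivative direct_wave_grad k x y) (at y)"
proof -
  have n: "((\<lambda>y. norm (x - y)) has_derivative (\<lambda>v. (y - x) \<bullet> v / norm (x - y))) (at y)"
  proof -
    have d: "((\<lambda>y. x - y) has_derivative (\<lambda>v. 0 - v)) (at y)" by (intro has_derivative_diff has_derivative_const has_derivative_ident)
    have "((\<lambda>y. norm (x - y)) has_derivative (\<lambda>v. (0 - v) \<bullet> sgn (x - y))) (at y)"
      by (rule has_derivative_compose[OF d has_derivative_norm]) (use xy in simp)
    moreover have "(0 - v) \<bullet> sgn (x - y) = (y - x) \<bullet> v / norm (x - y)" for v
    proof -
      have "(0 - v) \<bullet> (x - y) = (y - x) \<bullet> v" by (simp add: inner_diff_left inner_diff_right inner_commute)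
      then show ?thesis by (simp only: sgn_div_norm inner_scaleR_right divide_inverse mult.commute)
    qed
    ultimately show ?thesis by (simp only:)
  qed
  have n': "((\<lambda>y. k * norm (x - y)) has_derivative (\<lambda>v. k * ((y - x) \<bullet> v / norm (x - y)))) (at y)"
    by (rule has_derivative_mult_right[OF n])
  have "(hankel1_0 has_derivative (\<lambda>s. s *\<^sub>R hankel_deriv (k * norm (x - y)))) (at (k * norm (x - y)))"
    using hankel_has_derivative[of "k * norm (x - y)"] k xy unfolding has_vector_derivative_def by simp
  from has_derivative_compose[OF n' this]
  have "((\<lambda>y. hankel1_0 (k * norm (x - y))) has_derivative (\<lambda>v. (k * ((y - x) \<bullet> v / norm (x - y))) *\<^sub>R hankel_deriv (k * norm (x - y)))) (at y)" .
  from has_derivative_mult_right[OF this, of "\<i> / 4"]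
  show ?thesis unfolding direct_wave_def[abs_def] direct_wave_grad_def[abs_def]
    by (simp add: scaleR_conv_of_real mult_ac)
qed

lemma direct_wave_asymptotics:
  fixes R k :: real
  assumes k: "k > 0" and R: "0 \<le> R"
  obtains C where "C \<ge> 0" "\<And>(u::'a::real_inner) y r. norm u = 1 \<Longrightarrow> norm y \<le> R \<Longrightarrow> r > 0 \<Longrightarrow> 2 * R \<le> r \<Longrightarrow>
     norm (direct_wave k (r *\<^sub>R u) y - \<i> / 4 * plane_wave k r (r - u \<bullet> y)) \<le> C * r powr (-3/2)"
   "\<And>(u::'a::real_inner) y r v. norm u = 1 \<Longrightarrow> norm y \<le> R \<Longrightarrow> r > 0 \<Longrightarrow> 2 * R \<le> r \<Longrightarrow> norm v \<le> 1 \<Longrightarrow>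
     norm (direct_wave_grad k (r *\<^sub>R u) y v - of_real (k / 4 * (u \<bullet> v)) * plane_wave k r (r - u \<bullet> y)) \<le> C * r powr (-3/2)"
proof -
  define q where "q = (k / 2) powr (-3/2)"
  define C1 where "C1 = 12 * q + 2 * ((2 * R + k * R\<^sup>2) / sqrt k)"
  define C where "C = C1 + k * (C1 + 8 * R / sqrt k)"
  have q: "0 \<le> q" by (simp add: q_def)
  have C1: "0 \<le> C1" using q R k by (simp add: C1_def)
  have CC: "C1 \<le> C" "k * (C1 + 8 * R / sqrt k) \<le> C" using C1 R k by (simp_all add: C_def)
  have C0: "0 \<le> C" using C1 CC by linarith
  have n1: "norm (1 - \<i>) \<le> 2" using norm_triangle_ineq4[of 1 \<i>] by simp
  have main: "norm (hankel1_0 (k * d) - plane_wave k r (r - u \<bullet> y)) \<le> C1 * r powr (-3/2)"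
      "norm (hankel_deriv (k * d) - \<i> * plane_wave k r (r - u \<bullet> y)) \<le> C1 * r powr (-3/2)"
    if u: "norm u = 1" and y: "norm y \<le> R" and r: "r > 0" "2 * R \<le> r" and d: "d = norm (r *\<^sub>R u - y)" for u y :: 'a and r d
  proof -
    note D = distance_expansion[OF u y r, folded d]
    have d0: "k * d > 0" using D(2) r k by simp
    let ?w = "(1 - \<i>) * exp (\<i> * of_real (k * d)) / of_real (sqrt (pi * (k * d)))"
    let ?pr = "r powr (-3/2)"
    have pr: "0 \<le> ?pr" by simp
    have "norm (?w - plane_wave k r (r - u \<bullet> y)) = norm (1 - \<i>) * norm (exp (\<i> * of_real (k * d)) / of_real (sqrt (pi * (k * d))) - exp (\<i> * of_real (k * (r - u \<bullet> y))) / of_real (sqrt (pi * k * r)))"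
      unfolding plane_wave_def norm_mult[symmetric] by (simp only: right_diff_distrib times_divide_eq_right)
    also have "\<dots> \<le> 2 * ((2 * R + k * R\<^sup>2) / sqrt k * ?pr)"
      by (intro mult_mono n1 spherical_phase_difference k R r D) auto
    finally have w: "norm (?w - plane_wave k r (r - u \<bullet> y)) \<le> 2 * ((2 * R + k * R\<^sup>2) / sqrt k) * ?pr" by (simp only: mult.assoc)
    have h: "(k * d) powr (-3/2) \<le> q * ?pr" unfolding q_def by (rule half_powr_three_halves_le[OF k r(1) D(2)])
    have "norm (hankel1_0 (k * d) - ?w) \<le> 6 * (k * d) powr (-3/2)" by (rule hankel_asymptotics(1)[OF d0])
    then have h1: "norm (hankel1_0 (k * d) - ?w) \<le> 12 * q * ?pr" using h mult_nonneg_nonneg[OF q pr] by linarith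
    have "norm (hankel_deriv (k * d) - \<i> * ?w) \<le> 12 * (k * d) powr (-3/2)" by (rule hankel_asymptotics(2)[OF d0])
    then have h2: "norm (hankel_deriv (k * d) - \<i> * ?w) \<le> 12 * q * ?pr" using h by linarith
    have w2: "norm (\<i> * ?w - \<i> * plane_wave k r (r - u \<bullet> y)) \<le> 2 * ((2 * R + k * R\<^sup>2) / sqrt k) * ?pr"
      unfolding right_diff_distrib[symmetric] norm_mult using w by simp
    have s: "C1 * ?pr = 12 * q * ?pr + 2 * ((2 * R + k * R\<^sup>2) / sqrt k) * ?pr" by (simp only: C1_def distrib_right)
    show "norm (hankel1_0 (k * d) - plane_wave k r (r - u \<bullet> y)) \<le> C1 * ?pr"
      unfolding s by (rule norm_diff_triangle_le[OF h1 w])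
    show "norm (hankel_deriv (k * d) - \<i> * plane_wave k r (r - u \<bullet> y)) \<le> C1 * ?pr"
      unfolding s by (rule norm_diff_triangle_le[OF h2 w2])
  qed
  have "norm (direct_wave k (r *\<^sub>R u) y - \<i> / 4 * plane_wave k r (r - u \<bullet> y)) \<le> C * r powr (-3/2)"
    if u: "norm u = 1" and y: "norm y \<le> R" and r: "r > 0" "2 * R \<le> r" for u y :: 'a and r
  proof -
    have "norm (direct_wave k (r *\<^sub>R u) y - \<i> / 4 * plane_wave k r (r - u \<bullet> y)) = 1 / 4 * norm (hankel1_0 (k * norm (r *\<^sub>R u - y)) - plane_wave k r (r - u \<bullet> y))"
      unfolding direct_wave_def right_diff_distrib[symmetric] norm_mult by simp
    also have "\<dots> \<le> 1 * (C1 * r powr (-3/2))" by (intro mult_mono main u y r refl) auto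
    also have "\<dots> \<le> C * r powr (-3/2)" using CC by (simp add: mult_right_mono)
    finally show ?thesis .
  qed
  moreover have "norm (direct_wave_grad k (r *\<^sub>R u) y v - of_real (k / 4 * (u \<bullet> v)) * plane_wave k r (r - u \<bullet> y)) \<le> C * r powr (-3/2)"
    if u: "norm u = 1" and y: "norm y \<le> R" and r: "r > 0" "2 * R \<le> r" and v: "norm v \<le> 1" for u y v :: 'a and r
  proof -
    define d where "d = norm (r *\<^sub>R u - y)"
    define P where "P = plane_wave k r (r - u \<bullet> y)"
    define a where "a = (y - r *\<^sub>R u) \<bullet> v / d"
    note D = distance_expansion[OF u y r, folded d_def]
    have d0: "d > 0" using D(2) r by simp
    have A: "norm (hankel_deriv (k * d) - \<i> * P) \<le> C1 * r powr (-3/2)"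
      unfolding P_def by (rule main(2)[OF u y r d_def])
    have "\<bar>(y - r *\<^sub>R u) \<bullet> v\<bar> \<le> d * 1"
      using Cauchy_Schwarz_ineq2[of "y - r *\<^sub>R u" v] mult_left_mono[OF v, of d] d0 unfolding d_def norm_minus_commute[of "r *\<^sub>R u"] by linarith
    then have a: "\<bar>a\<bar> \<le> 1" using d0 by (simp add: a_def)
    have au: "\<bar>a + u \<bullet> v\<bar> \<le> 4 * R / r"
    proof -
      have "a + u \<bullet> v = (y + (d - r) *\<^sub>R u) \<bullet> v / d"
        using d0 by (simp add: a_def inner_diff_left inner_add_left field_simps)
      also have "\<bar>\<dots>\<bar> \<le> (2 * R) / (r / 2)"
        unfolding abs_divide
      proof (intro frac_le)
        have "\<bar>(y + (d - r) *\<^sub>R u) \<bullet> v\<bar> \<le> norm (y + (d - r) *\<^sub>R u) * norm v" by (rule Cauchy_Schwarz_ineq2)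
        also have "\<dots> \<le> (2 * R) * 1"
        proof (intro mult_mono v)
          show "norm (y + (d - r) *\<^sub>R u) \<le> 2 * R"
            using norm_triangle_ineq[of y "(d - r) *\<^sub>R u"] y D(1) u by simp
        qed (use R in auto)
        finally show "\<bar>(y + (d - r) *\<^sub>R u) \<bullet> v\<bar> \<le> 2 * R" by simp
      qed (use R D(2) d0 r in auto)
      finally show ?thesis by simp
    qed
    have P: "norm P \<le> 2 / sqrt k * (1 / sqrt r)"
    proof -
      have "norm P = norm (1 - \<i>) * (1 / (sqrt (pi * k) * sqrt r))"
        using k r unfolding P_def plane_wave_def norm_mult norm_divide norm_of_real by (simp add: norm_exp_eq_Re real_sqrt_mult)
      also have "\<dots> \<le> 2 * (1 / (sqrt k * sqrt r))"
      proof (intro mult_mono n1)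
        have "1 * k \<le> pi * k" using k pi_gt3 by (intro mult_right_mono) auto
        then show "1 / (sqrt (pi * k) * sqrt r) \<le> 1 / (sqrt k * sqrt r)" using k r by (intro divide_left_mono mult_right_mono) auto
      qed (use k r in auto)
      finally show ?thesis by simp
    qed
    have "norm (of_real a * (hankel_deriv (k * d) - \<i> * P)) \<le> 1 * (C1 * r powr (-3/2))"
      unfolding norm_mult norm_of_real by (intro mult_mono a A) auto
    moreover have "norm (of_real (a + u \<bullet> v) * (\<i> * P)) \<le> 8 * R / sqrt k * r powr (-3/2)"
    proof -
      have "norm (of_real (a + u \<bullet> v) * (\<i> * P)) = \<bar>a + u \<bullet> v\<bar> * norm P" unfolding norm_mult norm_of_real by simp
      also have "\<dots> \<le> (4 * R / r) * (2 / sqrt k * (1 / sqrt r))" using R r by (intro mult_mono au P) auto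
      also have "\<dots> = 8 * R / sqrt k * r powr (-3/2)" unfolding powr_three_halves[OF r(1)] by simp
      finally show ?thesis .
    qed
    ultimately have s: "norm (of_real a * (hankel_deriv (k * d) - \<i> * P) + of_real (a + u \<bullet> v) * (\<i> * P)) \<le> (C1 + 8 * R / sqrt k) * r powr (-3/2)"
      using norm_triangle_ineq[of "of_real a * (hankel_deriv (k * d) - \<i> * P)" "of_real (a + u \<bullet> v) * (\<i> * P)"] by (simp add: distrib_right)
    have "direct_wave_grad k (r *\<^sub>R u) y v - of_real (k / 4 * (u \<bullet> v)) * P
      = \<i> * of_real (k / 4) * (of_real a * (hankel_deriv (k * d) - \<i> * P) + of_real (a + u \<bullet> v) * (\<i> * P))"
      unfolding direct_wave_grad_def d_def[symmetric] a_def[symmetric] by (simp add: algebra_simps)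
    then have "norm (direct_wave_grad k (r *\<^sub>R u) y v - of_real (k / 4 * (u \<bullet> v)) * P)
      = k / 4 * norm (of_real a * (hankel_deriv (k * d) - \<i> * P) + of_real (a + u \<bullet> v) * (\<i> * P))"
      using k by (simp only: norm_mult norm_of_real) simp
    also have "\<dots> \<le> k * ((C1 + 8 * R / sqrt k) * r powr (-3/2))" using k by (intro mult_mono s) auto
    also have "\<dots> = k * (C1 + 8 * R / sqrt k) * r powr (-3/2)" by simp
    also have "\<dots> \<le> C * r powr (-3/2)" using CC by (intro mult_right_mono) auto
    finally show ?thesis unfolding P_def .
  qed
  ultimately show thesis using C0 that by blast
qed

section \<open>Far field of the Green function\<close>

text \<open>
The error class of the theorem: \<open>O(r^(-3/2))\<close> with constant and threshold independent of the parameter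
\<open>p\<close>, which will be the pair of observation angle and source point.
\<close>
definition uniformly_small :: "'p set \<Rightarrow> ('p \<Rightarrow> real \<Rightarrow> complex) \<Rightarrow> bool" where
  "uniformly_small P f \<longleftrightarrow> (\<exists>C r0. 0 \<le> C \<and> 0 < r0 \<and> (\<forall>p\<in>P. \<forall>r\<ge>r0. norm (f p r) \<le> C * r powr (-3/2)))"

lemma uniformly_small_add:
  assumes "uniformly_small P f" "uniformly_small P g"
  shows "uniformly_small P (\<lambda>p r. f p r + g p r)"
proof -
  obtain C r0 D s0 where "0 \<le> C" "0 < r0" "0 \<le> D" "0 < s0"
    and f: "\<And>p r. p \<in> P \<Longrightarrow> r \<ge> r0 \<Longrightarrow> norm (f p r) \<le> C * r powr (-3/2)"
    and g: "\<And>p r. p \<in> P \<Longrightarrow> r \<ge> s0 \<Longrightarrow> norm (g p r) \<le> D * r powr (-3/2)"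
    using assms unfolding uniformly_small_def by metis
  moreover have "norm (f p r + g p r) \<le> (C + D) * r powr (-3/2)" if "p \<in> P" "r \<ge> max r0 s0" for p r
    unfolding distrib_right using norm_triangle_ineq f[OF that(1)] g[OF that(1)] that(2) by (intro norm_triangle_le add_mono) auto
  ultimately show ?thesis unfolding uniformly_small_def
    by (rule_tac exI[of _ "C + D"], rule_tac exI[of _ "max r0 s0"]) auto
qed

lemma uniformly_small_mult:
  assumes "uniformly_small P f" and c: "\<And>p. p \<in> P \<Longrightarrow> norm (c p) \<le> B"
  shows "uniformly_small P (\<lambda>p r. c p * f p r)"
proof -
  obtain C r0 where C: "0 \<le> C" "0 < r0"
    and f: "\<And>p r. p \<in> P \<Longrightarrow> r \<ge> r0 \<Longrightarrow> norm (f p r) \<le> C * r powr (-3/2)"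
    using assms(1) unfolding uniformly_small_def by metis
  have "norm (c p * f p r) \<le> (\<bar>B\<bar> * C) * r powr (-3/2)" if "p \<in> P" "r \<ge> r0" for p r
  proof -
    have "norm (c p * f p r) \<le> \<bar>B\<bar> * (C * r powr (-3/2))"
      unfolding norm_mult using c[OF that(1)] f[OF that] by (intro mult_mono) auto
    then show ?thesis by (simp only: mult.assoc)
  qed
  then show ?thesis unfolding uniformly_small_def using C by (rule_tac exI[of _ "\<bar>B\<bar> * C"], rule_tac exI[of _ r0]) auto
qed

lemma uniformly_small_cmult: "uniformly_small P f \<Longrightarrow> uniformly_small P (\<lambda>p r. c * f p r)"
  by (rule uniformly_small_mult) auto

lemma uniformly_small_cong:
  assumes "uniformly_small P f" "\<And>p r. p \<in> P \<Longrightarrow> r > 0 \<Longrightarrow> g p r = f p r"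
  shows "uniformly_small P g"
proof -
  obtain C r0 where C: "0 \<le> C" "0 < r0"
    and f: "\<And>p r. p \<in> P \<Longrightarrow> r \<ge> r0 \<Longrightarrow> norm (f p r) \<le> C * r powr (-3/2)"
    using assms(1) unfolding uniformly_small_def by metis
  have "norm (g p r) \<le> C * r powr (-3/2)" if "p \<in> P" "r \<ge> r0" for p r
    unfolding assms(2)[OF that(1) less_le_trans[OF C(2) that(2)]] by (rule f[OF that])
  then show ?thesis unfolding uniformly_small_def using C by blast
qed

lemma direction_nth [simp]: "direction \<theta> $ 1 = cos \<theta>" "direction \<theta> $ 2 = sin \<theta>"
  by (simp_all add: direction_def)

lemma norm_direction [simp]: "norm (direction \<theta>) = 1"
  by (simp add: norm_vec_def L2_set_def UNIV_2)

lemma inner_2: "(u :: real^2) \<bullet> v = u $ 1 * v $ 1 + u $ 2 * v $ 2"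
  by (simp add: inner_vec_def UNIV_2)

lemma reflect_nth [simp]: "reflect y $ 1 = y $ 1" "reflect y $ 2 = - (y $ 2)"
  by (simp_all add: reflect_def)

lemma exp_quarter_pi: "exp (\<i> * complex_of_real (pi / 4)) = (1 + \<i>) / of_real (sqrt 2)"
  "exp (- \<i> * complex_of_real (pi / 4)) = (1 - \<i>) / of_real (sqrt 2)"
proof -
  have s: "sqrt 2 / 2 = 1 / sqrt 2" by (simp add: field_simps)
  show "exp (\<i> * complex_of_real (pi / 4)) = (1 + \<i>) / of_real (sqrt 2)"
    unfolding cis_conv_exp[symmetric] by (simp add: complex_eq_iff cos_45 sin_45 s)
  have "exp (- \<i> * complex_of_real (pi / 4)) = cis (- (pi / 4))" unfolding cis_conv_exp by simp
  also have "\<dots> = (1 - \<i>) / of_real (sqrt 2)" by (simp add: complex_eq_iff cos_45 sin_45 s)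
  finally show "exp (- \<i> * complex_of_real (pi / 4)) = (1 - \<i>) / of_real (sqrt 2)" .
qed

text \<open>
The radial factor of the far field. The spectral integrals, the direct wave and the gradients come with
different normalisations of it, which the next lemmas compare.
\<close>
definition outgoing :: "real \<Rightarrow> real \<Rightarrow> complex" where
  "outgoing k r = exp (\<i> * of_real (k * r)) / of_real (sqrt r) * (exp (\<i> * of_real (pi / 4)) / of_real (sqrt (8 * pi * k)))"

lemma outgoing_eq:
  assumes "k > 0" "r > 0"
  shows "outgoing k r = (1 + \<i>) / 4 * exp (\<i> * of_real (k * r)) / of_real (sqrt (pi * k * r))"
proof -
  have "sqrt (8 * pi * k) = 2 * sqrt 2 * sqrt (pi * k)"
    using real_sqrt_mult[of "4 * 2" "pi * k"] real_sqrt_mult[of 4 2] by (simp add: mult.assoc)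
  moreover have "sqrt (pi * k * r) = sqrt (pi * k) * sqrt r" by (rule real_sqrt_mult)
  moreover have "complex_of_real (sqrt 2) * of_real (sqrt 2) = 2" unfolding of_real_mult[symmetric] by simp
  ultimately show ?thesis
    unfolding outgoing_def exp_quarter_pi by (simp add: field_simps)
qed

lemma outgoing_spectral:
  assumes "k > 0" "r > 0"
  shows "(1 + \<i>) * exp (\<i> * of_real (k * r)) * of_real (sqrt (pi / (k * r))) = 4 * of_real pi * outgoing k r"
proof -
  have "sqrt (pi / (k * r)) = pi * (1 / sqrt (pi * k * r))"
    using assms by (simp add: real_sqrt_mult real_sqrt_divide field_simps)
  then have "complex_of_real (sqrt (pi / (k * r))) = of_real pi * (1 / of_real (sqrt (pi * k * r)))" by simp
  then show ?thesis unfolding outgoing_eq[OF assms] by (simp del: of_real_mult)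
qed

lemma outgoing_plane_wave:
  assumes "k > 0" "r > 0"
  shows "\<i> / 4 * plane_wave k r (r - p) = outgoing k r * exp (- \<i> * of_real (k * p))"
proof -
  have e: "exp (\<i> * complex_of_real (k * (r - p))) = exp (\<i> * of_real (k * r)) * exp (- \<i> * of_real (k * p))"
    unfolding exp_add[symmetric] by (simp add: algebra_simps)
  have i: "\<i> * (1 - \<i>) = 1 + \<i>" by (simp add: algebra_simps)
  have "\<i> / 4 * plane_wave k r (r - p) = (\<i> * (1 - \<i>)) / 4 * (exp (\<i> * complex_of_real (k * (r - p))) / of_real (sqrt (pi * k * r)))"
    unfolding plane_wave_def by simp
  then show ?thesis unfolding i e outgoing_eq[OF assms] by (simp only: times_divide_eq_left times_divide_eq_right mult.assoc)
qed

lemma outgoing_gradient: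
  assumes "k > 0"
  shows "exp (\<i> * of_real (k * r)) / of_real (sqrt r) * (exp (- \<i> * of_real (pi / 4)) * of_real (sqrt (k / (8 * pi)))) = - \<i> * of_real k * outgoing k r"
proof -
  have "sqrt (k / (8 * pi)) = k * (1 / sqrt (8 * pi * k))"
  proof -
    have "k / (8 * pi) = k\<^sup>2 / (8 * pi * k)" using assms by (simp add: power2_eq_square)
    then show ?thesis using assms by (simp add: real_sqrt_divide)
  qed
  then have s: "complex_of_real (sqrt (k / (8 * pi))) = of_real k * (1 / of_real (sqrt (8 * pi * k)))" by simp
  have "1 - \<i> = - \<i> * (1 + \<i>)" by (simp add: algebra_simps)
  then have "exp (- \<i> * complex_of_real (pi / 4)) = - \<i> * exp (\<i> * of_real (pi / 4))" unfolding exp_quarter_pi by simp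
  then show ?thesis unfolding outgoing_def s by simp
qed

context wave_numbers
begin

lemma S_scale: "\<bar>t\<bar> \<le> 1 \<Longrightarrow> S (of_real (k * t)) K = of_real k * S (of_real t) (K / k)"
proof -
  assume t: "\<bar>t\<bar> \<le> 1"
  have "\<bar>t\<bar> * k \<le> 1 * k" using t k_pos by (intro mult_right_mono) auto
  then have 1: "\<bar>k * t\<bar> < K" using k_less_K k_pos abs_mult[of k t] mult.commute[of "\<bar>t\<bar>" k] by linarith
  have "1 < K / k" using k_pos k_less_K by simp
  then have 2: "\<bar>t\<bar> < K / k" using t by linarith
  have "K\<^sup>2 - (k * t)\<^sup>2 = k\<^sup>2 * ((K / k)\<^sup>2 - t\<^sup>2)" using k_pos by (simp add: power_mult_distrib power_divide algebra_simps)
  then have "sqrt (K\<^sup>2 - (k * t)\<^sup>2) = k * sqrt ((K / k)\<^sup>2 - t\<^sup>2)" using k_pos by (simp add: real_sqrt_mult)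
  then show ?thesis using 1 2 k_pos K_pos by (simp add: S_of_real del: of_real_mult) simp
qed

text \<open>
Frequency and vertical rates at the saddle point, expressed by the observation angle \<open>\<theta> = 2\<pi> - \<phi>\<close>.
\<close>
definition xi_at :: "real \<Rightarrow> complex" where "xi_at \<theta> = of_real (k * cos \<theta>)"
definition m_at :: "real \<Rightarrow> complex" where "m_at \<theta> = \<i> * of_real (k * sin \<theta>)"
definition s_at :: "real \<Rightarrow> complex" where "s_at \<theta> = S (of_real (k * cos \<theta>)) K"

definition amplitude :: "nat \<Rightarrow> nat \<Rightarrow> nat \<Rightarrow> real \<Rightarrow> real \<Rightarrow> real \<Rightarrow> real^2 \<Rightarrow> complex" where
  "amplitude i j l \<alpha> \<beta> \<theta> y = amp i j l (y $ 1) (\<alpha> * y $ 2) (\<beta> * y $ 2) (xi_at \<theta>) (m_at \<theta>) (s_at \<theta>)"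

definition wave :: "nat \<Rightarrow> nat \<Rightarrow> nat \<Rightarrow> real \<Rightarrow> real \<Rightarrow> real^2 \<Rightarrow> real^2 \<Rightarrow> complex" where
  "wave i j l \<alpha> \<beta> x y = spectral_integral i j l (y $ 1) (\<alpha> * y $ 2) (\<beta> * y $ 2) (x $ 1) (- x $ 2)"

definition wave_deriv :: "nat \<Rightarrow> nat \<Rightarrow> nat \<Rightarrow> real \<Rightarrow> real \<Rightarrow> real^2 \<Rightarrow> real^2 \<Rightarrow> real^2 \<Rightarrow> complex" where
  "wave_deriv i j l \<alpha> \<beta> x y v = of_real (v $ 1) * (- \<i> * wave (Suc i) j l \<alpha> \<beta> x y)
        - of_real (v $ 2) * (of_real \<alpha> * wave i j (Suc l) \<alpha> \<beta> x y + of_real \<beta> * wave i (Suc j) l \<alpha> \<beta> x y)"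

text \<open>
The factor by which differentiation in direction \<open>v\<close> of the source multiplies the leading amplitude.
\<close>
definition slope :: "real \<Rightarrow> real \<Rightarrow> real \<Rightarrow> real^2 \<Rightarrow> complex" where
  "slope \<alpha> \<beta> \<theta> v = of_real (v $ 1) * (- \<i> * xi_at \<theta>) - of_real (v $ 2) * (of_real \<alpha> * s_at \<theta> + of_real \<beta> * m_at \<theta>)"

lemma wave_has_derivative:
  fixes x y :: "real^2"
  assumes "x $ 2 < 0" "0 \<le> \<alpha> * y $ 2" "0 \<le> \<beta> * y $ 2" "\<bar>\<alpha>\<bar> \<le> 1" "\<bar>\<beta>\<bar> \<le> 1"
  shows "(wave i j l \<alpha> \<beta> x has_derivative wave_deriv i j l \<alpha> \<beta> x y) (at y)"
  unfolding wave_def[abs_def] wave_deriv_def[abs_def] using assms by (intro spectral_integral_has_derivative) auto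

definition admissible :: "real \<Rightarrow> real \<Rightarrow> real \<Rightarrow> (real \<times> (real^2)) set" where
  "admissible R \<alpha> \<beta> = {(\<theta>, y :: real^2). pi < \<theta> \<and> \<theta> < 2 * pi \<and> norm y \<le> R \<and> 0 \<le> \<alpha> * y $ 2 \<and> 0 \<le> \<beta> * y $ 2}"

text \<open>
The angle of the spectral expansion is \<open>\<phi> = 2\<pi> - \<theta>\<close>, which lies in \<open>(0, \<pi>)\<close> as \<open>x\<close> is below the interface.
\<close>
lemma wave_asymptotics:
  fixes R :: real
  assumes R: "0 \<le> R" and ab: "\<bar>\<alpha>\<bar> \<le> 1" "\<bar>\<beta>\<bar> \<le> 1"
  shows "uniformly_small (admissible R \<alpha> \<beta>) (\<lambda>(\<theta>, y) r. wave i j l \<alpha> \<beta> (r *\<^sub>R direction \<theta>) y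
    - amplitude i j l \<alpha> \<beta> \<theta> y * (4 * of_real pi * outgoing k r))"
proof -
  obtain C r0 where C: "C \<ge> 0" "r0 > 0" and main:
    "\<And>y a b \<phi> \<rho>. \<lbrakk>\<bar>y\<bar> \<le> R; 0 \<le> a; a \<le> R; 0 \<le> b; b \<le> R; 0 < \<phi>; \<phi> < pi; \<rho> \<ge> r0\<rbrakk> \<Longrightarrow>
      norm ((LBINT \<xi>. spectral i j l y a b (\<rho> * cos \<phi>) (\<rho> * sin \<phi>) \<xi>)
        - amp_low i j l y a b (of_real \<phi>) * ((1 + \<i>) * exp (\<i> * of_real (k * \<rho>)) * of_real (sqrt (pi / (k * \<rho>)))))
      \<le> C * \<rho> powr (-3/2)"
    using spectral_asymptotics[OF R] by metis
  have "norm (wave i j l \<alpha> \<beta> (r *\<^sub>R direction \<theta>) y - amplitude i j l \<alpha> \<beta> \<theta> y * (4 * of_real pi * outgoing k r)) \<le> C * r powr (-3/2)"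
    if p: "(\<theta>, y) \<in> admissible R \<alpha> \<beta>" and r: "r \<ge> r0" for \<theta> r :: real and y :: "real^2"
  proof -
    from p have th: "pi < \<theta>" "\<theta> < 2 * pi" and y: "norm y \<le> R" "0 \<le> \<alpha> * y $ 2" "0 \<le> \<beta> * y $ 2" by (auto simp: admissible_def)
    have y1: "\<bar>y $ 1\<bar> \<le> R" and y2: "\<bar>y $ 2\<bar> \<le> R" using component_le_norm_cart[of y 1] component_le_norm_cart[of y 2] y by auto
    have le: "c * y $ 2 \<le> R" if "\<bar>c\<bar> \<le> 1" for c
    proof -
      have "\<bar>c * y $ 2\<bar> \<le> 1 * R" unfolding abs_mult using that y2 by (intro mult_mono) auto
      then show ?thesis by linarith
    qed
    define \<phi> where "\<phi> = 2 * pi - \<theta>"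
    have cs: "cos \<phi> = cos \<theta>" "sin \<phi> = - sin \<theta>" unfolding \<phi>_def by (simp_all add: cos_diff sin_diff)
    have "amp_low i j l (y $ 1) (\<alpha> * y $ 2) (\<beta> * y $ 2) (of_real \<phi>) = amplitude i j l \<alpha> \<beta> \<theta> y"
    proof -
      have "\<bar>k * cos \<phi>\<bar> \<le> k * 1" unfolding abs_mult using k_pos by (intro mult_mono) auto
      then have "\<bar>k * cos \<phi>\<bar> \<le> K" using k_less_K by linarith
      then have s: "s_low (of_real \<phi>) = s_at \<theta>" unfolding s_at_def cs(1)[symmetric] by (rule s_low_real)
      have x: "of_real k * cos (complex_of_real \<phi>) = xi_at \<theta>" "- \<i> * of_real k * sin (complex_of_real \<phi>) = m_at \<theta>"
        unfolding cos_of_real sin_of_real cs xi_at_def m_at_def by simp_all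
      show ?thesis unfolding amp_low_def amplitude_def s x ..
    qed
    moreover have "wave i j l \<alpha> \<beta> (r *\<^sub>R direction \<theta>) y = (LBINT \<xi>. spectral i j l (y $ 1) (\<alpha> * y $ 2) (\<beta> * y $ 2) (r * cos \<phi>) (r * sin \<phi>) \<xi>)"
      by (simp add: wave_def spectral_integral_def cs)
    moreover have "norm ((LBINT \<xi>. spectral i j l (y $ 1) (\<alpha> * y $ 2) (\<beta> * y $ 2) (r * cos \<phi>) (r * sin \<phi>) \<xi>)
        - amp_low i j l (y $ 1) (\<alpha> * y $ 2) (\<beta> * y $ 2) (of_real \<phi>) * ((1 + \<i>) * exp (\<i> * of_real (k * r)) * of_real (sqrt (pi / (k * r)))))
      \<le> C * r powr (-3/2)"
      by (rule main) (use y1 y le ab th r in \<open>auto simp: \<phi>_def\<close>)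
    ultimately show ?thesis using outgoing_spectral[OF k_pos less_le_trans[OF C(2) r]] by (simp only:)
  qed
  then show ?thesis unfolding uniformly_small_def using C by (rule_tac exI[of _ C], rule_tac exI[of _ r0]) auto
qed

lemma wave_deriv_asymptotics:
  fixes R :: real and v :: "real^2"
  assumes R: "0 \<le> R" and ab: "\<bar>\<alpha>\<bar> \<le> 1" "\<bar>\<beta>\<bar> \<le> 1"
  shows "uniformly_small (admissible R \<alpha> \<beta>) (\<lambda>(\<theta>, y) r. wave_deriv i j l \<alpha> \<beta> (r *\<^sub>R direction \<theta>) y v
    - slope \<alpha> \<beta> \<theta> v * amplitude i j l \<alpha> \<beta> \<theta> y * (4 * of_real pi * outgoing k r))"
proof -
  let ?d = "\<lambda>i j l (p :: real \<times> (real^2)) r. wave i j l \<alpha> \<beta> (r *\<^sub>R direction (fst p)) (snd p) - amplitude i j l \<alpha> \<beta> (fst p) (snd p) * (4 * of_real pi * outgoing k r)"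
  have w: "uniformly_small (admissible R \<alpha> \<beta>) (?d i j l)" for i j l
    using wave_asymptotics[OF assms, of i j l] by (rule uniformly_small_cong) (simp add: case_prod_beta)
  have A: "amplitude (Suc i) j l \<alpha> \<beta> \<theta> y = xi_at \<theta> * amplitude i j l \<alpha> \<beta> \<theta> y"
    "amplitude i (Suc j) l \<alpha> \<beta> \<theta> y = m_at \<theta> * amplitude i j l \<alpha> \<beta> \<theta> y"
    "amplitude i j (Suc l) \<alpha> \<beta> \<theta> y = s_at \<theta> * amplitude i j l \<alpha> \<beta> \<theta> y" for \<theta> y
    by (simp_all add: amplitude_def amp_def)
  have "uniformly_small (admissible R \<alpha> \<beta>) (\<lambda>p r. (- \<i> * of_real (v $ 1)) * ?d (Suc i) j l p r
     + ((- of_real (v $ 2) * of_real \<alpha>) * ?d i j (Suc l) p r + (- of_real (v $ 2) * of_real \<beta>) * ?d i (Suc j) l p r))"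
    by (intro uniformly_small_add uniformly_small_cmult w)
  then show ?thesis
    by (rule uniformly_small_cong) (simp add: case_prod_beta wave_deriv_def slope_def A algebra_simps)
qed

end

lemma uniformly_small_subset: "uniformly_small P f \<Longrightarrow> Q \<subseteq> P \<Longrightarrow> uniformly_small Q f"
  unfolding uniformly_small_def by blast

lemma uniformly_small_mono:
  assumes "uniformly_small P f" "\<And>p r. p \<in> P \<Longrightarrow> r > 0 \<Longrightarrow> norm (g p r) \<le> norm (f p r)"
  shows "uniformly_small P g"
proof -
  obtain C r0 where C: "0 \<le> C" "0 < r0"
    and f: "\<And>p r. p \<in> P \<Longrightarrow> r \<ge> r0 \<Longrightarrow> norm (f p r) \<le> C * r powr (-3/2)"
    using assms(1) unfolding uniformly_small_def by metis
  have "norm (g p r) \<le> C * r powr (-3/2)" if "p \<in> P" "r \<ge> r0" for p r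
    by (rule order_trans[OF assms(2)[OF that(1) less_le_trans[OF C(2) that(2)]] f[OF that]])
  then show ?thesis unfolding uniformly_small_def using C by blast
qed

lemma uniformly_small_Un:
  assumes "uniformly_small P f" "uniformly_small Q f"
  shows "uniformly_small (P \<union> Q) f"
proof -
  obtain C r0 D s0 where "0 \<le> C" "0 < r0" "0 \<le> D" "0 < s0"
    and f: "\<And>p r. p \<in> P \<Longrightarrow> r \<ge> r0 \<Longrightarrow> norm (f p r) \<le> C * r powr (-3/2)"
    and g: "\<And>p r. p \<in> Q \<Longrightarrow> r \<ge> s0 \<Longrightarrow> norm (f p r) \<le> D * r powr (-3/2)"
    using assms unfolding uniformly_small_def by metis
  moreover have "norm (f p r) \<le> (C + D) * r powr (-3/2)" if p: "p \<in> P \<union> Q" and r: "r \<ge> max r0 s0" for p r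
  proof -
    have "C * r powr (-3/2) \<ge> 0" "D * r powr (-3/2) \<ge> 0" using \<open>0 \<le> C\<close> \<open>0 \<le> D\<close> by simp_all
    then show ?thesis using p r f[of p r] g[of p r] unfolding distrib_right by (auto simp del: mult_nonneg_nonneg)
  qed
  ultimately show ?thesis unfolding uniformly_small_def
    by (rule_tac exI[of _ "C + D"], rule_tac exI[of _ "max r0 s0"]) auto
qed

lemma axis_nth_2 [simp]: "axis 1 (1::real) $ (2::2) = 0" "axis 2 (1::real) $ (1::2) = 0" "axis 1 (1::real) $ (1::2) = 1" "axis 2 (1::real) $ (2::2) = 1"
  by (simp_all add: axis_def)

context wave_numbers
begin

lemma xi_eq: "xi_at \<theta> = of_real k * of_real (cos \<theta>)" and m_eq: "m_at \<theta> = of_real k * (\<i> * of_real (sin \<theta>))"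
  and s_eq: "s_at \<theta> = of_real k * S (of_real (cos \<theta>)) (1 / (k / K))"
  using S_scale[of "cos \<theta>"] by (simp_all add: xi_at_def m_at_def s_at_def)

lemma m_s_squares: "(m_at \<theta> + s_at \<theta>) * (m_at \<theta> - s_at \<theta>) = of_real (K\<^sup>2 - k\<^sup>2)"
proof -
  have "(s_at \<theta>)\<^sup>2 = of_real ((k * cos \<theta>)\<^sup>2 - K\<^sup>2)" unfolding s_at_def by (rule S_power2[OF K_pos])
  moreover have "(m_at \<theta>)\<^sup>2 = of_real (- (k * sin \<theta>)\<^sup>2)" by (simp add: m_at_def power_mult_distrib)
  moreover have "- (k * sin \<theta>)\<^sup>2 - ((k * cos \<theta>)\<^sup>2 - K\<^sup>2) = K\<^sup>2 - k\<^sup>2 * ((sin \<theta>)\<^sup>2 + (cos \<theta>)\<^sup>2)"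
    unfolding power_mult_distrib distrib_left by linarith
  moreover have "(m_at \<theta> + s_at \<theta>) * (m_at \<theta> - s_at \<theta>) = (m_at \<theta>)\<^sup>2 - (s_at \<theta>)\<^sup>2"
    by (simp add: power2_eq_square algebra_simps)
  ultimately show ?thesis by (simp only: of_real_diff[symmetric] sin_cos_squared_add mult_1_right)
qed

lemma K2_k2_nonzero: "complex_of_real (K\<^sup>2 - k\<^sup>2) \<noteq> 0"
proof -
  have "k\<^sup>2 < K\<^sup>2" using k_pos k_less_K by (intro power_strict_mono) auto
  then show ?thesis unfolding of_real_eq_0_iff by simp
qed

lemma m_plus_s_nonzero: "m_at \<theta> + s_at \<theta> \<noteq> 0"
  using m_s_squares[of \<theta>] K2_k2_nonzero by auto

lemma refl_coeff_eq: "refl_coeff (k / K) \<theta> = (m_at \<theta> - s_at \<theta>) / (m_at \<theta> + s_at \<theta>)"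
  unfolding refl_coeff_def m_eq s_eq distrib_left[symmetric] right_diff_distrib[symmetric] using k_pos by simp

text \<open>
At the saddle point the polynomial numerators of the spectral integrals turn back into the transmission
and reflection coefficients, by \<open>m\<^sup>2 - s\<^sup>2 = K\<^sup>2 - k\<^sup>2\<close>.
\<close>
lemma fresnel_coefficients:
  "((m_at \<theta>)\<^sup>2 - m_at \<theta> * s_at \<theta>) / of_real (K\<^sup>2 - k\<^sup>2) = trans_coeff (k / K) \<theta> / 2"
  "((m_at \<theta>)\<^sup>2 - 2 * (m_at \<theta> * s_at \<theta>) + (s_at \<theta>)\<^sup>2) / of_real (K\<^sup>2 - k\<^sup>2) = refl_coeff (k / K) \<theta>"
proof -
  have nz: "m_at \<theta> - s_at \<theta> \<noteq> 0" using m_s_squares[of \<theta>] K2_k2_nonzero by auto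
  have f: "(m_at \<theta>)\<^sup>2 - m_at \<theta> * s_at \<theta> = m_at \<theta> * (m_at \<theta> - s_at \<theta>)" by (simp add: power2_eq_square algebra_simps)
  have t: "trans_coeff (k / K) \<theta> = 2 * m_at \<theta> / (m_at \<theta> + s_at \<theta>)"
    unfolding trans_coeff_def refl_coeff_eq using m_plus_s_nonzero[of \<theta>] by (simp add: field_simps)
  have q: "a * d / (p * d) = 2 * a / p / 2" if "d \<noteq> 0" for a d p :: complex using that by simp
  show "((m_at \<theta>)\<^sup>2 - m_at \<theta> * s_at \<theta>) / of_real (K\<^sup>2 - k\<^sup>2) = trans_coeff (k / K) \<theta> / 2"
    unfolding f t m_s_squares[of \<theta>, symmetric] by (rule q[OF nz])
  have "(m_at \<theta>)\<^sup>2 - 2 * (m_at \<theta> * s_at \<theta>) + (s_at \<theta>)\<^sup>2 = (m_at \<theta> - s_at \<theta>) * (m_at \<theta> - s_at \<theta>)" by (simp add: power2_eq_square algebra_simps)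
  then show "((m_at \<theta>)\<^sup>2 - 2 * (m_at \<theta> * s_at \<theta>) + (s_at \<theta>)\<^sup>2) / of_real (K\<^sup>2 - k\<^sup>2) = refl_coeff (k / K) \<theta>"
    unfolding m_s_squares[of \<theta>, symmetric] refl_coeff_eq using nz by simp
qed

definition transmitted :: "real \<Rightarrow> real^2 \<Rightarrow> complex" where
  "transmitted \<theta> y = trans_coeff (k / K) \<theta> * exp (- \<i> * of_real k *
          (of_real (y $ 1 * cos \<theta>) - \<i> * of_real (y $ 2) * S (of_real (cos \<theta>)) (1 / (k / K))))"

definition reflected :: "real \<Rightarrow> real^2 \<Rightarrow> complex" where
  "reflected \<theta> y = refl_coeff (k / K) \<theta> * exp (- \<i> * of_real (k * (direction \<theta> \<bullet> reflect y)))"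

lemma transmitted_eq:
  "1 / (2 * of_real pi * of_real (K\<^sup>2 - k\<^sup>2)) * (amplitude 0 2 0 1 0 \<theta> y - amplitude 0 1 1 1 0 \<theta> y) * (4 * of_real pi) = transmitted \<theta> y"
proof -
  let ?e = "exp (- (\<i> * xi_at \<theta> * of_real (y $ 1)) - s_at \<theta> * of_real (y $ 2))"
  have e: "- \<i> * of_real k * (of_real (y $ 1 * cos \<theta>) - \<i> * of_real (y $ 2) * S (of_real (cos \<theta>)) (1 / (k / K))) = - (\<i> * xi_at \<theta> * of_real (y $ 1)) - s_at \<theta> * of_real (y $ 2)"
    unfolding xi_eq s_eq by (simp add: algebra_simps)
  have A: "amplitude 0 2 0 1 0 \<theta> y - amplitude 0 1 1 1 0 \<theta> y = ((m_at \<theta>)\<^sup>2 - m_at \<theta> * s_at \<theta>) * ?e"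
    by (simp add: amplitude_def amp_def algebra_simps)
  have q: "1 / (2 * of_real pi * D) * (a * ?e) * (4 * of_real pi) = a / D * 2 * ?e" for a D :: complex
    by simp
  show ?thesis unfolding A transmitted_def e q fresnel_coefficients by simp
qed

lemma reflected_eq:
  "1 / (4 * of_real pi * of_real (K\<^sup>2 - k\<^sup>2)) * (amplitude 0 2 0 0 (- 1) \<theta> y - 2 * amplitude 0 1 1 0 (- 1) \<theta> y + amplitude 0 0 2 0 (- 1) \<theta> y) * (4 * of_real pi) = reflected \<theta> y"
proof -
  let ?e = "exp (- (\<i> * xi_at \<theta> * of_real (y $ 1)) + m_at \<theta> * of_real (y $ 2))"
  have e: "- \<i> * of_real (k * (direction \<theta> \<bullet> reflect y)) = - (\<i> * xi_at \<theta> * of_real (y $ 1)) + m_at \<theta> * of_real (y $ 2)"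
    unfolding xi_eq m_eq inner_2 by (simp add: algebra_simps)
  have A: "amplitude 0 2 0 0 (- 1) \<theta> y - 2 * amplitude 0 1 1 0 (- 1) \<theta> y + amplitude 0 0 2 0 (- 1) \<theta> y = ((m_at \<theta>)\<^sup>2 - 2 * (m_at \<theta> * s_at \<theta>) + (s_at \<theta>)\<^sup>2) * ?e"
    by (simp add: amplitude_def amp_def algebra_simps)
  have "1 / (4 * of_real pi * D) * (a * ?e) * (4 * of_real pi) = a / D * ?e" for a D :: complex
    by simp
  then show ?thesis unfolding A reflected_def e fresnel_coefficients(2)[symmetric] by (simp only:)
qed

definition upper_grad :: "real^2 \<Rightarrow> real^2 \<Rightarrow> real^2 \<Rightarrow> complex" where
  "upper_grad x y v = 1 / (2 * of_real pi * of_real (K\<^sup>2 - k\<^sup>2)) * (wave_deriv 0 2 0 1 0 x y v - wave_deriv 0 1 1 1 0 x y v)"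

definition lower_grad :: "real^2 \<Rightarrow> real^2 \<Rightarrow> real^2 \<Rightarrow> complex" where
  "lower_grad x y v = direct_wave_grad k x y v + 1 / (4 * of_real pi * of_real (K\<^sup>2 - k\<^sup>2)) *
     (wave_deriv 0 2 0 0 (- 1) x y v - 2 * wave_deriv 0 1 1 0 (- 1) x y v + wave_deriv 0 0 2 0 (- 1) x y v)"

lemma green_upper_wave:
  fixes x y :: "real^2"
  assumes "x $ 2 < 0" "y \<in> upper_half"
  shows "layered_green K k x y = 1 / (2 * of_real pi * of_real (K\<^sup>2 - k\<^sup>2)) * (wave 0 2 0 1 0 x y - wave 0 1 1 1 0 x y)"
  unfolding green_upper[OF assms] wave_def by simp

lemma green_lower_wave:
  fixes x y :: "real^2"
  assumes "x $ 2 < 0" "y \<in> lower_half"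
  shows "layered_green K k x y = direct_wave k x y + 1 / (4 * of_real pi * of_real (K\<^sup>2 - k\<^sup>2)) *
    (wave 0 2 0 0 (- 1) x y - 2 * wave 0 1 1 0 (- 1) x y + wave 0 0 2 0 (- 1) x y)"
  unfolding green_lower[OF assms] wave_def direct_wave_def by simp

lemma green_upper_derivative:
  fixes x y :: "real^2"
  assumes x: "x $ 2 < 0" and y: "y \<in> upper_half"
  shows "(layered_green K k x has_derivative upper_grad x y) (at y)"
proof -
  have o: "open upper_half" unfolding upper_half_def by (rule open_halfspace_component_gt_cart)
  have y2: "y $ 2 > 0" using y by (simp add: upper_half_def)
  have "((\<lambda>y. 1 / (2 * of_real pi * of_real (K\<^sup>2 - k\<^sup>2)) * (wave 0 2 0 1 0 x y - wave 0 1 1 1 0 x y)) has_derivative upper_grad x y) (at y)"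
    unfolding upper_grad_def[abs_def] using x y2
    by (intro has_derivative_mult_right has_derivative_diff wave_has_derivative) auto
  then show ?thesis
    by (rule has_derivative_transform_within_open[OF _ o y]) (simp only: green_upper_wave[OF x])
qed

lemma green_lower_derivative:
  fixes x y :: "real^2"
  assumes x: "x $ 2 < 0" and y: "y \<in> lower_half" and xy: "x \<noteq> y"
  shows "(layered_green K k x has_derivative lower_grad x y) (at y)"
proof -
  have o: "open lower_half" unfolding lower_half_def by (rule open_halfspace_component_lt_cart)
  have y2: "y $ 2 < 0" using y by (simp add: lower_half_def)
  have "((\<lambda>y. direct_wave k x y + 1 / (4 * of_real pi * of_real (K\<^sup>2 - k\<^sup>2)) *
    (wave 0 2 0 0 (- 1) x y - 2 * wave 0 1 1 0 (- 1) x y + wave 0 0 2 0 (- 1) x y)) has_derivative lower_grad x y) (at y)"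
    unfolding lower_grad_def[abs_def] using x y2
    by (intro has_derivative_add has_derivative_mult_right has_derivative_diff wave_has_derivative direct_wave_has_derivative k_pos xy) auto
  then show ?thesis
    by (rule has_derivative_transform_within_open[OF _ o y]) (simp only: green_lower_wave[OF x])
qed

lemma grad_component: "(layered_green K k x has_derivative D) (at y) \<Longrightarrow> layered_green_grad K k x y $ j = D (axis j 1)"
  using frechet_derivative_at[of "layered_green K k x" D y] by (simp add: layered_green_grad_def)

definition upper_params :: "real \<Rightarrow> (real \<times> (real^2)) set" where
  "upper_params R = {pi<..<2*pi} \<times> upper_half_disc R"
definition lower_params :: "real \<Rightarrow> (real \<times> (real^2)) set" where
  "lower_params R = {pi<..<2*pi} \<times> lower_half_disc R"

lemma params_admissible: "upper_params R \<subseteq> admissible R 1 0" "lower_params R \<subseteq> admissible R 0 (- 1)"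
  by (auto simp: upper_params_def lower_params_def admissible_def upper_half_disc_def lower_half_disc_def upper_half_def lower_half_def)

lemma observation_below:
  assumes "pi < \<theta>" "\<theta> < 2 * pi" "r > 0"
  shows "(r *\<^sub>R direction \<theta>) $ 2 < 0"
proof -
  have "sin \<theta> < 0" using assms by (rule_tac sin_lt_zero)
  then show ?thesis using assms by (simp add: mult_less_0_iff)
qed

abbreviation green_remainder :: "real \<times> (real^2) \<Rightarrow> real \<Rightarrow> complex" where
  "green_remainder p r \<equiv> layered_green K k (r *\<^sub>R direction (fst p)) (snd p)
     - exp (\<i> * of_real (k * r)) / of_real (sqrt r) * G_inf K k (fst p) (snd p)"

abbreviation grad_remainder :: "real \<times> (real^2) \<Rightarrow> real \<Rightarrow> complex^2" where
  "grad_remainder p r \<equiv> layered_green_grad K k (r *\<^sub>R direction (fst p)) (snd p)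
     - (exp (\<i> * of_real (k * r)) / of_real (sqrt r)) *s H_inf K k (fst p) (snd p)"

lemma wave_asymptotics_on:
  assumes "0 \<le> R" "\<bar>\<alpha>\<bar> \<le> 1" "\<bar>\<beta>\<bar> \<le> 1" "P \<subseteq> admissible R \<alpha> \<beta>"
  shows "uniformly_small P (\<lambda>p r. wave i j l \<alpha> \<beta> (r *\<^sub>R direction (fst p)) (snd p)
    - amplitude i j l \<alpha> \<beta> (fst p) (snd p) * (4 * of_real pi * outgoing k r))"
    and "uniformly_small P (\<lambda>p r. wave_deriv i j l \<alpha> \<beta> (r *\<^sub>R direction (fst p)) (snd p) v
    - slope \<alpha> \<beta> (fst p) v * amplitude i j l \<alpha> \<beta> (fst p) (snd p) * (4 * of_real pi * outgoing k r))"
proof -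
  show "uniformly_small P (\<lambda>p r. wave i j l \<alpha> \<beta> (r *\<^sub>R direction (fst p)) (snd p)
    - amplitude i j l \<alpha> \<beta> (fst p) (snd p) * (4 * of_real pi * outgoing k r))"
    using uniformly_small_subset[OF wave_asymptotics[OF assms(1-3), of i j l] assms(4)]
    by (rule uniformly_small_cong) (simp add: case_prod_beta)
  show "uniformly_small P (\<lambda>p r. wave_deriv i j l \<alpha> \<beta> (r *\<^sub>R direction (fst p)) (snd p) v
    - slope \<alpha> \<beta> (fst p) v * amplitude i j l \<alpha> \<beta> (fst p) (snd p) * (4 * of_real pi * outgoing k r))"
    using uniformly_small_subset[OF wave_deriv_asymptotics[OF assms(1-3), of i j l v] assms(4)]
    by (rule uniformly_small_cong) (simp add: case_prod_beta)
qed

lemma outgoing_profile: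
  "y \<in> upper_half \<Longrightarrow> exp (\<i> * of_real (k * r)) / of_real (sqrt r) * G_inf K k \<theta> y = outgoing k r * transmitted \<theta> y"
  "y \<notin> upper_half \<Longrightarrow> exp (\<i> * of_real (k * r)) / of_real (sqrt r) * G_inf K k \<theta> y = outgoing k r * (exp (- \<i> * of_real (k * (direction \<theta> \<bullet> y))) + reflected \<theta> y)"
  unfolding G_inf_def outgoing_def transmitted_def reflected_def Let_def by (simp_all only: if_True if_False mult.assoc)

lemma outgoing_profile_grad:
  "y \<in> upper_half \<Longrightarrow> ((exp (\<i> * of_real (k * r)) / of_real (sqrt r)) *s H_inf K k \<theta> y) $ j = outgoing k r * transmitted \<theta> y * slope 1 0 \<theta> (axis j 1)"
  "y \<notin> upper_half \<Longrightarrow> ((exp (\<i> * of_real (k * r)) / of_real (sqrt r)) *s H_inf K k \<theta> y) $ j =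
     - \<i> * of_real k * outgoing k r * exp (- \<i> * of_real (k * (direction \<theta> \<bullet> y))) * of_real (direction \<theta> \<bullet> axis j 1) + outgoing k r * reflected \<theta> y * slope 0 (- 1) \<theta> (axis j 1)"
proof -
  define E where "E = exp (\<i> * of_real (k * r)) / of_real (sqrt r)"
  define F where "F = exp (- \<i> * complex_of_real (pi/4)) * complex_of_real (sqrt (k / (8 * pi)))"
  have EF: "E * (F * z) = - \<i> * of_real k * outgoing k r * z" for z
    unfolding mult.assoc[symmetric] E_def F_def using outgoing_gradient[OF k_pos, of r] by (simp only: mult.assoc)
  define s where "s = S (of_real (cos \<theta>)) (1 / (k / K))"
  have sl: "s_at \<theta> = of_real k * s" unfolding s_def by (rule s_eq)
  { assume y: "y \<in> upper_half"
    have "((exp (\<i> * of_real (k * r)) / of_real (sqrt r)) *s H_inf K k \<theta> y) $ j = E * (F * (transmitted \<theta> y * (vector [complex_of_real (cos \<theta>), - \<i> * s] :: complex^2) $ j))"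
      using y unfolding H_inf_def Let_def E_def[symmetric] F_def[symmetric] transmitted_def s_def[symmetric] by simp
    also have "\<dots> = outgoing k r * transmitted \<theta> y * slope 1 0 \<theta> (axis j 1)"
      unfolding EF using exhaust_2[of j] by (auto simp: slope_def sl xi_eq algebra_simps)
    finally show "((exp (\<i> * of_real (k * r)) / of_real (sqrt r)) *s H_inf K k \<theta> y) $ j = outgoing k r * transmitted \<theta> y * slope 1 0 \<theta> (axis j 1)" . }
  { assume y: "y \<notin> upper_half"
    let ?e = "exp (- \<i> * complex_of_real (k * (direction \<theta> \<bullet> y)))"
    have "((exp (\<i> * of_real (k * r)) / of_real (sqrt r)) *s H_inf K k \<theta> y) $ j =
       E * (F * (?e * (vector [complex_of_real (cos \<theta>), of_real (sin \<theta>)] :: complex^2) $ j + reflected \<theta> y * (vector [complex_of_real (cos \<theta>), - of_real (sin \<theta>)] :: complex^2) $ j))"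
      using y unfolding H_inf_def Let_def E_def[symmetric] F_def[symmetric] reflected_def by (simp add: algebra_simps)
    also have "\<dots> = - \<i> * of_real k * outgoing k r * ?e * of_real (direction \<theta> \<bullet> axis j 1) + outgoing k r * reflected \<theta> y * slope 0 (- 1) \<theta> (axis j 1)"
      unfolding EF using exhaust_2[of j] by (auto simp: slope_def m_eq xi_eq inner_2 algebra_simps)
    finally show "((exp (\<i> * of_real (k * r)) / of_real (sqrt r)) *s H_inf K k \<theta> y) $ j =
     - \<i> * of_real k * outgoing k r * ?e * of_real (direction \<theta> \<bullet> axis j 1) + outgoing k r * reflected \<theta> y * slope 0 (- 1) \<theta> (axis j 1)" . }
qed

lemma upper_asymptotics:
  assumes R: "0 \<le> R"
  shows "uniformly_small (upper_params R) green_remainder" "uniformly_small (upper_params R) (\<lambda>p r. grad_remainder p r $ j)"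
proof -
  let ?c = "1 / (2 * complex_of_real pi * of_real (K\<^sup>2 - k\<^sup>2))"
  note W = wave_asymptotics_on[OF R _ _ params_admissible(1), simplified]
  have up: "snd p \<in> upper_half" "(r *\<^sub>R direction (fst p)) $ 2 < 0" if "p \<in> upper_params R" "r > 0" for p r
    using that observation_below[of "fst p" r] by (auto simp: upper_params_def upper_half_disc_def)
  have "uniformly_small (upper_params R) (\<lambda>p r.
      ?c * (wave 0 2 0 1 0 (r *\<^sub>R direction (fst p)) (snd p) - amplitude 0 2 0 1 0 (fst p) (snd p) * (4 * of_real pi * outgoing k r))
    + (- ?c) * (wave 0 1 1 1 0 (r *\<^sub>R direction (fst p)) (snd p) - amplitude 0 1 1 1 0 (fst p) (snd p) * (4 * of_real pi * outgoing k r)))"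
    by (intro uniformly_small_add uniformly_small_cmult W)
  then show "uniformly_small (upper_params R) green_remainder"
  proof (rule uniformly_small_cong)
    fix p r assume p: "p \<in> upper_params R" "(r::real) > 0"
    show "green_remainder p r = ?c * (wave 0 2 0 1 0 (r *\<^sub>R direction (fst p)) (snd p) - amplitude 0 2 0 1 0 (fst p) (snd p) * (4 * of_real pi * outgoing k r))
    + (- ?c) * (wave 0 1 1 1 0 (r *\<^sub>R direction (fst p)) (snd p) - amplitude 0 1 1 1 0 (fst p) (snd p) * (4 * of_real pi * outgoing k r))"
    proof -
      have "a * (w - w') - e * (a * (A - A') * q) = a * (w - A * (q * e)) + (- a) * (w' - A' * (q * e))" for a w w' e A A' q :: complex
        by (simp add: algebra_simps)
      then show ?thesis
        unfolding outgoing_profile(1)[OF up(1)[OF p]] green_upper_wave[OF up(2)[OF p] up(1)[OF p]] transmitted_eq[symmetric] .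
    qed
  qed
  let ?v = "axis j 1 :: real^2"
  have "uniformly_small (upper_params R) (\<lambda>p r.
      ?c * (wave_deriv 0 2 0 1 0 (r *\<^sub>R direction (fst p)) (snd p) ?v - slope 1 0 (fst p) ?v * amplitude 0 2 0 1 0 (fst p) (snd p) * (4 * of_real pi * outgoing k r))
    + (- ?c) * (wave_deriv 0 1 1 1 0 (r *\<^sub>R direction (fst p)) (snd p) ?v - slope 1 0 (fst p) ?v * amplitude 0 1 1 1 0 (fst p) (snd p) * (4 * of_real pi * outgoing k r)))"
    by (intro uniformly_small_add uniformly_small_cmult W)
  then show "uniformly_small (upper_params R) (\<lambda>p r. grad_remainder p r $ j)"
  proof (rule uniformly_small_cong)
    fix p r assume p: "p \<in> upper_params R" "(r::real) > 0"
    show "grad_remainder p r $ j = ?c * (wave_deriv 0 2 0 1 0 (r *\<^sub>R direction (fst p)) (snd p) ?v - slope 1 0 (fst p) ?v * amplitude 0 2 0 1 0 (fst p) (snd p) * (4 * of_real pi * outgoing k r))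
    + (- ?c) * (wave_deriv 0 1 1 1 0 (r *\<^sub>R direction (fst p)) (snd p) ?v - slope 1 0 (fst p) ?v * amplitude 0 1 1 1 0 (fst p) (snd p) * (4 * of_real pi * outgoing k r))"
    proof -
      have "a * (w - w') - e * (a * (A - A') * q) * s = a * (w - s * A * (q * e)) + (- a) * (w' - s * A' * (q * e))" for a w w' e A A' q s :: complex
        by (simp add: algebra_simps)
      then show ?thesis
        unfolding vector_minus_component outgoing_profile_grad(1)[OF up(1)[OF p]] grad_component[OF green_upper_derivative[OF up(2)[OF p] up(1)[OF p]]] upper_grad_def transmitted_eq[symmetric] .
    qed
  qed
qed

lemma direct_wave_uniformly_small:
  assumes R: "0 \<le> R"
  shows "uniformly_small (lower_params R) (\<lambda>p r. direct_wave k (r *\<^sub>R direction (fst p)) (snd p) - outgoing k r * exp (- \<i> * of_real (k * (direction (fst p) \<bullet> snd p))))"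
    and "uniformly_small (lower_params R) (\<lambda>p r. direct_wave_grad k (r *\<^sub>R direction (fst p)) (snd p) (axis j 1)
      - - \<i> * of_real k * outgoing k r * exp (- \<i> * of_real (k * (direction (fst p) \<bullet> snd p))) * of_real (direction (fst p) \<bullet> axis j 1))"
proof -
  obtain C where C: "C \<ge> 0" and f: "\<And>(u::real^2) y r. norm u = 1 \<Longrightarrow> norm y \<le> R \<Longrightarrow> r > 0 \<Longrightarrow> 2 * R \<le> r \<Longrightarrow>
     norm (direct_wave k (r *\<^sub>R u) y - \<i> / 4 * plane_wave k r (r - u \<bullet> y)) \<le> C * r powr (-3/2)"
   "\<And>(u::real^2) y r v. norm u = 1 \<Longrightarrow> norm y \<le> R \<Longrightarrow> r > 0 \<Longrightarrow> 2 * R \<le> r \<Longrightarrow> norm v \<le> 1 \<Longrightarrow>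
     norm (direct_wave_grad k (r *\<^sub>R u) y v - of_real (k / 4 * (u \<bullet> v)) * plane_wave k r (r - u \<bullet> y)) \<le> C * r powr (-3/2)"
    using direct_wave_asymptotics[OF k_pos R, where 'a="real^2"] by metis
  have y: "norm (snd p) \<le> R" if "p \<in> lower_params R" for p
    using that by (auto simp: lower_params_def lower_half_disc_def)
  have "uniformly_small (lower_params R) (\<lambda>p r. direct_wave k (r *\<^sub>R direction (fst p)) (snd p) - \<i> / 4 * plane_wave k r (r - direction (fst p) \<bullet> snd p))"
    unfolding uniformly_small_def using C R f(1)[OF norm_direction y]
    by (rule_tac exI[of _ C], rule_tac exI[of _ "2 * R + 1"]) auto
  then show "uniformly_small (lower_params R) (\<lambda>p r. direct_wave k (r *\<^sub>R direction (fst p)) (snd p) - outgoing k r * exp (- \<i> * of_real (k * (direction (fst p) \<bullet> snd p))))"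
    by (rule uniformly_small_cong) (simp only: outgoing_plane_wave[OF k_pos])
  have "uniformly_small (lower_params R) (\<lambda>p r. direct_wave_grad k (r *\<^sub>R direction (fst p)) (snd p) (axis j 1) - of_real (k / 4 * (direction (fst p) \<bullet> axis j 1)) * plane_wave k r (r - direction (fst p) \<bullet> snd p))"
    unfolding uniformly_small_def using C R f(2)[OF norm_direction y, of _ _ "axis j 1"]
    by (rule_tac exI[of _ C], rule_tac exI[of _ "2 * R + 1"]) auto
  then show "uniformly_small (lower_params R) (\<lambda>p r. direct_wave_grad k (r *\<^sub>R direction (fst p)) (snd p) (axis j 1)
      - - \<i> * of_real k * outgoing k r * exp (- \<i> * of_real (k * (direction (fst p) \<bullet> snd p))) * of_real (direction (fst p) \<bullet> axis j 1))"
  proof (rule uniformly_small_cong)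
    fix p :: "real \<times> (real^2)" and r :: real assume "r > 0"
    have "of_real (k / 4 * c) * w = - \<i> * of_real k * (\<i> / 4 * w) * of_real c" for c and w :: complex by (simp add: algebra_simps)
    then have "of_real (k / 4 * (direction (fst p) \<bullet> axis j 1)) * plane_wave k r (r - direction (fst p) \<bullet> snd p)
       = - \<i> * of_real k * (outgoing k r * exp (- \<i> * of_real (k * (direction (fst p) \<bullet> snd p)))) * of_real (direction (fst p) \<bullet> axis j 1)"
      unfolding outgoing_plane_wave[OF k_pos \<open>r > 0\<close>, symmetric] by (simp only:)
    then show "direct_wave_grad k (r *\<^sub>R direction (fst p)) (snd p) (axis j 1)
      - - \<i> * of_real k * outgoing k r * exp (- \<i> * of_real (k * (direction (fst p) \<bullet> snd p))) * of_real (direction (fst p) \<bullet> axis j 1)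
      = direct_wave_grad k (r *\<^sub>R direction (fst p)) (snd p) (axis j 1) - of_real (k / 4 * (direction (fst p) \<bullet> axis j 1)) * plane_wave k r (r - direction (fst p) \<bullet> snd p)"
      by (simp only: mult.assoc)
  qed
qed

text \<open>
If \<open>x = y\<close> the direct wave is singular and the gradient is meaningless, hence the case distinction; it is
void for large \<open>r\<close>.
\<close>
lemma lower_asymptotics:
  assumes R: "0 \<le> R"
  shows "uniformly_small (lower_params R) green_remainder"
    and "uniformly_small (lower_params R) (\<lambda>p r. if r *\<^sub>R direction (fst p) = snd p then 0 else grad_remainder p r $ j)"
proof -
  let ?c = "1 / (4 * complex_of_real pi * of_real (K\<^sup>2 - k\<^sup>2))"
  note W = wave_asymptotics_on[OF R _ _ params_admissible(2), simplified]
  have low: "snd p \<in> lower_half" "snd p \<notin> upper_half" "(r *\<^sub>R direction (fst p)) $ 2 < 0" if "p \<in> lower_params R" "r > 0" for p r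
    using that observation_below[of "fst p" r] by (auto simp: lower_params_def lower_half_disc_def lower_half_def upper_half_def)
  define w where "w = (\<lambda>j l p r. wave 0 j l 0 (- 1) (r *\<^sub>R direction (fst p)) (snd p) - amplitude 0 j l 0 (- 1) (fst p) (snd p) * (4 * of_real pi * outgoing k r))"
  define d where "d = (\<lambda>p r. direct_wave k (r *\<^sub>R direction (fst p)) (snd p) - outgoing k r * exp (- \<i> * of_real (k * (direction (fst p) \<bullet> snd p))))"
  have "uniformly_small (lower_params R) (\<lambda>p r. d p r + (?c * w 2 0 p r + ((- 2 * ?c) * w 1 1 p r + ?c * w 0 2 p r)))"
    unfolding d_def w_def by (intro uniformly_small_add uniformly_small_cmult W direct_wave_uniformly_small(1) R)
  then show "uniformly_small (lower_params R) green_remainder"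
  proof (rule uniformly_small_cong)
    fix p r assume p: "p \<in> lower_params R" "(r::real) > 0"
    have "f + a * (w1 - 2 * w2 + w3) - e * (x + a * (A1 - 2 * A2 + A3) * q)
       = (f - e * x) + (a * (w1 - A1 * (q * e)) + ((- 2 * a) * (w2 - A2 * (q * e)) + a * (w3 - A3 * (q * e))))" for f a w1 w2 w3 e x A1 A2 A3 q :: complex
      by (simp add: algebra_simps)
    then show "green_remainder p r = d p r + (?c * w 2 0 p r + ((- 2 * ?c) * w 1 1 p r + ?c * w 0 2 p r))"
      unfolding outgoing_profile(2)[OF low(2)[OF p]] green_lower_wave[OF low(3)[OF p] low(1)[OF p]] reflected_eq[symmetric] d_def w_def .
  qed
  let ?v = "axis j 1 :: real^2"
  define w where "w = (\<lambda>i l p r. wave_deriv 0 i l 0 (- 1) (r *\<^sub>R direction (fst p)) (snd p) ?v - slope 0 (- 1) (fst p) ?v * amplitude 0 i l 0 (- 1) (fst p) (snd p) * (4 * of_real pi * outgoing k r))"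
  define d where "d = (\<lambda>p r. direct_wave_grad k (r *\<^sub>R direction (fst p)) (snd p) ?v
      - - \<i> * of_real k * outgoing k r * exp (- \<i> * of_real (k * (direction (fst p) \<bullet> snd p))) * of_real (direction (fst p) \<bullet> ?v))"
  have u: "uniformly_small (lower_params R) (\<lambda>p r. d p r + (?c * w 2 0 p r + ((- 2 * ?c) * w 1 1 p r + ?c * w 0 2 p r)))"
    unfolding d_def w_def by (intro uniformly_small_add uniformly_small_cmult W direct_wave_uniformly_small(2) R)
  have e: "grad_remainder p r $ j = d p r + (?c * w 2 0 p r + ((- 2 * ?c) * w 1 1 p r + ?c * w 0 2 p r))"
    if p: "p \<in> lower_params R" "r > 0" and ne: "r *\<^sub>R direction (fst p) \<noteq> snd p" for p and r :: real
  proof -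
    have "f + a * (w1 - 2 * w2 + w3) - (x + e * (a * (A1 - 2 * A2 + A3) * q) * s)
       = (f - x) + (a * (w1 - s * A1 * (q * e)) + ((- 2 * a) * (w2 - s * A2 * (q * e)) + a * (w3 - s * A3 * (q * e))))" for f a w1 w2 w3 e x A1 A2 A3 q s :: complex
      by (simp add: algebra_simps)
    then show ?thesis
      unfolding vector_minus_component outgoing_profile_grad(2)[OF low(2)[OF p]] grad_component[OF green_lower_derivative[OF low(3)[OF p] low(1)[OF p] ne]] lower_grad_def reflected_eq[symmetric] d_def w_def .
  qed
  show "uniformly_small (lower_params R) (\<lambda>p r. if r *\<^sub>R direction (fst p) = snd p then 0 else grad_remainder p r $ j)"
  proof (rule uniformly_small_mono[OF u])
    fix p and r :: real assume p: "p \<in> lower_params R" "r > 0"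
    show "norm (if r *\<^sub>R direction (fst p) = snd p then 0 else grad_remainder p r $ j) \<le> norm (d p r + (?c * w 2 0 p r + ((- 2 * ?c) * w 1 1 p r + ?c * w 0 2 p r)))"
    proof (cases "r *\<^sub>R direction (fst p) = snd p")
      case True
      show ?thesis unfolding if_P[OF True] norm_zero by (rule norm_ge_zero)
    next
      case False
      show ?thesis unfolding if_not_P[OF False] e[OF p False] by (rule order_refl)
    qed
  qed
qed

end

lemma uniformly_smallE:
  assumes "uniformly_small P f"
  obtains C r0 where "0 \<le> C" "0 < r0" "\<And>p r. p \<in> P \<Longrightarrow> r \<ge> r0 \<Longrightarrow> norm (f p r) \<le> C * r powr (-3/2)"
  using assms unfolding uniformly_small_def by blast

text \<open>
The observation angle is determined by the point, so that a remainder that is given in polar coordinates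
defines a function of \<open>x\<close>.
\<close>
lemma direction_inj:
  assumes "direction \<theta> = direction \<theta>'" "\<theta> \<in> {pi<..<2*pi}" "\<theta>' \<in> {pi<..<2*pi}"
  shows "\<theta> = \<theta>'"
proof -
  have "cos \<theta> = cos \<theta>'" using direction_nth(1)[of \<theta>] direction_nth(1)[of \<theta>'] unfolding assms(1) by (rule trans[OF sym])
  then have "cos (2 * pi - \<theta>) = cos (2 * pi - \<theta>')" unfolding cos_2pi_minus .
  moreover have "pi < \<theta>" "\<theta> < 2 * pi" "pi < \<theta>'" "\<theta>' < 2 * pi" using assms(2,3) by simp_all
  ultimately have "2 * pi - \<theta> = 2 * pi - \<theta>'" by (rule_tac cos_inj_pi) linarith+
  then show ?thesis by simp
qed

theorem theorem3p2:
  fixes kp km R0 :: real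
  assumes "kp > km" and "km > 0" and "R0 > 0"
  shows "\<exists>(G_Res :: real^2 \<Rightarrow> real^2 \<Rightarrow> complex) (H_Res :: real^2 \<Rightarrow> real^2 \<Rightarrow> complex^2) (C :: real).
    C > 0 \<and>
    (\<forall>r > 0. \<forall>\<theta> \<in> {pi<..<2*pi}. \<forall>y \<in> upper_half_disc R0 \<union> lower_half_disc R0.
       let x = r *\<^sub>R direction \<theta> in
       x \<noteq> y \<longrightarrow>
         layered_green kp km x y =
           exp (\<i> * complex_of_real (km * r)) / complex_of_real (sqrt r) * G_inf kp km \<theta> y
           + G_Res x y \<and>
         layered_green kp km x differentiable (at y) \<and>
         layered_green_grad kp km x y =
           (exp (\<i> * complex_of_real (km * r)) / complex_of_real (sqrt r)) *s H_inf kp km \<theta> y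
           + H_Res x y) \<and>
    (\<forall>\<^sub>F r in at_top. \<forall>\<theta> \<in> {pi<..<2*pi}. \<forall>y \<in> upper_half_disc R0 \<union> lower_half_disc R0.
       norm (G_Res (r *\<^sub>R direction \<theta>) y) \<le> C * r powr (-3/2) \<and>
       norm (H_Res (r *\<^sub>R direction \<theta>) y) \<le> C * r powr (-3/2))"
proof -
  interpret wave_numbers km kp by unfold_locales (use assms in auto)
  let ?P = "{pi<..<2*pi} \<times> (upper_half_disc R0 \<union> lower_half_disc R0)"
  have P: "?P = upper_params R0 \<union> lower_params R0" by (auto simp: upper_params_def lower_params_def)
  have R: "0 \<le> R0" using assms by simp
  (* Far field patterns are functions of the angle; it is recovered from the point x. *)
  define ang where "ang = (\<lambda>x::real^2. SOME \<theta>. \<theta> \<in> {pi<..<2*pi} \<and> x = norm x *\<^sub>R direction \<theta>)"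
  have ang: "ang (r *\<^sub>R direction \<theta>) = \<theta>" if "r > 0" "\<theta> \<in> {pi<..<2*pi}" for r \<theta>
  proof -
    let ?x = "r *\<^sub>R direction \<theta>"
    have n: "norm ?x = r" using that by simp
    have "ang ?x \<in> {pi<..<2*pi} \<and> ?x = norm ?x *\<^sub>R direction (ang ?x)"
      unfolding ang_def by (rule someI[where x=\<theta>]) (use that n in auto)
    then have a: "ang ?x \<in> {pi<..<2*pi}" "r *\<^sub>R direction \<theta> = r *\<^sub>R direction (ang ?x)" unfolding n by (rule conjunct1, rule conjunct2)
    then have "direction \<theta> = direction (ang ?x)" using that(1) unfolding scaleR_cancel_left by linarith
    from direction_inj[OF this that(2) a(1)] show ?thesis by (rule sym)
  qed
  define E where "E = (\<lambda>x::real^2. exp (\<i> * complex_of_real (km * norm x)) / complex_of_real (sqrt (norm x)))"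
  define G_Res where "G_Res = (\<lambda>x y. layered_green kp km x y - E x * G_inf kp km (ang x) y)"
  define H_Res where "H_Res = (\<lambda>x y. if x = y then 0 else layered_green_grad kp km x y - E x *s H_inf kp km (ang x) y)"
  have E: "E (r *\<^sub>R direction \<theta>) = exp (\<i> * complex_of_real (km * r)) / complex_of_real (sqrt r)" if "r > 0" for r \<theta>
    using that by (simp add: E_def)
  have G: "G_Res (r *\<^sub>R direction \<theta>) y = green_remainder (\<theta>, y) r" if "r > 0" "\<theta> \<in> {pi<..<2*pi}" for r \<theta> y
    unfolding G_Res_def ang[OF that] E[OF that(1)] by simp
  have H: "H_Res (r *\<^sub>R direction \<theta>) y = (if r *\<^sub>R direction \<theta> = y then 0 else grad_remainder (\<theta>, y) r)" if "r > 0" "\<theta> \<in> {pi<..<2*pi}" for r \<theta> y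
    unfolding H_Res_def ang[OF that] E[OF that(1)] fst_conv snd_conv by (rule refl)
  have diff: "layered_green kp km (r *\<^sub>R direction \<theta>) differentiable (at y)"
    if r: "r > 0" and th: "\<theta> \<in> {pi<..<2*pi}" and y: "y \<in> upper_half_disc R0 \<union> lower_half_disc R0" and ne: "r *\<^sub>R direction \<theta> \<noteq> y" for r \<theta> y
  proof -
    have x: "(r *\<^sub>R direction \<theta>) $ 2 < 0" using th r by (intro observation_below) auto
    from y have "y \<in> upper_half \<or> y \<in> lower_half" by (auto simp: upper_half_disc_def lower_half_disc_def)
    then show ?thesis
    proof
      assume "y \<in> upper_half"
      from green_upper_derivative[OF x this] show ?thesis by (rule differentiableI)
    next
      assume "y \<in> lower_half"
      from green_lower_derivative[OF x this ne] show ?thesis by (rule differentiableI)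
    qed
  qed
  have sG: "uniformly_small ?P green_remainder"
    unfolding P by (intro uniformly_small_Un upper_asymptotics lower_asymptotics R)
  have sH: "uniformly_small ?P (\<lambda>p r. if r *\<^sub>R direction (fst p) = snd p then 0 else grad_remainder p r $ j)" for j
    unfolding P
  proof (intro uniformly_small_Un lower_asymptotics R)
    show "uniformly_small (upper_params R0) (\<lambda>p r. if r *\<^sub>R direction (fst p) = snd p then 0 else grad_remainder p r $ j)"
    proof (rule uniformly_small_cong[OF upper_asymptotics(2)[OF R, of j]])
      fix p :: "real \<times> (real^2)" and r :: real assume "p \<in> upper_params R0" "r > 0"
      then have "snd p $ 2 > 0" "(r *\<^sub>R direction (fst p)) $ 2 < 0"
        using observation_below[of "fst p" r] by (auto simp: upper_params_def upper_half_disc_def upper_half_def)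
      then have "r *\<^sub>R direction (fst p) \<noteq> snd p" by (metis less_asym)
      then show "(if r *\<^sub>R direction (fst p) = snd p then 0 else grad_remainder p r $ j) = grad_remainder p r $ j" by (rule if_not_P)
    qed
  qed
  obtain C0 r0 where C0: "0 \<le> C0" "0 < r0" "\<And>p r. p \<in> ?P \<Longrightarrow> r \<ge> r0 \<Longrightarrow> norm (green_remainder p r) \<le> C0 * r powr (-3/2)"
    by (rule uniformly_smallE[OF sG], rule that, assumption, assumption, simp only:)
  obtain C1 r1 where C1: "0 \<le> C1" "0 < r1" "\<And>p r. p \<in> ?P \<Longrightarrow> r \<ge> r1 \<Longrightarrow> norm (if r *\<^sub>R direction (fst p) = snd p then 0 else grad_remainder p r $ 1) \<le> C1 * r powr (-3/2)"
    by (rule uniformly_smallE[OF sH[of 1]], rule that, assumption, assumption, simp only:)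
  obtain C2 r2 where C2: "0 \<le> C2" "0 < r2" "\<And>p r. p \<in> ?P \<Longrightarrow> r \<ge> r2 \<Longrightarrow> norm (if r *\<^sub>R direction (fst p) = snd p then 0 else grad_remainder p r $ 2) \<le> C2 * r powr (-3/2)"
    by (rule uniformly_smallE[OF sH[of 2]], rule that, assumption, assumption, simp only:)
  define C where "C = C0 + C1 + C2 + 1"
  have "norm (G_Res (r *\<^sub>R direction \<theta>) y) \<le> C * r powr (-3/2) \<and> norm (H_Res (r *\<^sub>R direction \<theta>) y) \<le> C * r powr (-3/2)"
    if r: "r \<ge> max r0 (max r1 r2)" and th: "\<theta> \<in> {pi<..<2*pi}" and y: "y \<in> upper_half_disc R0 \<union> lower_half_disc R0" for r \<theta> y
  proof -
    let ?h = "H_Res (r *\<^sub>R direction \<theta>) y"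
    have r0: "r > 0" using r C0(2) by simp
    have p: "(\<theta>, y) \<in> ?P" using th y by simp
    have h: "norm (?h $ 1) \<le> C1 * r powr (-3/2)" "norm (?h $ 2) \<le> C2 * r powr (-3/2)"
      unfolding H[OF r0 th] using C1(3)[OF p, of r] C2(3)[OF p, of r] r by (auto split: if_splits)
    have "norm ?h \<le> norm (?h $ 1) + norm (?h $ 2)"
      unfolding norm_vec_def by (rule order_trans[OF L2_set_le_sum]) (simp_all add: UNIV_2)
    then have "norm ?h \<le> (C1 + C2) * r powr (-3/2)" using h by (simp add: distrib_right)
    also have "\<dots> \<le> C * r powr (-3/2)" using C0 by (intro mult_right_mono) (auto simp: C_def)
    finally have 1: "norm ?h \<le> C * r powr (-3/2)" .
    have "norm (G_Res (r *\<^sub>R direction \<theta>) y) \<le> C0 * r powr (-3/2)"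
      unfolding G[OF r0 th] using C0(3)[OF p, of r] r by simp
    also have "\<dots> \<le> C * r powr (-3/2)" using C1 C2 by (intro mult_right_mono) (auto simp: C_def)
    finally show ?thesis using 1 by simp
  qed
  then have ev: "\<forall>\<^sub>F r in at_top. \<forall>\<theta> \<in> {pi<..<2*pi}. \<forall>y \<in> upper_half_disc R0 \<union> lower_half_disc R0.
       norm (G_Res (r *\<^sub>R direction \<theta>) y) \<le> C * r powr (-3/2) \<and> norm (H_Res (r *\<^sub>R direction \<theta>) y) \<le> C * r powr (-3/2)"
    unfolding eventually_at_top_linorder by (intro exI[of _ "max r0 (max r1 r2)"]) blast
  have C: "C > 0" using C0 C1 C2 by (simp add: C_def)
  have split: "a = b + (a - b)" for a b :: "'z::ab_group_add" by simp
  show ?thesis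
  proof (rule exI[of _ G_Res], rule exI[of _ H_Res], rule exI[of _ C], intro conjI)
    show "C > 0" by (rule C)
    show "\<forall>\<^sub>F r in at_top. \<forall>\<theta> \<in> {pi<..<2*pi}. \<forall>y \<in> upper_half_disc R0 \<union> lower_half_disc R0.
       norm (G_Res (r *\<^sub>R direction \<theta>) y) \<le> C * r powr (-3/2) \<and>
       norm (H_Res (r *\<^sub>R direction \<theta>) y) \<le> C * r powr (-3/2)" by (rule ev)
    show "\<forall>r > 0. \<forall>\<theta> \<in> {pi<..<2*pi}. \<forall>y \<in> upper_half_disc R0 \<union> lower_half_disc R0.
       let x = r *\<^sub>R direction \<theta> in
       x \<noteq> y \<longrightarrow>
         layered_green kp km x y =
           exp (\<i> * complex_of_real (km * r)) / complex_of_real (sqrt r) * G_inf kp km \<theta> y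
           + G_Res x y \<and>
         layered_green kp km x differentiable (at y) \<and>
         layered_green_grad kp km x y =
           (exp (\<i> * complex_of_real (km * r)) / complex_of_real (sqrt r)) *s H_inf kp km \<theta> y
           + H_Res x y"
      unfolding Let_def
    proof (intro allI impI ballI)
      fix r \<theta> :: real and y assume r: "r > 0" and th: "\<theta> \<in> {pi<..<2*pi}"
        and y: "y \<in> upper_half_disc R0 \<union> lower_half_disc R0" and ne: "r *\<^sub>R direction \<theta> \<noteq> y"
      show "layered_green kp km (r *\<^sub>R direction \<theta>) y =
           exp (\<i> * complex_of_real (km * r)) / complex_of_real (sqrt r) * G_inf kp km \<theta> y
           + G_Res (r *\<^sub>R direction \<theta>) y \<and>
         layered_green kp km (r *\<^sub>R direction \<theta>) differentiable (at y) \<and>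
         layered_green_grad kp km (r *\<^sub>R direction \<theta>) y =
           (exp (\<i> * complex_of_real (km * r)) / complex_of_real (sqrt r)) *s H_inf kp km \<theta> y
           + H_Res (r *\<^sub>R direction \<theta>) y"
        unfolding G[OF r th] H[OF r th] if_not_P[OF ne] fst_conv snd_conv by (intro conjI diff[OF r th y ne] split)
    qed
  qed
qed

end
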